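(* Let $k$ be a field, $H$ a finite-dimensional Hopf $k$-algebra, and $A | B$ an $H$-Galois extension with centralizer $R = C_A(B)$. Then the left $R$-bialgebroid $T^{\mathrm{op}}$ associated to $A|B$, where $T = (A\otimes_BA)^B$ (structure described in the context), is a Hopf algebroid of Lu's smash product type. That is, there exist a finite-dimensional Hopf algebra $H'$ and a left $D(H')$-module algebra $V$ (with $D(H')$ the Drinfel'd double) satisfying the pre-braided commutativity condition $$\sum_i (p_i\cdot u)(h_i\cdot v) = vu\qquad (u,v\in V),$$ where $\{h_i\}$, $\{p_i\}$ are dual bases of $H'$ and $H'^*$, such that $T^{\mathrm{op}}$ is isomorphic as a left bialgebroid to the Lu Hopf algebroid $V\rtimes H'$ over $V$ described in the context; in particular $T^{\mathrm{op}}$ has an antipode making it a Hopf algebroid over $R$.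
   Context: $H$-Galois extension: $A$ is a $k$-algebra and right $H$-comodule algebra with coaction $a\mapsto a_{(0)}\otimes a_{(1)}\in A\otimes_kH$, $B = \{a : a_{(0)}\otimes a_{(1)} = a\otimes 1\}$ is the subalgebra of coinvariants, and $\beta:A\otimes_BA\to A\otimes_kH$, $\beta(a\otimes a') = aa'_{(0)}\otimes a'_{(1)}$, is bijective. Such an extension has depth two: $A\otimes_BA$ is isomorphic to a finite direct sum of copies of $A$ both as $A$-$B$- and as $B$-$A$-bimodules. Left bialgebroid $(L,R,\tilde s,\tilde t,\Delta,\varepsilon)$: $L,R$ are $k$-algebras; $\tilde s:R\to L$ is an algebra homomorphism, $\tilde t:R\to L$ an algebra anti-homomorphism, with $\tilde s(r)\tilde t(r')=\tilde t(r')\tilde s(r)$; $L$ is an $R$-bimodule by $r\cdot x\cdot r' = \tilde s(r)\tilde t(r')x$; $(L,\Delta,\varepsilon)$ is an $R$-coring (coassociative, counital, with $\Delta:L\to L\otimes_RL$ and $\varepsilon:L\to R$ bimodule maps); $a_{(1)}\tilde t(r)\otimes a_{(2)} = a_{(1)}\otimes a_{(2)}\tilde s(r)$; $\Delta(ab)=\Delta(a)\Delta(b)$, $\Delta(1)=1\otimes1$; $\varepsilon(ab) = \varepsilon(a\tilde s(\varepsilon(b))) = \varepsilon(a\tilde t(\varepsilon(b)))$, $\varepsilon(1_L)=1_R$. Hopf algebroid (Lu): a left bialgebroid with an algebra anti-automorphism $\tau:L\to L$ (antipode) such that (1) $\tau\tilde t=\tilde s$; (2) $\tau(a_{(1)})a_{(2)}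 = \tilde t(\varepsilon(\tau(a)))$ for all $a\in L$; (3) there is a $k$-linear section $\eta:L\otimes_RL\to L\otimes_kL$ of the natural projection with $\mu(\mathrm{id}\otimes\tau)\eta\Delta = \tilde s\varepsilon$, $\mu$ being multiplication. Bialgebroid isomorphism: a pair of algebra isomorphisms of the total algebras and of the base algebras that commutes with source maps, target maps, coproducts and counits. The left $R$-bialgebroid $T^{\mathrm{op}}$: writing $t=t^1\otimes t^2\in T=(A\otimes_BA)^B=\{t: bt=tb\ \forall b\in B\}$ (summation suppressed), $T$ has multiplication $tt' = t'^1t^1\otimes t^2t'^2$, and $T^{\mathrm{op}}$ has the opposite multiplication. In $T^{\mathrm{op}}$, $\tilde s(r) = r\otimes 1$, $\tilde t(r) = 1\otimes r$ (so the $R$-bimodule structure is $r\cdot t\cdot r' = rt^1\otimes t^2r'$), $\varepsilon(t)=t^1t^2$, and under the isomorphism $T\otimes_RT\cong(A\otimes_BA\otimes_BA)^B$, $t\otimes t'\mapsto t^1\otimes t^2t'^1\otimes t'^2$, the coproduct is $\Delta(t) = t^1\otimes1\otimes t^2$. Drinfel'd double: $D(H') = H'^{*\,\mathrm{cop}}\bowtie H'$, with coalgebra $H'^{*\,\mathrm{cop}}\otimes H'$, containing $H'^*$ and $H'$ as subalgebras $p\mapsto p\bowtie1$, $h\mapsto1\bowtie h$, with $(p\bowtie1)(1\bowtie h)=p\bowtie h$ and $(1\bowtie h)(p\bowtie1) = \sum p(\tilde S^{-1}(h_{(3)})\,?\,h_{(1)})\bowtie h_{(2)}$, where $\tilde S$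 is the antipode of $H'$. Lu's Hopf algebroid $V\rtimes H'$: for $V$ as in the claim, it is the smash product algebra $V\otimes_k H'$ with $(v\rtimes h)(v'\rtimes h') = v(h_{(1)}\cdot v')\rtimes h_{(2)}h'$, base algebra $V$, and $\tilde s(v)=v\rtimes1$, $\tilde t(v)=\sum_i(p_i\cdot v)\rtimes h_i$, $\Delta(v\rtimes h) = (v\rtimes h_{(1)})\otimes_V(1\rtimes h_{(2)})$, $\varepsilon(v\rtimes h)=\varepsilon(h)v$, $\tau(v\rtimes h) = \sum_i(1\rtimes\tilde S(h))\,\tilde t(\tilde S^2(h_i)\cdot p_i\cdot v)$. (Lu proved that these data form a Hopf algebroid over $V$.) *)

theory Defs
  imports "HOL-Algebra.Module" "HOL-Algebra.Generated_Groups" "HOL-Algebra.Free_Abelian_Groups"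
begin

section \<open>Algebras over a field\<close>

text \<open>The library locale \<open>algebra\<close> covers commutative algebras only.  A \<open>K\<close>-algebra here is
  associative and unital, possibly noncommutative.\<close>

definition k_algebra :: "('k, 'c) ring_scheme \<Rightarrow> ('k, 'a, 'x) module_scheme \<Rightarrow> bool" where
  "k_algebra K A \<longleftrightarrow> field K \<and> module K A \<and> ring A \<and>
     (\<forall>c \<in> carrier K. \<forall>x \<in> carrier A. \<forall>y \<in> carrier A.
        (c \<odot>\<^bsub>A\<^esub> x) \<otimes>\<^bsub>A\<^esub> y = c \<odot>\<^bsub>A\<^esub> (x \<otimes>\<^bsub>A\<^esub> y) \<and>
        x \<otimes>\<^bsub>A\<^esub> (c \<odot>\<^bsub>A\<^esub> y) = c \<odot>\<^bsub>A\<^esub> (x \<otimes>\<^bsub>A\<^esub> y))"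

definition linear_map ::
  "('k, 'c) ring_scheme \<Rightarrow> ('k, 'a, 'x) module_scheme \<Rightarrow> ('k, 'b, 'y) module_scheme \<Rightarrow>
    ('a \<Rightarrow> 'b) \<Rightarrow> bool" where
  "linear_map K M N f \<longleftrightarrow> f \<in> carrier M \<rightarrow> carrier N \<and>
     (\<forall>x \<in> carrier M. \<forall>y \<in> carrier M. f (x \<oplus>\<^bsub>M\<^esub> y) = f x \<oplus>\<^bsub>N\<^esub> f y) \<and>
     (\<forall>c \<in> carrier K. \<forall>x \<in> carrier M. f (c \<odot>\<^bsub>M\<^esub> x) = c \<odot>\<^bsub>N\<^esub> f x)"

definition alg_hom ::
  "('k, 'c) ring_scheme \<Rightarrow> ('k, 'a, 'x) module_scheme \<Rightarrow> ('k, 'b, 'y) module_scheme \<Rightarrow>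
    ('a \<Rightarrow> 'b) \<Rightarrow> bool" where
  "alg_hom K A B f \<longleftrightarrow> f \<in> ring_hom A B \<and> linear_map K A B f"

definition alg_iso ::
  "('k, 'c) ring_scheme \<Rightarrow> ('k, 'a, 'x) module_scheme \<Rightarrow> ('k, 'b, 'y) module_scheme \<Rightarrow>
    ('a \<Rightarrow> 'b) \<Rightarrow> bool" where
  "alg_iso K A B f \<longleftrightarrow> alg_hom K A B f \<and> bij_betw f (carrier A) (carrier B)"

definition opposite :: "('k, 'a, 'x) module_scheme \<Rightarrow> ('k, 'a, 'x) module_scheme" where
  "opposite A = A\<lparr>monoid.mult := (\<lambda>x y. y \<otimes>\<^bsub>A\<^esub> x)\<rparr>"

definition self_module :: "('k, 'c) ring_scheme \<Rightarrow> ('k, 'k) module" where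
  "self_module K = \<lparr>carrier = carrier K, monoid.mult = monoid.mult K, one = \<one>\<^bsub>K\<^esub>,
     ring.zero = \<zero>\<^bsub>K\<^esub>, add = add K, smult = monoid.mult K\<rparr>"

definition finite_dim :: "('k, 'c) ring_scheme \<Rightarrow> ('k, 'a, 'x) module_scheme \<Rightarrow> bool" where
  "finite_dim K M \<longleftrightarrow> (\<exists>S. finite S \<and> S \<subseteq> carrier M \<and>
     (\<forall>x \<in> carrier M. \<exists>c \<in> S \<rightarrow> carrier K. x = (\<Oplus>\<^bsub>M\<^esub>s\<in>S. c s \<odot>\<^bsub>M\<^esub> s)))"


section \<open>Tensor products\<close>

text \<open>\<open>tensor M N S ra la\<close> is the balanced tensor product \<open>M \<otimes>\<^sub>S N\<close>, where \<open>ra m s\<close> is the right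
  action of \<open>s \<in> S\<close> on \<open>M\<close> and \<open>la s n\<close> the left action on \<open>N\<close>: the free abelian group on the
  pairs modulo the biadditivity and balancing relations.  \<open>m \<boxtimes> n\<close> is the class of a pair.
  The fields \<open>smult\<close> and \<open>mult\<close> are \<open>c(m \<otimes> n) = cm \<otimes> n\<close> and \<open>(m \<otimes> n)(m' \<otimes> n') = mm' \<otimes> nn'\<close>;
  the latter is meaningful only where it does not depend on representatives.\<close>

record ('k, 'm, 'n) tensor_prod = "('k, ('m \<times> 'n \<Rightarrow>\<^sub>0 int) set) module" +
  pure_tensor :: "'m \<Rightarrow> 'n \<Rightarrow> ('m \<times> 'n \<Rightarrow>\<^sub>0 int) set"  (infixl \<open>\<boxtimes>\<index>\<close> 67)

definition tensor_rels ::
  "('k, 'm, 'x) module_scheme \<Rightarrow> ('k, 'n, 'y) module_scheme \<Rightarrow> 's set \<Rightarrow>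
    ('m \<Rightarrow> 's \<Rightarrow> 'm) \<Rightarrow> ('s \<Rightarrow> 'n \<Rightarrow> 'n) \<Rightarrow> ('m \<times> 'n \<Rightarrow>\<^sub>0 int) set" where
  "tensor_rels M N S ra la =
     {frag_of (m \<oplus>\<^bsub>M\<^esub> m', n) - frag_of (m, n) - frag_of (m', n) | m m' n.
        m \<in> carrier M \<and> m' \<in> carrier M \<and> n \<in> carrier N} \<union>
     {frag_of (m, n \<oplus>\<^bsub>N\<^esub> n') - frag_of (m, n) - frag_of (m, n') | m n n'.
        m \<in> carrier M \<and> n \<in> carrier N \<and> n' \<in> carrier N} \<union>
     {frag_of (ra m s, n) - frag_of (m, la s n) | m s n.
        m \<in> carrier M \<and> s \<in> S \<and> n \<in> carrier N}"

text \<open>\<open>tensor_lift G \<phi> X\<close> is the value at \<open>X\<close> of the additive map \<open>M \<otimes>\<^sub>S N \<rightarrow> G\<close> induced by a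
  balanced \<open>\<phi>\<close>.  It renders Sweedler notation: the sum of \<open>\<phi> x\<^sub>1 x\<^sub>2\<close>, where \<open>X\<close> is the sum of the
  \<open>x\<^sub>1 \<otimes> x\<^sub>2\<close>.\<close>

definition frag_sum :: "('g, 'x) ring_scheme \<Rightarrow> ('i \<Rightarrow> 'g) \<Rightarrow> ('i \<Rightarrow>\<^sub>0 int) \<Rightarrow> 'g" where
  "frag_sum G \<phi> u = (\<Oplus>\<^bsub>G\<^esub>i\<in>Poly_Mapping.keys u. add_pow G (Poly_Mapping.lookup u i) (\<phi> i))"

definition tensor_lift ::
  "('g, 'x) ring_scheme \<Rightarrow> ('m \<Rightarrow> 'n \<Rightarrow> 'g) \<Rightarrow> ('m \<times> 'n \<Rightarrow>\<^sub>0 int) set \<Rightarrow> 'g" where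
  "tensor_lift G \<phi> X = the_elem (frag_sum G (case_prod \<phi>) ` X)"

definition tensor ::
  "('k, 'm, 'x) module_scheme \<Rightarrow> ('k, 'n, 'y) module_scheme \<Rightarrow> 's set \<Rightarrow>
    ('m \<Rightarrow> 's \<Rightarrow> 'm) \<Rightarrow> ('s \<Rightarrow> 'n \<Rightarrow> 'n) \<Rightarrow> ('k, 'm, 'n) tensor_prod" where
  "tensor M N S ra la =
    (let F = free_Abelian_group (carrier M \<times> carrier N);
         I = generate F (tensor_rels M N S ra la);
         Q = F Mod I;
         p = (\<lambda>m n. I #>\<^bsub>F\<^esub> frag_of (m, n));
         G = \<lparr>carrier = carrier Q, monoid.mult = undefined, one = undefined,
               ring.zero = \<one>\<^bsub>Q\<^esub>, add = monoid.mult Q\<rparr>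
     in \<lparr>carrier = carrier Q,
         monoid.mult = (\<lambda>X Y. tensor_lift G (\<lambda>m' n'.
                          tensor_lift G (\<lambda>m n. p (m \<otimes>\<^bsub>M\<^esub> m') (n \<otimes>\<^bsub>N\<^esub> n')) X) Y),
         one = p \<one>\<^bsub>M\<^esub> \<one>\<^bsub>N\<^esub>,
         ring.zero = \<one>\<^bsub>Q\<^esub>,
         add = monoid.mult Q,
         smult = (\<lambda>c. tensor_lift G (\<lambda>m n. p (c \<odot>\<^bsub>M\<^esub> m) n)),
         pure_tensor = p\<rparr>)"

definition ktensor ::
  "('k, 'c) ring_scheme \<Rightarrow> ('k, 'm, 'x) module_scheme \<Rightarrow> ('k, 'n, 'y) module_scheme \<Rightarrow>
    ('k, 'm, 'n) tensor_prod" where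
  "ktensor K M N = tensor M N (carrier K) (\<lambda>m c. c \<odot>\<^bsub>M\<^esub> m) (\<lambda>c n. c \<odot>\<^bsub>N\<^esub> n)"


section \<open>Hopf algebras\<close>

record ('k, 'h) bialg = "('k, 'h) module" +
  comult :: "'h \<Rightarrow> ('h \<times> 'h \<Rightarrow>\<^sub>0 int) set"
  counit :: "'h \<Rightarrow> 'k"

record ('k, 'h) hopf = "('k, 'h) bialg" +
  antipode :: "'h \<Rightarrow> 'h"

text \<open>Triple tensor products are bracketed to the right; in coassociativity laws the left-hand
  side is already composed with the associativity isomorphism.\<close>

definition coalgebra :: "('k, 'c) ring_scheme \<Rightarrow> ('k, 'h, 'x) bialg_scheme \<Rightarrow> bool" where
  "coalgebra K C \<longleftrightarrow>
    (let C2 = ktensor K C C; C3 = ktensor K C C2 in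
     module K C \<and>
     linear_map K C C2 (comult C) \<and>
     linear_map K C (self_module K) (counit C) \<and>
     (\<forall>h \<in> carrier C.
        tensor_lift C3 (\<lambda>x y. tensor_lift C3 (\<lambda>x1 x2. x1 \<boxtimes>\<^bsub>C3\<^esub> (x2 \<boxtimes>\<^bsub>C2\<^esub> y)) (comult C x))
            (comult C h)
        = tensor_lift C3 (\<lambda>x y. x \<boxtimes>\<^bsub>C3\<^esub> comult C y) (comult C h) \<and>
        tensor_lift C (\<lambda>x y. counit C x \<odot>\<^bsub>C\<^esub> y) (comult C h) = h \<and>
        tensor_lift C (\<lambda>x y. counit C y \<odot>\<^bsub>C\<^esub> x) (comult C h) = h))"

definition hopf_algebra :: "('k, 'c) ring_scheme \<Rightarrow> ('k, 'h, 'x) hopf_scheme \<Rightarrow> bool" where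
  "hopf_algebra K H \<longleftrightarrow>
     k_algebra K H \<and> coalgebra K H \<and>
     alg_hom K H (ktensor K H H) (comult H) \<and>
     alg_hom K H (self_module K) (counit H) \<and>
     linear_map K H H (antipode H) \<and>
     (\<forall>h \<in> carrier H.
        tensor_lift H (\<lambda>x y. antipode H x \<otimes>\<^bsub>H\<^esub> y) (comult H h) = counit H h \<odot>\<^bsub>H\<^esub> \<one>\<^bsub>H\<^esub> \<and>
        tensor_lift H (\<lambda>x y. x \<otimes>\<^bsub>H\<^esub> antipode H y) (comult H h) = counit H h \<odot>\<^bsub>H\<^esub> \<one>\<^bsub>H\<^esub>)"

text \<open>\<open>dual_bialg K H\<close> is the dual of a finite-dimensional bialgebra: the product is convolution,
  and the coproduct of \<open>p\<close> is the element of \<open>H\<^sup>* \<otimes> H\<^sup>*\<close> that sends \<open>x \<otimes> y\<close> to \<open>p(xy)\<close>.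
  Functionals are extensional on the carrier of \<open>H\<close>.\<close>

definition dual_bialg ::
  "('k, 'c) ring_scheme \<Rightarrow> ('k, 'h, 'x) bialg_scheme \<Rightarrow> ('k, 'h \<Rightarrow> 'k) bialg" where
  "dual_bialg K H =
    (let M = \<lparr>carrier = {f \<in> extensional (carrier H). linear_map K H (self_module K) f},
              monoid.mult = (\<lambda>p q. \<lambda>h\<in>carrier H.
                 tensor_lift K (\<lambda>x y. p x \<otimes>\<^bsub>K\<^esub> q y) (comult H h)),
              one = (\<lambda>h\<in>carrier H. counit H h),
              ring.zero = (\<lambda>h\<in>carrier H. \<zero>\<^bsub>K\<^esub>),
              add = (\<lambda>p q. \<lambda>h\<in>carrier H. p h \<oplus>\<^bsub>K\<^esub> q h),
              smult = (\<lambda>c p. \<lambda>h\<in>carrier H. c \<otimes>\<^bsub>K\<^esub> p h)\<rparr>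
     in module.extend M (bialg.fields
          (\<lambda>p. THE z. z \<in> carrier (ktensor K M M) \<and>
             (\<forall>x \<in> carrier H. \<forall>y \<in> carrier H.
                tensor_lift K (\<lambda>f g. f x \<otimes>\<^bsub>K\<^esub> g y) z = p (x \<otimes>\<^bsub>H\<^esub> y)))
          (\<lambda>p. p \<one>\<^bsub>H\<^esub>)))"

definition co_opposite ::
  "('k, 'c) ring_scheme \<Rightarrow> ('k, 'h, 'x) bialg_scheme \<Rightarrow> ('k, 'h, 'x) bialg_scheme" where
  "co_opposite K C =
     C\<lparr>comult := (\<lambda>c. tensor_lift (ktensor K C C) (\<lambda>x y. y \<boxtimes>\<^bsub>ktensor K C C\<^esub> x) (comult C c))\<rparr>"

definition dual_bases ::
  "('k, 'c) ring_scheme \<Rightarrow> ('k, 'h, 'x) bialg_scheme \<Rightarrow> nat \<Rightarrow> (nat \<Rightarrow> 'h) \<Rightarrow>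
    (nat \<Rightarrow> 'h \<Rightarrow> 'k) \<Rightarrow> bool" where
  "dual_bases K H n h p \<longleftrightarrow>
     h \<in> {..<n} \<rightarrow> carrier H \<and> p \<in> {..<n} \<rightarrow> carrier (dual_bialg K H) \<and>
     (\<forall>i<n. \<forall>j<n. p i (h j) = (if i = j then \<one>\<^bsub>K\<^esub> else \<zero>\<^bsub>K\<^esub>)) \<and>
     (\<forall>x \<in> carrier H. x = (\<Oplus>\<^bsub>H\<^esub>i\<in>{..<n}. p i x \<odot>\<^bsub>H\<^esub> h i))"


section \<open>The Drinfel'd double and its module algebras\<close>

definition comult2 ::
  "('k, 'c) ring_scheme \<Rightarrow> ('k, 'h, 'x) bialg_scheme \<Rightarrow> 'h \<Rightarrow>
    ('h \<times> ('h \<times> 'h \<Rightarrow>\<^sub>0 int) set \<Rightarrow>\<^sub>0 int) set" where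
  "comult2 K H h = (let H3 = ktensor K H (ktensor K H H) in
     tensor_lift H3 (\<lambda>x y. x \<boxtimes>\<^bsub>H3\<^esub> comult H y) (comult H h))"

abbreviation inv_antipode :: "('k, 'h, 'x) hopf_scheme \<Rightarrow> 'h \<Rightarrow> 'h" where
  "inv_antipode H \<equiv> inv_into (carrier H) (antipode H)"

definition double_tensor ::
  "('k, 'c) ring_scheme \<Rightarrow> ('k, 'h, 'x) hopf_scheme \<Rightarrow> ('k, 'h \<Rightarrow> 'k, 'h) tensor_prod" where
  "double_tensor K H = ktensor K (dual_bialg K H) H"

text \<open>\<open>p \<bowtie> h\<close> is \<open>p \<boxtimes>\<^bsub>double_tensor K H\<^esub> h\<close>.  The product combines
  \<open>(p \<bowtie> h)(q \<bowtie> g) = (p \<bowtie> 1) (1 \<bowtie> h) (q \<bowtie> 1) (1 \<bowtie> g)\<close> with the straightening rule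
  \<open>(1 \<bowtie> h)(q \<bowtie> 1) = q(S\<^sup>-\<^sup>1(h\<^sub>3) ? h\<^sub>1) \<bowtie> h\<^sub>2\<close>.\<close>

definition drinfeld_double ::
  "('k, 'c) ring_scheme \<Rightarrow> ('k, 'h, 'x) hopf_scheme \<Rightarrow>
    ('k, (('h \<Rightarrow> 'k) \<times> 'h \<Rightarrow>\<^sub>0 int) set) bialg" where
  "drinfeld_double K H =
    (let P = dual_bialg K H;
         Pc = co_opposite K P;
         T = double_tensor K H;
         TT = ktensor K T T
     in module.extend
          (module.truncate (T\<lparr>monoid.mult := (\<lambda>X Y.
             tensor_lift T (\<lambda>p h. tensor_lift T (\<lambda>q g.
               tensor_lift T (\<lambda>h1 h23. tensor_lift T (\<lambda>h2 h3.
                   (p \<otimes>\<^bsub>P\<^esub> (\<lambda>x\<in>carrier H. q (inv_antipode H h3 \<otimes>\<^bsub>H\<^esub> x \<otimes>\<^bsub>H\<^esub> h1)))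
                     \<boxtimes>\<^bsub>T\<^esub> (h2 \<otimes>\<^bsub>H\<^esub> g)) h23)
                 (comult2 K H h)) Y) X)\<rparr>))
          (bialg.fields
            (\<lambda>X. tensor_lift TT (\<lambda>p h. tensor_lift TT (\<lambda>p1 p2. tensor_lift TT (\<lambda>h1 h2.
                 (p1 \<boxtimes>\<^bsub>T\<^esub> h1) \<boxtimes>\<^bsub>TT\<^esub> (p2 \<boxtimes>\<^bsub>T\<^esub> h2)) (comult H h)) (comult Pc p)) X)
            (\<lambda>X. tensor_lift K (\<lambda>p h. counit P p \<otimes>\<^bsub>K\<^esub> counit H h) X)))"

definition module_algebra ::
  "('k, 'c) ring_scheme \<Rightarrow> ('k, 'd, 'x) bialg_scheme \<Rightarrow> ('k, 'v, 'y) module_scheme \<Rightarrow>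
    ('d \<Rightarrow> 'v \<Rightarrow> 'v) \<Rightarrow> bool" where
  "module_algebra K D V act \<longleftrightarrow>
     k_algebra K V \<and>
     (\<forall>v \<in> carrier V. linear_map K D V (\<lambda>d. act d v)) \<and>
     (\<forall>d \<in> carrier D. linear_map K V V (act d)) \<and>
     (\<forall>d \<in> carrier D. \<forall>e \<in> carrier D. \<forall>v \<in> carrier V.
        act (d \<otimes>\<^bsub>D\<^esub> e) v = act d (act e v)) \<and>
     (\<forall>v \<in> carrier V. act \<one>\<^bsub>D\<^esub> v = v) \<and>
     (\<forall>d \<in> carrier D. \<forall>u \<in> carrier V. \<forall>v \<in> carrier V.
        act d (u \<otimes>\<^bsub>V\<^esub> v) = tensor_lift V (\<lambda>d1 d2. act d1 u \<otimes>\<^bsub>V\<^esub> act d2 v) (comult D d)) \<and>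
     (\<forall>d \<in> carrier D. act d \<one>\<^bsub>V\<^esub> = counit D d \<odot>\<^bsub>V\<^esub> \<one>\<^bsub>V\<^esub>)"

text \<open>Restrictions of a \<open>D(H)\<close>-action along \<open>p \<mapsto> p \<bowtie> 1\<close> and \<open>h \<mapsto> 1 \<bowtie> h\<close>.\<close>

definition dual_act ::
  "('k, 'c) ring_scheme \<Rightarrow> ('k, 'h, 'x) hopf_scheme \<Rightarrow>
    ((('h \<Rightarrow> 'k) \<times> 'h \<Rightarrow>\<^sub>0 int) set \<Rightarrow> 'v \<Rightarrow> 'v) \<Rightarrow> ('h \<Rightarrow> 'k) \<Rightarrow> 'v \<Rightarrow> 'v" where
  "dual_act K H act p v = act (p \<boxtimes>\<^bsub>double_tensor K H\<^esub> \<one>\<^bsub>H\<^esub>) v"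

definition hopf_act ::
  "('k, 'c) ring_scheme \<Rightarrow> ('k, 'h, 'x) hopf_scheme \<Rightarrow>
    ((('h \<Rightarrow> 'k) \<times> 'h \<Rightarrow>\<^sub>0 int) set \<Rightarrow> 'v \<Rightarrow> 'v) \<Rightarrow> 'h \<Rightarrow> 'v \<Rightarrow> 'v" where
  "hopf_act K H act h v =
     act (\<one>\<^bsub>dual_bialg K H\<^esub> \<boxtimes>\<^bsub>double_tensor K H\<^esub> h) v"

definition prebraided_commutative ::
  "('k, 'c) ring_scheme \<Rightarrow> ('k, 'h, 'x) hopf_scheme \<Rightarrow> ('k, 'v, 'y) module_scheme \<Rightarrow>
    ((('h \<Rightarrow> 'k) \<times> 'h \<Rightarrow>\<^sub>0 int) set \<Rightarrow> 'v \<Rightarrow> 'v) \<Rightarrow>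
    nat \<Rightarrow> (nat \<Rightarrow> 'h) \<Rightarrow> (nat \<Rightarrow> 'h \<Rightarrow> 'k) \<Rightarrow> bool" where
  "prebraided_commutative K H V act n h p \<longleftrightarrow>
     (\<forall>u \<in> carrier V. \<forall>v \<in> carrier V.
        (\<Oplus>\<^bsub>V\<^esub>i\<in>{..<n}. dual_act K H act (p i) u \<otimes>\<^bsub>V\<^esub> hopf_act K H act (h i) v) = v \<otimes>\<^bsub>V\<^esub> u)"


section \<open>Left bialgebroids and Lu's Hopf algebroids\<close>

record ('k, 'l, 'r) bialgebroid =
  total :: "('k, 'l) module"
  base :: "('k, 'r) module"
  source :: "'r \<Rightarrow> 'l"
  target :: "'r \<Rightarrow> 'l"
  coprod :: "'l \<Rightarrow> ('l \<times> 'l \<Rightarrow>\<^sub>0 int) set"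
  coun :: "'l \<Rightarrow> 'r"

text \<open>\<open>L \<otimes>\<^sub>R L\<close> for the bimodule structure \<open>r \<cdot> x \<cdot> r' = s(r) t(r') x\<close>.\<close>

definition base_tensor ::
  "('k, 'l, 'x) module_scheme \<Rightarrow> ('k, 'r, 'y) module_scheme \<Rightarrow> ('r \<Rightarrow> 'l) \<Rightarrow> ('r \<Rightarrow> 'l) \<Rightarrow>
    ('k, 'l, 'l) tensor_prod" where
  "base_tensor L R s t = tensor L L (carrier R) (\<lambda>x r. t r \<otimes>\<^bsub>L\<^esub> x) (\<lambda>r x. s r \<otimes>\<^bsub>L\<^esub> x)"

text \<open>In the multiplicativity axiom, the product \<open>\<Delta>(a)\<Delta>(b)\<close> (field \<open>mult\<close> of \<open>L \<otimes>\<^sub>R L\<close>) is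
  well defined by virtue of the preceding axiom on \<open>a\<^sub>1 t(r) \<otimes> a\<^sub>2\<close>.\<close>

definition left_bialgebroid ::
  "('k, 'c) ring_scheme \<Rightarrow> ('k, 'l, 'r) bialgebroid \<Rightarrow> bool" where
  "left_bialgebroid K B \<longleftrightarrow>
    (let L = total B; R = base B; s = source B; t = target B; \<Delta> = coprod B; \<epsilon> = coun B;
         L2 = base_tensor L R s t;
         L3 = tensor L L2 (carrier R) (\<lambda>x r. t r \<otimes>\<^bsub>L\<^esub> x)
                (\<lambda>r. tensor_lift L2 (\<lambda>x y. (s r \<otimes>\<^bsub>L\<^esub> x) \<boxtimes>\<^bsub>L2\<^esub> y))
     in
     k_algebra K L \<and> k_algebra K R \<and>
     alg_hom K R L s \<and> alg_hom K R (opposite L) t \<and>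
     (\<forall>r \<in> carrier R. \<forall>r' \<in> carrier R. s r \<otimes>\<^bsub>L\<^esub> t r' = t r' \<otimes>\<^bsub>L\<^esub> s r) \<and>
     linear_map K L L2 \<Delta> \<and> linear_map K L R \<epsilon> \<and>
     (\<forall>r \<in> carrier R. \<forall>r' \<in> carrier R. \<forall>a \<in> carrier L.
        \<Delta> (s r \<otimes>\<^bsub>L\<^esub> t r' \<otimes>\<^bsub>L\<^esub> a)
          = tensor_lift L2 (\<lambda>x y. (s r \<otimes>\<^bsub>L\<^esub> x) \<boxtimes>\<^bsub>L2\<^esub> (t r' \<otimes>\<^bsub>L\<^esub> y)) (\<Delta> a) \<and>
        \<epsilon> (s r \<otimes>\<^bsub>L\<^esub> t r' \<otimes>\<^bsub>L\<^esub> a) = r \<otimes>\<^bsub>R\<^esub> \<epsilon> a \<otimes>\<^bsub>R\<^esub> r') \<and>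
     (\<forall>a \<in> carrier L.
        tensor_lift L3 (\<lambda>x y. tensor_lift L3 (\<lambda>x1 x2. x1 \<boxtimes>\<^bsub>L3\<^esub> (x2 \<boxtimes>\<^bsub>L2\<^esub> y)) (\<Delta> x)) (\<Delta> a)
          = tensor_lift L3 (\<lambda>x y. x \<boxtimes>\<^bsub>L3\<^esub> \<Delta> y) (\<Delta> a) \<and>
        tensor_lift L (\<lambda>x y. s (\<epsilon> x) \<otimes>\<^bsub>L\<^esub> y) (\<Delta> a) = a \<and>
        tensor_lift L (\<lambda>x y. t (\<epsilon> y) \<otimes>\<^bsub>L\<^esub> x) (\<Delta> a) = a) \<and>
     (\<forall>a \<in> carrier L. \<forall>r \<in> carrier R.
        tensor_lift L2 (\<lambda>x y. (x \<otimes>\<^bsub>L\<^esub> t r) \<boxtimes>\<^bsub>L2\<^esub> y) (\<Delta> a)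
          = tensor_lift L2 (\<lambda>x y. x \<boxtimes>\<^bsub>L2\<^esub> (y \<otimes>\<^bsub>L\<^esub> s r)) (\<Delta> a)) \<and>
     (\<forall>a \<in> carrier L. \<forall>b \<in> carrier L. \<Delta> (a \<otimes>\<^bsub>L\<^esub> b) = \<Delta> a \<otimes>\<^bsub>L2\<^esub> \<Delta> b) \<and>
     \<Delta> \<one>\<^bsub>L\<^esub> = \<one>\<^bsub>L\<^esub> \<boxtimes>\<^bsub>L2\<^esub> \<one>\<^bsub>L\<^esub> \<and>
     (\<forall>a \<in> carrier L. \<forall>b \<in> carrier L.
        \<epsilon> (a \<otimes>\<^bsub>L\<^esub> b) = \<epsilon> (a \<otimes>\<^bsub>L\<^esub> s (\<epsilon> b)) \<and>
        \<epsilon> (a \<otimes>\<^bsub>L\<^esub> b) = \<epsilon> (a \<otimes>\<^bsub>L\<^esub> t (\<epsilon> b))) \<and>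
     \<epsilon> \<one>\<^bsub>L\<^esub> = \<one>\<^bsub>R\<^esub>)"

definition hopf_algebroid ::
  "('k, 'c) ring_scheme \<Rightarrow> ('k, 'l, 'r) bialgebroid \<Rightarrow> ('l \<Rightarrow> 'l) \<Rightarrow> bool" where
  "hopf_algebroid K B \<tau> \<longleftrightarrow>
    (let L = total B; R = base B; s = source B; t = target B; \<Delta> = coprod B; \<epsilon> = coun B;
         L2 = base_tensor L R s t; L2k = ktensor K L L
     in
     left_bialgebroid K B \<and>
     alg_iso K L (opposite L) \<tau> \<and>
     (\<forall>r \<in> carrier R. \<tau> (t r) = s r) \<and>
     (\<forall>a \<in> carrier L. tensor_lift L (\<lambda>x y. \<tau> x \<otimes>\<^bsub>L\<^esub> y) (\<Delta> a) = t (\<epsilon> (\<tau> a))) \<and>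
     (\<exists>\<eta>. linear_map K L2 L2k \<eta> \<and>
        (\<forall>z \<in> carrier L2. tensor_lift L2 (\<lambda>x y. x \<boxtimes>\<^bsub>L2\<^esub> y) (\<eta> z) = z) \<and>
        (\<forall>a \<in> carrier L. tensor_lift L (\<lambda>x y. x \<otimes>\<^bsub>L\<^esub> \<tau> y) (\<eta> (\<Delta> a)) = s (\<epsilon> a))))"

definition bialgebroid_isomorphic ::
  "('k, 'c) ring_scheme \<Rightarrow> ('k, 'l, 'r) bialgebroid \<Rightarrow> ('k, 'm, 'q) bialgebroid \<Rightarrow> bool" where
  "bialgebroid_isomorphic K B C \<longleftrightarrow>
    (let C2 = base_tensor (total C) (base C) (source C) (target C) in
     \<exists>\<Phi> \<phi>. alg_iso K (total B) (total C) \<Phi> \<and> alg_iso K (base B) (base C) \<phi> \<and>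
       (\<forall>r \<in> carrier (base B). \<Phi> (source B r) = source C (\<phi> r)) \<and>
       (\<forall>r \<in> carrier (base B). \<Phi> (target B r) = target C (\<phi> r)) \<and>
       (\<forall>a \<in> carrier (total B).
          coprod C (\<Phi> a) = tensor_lift C2 (\<lambda>x y. \<Phi> x \<boxtimes>\<^bsub>C2\<^esub> \<Phi> y) (coprod B a)) \<and>
       (\<forall>a \<in> carrier (total B). coun C (\<Phi> a) = \<phi> (coun B a)))"


section \<open>Lu's smash product Hopf algebroid\<close>

definition smash_algebra ::
  "('k, 'c) ring_scheme \<Rightarrow> ('k, 'h, 'x) hopf_scheme \<Rightarrow> ('k, 'v, 'y) module_scheme \<Rightarrow>
    ((('h \<Rightarrow> 'k) \<times> 'h \<Rightarrow>\<^sub>0 int) set \<Rightarrow> 'v \<Rightarrow> 'v) \<Rightarrow>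
    ('k, ('v \<times> 'h \<Rightarrow>\<^sub>0 int) set) module" where
  "smash_algebra K H V act =
    (let T = ktensor K V H in
     module.truncate (T\<lparr>monoid.mult := (\<lambda>X Y.
       tensor_lift T (\<lambda>v h. tensor_lift T (\<lambda>v' h'.
         tensor_lift T (\<lambda>h1 h2. (v \<otimes>\<^bsub>V\<^esub> hopf_act K H act h1 v') \<boxtimes>\<^bsub>T\<^esub> (h2 \<otimes>\<^bsub>H\<^esub> h'))
           (comult H h)) Y) X)\<rparr>))"

definition lu_target ::
  "('k, 'c) ring_scheme \<Rightarrow> ('k, 'h, 'x) hopf_scheme \<Rightarrow> ('k, 'v) module \<Rightarrow>
    ((('h \<Rightarrow> 'k) \<times> 'h \<Rightarrow>\<^sub>0 int) set \<Rightarrow> 'v \<Rightarrow> 'v) \<Rightarrow>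
    nat \<Rightarrow> (nat \<Rightarrow> 'h) \<Rightarrow> (nat \<Rightarrow> 'h \<Rightarrow> 'k) \<Rightarrow> 'v \<Rightarrow> ('v \<times> 'h \<Rightarrow>\<^sub>0 int) set" where
  "lu_target K H V act n h p v =
     (\<Oplus>\<^bsub>ktensor K V H\<^esub>i\<in>{..<n}. dual_act K H act (p i) v \<boxtimes>\<^bsub>ktensor K V H\<^esub> h i)"

definition lu_bialgebroid ::
  "('k, 'c) ring_scheme \<Rightarrow> ('k, 'h, 'x) hopf_scheme \<Rightarrow> ('k, 'v) module \<Rightarrow>
    ((('h \<Rightarrow> 'k) \<times> 'h \<Rightarrow>\<^sub>0 int) set \<Rightarrow> 'v \<Rightarrow> 'v) \<Rightarrow>
    nat \<Rightarrow> (nat \<Rightarrow> 'h) \<Rightarrow> (nat \<Rightarrow> 'h \<Rightarrow> 'k) \<Rightarrow>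
    ('k, ('v \<times> 'h \<Rightarrow>\<^sub>0 int) set, 'v) bialgebroid" where
  "lu_bialgebroid K H V act n h p =
    (let T = ktensor K V H;
         L = smash_algebra K H V act;
         s = (\<lambda>v. v \<boxtimes>\<^bsub>T\<^esub> \<one>\<^bsub>H\<^esub>);
         t = lu_target K H V act n h p;
         L2 = base_tensor L V s t
     in \<lparr>total = L, base = V, source = s, target = t,
         coprod = tensor_lift L2 (\<lambda>v g. tensor_lift L2
           (\<lambda>g1 g2. (v \<boxtimes>\<^bsub>T\<^esub> g1) \<boxtimes>\<^bsub>L2\<^esub> (\<one>\<^bsub>V\<^esub> \<boxtimes>\<^bsub>T\<^esub> g2)) (comult H g)),
         coun = tensor_lift V (\<lambda>v g. counit H g \<odot>\<^bsub>V\<^esub> v)\<rparr>)"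

definition lu_antipode ::
  "('k, 'c) ring_scheme \<Rightarrow> ('k, 'h, 'x) hopf_scheme \<Rightarrow> ('k, 'v) module \<Rightarrow>
    ((('h \<Rightarrow> 'k) \<times> 'h \<Rightarrow>\<^sub>0 int) set \<Rightarrow> 'v \<Rightarrow> 'v) \<Rightarrow>
    nat \<Rightarrow> (nat \<Rightarrow> 'h) \<Rightarrow> (nat \<Rightarrow> 'h \<Rightarrow> 'k) \<Rightarrow>
    ('v \<times> 'h \<Rightarrow>\<^sub>0 int) set \<Rightarrow> ('v \<times> 'h \<Rightarrow>\<^sub>0 int) set" where
  "lu_antipode K H V act n h p =
    (let T = ktensor K V H; L = smash_algebra K H V act; S = antipode H in
     tensor_lift L (\<lambda>v g. \<Oplus>\<^bsub>L\<^esub>i\<in>{..<n}.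
       (\<one>\<^bsub>V\<^esub> \<boxtimes>\<^bsub>T\<^esub> S g) \<otimes>\<^bsub>L\<^esub>
         lu_target K H V act n h p
           (hopf_act K H act (S (S (h i))) (dual_act K H act (p i) v))))"


section \<open>Hopf-Galois extensions\<close>

definition comodule_algebra ::
  "('k, 'c) ring_scheme \<Rightarrow> ('k, 'h, 'x) hopf_scheme \<Rightarrow> ('k, 'a, 'y) module_scheme \<Rightarrow>
    ('a \<Rightarrow> ('a \<times> 'h \<Rightarrow>\<^sub>0 int) set) \<Rightarrow> bool" where
  "comodule_algebra K H A \<rho> \<longleftrightarrow>
    (let H2 = ktensor K H H; AHH = ktensor K A H2 in
     k_algebra K A \<and> alg_hom K A (ktensor K A H) \<rho> \<and>
     (\<forall>a \<in> carrier A.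
        tensor_lift AHH (\<lambda>x h. tensor_lift AHH (\<lambda>y g. y \<boxtimes>\<^bsub>AHH\<^esub> (g \<boxtimes>\<^bsub>H2\<^esub> h)) (\<rho> x)) (\<rho> a)
          = tensor_lift AHH (\<lambda>x h. x \<boxtimes>\<^bsub>AHH\<^esub> comult H h) (\<rho> a) \<and>
        tensor_lift A (\<lambda>x h. counit H h \<odot>\<^bsub>A\<^esub> x) (\<rho> a) = a))"

definition coinvariants ::
  "('k, 'c) ring_scheme \<Rightarrow> ('k, 'h, 'x) hopf_scheme \<Rightarrow> ('k, 'a, 'y) module_scheme \<Rightarrow>
    ('a \<Rightarrow> ('a \<times> 'h \<Rightarrow>\<^sub>0 int) set) \<Rightarrow> 'a set" where
  "coinvariants K H A \<rho> = {a \<in> carrier A. \<rho> a = a \<boxtimes>\<^bsub>ktensor K A H\<^esub> \<one>\<^bsub>H\<^esub>}"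

definition tensor_over ::
  "('k, 'a, 'y) module_scheme \<Rightarrow> 'a set \<Rightarrow> ('k, 'a, 'a) tensor_prod" where
  "tensor_over A B = tensor A A B (\<lambda>a b. a \<otimes>\<^bsub>A\<^esub> b) (\<lambda>b a. b \<otimes>\<^bsub>A\<^esub> a)"

definition galois_map ::
  "('k, 'c) ring_scheme \<Rightarrow> ('k, 'h, 'x) hopf_scheme \<Rightarrow> ('k, 'a, 'y) module_scheme \<Rightarrow>
    ('a \<Rightarrow> ('a \<times> 'h \<Rightarrow>\<^sub>0 int) set) \<Rightarrow> ('a \<times> 'a \<Rightarrow>\<^sub>0 int) set \<Rightarrow> ('a \<times> 'h \<Rightarrow>\<^sub>0 int) set" where
  "galois_map K H A \<rho> = (let AH = ktensor K A H in
     tensor_lift AH (\<lambda>a a'. tensor_lift AH (\<lambda>x h. (a \<otimes>\<^bsub>A\<^esub> x) \<boxtimes>\<^bsub>AH\<^esub> h) (\<rho> a')))"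

definition galois_extension ::
  "('k, 'c) ring_scheme \<Rightarrow> ('k, 'h, 'x) hopf_scheme \<Rightarrow> ('k, 'a, 'y) module_scheme \<Rightarrow>
    ('a \<Rightarrow> ('a \<times> 'h \<Rightarrow>\<^sub>0 int) set) \<Rightarrow> 'a set \<Rightarrow> bool" where
  "galois_extension K H A \<rho> B \<longleftrightarrow>
     comodule_algebra K H A \<rho> \<and> B = coinvariants K H A \<rho> \<and>
     bij_betw (galois_map K H A \<rho>) (carrier (tensor_over A B)) (carrier (ktensor K A H))"


section \<open>The bialgebroid \<open>T\<^sup>o\<^sup>p\<close> of a ring extension\<close>

definition centralizer :: "('a, 'y) ring_scheme \<Rightarrow> 'a set \<Rightarrow> 'a set" where
  "centralizer A B = {r \<in> carrier A. \<forall>b \<in> B. r \<otimes>\<^bsub>A\<^esub> b = b \<otimes>\<^bsub>A\<^esub> r}"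

text \<open>\<open>T = (A \<otimes>\<^sub>B A)\<^sup>B\<close> with product \<open>t t' = t'\<^sup>1 t\<^sup>1 \<otimes> t\<^sup>2 t'\<^sup>2\<close>.  This is independent of
  representatives only if \<open>t\<close> is expanded before \<open>t'\<close>.\<close>

definition T_algebra ::
  "('k, 'a, 'y) module_scheme \<Rightarrow> 'a set \<Rightarrow> ('k, ('a \<times> 'a \<Rightarrow>\<^sub>0 int) set) module" where
  "T_algebra A B =
    (let AA = tensor_over A B in
     module.truncate (AA\<lparr>
       carrier := {t \<in> carrier AA. \<forall>b \<in> B.
          tensor_lift AA (\<lambda>x y. (b \<otimes>\<^bsub>A\<^esub> x) \<boxtimes>\<^bsub>AA\<^esub> y) t = tensor_lift AA (\<lambda>x y. x \<boxtimes>\<^bsub>AA\<^esub> (y \<otimes>\<^bsub>A\<^esub> b)) t},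
       monoid.mult := (\<lambda>t t'. tensor_lift AA (\<lambda>x' y'.
          tensor_lift AA (\<lambda>x y. (x' \<otimes>\<^bsub>A\<^esub> x) \<boxtimes>\<^bsub>AA\<^esub> (y \<otimes>\<^bsub>A\<^esub> y')) t) t')\<rparr>))"

text \<open>The coproduct of \<open>t\<close> is the preimage of \<open>t\<^sup>1 \<otimes> 1 \<otimes> t\<^sup>2\<close> under
  \<open>T \<otimes>\<^sub>R T \<rightarrow> A \<otimes>\<^sub>B (A \<otimes>\<^sub>B A)\<close>, \<open>t \<otimes> t' \<mapsto> t\<^sup>1 \<otimes> (t\<^sup>2 t'\<^sup>1 \<otimes> t'\<^sup>2)\<close>, which for depth two extensions
  is injective with image the \<open>B\<close>-central elements.  In \<open>T\<^sup>o\<^sup>p\<close> the generic bimodule structure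
  \<open>s(r) t(r') x\<close> used by \<open>base_tensor\<close> is \<open>r x\<^sup>1 \<otimes> x\<^sup>2 r'\<close>.\<close>

definition T_op ::
  "('k, 'a) module \<Rightarrow> 'a set \<Rightarrow> ('k, ('a \<times> 'a \<Rightarrow>\<^sub>0 int) set, 'a) bialgebroid" where
  "T_op A B =
    (let AA = tensor_over A B;
         AAA = tensor A AA B (\<lambda>a b. a \<otimes>\<^bsub>A\<^esub> b) (\<lambda>b. tensor_lift AA (\<lambda>x y. (b \<otimes>\<^bsub>A\<^esub> x) \<boxtimes>\<^bsub>AA\<^esub> y));
         L = opposite (T_algebra A B);
         R = A\<lparr>carrier := centralizer A B\<rparr>;
         s = (\<lambda>r. r \<boxtimes>\<^bsub>AA\<^esub> \<one>\<^bsub>A\<^esub>);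
         t = (\<lambda>r. \<one>\<^bsub>A\<^esub> \<boxtimes>\<^bsub>AA\<^esub> r);
         can = tensor_lift AAA (\<lambda>u u'. tensor_lift AAA (\<lambda>x y.
                 tensor_lift AAA (\<lambda>x' y'. x \<boxtimes>\<^bsub>AAA\<^esub> ((y \<otimes>\<^bsub>A\<^esub> x') \<boxtimes>\<^bsub>AA\<^esub> y')) u') u)
     in \<lparr>total = L, base = R, source = s, target = t,
         coprod = (\<lambda>u. inv_into (carrier (base_tensor L R s t)) can
                      (tensor_lift AAA (\<lambda>x y. x \<boxtimes>\<^bsub>AAA\<^esub> (\<one>\<^bsub>A\<^esub> \<boxtimes>\<^bsub>AA\<^esub> y)) u)),
         coun = tensor_lift A (\<lambda>x y. x \<otimes>\<^bsub>A\<^esub> y)\<rparr>)"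

end

theory Submission
  imports Defs
begin

text \<open>For \<open>h \<in> H\<close> put \<open>\<gamma>(h) = \<beta>\<^sup>-\<^sup>1(1 \<otimes> h) = h\<^sup>1 \<otimes> h\<^sup>2\<close>.  The centralizer \<open>R\<close> carries the Miyashita-Ulbrich action
  \<open>h \<triangleright> r = h\<^sup>1 r h\<^sup>2\<close>, for which \<open>r y = y\<^sub>0 (y\<^sub>1 \<triangleright> r)\<close>, and the restricted \<open>H\<close>-coaction; expanding
  \<open>\<rho>(r y)\<close> in two ways yields the Yetter-Drinfel'd condition, i.e. an action of \<open>D(H')\<close> on \<open>R\<close> for
  \<open>H' = H\<^sup>o\<^sup>p\<close>, and the displayed formula is pre-braided commutativity.  Since
  \<open>x \<otimes> y = x y\<^sub>0 \<gamma>(y\<^sub>1)\<close> in \<open>A \<otimes>\<^sub>B A\<close>, the map \<open>r \<otimes> h \<mapsto> r \<gamma>(h)\<close> is a bijection \<open>R \<otimes> H' \<rightarrow> T\<^sup>o\<^sup>p\<close>,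
  with \<open>\<gamma>\<close> multiplicative, \<open>\<gamma>(h) s(r) = s(h\<^sub>1 \<triangleright> r) \<gamma>(h\<^sub>2)\<close> and \<open>t(r) = s(r\<^sub>0) \<gamma>(r\<^sub>1)\<close>.  These relations alone
  determine a Hopf algebroid.  Its antipode \<open>\<tau>\<close> is inverse to the map \<open>\<sigma> : s(r) \<gamma>(h) \<mapsto> \<gamma>(S\<^sup>-\<^sup>1 h) t(r)\<close>,
  whose multiplicativity is easier to check.\<close>

text \<open>The definition of a Hopf algebra says nothing about invertibility of the antipode, while
  \<open>H^op\<close>, the double and \<open>\<sigma>\<close> all use \<open>S^-1\<close>. Its
  existence comes from integrals: for each functional \<open>g\<close> on \<open>H\<close>, the
  trace of \<open>u \<mapsto> g(y2) y1\<close> with \<open>y = x S(S u)\<close> is an invariant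
  functional of \<open>x\<close>, and for \<open>g\<close> running through a dual basis certain
  values of these functionals add up to one. If \<open>S h = 0\<close>, invariance shows that each
  of these values annihilates \<open>h\<close>, whence \<open>h = 0\<close>. The opposite algebra
  enters because \<open>\<gamma>(h)\<close> times \<open>\<gamma>(g)\<close> in \<open>T^op\<close>
  is \<open>\<gamma>(g h)\<close>. Elements of a tensor product are cosets of formal combinations of
  pairs from the two carriers. So \<open>R \<otimes> H\<close> is not a subset of
  \<open>A \<otimes> H\<close>, and the coaction of \<open>A\<close> cannot simply be restricted to
  \<open>R\<close>. It is rebuilt over dual bases from the operators \<open>E f\<close>,
  \<open>a \<mapsto> f(a1) a0\<close>, which preserve \<open>R\<close>. Coordinates of
  \<open>T^op\<close> along \<open>\<gamma>\<close> are found in the same way, and the smash product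
  inherits its algebra laws from \<open>T^op\<close> through these coordinates.\<close>

abbreviation in_carrier (infix \<open>\<in>!\<close> 50) where "x \<in>! M \<equiv> x \<in> carrier M"
abbreviation "supp \<equiv> Poly_Mapping.keys"

section \<open>Linear maps\<close>

lemma linear_mapI:
  assumes "\<And>x. x \<in>! M ==> f x \<in>! N"
    and "\<And>x y. x \<in>! M ==> y \<in>! M ==> f (x \<oplus>\<^bsub>M\<^esub> y) = f x \<oplus>\<^bsub>N\<^esub> f y"
    and "\<And>c x. c \<in>! K ==> x \<in>! M ==> f (c \<odot>\<^bsub>M\<^esub> x) = c \<odot>\<^bsub>N\<^esub> f x"
  shows "linear_map K M N f"
  using assms by (auto simp: linear_map_def)

lemma linear_mapD:
  assumes "linear_map K M N f"
  shows "x \<in>! M ==> f x \<in>! N"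
    and "x \<in>! M ==> y \<in>! M ==> f (x \<oplus>\<^bsub>M\<^esub> y) = f x \<oplus>\<^bsub>N\<^esub> f y"
    and "c \<in>! K ==> x \<in>! M ==> f (c \<odot>\<^bsub>M\<^esub> x) = c \<odot>\<^bsub>N\<^esub> f x"
  using assms by (auto simp: linear_map_def)

lemma linear_map_zero:
  assumes "linear_map K M N f" "module K M" "module K N"
  shows "f \<zero>\<^bsub>M\<^esub> = \<zero>\<^bsub>N\<^esub>"
proof -
  interpret M: module K M by fact
  interpret N: module K N by fact
  have "f \<zero>\<^bsub>M\<^esub> = f (\<zero>\<^bsub>K\<^esub> \<odot>\<^bsub>M\<^esub> \<zero>\<^bsub>M\<^esub>)" by simp
  also have "... = \<zero>\<^bsub>K\<^esub> \<odot>\<^bsub>N\<^esub> f \<zero>\<^bsub>M\<^esub>"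
    by (rule linear_mapD(3)[OF assms(1)]) auto
  also have "... = \<zero>\<^bsub>N\<^esub>"
    by (rule N.smult_l_null) (auto intro: linear_mapD(1)[OF assms(1)])
  finally show ?thesis .
qed

lemma linear_map_minus:
  assumes "linear_map K M N f" "module K M" "module K N" "x \<in>! M"
  shows "f (\<ominus>\<^bsub>M\<^esub> x) = \<ominus>\<^bsub>N\<^esub> f x"
proof -
  interpret M: module K M by fact
  interpret N: module K N by fact
  have "f (\<ominus>\<^bsub>M\<^esub> x) \<oplus>\<^bsub>N\<^esub> f x = \<zero>\<^bsub>N\<^esub>"
    using linear_mapD(2)[OF assms(1), of "\<ominus>\<^bsub>M\<^esub> x" x] linear_map_zero[OF assms(1-3)] assms(4)
    by (simp add: M.M.l_neg)
  then show ?thesis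
    using assms(4) linear_mapD(1)[OF assms(1)] by (simp add: N.M.minus_equality)
qed

lemma linear_map_cong:
  assumes "linear_map K M N f" "module K M" "\<And>x. x \<in>! M ==> f x = g x"
  shows "linear_map K M N g"
proof -
  interpret M: module K M by fact
  show ?thesis
    using assms(1,3) by (auto simp: linear_map_def Pi_iff)
qed

lemma linear_comp:
  assumes "linear_map K M N f" "linear_map K N P g"
  shows "linear_map K M P (\<lambda>x. g (f x))"
  using assms by (auto simp: linear_map_def Pi_iff)

lemma linear_map_id: "linear_map K M M (\<lambda>x. x)"
  by (simp add: linear_map_def)

lemma linear_map_add:
  assumes "linear_map K M N f" "linear_map K M N g" "module K N"
  shows "linear_map K M N (\<lambda>x. f x \<oplus>\<^bsub>N\<^esub> g x)"
proof -
  interpret N: module K N by fact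
  show ?thesis
    using assms(1,2)
    by (intro linear_mapI) (auto simp: linear_map_def Pi_iff N.smult_r_distr N.M.a_ac)
qed

lemma linear_map_smult:
  assumes "linear_map K M N f" "module K N" "c \<in>! K"
  shows "linear_map K M N (\<lambda>x. c \<odot>\<^bsub>N\<^esub> f x)"
proof -
  interpret N: module K N by fact
  show ?thesis
    using assms(1,3)
    by (intro linear_mapI)
      (auto simp: linear_map_def Pi_iff N.smult_r_distr N.smult_assoc1[symmetric] N.R.m_comm)
qed

lemma module_self: "cring K ==> module K (self_module K)"
proof -
  assume "cring K"
  then interpret cring K .
  have "abelian_group (self_module K)"
    by (rule abelian_groupI) (auto simp: self_module_def a_ac intro: bexI[of _ "a_inv K _"] l_neg)
  then show ?thesis
    by (intro moduleI) (auto simp: self_module_def l_distr r_distr m_assoc \<open>cring K\<close>)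
qed

lemma self_module_simps [simp]:
  "carrier (self_module K) = carrier K" "x \<oplus>\<^bsub>self_module K\<^esub> y = x \<oplus>\<^bsub>K\<^esub> y"
  "x \<odot>\<^bsub>self_module K\<^esub> y = x \<otimes>\<^bsub>K\<^esub> y" "x \<otimes>\<^bsub>self_module K\<^esub> y = x \<otimes>\<^bsub>K\<^esub> y"
  "\<zero>\<^bsub>self_module K\<^esub> = \<zero>\<^bsub>K\<^esub>" "\<one>\<^bsub>self_module K\<^esub> = \<one>\<^bsub>K\<^esub>"
  by (simp_all add: self_module_def)

lemma linear_map_scalar:
  assumes "linear_map K M (self_module K) e" "module K N" "z \<in>! N"
  shows "linear_map K M N (\<lambda>x. e x \<odot>\<^bsub>N\<^esub> z)"
proof -
  interpret N: module K N by fact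
  show ?thesis
    using assms(1,3)
    by (intro linear_mapI) (auto simp: linear_map_def Pi_iff N.smult_l_distr N.smult_assoc1)
qed

lemma linear_map_const_zero:
  assumes "module K N" shows "linear_map K M N (\<lambda>x. \<zero>\<^bsub>N\<^esub>)"
proof -
  interpret N: module K N by fact
  show ?thesis by (intro linear_mapI) auto
qed

lemma linear_map_finsum_fun:
  assumes "finite I" "\<And>i. i \<in> I ==> linear_map K M N (f i)" "module K N"
  shows "linear_map K M N (\<lambda>x. \<Oplus>\<^bsub>N\<^esub>i\<in>I. f i x)"
proof -
  interpret N: module K N by fact
  show ?thesis
  proof (intro linear_mapI)
    fix x assume "x \<in>! M"
    then show "(\<Oplus>\<^bsub>N\<^esub>i\<in>I. f i x) \<in>! N"
      using linear_mapD(1)[OF assms(2)] by (intro N.M.finsum_closed) auto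
  next
    fix x y assume xy: "x \<in>! M" "y \<in>! M"
    have "(\<Oplus>\<^bsub>N\<^esub>i\<in>I. f i (x \<oplus>\<^bsub>M\<^esub> y)) = (\<Oplus>\<^bsub>N\<^esub>i\<in>I. f i x \<oplus>\<^bsub>N\<^esub> f i y)"
      using linear_mapD(1,2)[OF assms(2)] xy by (intro N.M.finsum_cong') auto
    also have "... = (\<Oplus>\<^bsub>N\<^esub>i\<in>I. f i x) \<oplus>\<^bsub>N\<^esub> (\<Oplus>\<^bsub>N\<^esub>i\<in>I. f i y)"
      using linear_mapD(1)[OF assms(2)] xy by (intro N.M.finsum_addf) auto
    finally show "(\<Oplus>\<^bsub>N\<^esub>i\<in>I. f i (x \<oplus>\<^bsub>M\<^esub> y)) = (\<Oplus>\<^bsub>N\<^esub>i\<in>I. f i x) \<oplus>\<^bsub>N\<^esub> (\<Oplus>\<^bsub>N\<^esub>i\<in>I. f i y)" .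
  next
    fix c x assume cx: "c \<in>! K" "x \<in>! M"
    have "(\<Oplus>\<^bsub>N\<^esub>i\<in>I. f i (c \<odot>\<^bsub>M\<^esub> x)) = (\<Oplus>\<^bsub>N\<^esub>i\<in>I. c \<odot>\<^bsub>N\<^esub> f i x)"
      using linear_mapD(1,3)[OF assms(2)] cx by (intro N.M.finsum_cong') auto
    also have "... = c \<odot>\<^bsub>N\<^esub> (\<Oplus>\<^bsub>N\<^esub>i\<in>I. f i x)"
      using linear_mapD(1)[OF assms(2)] cx assms(1)
      by (intro N.finsum_smult_ldistr[symmetric]) auto
    finally show "(\<Oplus>\<^bsub>N\<^esub>i\<in>I. f i (c \<odot>\<^bsub>M\<^esub> x)) = c \<odot>\<^bsub>N\<^esub> (\<Oplus>\<^bsub>N\<^esub>i\<in>I. f i x)" .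
  qed
qed

lemma linear_map_finsum:
  assumes "linear_map K M N f" "module K M" "module K N" "finite I" "g \<in> I \<rightarrow> carrier M"
  shows "f (\<Oplus>\<^bsub>M\<^esub>i\<in>I. g i) = (\<Oplus>\<^bsub>N\<^esub>i\<in>I. f (g i))"
proof -
  interpret M: module K M by fact
  interpret N: module K N by fact
  show ?thesis
    using assms(4,5)
  proof (induction I rule: finite_induct)
    case empty
    then show ?case using linear_map_zero[OF assms(1-3)] by simp
  next
    case (insert i I)
    then have "g \<in> I \<rightarrow> carrier M" "g i \<in>! M" by auto
    then show ?case
      using insert linear_mapD(1,2)[OF assms(1)] by (simp add: Pi_iff)
  qed
qed

section \<open>Sums over formal combinations\<close>

lemma foldSetD_cong:
  assumes "(A, z) \<in> foldSetD D f e" "\<And>x. x \<in> A ==> f x = g x"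
  shows "(A, z) \<in> foldSetD D g e"
  using assms
proof (induction rule: foldSetD.induct)
  case emptyI
  then show ?case by (intro foldSetD.emptyI)
next
  case (insertI x A y)
  then have "(A, y) \<in> foldSetD D g e" by auto
  then have "(insert x A, g x y) \<in> foldSetD D g e"
    using insertI by (intro foldSetD.insertI) auto
  then show ?case using insertI by auto
qed

lemma foldD_cong:
  assumes "\<And>x. x \<in> A ==> f x = g x"
  shows "foldD D f e A = foldD D g e A"
  unfolding foldD_def
  by (intro arg_cong[where f = The] ext iffI; erule foldSetD_cong) (auto simp: assms)

text \<open>The fold behind \<open>finsum\<close> applies its function only to members of
  \<open>A\<close>; thus the sums agree even when values lie outside the carrier and the sums have
  no meaning.\<close>

lemma finsum_eqI:
  assumes "\<And>x. x \<in> A ==> f x = g x"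
  shows "finsum G f A = finsum G g A"
  unfolding finsum_def finprod_def using assms by (auto intro!: foldD_cong)

lemma frag_sum_cong:
  assumes "\<And>i. i \<in> supp u ==> \<phi> i = \<psi> i"
  shows "frag_sum G \<phi> u = frag_sum G \<psi> u"
  unfolding frag_sum_def using assms by (intro finsum_eqI) simp

lemma finsum_structure_cong:
  assumes "carrier G = carrier G'" "add G = add G'" "\<zero>\<^bsub>G\<^esub> = \<zero>\<^bsub>G'\<^esub>"
  shows "finsum G f A = finsum G' f A"
  using assms unfolding finsum_def finprod_def by simp

lemma add_pow_int_structure_cong:
  fixes k :: int
  assumes "carrier G = carrier G'" "add G = add G'" "\<zero>\<^bsub>G\<^esub> = \<zero>\<^bsub>G'\<^esub>"
  shows "add_pow G k x = add_pow G' k x"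
  using assms unfolding add_pow_def int_pow_def nat_pow_def m_inv_def Let_def by simp

lemma frag_sum_structure_cong:
  assumes "carrier G = carrier G'" "add G = add G'" "\<zero>\<^bsub>G\<^esub> = \<zero>\<^bsub>G'\<^esub>"
  shows "frag_sum G \<phi> u = frag_sum G' \<phi> u"
  unfolding frag_sum_def finsum_structure_cong[OF assms] add_pow_int_structure_cong[OF assms] ..

text \<open>Inside \<open>tensor\<close> the lifts are taken in an auxiliary structure that has a
  meaningful addition only; this rule identifies them with lifts into the finished tensor
  product.\<close>

lemma tensor_lift_structure_cong:
  assumes "carrier G = carrier G'" "add G = add G'" "\<zero>\<^bsub>G\<^esub> = \<zero>\<^bsub>G'\<^esub>"
  shows "tensor_lift G \<phi> X = tensor_lift G' \<phi> X"
  unfolding tensor_lift_def using frag_sum_structure_cong[OF assms] by metis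

section \<open>Additivity of formal sums in an abelian group\<close>

context abelian_group
begin

lemma add_pow_int_closed: "x \<in>! G ==> add_pow G (k::int) x \<in>! G"
  by (rule add.int_pow_closed)

lemma frag_sum_closed:
  assumes "\<phi> \<in> supp u \<rightarrow> carrier G"
  shows "frag_sum G \<phi> u \<in>! G"
  unfolding frag_sum_def using assms by (intro finsum_closed) (auto intro: add_pow_int_closed)

text \<open>Indices outside the support contribute zero, so several combinations can be summed over
  one common index set; this is how they are compared in \<open>frag_sum_add\<close>.\<close>

lemma frag_sum_superset:
  assumes "\<phi> \<in> S \<rightarrow> carrier G" "supp u \<subseteq> S" "finite S"
  shows "frag_sum G \<phi> u = (\<Oplus>i\<in>S. add_pow G (Poly_Mapping.lookup u i) (\<phi> i))"
proof -
  have "add_pow G (0::int) x = \<zero>" for x by (simp add: add_pow_def)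
  then show ?thesis
    unfolding frag_sum_def using assms
    by (intro add.finprod_mono_neutral_cong_left) (auto intro!: add_pow_int_closed simp: in_keys_iff)
qed

lemma frag_sum_0 [simp]: "frag_sum G \<phi> 0 = \<zero>"
  by (simp add: frag_sum_def)

lemma frag_sum_of:
  assumes "\<phi> i \<in>! G"
  shows "frag_sum G \<phi> (frag_of i) = \<phi> i"
  using assms by (simp add: frag_sum_def)

lemma frag_sum_add:
  assumes "\<phi> \<in> S \<rightarrow> carrier G" "supp u \<subseteq> S" "supp v \<subseteq> S"
  shows "frag_sum G \<phi> (u + v) = frag_sum G \<phi> u \<oplus> frag_sum G \<phi> v"
proof -
  let ?S = "supp u \<union> supp v"
  have S: "\<phi> \<in> ?S \<rightarrow> carrier G" "finite ?S" using assms by auto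
  have "supp (u + v) \<subseteq> ?S" by (rule keys_add)
  then have "frag_sum G \<phi> (u + v)
      = (\<Oplus>i\<in>?S. add_pow G (Poly_Mapping.lookup u i + Poly_Mapping.lookup v i) (\<phi> i))"
    using frag_sum_superset[OF S(1) _ S(2)] by (simp add: lookup_add)
  also have "... = (\<Oplus>i\<in>?S. add_pow G (Poly_Mapping.lookup u i) (\<phi> i)
        \<oplus> add_pow G (Poly_Mapping.lookup v i) (\<phi> i))"
    using S(1) by (intro finsum_eqI) (auto simp: add.int_pow_mult Pi_iff)
  also have "... = frag_sum G \<phi> u \<oplus> frag_sum G \<phi> v"
    using S(1) frag_sum_superset[OF S(1) _ S(2)]
    by (subst finsum_addf) (auto intro!: add_pow_int_closed)
  finally show ?thesis .
qed

lemma frag_sum_minus: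
  assumes "\<phi> \<in> S \<rightarrow> carrier G" "supp u \<subseteq> S"
  shows "frag_sum G \<phi> (- u) = \<ominus> frag_sum G \<phi> u"
proof -
  have "frag_sum G \<phi> (- u) \<oplus> frag_sum G \<phi> u = \<zero>"
    using frag_sum_add[OF assms(1), of "- u" u] assms(2) by simp
  moreover have "frag_sum G \<phi> u \<in>! G" "frag_sum G \<phi> (- u) \<in>! G"
    using assms by (auto intro!: frag_sum_closed)
  ultimately show ?thesis by (metis minus_equality)
qed

lemma frag_sum_diff:
  assumes "\<phi> \<in> S \<rightarrow> carrier G" "supp u \<subseteq> S" "supp v \<subseteq> S"
  shows "frag_sum G \<phi> (u - v) = frag_sum G \<phi> u \<ominus> frag_sum G \<phi> v"
  using frag_sum_add[OF assms(1,2), of "- v"] frag_sum_minus[OF assms(1,3)] assms(3)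
  by (simp add: minus_eq)

lemma frag_sum_addf:
  assumes "\<phi> \<in> supp u \<rightarrow> carrier G" "\<psi> \<in> supp u \<rightarrow> carrier G"
  shows "frag_sum G (\<lambda>i. \<phi> i \<oplus> \<psi> i) u = frag_sum G \<phi> u \<oplus> frag_sum G \<psi> u"
proof -
  have "frag_sum G (\<lambda>i. \<phi> i \<oplus> \<psi> i) u = (\<Oplus>i\<in>supp u.
      add_pow G (Poly_Mapping.lookup u i) (\<phi> i) \<oplus> add_pow G (Poly_Mapping.lookup u i) (\<psi> i))"
    unfolding frag_sum_def using assms
    by (intro finsum_eqI) (auto simp: add.int_pow_distrib Pi_iff)
  then show ?thesis
    using assms by (simp add: frag_sum_def finsum_addf add_pow_int_closed Pi_iff)
qed

end

lemma frag_sum_hom: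
  assumes G: "abelian_group G" and G': "abelian_group G'"
    and f: "\<And>x. x \<in>! G ==> f x \<in>! G'"
      "\<And>x y. x \<in>! G ==> y \<in>! G ==> f (x \<oplus>\<^bsub>G\<^esub> y) = f x \<oplus>\<^bsub>G'\<^esub> f y"
    and \<phi>: "\<phi> \<in> supp u \<rightarrow> carrier G"
  shows "f (frag_sum G \<phi> u) = frag_sum G' (\<lambda>i. f (\<phi> i)) u"
proof -
  interpret G: abelian_group G by fact
  interpret G': abelian_group G' by fact
  have f0: "f \<zero>\<^bsub>G\<^esub> = \<zero>\<^bsub>G'\<^esub>"
    using f(1)[of "\<zero>\<^bsub>G\<^esub>"] f(2)[of "\<zero>\<^bsub>G\<^esub>" "\<zero>\<^bsub>G\<^esub>"]
    by (metis G'.add.l_cancel_one G.l_zero G.zero_closed)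
  have fm: "f (\<ominus>\<^bsub>G\<^esub> x) = \<ominus>\<^bsub>G'\<^esub> f x" if "x \<in>! G" for x
    using f(2)[of "\<ominus>\<^bsub>G\<^esub> x" "x"] that f(1) f0 by (metis G'.minus_equality G.a_inv_closed G.l_neg)
  let ?S = "supp u"
  \<comment> \<open>Carrying the support bound inside the induction statement makes it available for
    both parts of a difference.\<close>
  have "supp v \<subseteq> ?S ==> supp v \<subseteq> ?S \<and>
    f (frag_sum G \<phi> v) = frag_sum G' (\<lambda>i. f (\<phi> i)) v" for v
  proof (induction v rule: frag_induction)
    case zero
    show ?case using f0 by simp
  next
    case (one x)
    then show ?case using f(1) \<phi> by (simp add: G.frag_sum_of G'.frag_sum_of Pi_iff)
  next
    case (diff a b)
    then have "supp (a - b) \<subseteq> ?S" using keys_diff by fastforce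
    moreover have "frag_sum G \<phi> a \<in>! G" "frag_sum G \<phi> b \<in>! G"
      using diff \<phi> by (auto intro!: G.frag_sum_closed)
    ultimately show ?case
      using diff \<phi> f(1) by (subst G.frag_sum_diff[where S = ?S], simp_all,
        subst G'.frag_sum_diff[where S = ?S], auto simp: G.minus_eq G'.minus_eq f(2) fm)
  qed
  then show ?thesis by blast
qed

text \<open>For a balanced \<open>\<phi>\<close> this equals \<open>tensor_lift G \<phi> X\<close>, but it commutes with additive maps for
  every \<open>\<phi>\<close>, balanced or not.\<close>

definition rsum :: "('g, 'x) ring_scheme \<Rightarrow> ('m \<Rightarrow> 'n \<Rightarrow> 'g) \<Rightarrow> ('m \<times> 'n \<Rightarrow>\<^sub>0 int) set \<Rightarrow> 'g" where
  "rsum G \<phi> X = frag_sum G (case_prod \<phi>) (SOME u. u \<in> X)"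

text \<open>Guarantee that the representative chosen by \<open>rsum\<close> involves only pairs from
  the two sets; every closure argument about \<open>rsum\<close> rests on it.\<close>

definition rep_in :: "('m \<times> 'n \<Rightarrow>\<^sub>0 int) set \<Rightarrow> 'm set \<Rightarrow> 'n set \<Rightarrow> bool" where
  "rep_in X M N \<longleftrightarrow> supp (SOME u. u \<in> X) \<subseteq> M \<times> N"

lemma rsum_cong:
  assumes "rep_in X M N" "\<And>x y. x \<in> M ==> y \<in> N ==> \<phi> x y = \<psi> x y"
  shows "rsum G \<phi> X = rsum G \<psi> X"
  unfolding rsum_def using assms by (intro frag_sum_cong) (auto simp: rep_in_def)

lemma rsum_closed:
  assumes "abelian_group G" "rep_in X M N" "\<And>x y. x \<in> M ==> y \<in> N ==> \<phi> x y \<in>! G"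
  shows "rsum G \<phi> X \<in>! G"
  unfolding rsum_def using assms
  by (intro abelian_group.frag_sum_closed) (auto simp: rep_in_def)

lemma rsum_hom:
  assumes "abelian_group G" "abelian_group G'"
    and "\<And>x. x \<in>! G ==> f x \<in>! G'"
      "\<And>x y. x \<in>! G ==> y \<in>! G ==> f (x \<oplus>\<^bsub>G\<^esub> y) = f x \<oplus>\<^bsub>G'\<^esub> f y"
    and "rep_in X M N" "\<And>x y. x \<in> M ==> y \<in> N ==> \<phi> x y \<in>! G"
  shows "f (rsum G \<phi> X) = rsum G' (\<lambda>x y. f (\<phi> x y)) X"
proof -
  have "f (rsum G \<phi> X) = frag_sum G' (\<lambda>i. f (case_prod \<phi> i)) (SOME u. u \<in> X)"
    unfolding rsum_def using assms(5,6)
    by (intro frag_sum_hom[OF assms(1-4)]) (auto simp: rep_in_def)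
  then show ?thesis
    unfolding rsum_def by (simp add: case_prod_unfold)
qed

lemma rsum_linear:
  assumes "linear_map K G G' f" "module K G" "module K G'"
    and "rep_in X M N" "\<And>x y. x \<in> M ==> y \<in> N ==> \<phi> x y \<in>! G"
  shows "f (rsum G \<phi> X) = rsum G' (\<lambda>x y. f (\<phi> x y)) X"
  using assms linear_mapD[OF assms(1)] by (intro rsum_hom) (auto simp: module_def)

lemma rsum_add:
  assumes "abelian_group G" "rep_in X M N"
    and "\<And>x y. x \<in> M ==> y \<in> N ==> \<phi> x y \<in>! G"
      "\<And>x y. x \<in> M ==> y \<in> N ==> \<psi> x y \<in>! G"
  shows "rsum G (\<lambda>x y. \<phi> x y \<oplus>\<^bsub>G\<^esub> \<psi> x y) X = rsum G \<phi> X \<oplus>\<^bsub>G\<^esub> rsum G \<psi> X"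
  unfolding rsum_def using assms
  by (subst abelian_group.frag_sum_addf[OF assms(1), symmetric])
    (auto simp: rep_in_def case_prod_unfold)

lemma linear_map_rsum:
  assumes "module K N" "rep_in X P Q"
    and "\<And>x y. x \<in> P ==> y \<in> Q ==> linear_map K M N (\<lambda>z. \<phi> z x y)"
  shows "linear_map K M N (\<lambda>z. rsum N (\<phi> z) X)"
proof -
  interpret N: module K N by fact
  note * = linear_mapD[OF assms(3)]
  show ?thesis
  proof (intro linear_mapI)
    fix x assume "x \<in>! M"
    then show "rsum N (\<phi> x) X \<in>! N"
      using * by (intro rsum_closed[OF N.abelian_group_axioms assms(2)]) auto
  next
    fix x y assume xy: "x \<in>! M" "y \<in>! M"
    have "rsum N (\<phi> (x \<oplus>\<^bsub>M\<^esub> y)) X = rsum N (\<lambda>a b. \<phi> x a b \<oplus>\<^bsub>N\<^esub> \<phi> y a b) X"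
      using xy * by (intro rsum_cong[OF assms(2)]) auto
    also have "... = rsum N (\<phi> x) X \<oplus>\<^bsub>N\<^esub> rsum N (\<phi> y) X"
      using xy * by (intro rsum_add[OF N.abelian_group_axioms assms(2)]) auto
    finally show "rsum N (\<phi> (x \<oplus>\<^bsub>M\<^esub> y)) X = rsum N (\<phi> x) X \<oplus>\<^bsub>N\<^esub> rsum N (\<phi> y) X" .
  next
    fix c x assume cx: "c \<in>! K" "x \<in>! M"
    have "rsum N (\<phi> (c \<odot>\<^bsub>M\<^esub> x)) X = rsum N (\<lambda>a b. c \<odot>\<^bsub>N\<^esub> \<phi> x a b) X"
      using cx * by (intro rsum_cong[OF assms(2)]) auto
    also have "... = c \<odot>\<^bsub>N\<^esub> rsum N (\<phi> x) X"
      using cx * by (intro rsum_linear[symmetric, where f = "\<lambda>x. c \<odot>\<^bsub>N\<^esub> x", OF _ \<open>module K N\<close> \<open>module K N\<close> assms(2)]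
          linear_map_smult linear_map_id \<open>module K N\<close>) auto
    finally show "rsum N (\<phi> (c \<odot>\<^bsub>M\<^esub> x)) X = c \<odot>\<^bsub>N\<^esub> rsum N (\<phi> x) X" .
  qed
qed

text \<open>Fubini for formal sums: both sides are additive in the combination representing
  \<open>X\<close>, so it is enough to compare them on single generators.\<close>

lemma rsum_swap:
  assumes "abelian_group G" "rep_in X M N" "rep_in Y P Q"
    and "\<And>x y z w. x \<in> M ==> y \<in> N ==> z \<in> P ==> w \<in> Q ==> \<phi> x y z w \<in>! G"
  shows "rsum G (\<lambda>x y. rsum G (\<phi> x y) Y) X = rsum G (\<lambda>z w. rsum G (\<lambda>x y. \<phi> x y z w) X) Y"
proof -
  interpret G: abelian_group G by fact
  define u where "u = (SOME u. u \<in> X)"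
  define v where "v = (SOME u. u \<in> Y)"
  let ?\<phi> = "\<lambda>i j. \<phi> (fst i) (snd i) (fst j) (snd j)"
  have v: "supp v \<subseteq> P \<times> Q" and u: "supp u \<subseteq> M \<times> N"
    using assms(2,3) by (auto simp: rep_in_def u_def v_def)
  have "supp u' \<subseteq> M \<times> N ==> supp u' \<subseteq> M \<times> N \<and>
     frag_sum G (\<lambda>i. frag_sum G (?\<phi> i) v) u' = frag_sum G (\<lambda>j. frag_sum G (\<lambda>i. ?\<phi> i j) u') v" for u'
  proof (induction u' rule: frag_induction)
    case zero
    have "frag_sum G (\<lambda>j. \<zero>\<^bsub>G\<^esub>) v \<oplus>\<^bsub>G\<^esub> frag_sum G (\<lambda>j. \<zero>\<^bsub>G\<^esub>) v = frag_sum G (\<lambda>j. \<zero>\<^bsub>G\<^esub>) v"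
      by (subst G.frag_sum_addf[symmetric]) auto
    then have "frag_sum G (\<lambda>j. \<zero>\<^bsub>G\<^esub>) v = \<zero>\<^bsub>G\<^esub>"
      by (metis G.add.l_cancel_one G.frag_sum_closed G.zero_closed Pi_I)
    then show ?case by simp
  next
    case (one x)
    have "frag_sum G (\<lambda>j. frag_sum G (\<lambda>i. ?\<phi> i j) (frag_of x)) v = frag_sum G (?\<phi> x) v"
      using v one by (intro frag_sum_cong G.frag_sum_of) (auto intro!: assms(4))
    moreover have "frag_sum G (?\<phi> x) v \<in>! G"
      using v one by (intro G.frag_sum_closed) (auto intro!: assms(4))
    ultimately show ?case
      using one by (simp add: G.frag_sum_of)
  next
    case (diff a b)
    then have ab: "supp (a - b) \<subseteq> M \<times> N" "supp a \<subseteq> M \<times> N" "supp b \<subseteq> M \<times> N"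
      using keys_diff by fastforce+
    have 1: "?\<phi> i j \<in>! G" if "i \<in> M \<times> N" "j \<in> supp v" for i j
      using that v by (auto intro!: assms(4))
    have 2: "(\<lambda>i. frag_sum G (?\<phi> i) v) \<in> M \<times> N \<rightarrow> carrier G"
      using 1 by (auto intro!: G.frag_sum_closed)
    have 3: "frag_sum G (\<lambda>i. ?\<phi> i j) a' \<in>! G"
      if "supp a' \<subseteq> M \<times> N" "j \<in> supp v" for j a'
      using 1 that by (auto intro!: G.frag_sum_closed)
    \<comment> \<open>The part coming from \<open>b\<close> is added to both sides instead of being
      subtracted, so that only additivity of the sums is used; it is cancelled at the end.\<close>
    have "frag_sum G (\<lambda>j. frag_sum G (\<lambda>i. ?\<phi> i j) (a - b)) v \<oplus>\<^bsub>G\<^esub> frag_sum G (\<lambda>j. frag_sum G (\<lambda>i. ?\<phi> i j) b) v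
      = frag_sum G (\<lambda>j. frag_sum G (\<lambda>i. ?\<phi> i j) (a - b) \<oplus>\<^bsub>G\<^esub> frag_sum G (\<lambda>i. ?\<phi> i j) b) v"
      using 3 ab by (intro G.frag_sum_addf[symmetric]) auto
    also have "... = frag_sum G (\<lambda>j. frag_sum G (\<lambda>i. ?\<phi> i j) a) v"
    proof (intro frag_sum_cong)
      fix j assume j: "j \<in> supp v"
      have "frag_sum G (\<lambda>i. ?\<phi> i j) ((a - b) + b)
        = frag_sum G (\<lambda>i. ?\<phi> i j) (a - b) \<oplus>\<^bsub>G\<^esub> frag_sum G (\<lambda>i. ?\<phi> i j) b"
        using 1 ab j by (intro G.frag_sum_add[where S = "M \<times> N"]) auto
      then show "frag_sum G (\<lambda>i. ?\<phi> i j) (a - b) \<oplus>\<^bsub>G\<^esub> frag_sum G (\<lambda>i. ?\<phi> i j) b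
        = frag_sum G (\<lambda>i. ?\<phi> i j) a" by simp
    qed
    also have "... = frag_sum G (\<lambda>i. frag_sum G (?\<phi> i) v) ((a - b) + b)" using diff by simp
    also have "... = frag_sum G (\<lambda>i. frag_sum G (?\<phi> i) v) (a - b) \<oplus>\<^bsub>G\<^esub> frag_sum G (\<lambda>i. frag_sum G (?\<phi> i) v) b"
      using 2 ab by (intro G.frag_sum_add[where S = "M \<times> N"])
    finally have "frag_sum G (\<lambda>j. frag_sum G (\<lambda>i. ?\<phi> i j) (a - b)) v \<oplus>\<^bsub>G\<^esub> frag_sum G (\<lambda>i. frag_sum G (?\<phi> i) v) b
      = frag_sum G (\<lambda>i. frag_sum G (?\<phi> i) v) (a - b) \<oplus>\<^bsub>G\<^esub> frag_sum G (\<lambda>i. frag_sum G (?\<phi> i) v) b"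
      using diff ab by simp
    moreover have "frag_sum G (\<lambda>j. frag_sum G (\<lambda>i. ?\<phi> i j) (a - b)) v \<in>! G"
      using 3 ab by (intro G.frag_sum_closed) blast
    moreover have "frag_sum G (\<lambda>i. frag_sum G (?\<phi> i) v) (a - b) \<in>! G"
      "frag_sum G (\<lambda>i. frag_sum G (?\<phi> i) v) b \<in>! G"
      using 2 ab by (intro G.frag_sum_closed; blast)+
    ultimately show ?case using ab by (simp add: G.add.right_cancel)
  qed
  then show ?thesis
    using u unfolding rsum_def u_def[symmetric] v_def[symmetric]
    by (simp add: case_prod_unfold)
qed

section \<open>Balanced tensor products\<close>

definition bilinear ::
  "('k, 'c) ring_scheme \<Rightarrow> ('k, 'm, 'x) module_scheme \<Rightarrow> ('k, 'n, 'y) module_scheme \<Rightarrow>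
    ('k, 'g, 'z) module_scheme \<Rightarrow> ('m \<Rightarrow> 'n \<Rightarrow> 'g) \<Rightarrow> bool" where
  "bilinear K M N G \<phi> \<longleftrightarrow> module K G \<and>
     (\<forall>y \<in> carrier N. linear_map K M G (\<lambda>x. \<phi> x y)) \<and> (\<forall>x \<in> carrier M. linear_map K N G (\<phi> x))"

lemma bilinearI:
  assumes "module K G" "\<And>y. y \<in>! N ==> linear_map K M G (\<lambda>x. \<phi> x y)"
    "\<And>x. x \<in>! M ==> linear_map K N G (\<phi> x)"
  shows "bilinear K M N G \<phi>"
  using assms by (simp add: bilinear_def)

lemma bilinearD:
  assumes "bilinear K M N G \<phi>"
  shows "module K G" "y \<in>! N ==> linear_map K M G (\<lambda>x. \<phi> x y)"
    "x \<in>! M ==> linear_map K N G (\<phi> x)"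
    "x \<in>! M ==> y \<in>! N ==> \<phi> x y \<in>! G"
  using assms linear_mapD(1)[of K N G "\<phi> x" y] by (simp_all add: bilinear_def)

text \<open>Scalar multiplication on a tensor product is itself a lift, so the universal property is
  first stated for maps that are merely additive in each argument.\<close>

definition biadditive ::
  "('m, 'x) ring_scheme \<Rightarrow> ('n, 'y) ring_scheme \<Rightarrow> ('g, 'z) ring_scheme \<Rightarrow> ('m \<Rightarrow> 'n \<Rightarrow> 'g) \<Rightarrow> bool" where
  "biadditive M N G \<phi> \<longleftrightarrow> abelian_group G \<and>
     (\<forall>x \<in> carrier M. \<forall>y \<in> carrier N. \<phi> x y \<in>! G) \<and>
     (\<forall>x \<in> carrier M. \<forall>x' \<in> carrier M. \<forall>y \<in> carrier N. \<phi> (x \<oplus>\<^bsub>M\<^esub> x') y = \<phi> x y \<oplus>\<^bsub>G\<^esub> \<phi> x' y) \<and>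
     (\<forall>x \<in> carrier M. \<forall>y \<in> carrier N. \<forall>y' \<in> carrier N. \<phi> x (y \<oplus>\<^bsub>N\<^esub> y') = \<phi> x y \<oplus>\<^bsub>G\<^esub> \<phi> x y')"

lemma biadditiveD:
  assumes "biadditive M N G \<phi>"
  shows "abelian_group G"
    "x \<in>! M ==> x' \<in>! M ==> y \<in>! N ==> \<phi> (x \<oplus>\<^bsub>M\<^esub> x') y = \<phi> x y \<oplus>\<^bsub>G\<^esub> \<phi> x' y"
    "x \<in>! M ==> y \<in>! N ==> y' \<in>! N ==> \<phi> x (y \<oplus>\<^bsub>N\<^esub> y') = \<phi> x y \<oplus>\<^bsub>G\<^esub> \<phi> x y'"
    "x \<in>! M ==> y \<in>! N ==> \<phi> x y \<in>! G"
  using assms by (auto simp: biadditive_def)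

lemma bilinear_biadditive:
  assumes "bilinear K M N G \<phi>"
  shows "biadditive M N G \<phi>"
proof -
  interpret G: module K G using bilinearD(1)[OF assms] .
  show ?thesis
    unfolding biadditive_def
    using G.M.abelian_group_axioms bilinearD(4)[OF assms] linear_mapD(2)[OF bilinearD(2)[OF assms]]
      linear_mapD(2)[OF bilinearD(3)[OF assms]] by simp
qed

text \<open>The condition \<open>scalars\<close> says that each scalar acts on both factors like
  some member of \<open>S\<close>: for \<open>S = carrier K\<close> the scalar itself, for a
  subalgebra or a base ring its multiple of the unit. It makes the scalar actions on the left and on
  the right factor agree in the tensor product.\<close>

locale balanced_tensor =
  fixes K :: "('k, 'c) ring_scheme" and M :: "('k, 'm, 'x) module_scheme"
    and N :: "('k, 'n, 'y) module_scheme" and S :: "'s set" and ra la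
    and T :: "('k, 'm, 'n) tensor_prod"
  assumes T: "T = tensor M N S ra la"
    and modM: "module K M" and modN: "module K N"
    and ra: "s \<in> S ==> linear_map K M M (\<lambda>m. ra m s)"
    and la: "s \<in> S ==> linear_map K N N (la s)"
    and scalars: "c \<in>! K ==> \<exists>s\<in>S. (\<forall>m\<in>carrier M. ra m s = c \<odot>\<^bsub>M\<^esub> m) \<and>
      (\<forall>n\<in>carrier N. la s n = c \<odot>\<^bsub>N\<^esub> n)"
begin

sublocale M: module K M by (rule modM)
sublocale N: module K N by (rule modN)

abbreviation "F \<equiv> free_Abelian_group (carrier M \<times> carrier N)"
definition "I = generate F (tensor_rels M N S ra la)"

abbreviation balanced :: "('m \<Rightarrow> 'n \<Rightarrow> 'g) \<Rightarrow> bool" where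
  "balanced \<phi> \<equiv> \<forall>m\<in>carrier M. \<forall>s\<in>S. \<forall>n\<in>carrier N. \<phi> (ra m s) n = \<phi> m (la s n)"

sublocale F: comm_group F by (rule abelian_free_Abelian_group)

lemma ra_closed: "m \<in>! M ==> s \<in> S ==> ra m s \<in>! M"
  using linear_mapD(1)[OF ra] .

lemma la_closed: "n \<in>! N ==> s \<in> S ==> la s n \<in>! N"
  using linear_mapD(1)[OF la] .

lemma rels_subset: "tensor_rels M N S ra la \<subseteq> carrier F"
proof -
  have 3: "supp (frag_of a - frag_of b - frag_of c) \<subseteq> {a, b, c}" for a b c :: "'m \<times> 'n"
    using keys_diff[of "frag_of a - frag_of b" "frag_of c"] keys_diff[of "frag_of a" "frag_of b"] by auto
  have 2: "supp (frag_of a - frag_of b) \<subseteq> {a, b}" for a b :: "'m \<times> 'n"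
    using keys_diff[of "frag_of a" "frag_of b"] by auto
  show ?thesis
    unfolding tensor_rels_def
    by (auto simp del: split_paired_All dest!: subsetD[OF 3] subsetD[OF 2] simp: ra_closed la_closed)
qed

lemma I_normal: "I \<lhd> F"
  unfolding I_def by (intro F.subgroup_imp_normal F.generate_is_subgroup rels_subset)

lemma carrier_T: "carrier T = (\<lambda>u. I #>\<^bsub>F\<^esub> u) ` {u. supp u \<subseteq> carrier M \<times> carrier N}"
  unfolding T tensor_def Let_def I_def[symmetric]
  by (auto simp: FactGroup_def RCOSETS_def)

lemma carrier_T_E:
  assumes "x \<in>! T"
  obtains u where "x = I #>\<^bsub>F\<^esub> u" "supp u \<subseteq> carrier M \<times> carrier N"
  using assms unfolding carrier_T by blast

lemma T_simps:
  "\<zero>\<^bsub>T\<^esub> = I" "x \<oplus>\<^bsub>T\<^esub> y = x <#>\<^bsub>F\<^esub> y" "m \<boxtimes>\<^bsub>T\<^esub> n = I #>\<^bsub>F\<^esub> frag_of (m, n)"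
  unfolding T tensor_def Let_def I_def[symmetric] by (simp_all add: FactGroup_def)

lemma coset_add:
  assumes "supp u \<subseteq> carrier M \<times> carrier N" "supp v \<subseteq> carrier M \<times> carrier N"
  shows "(I #>\<^bsub>F\<^esub> u) \<oplus>\<^bsub>T\<^esub> (I #>\<^bsub>F\<^esub> v) = I #>\<^bsub>F\<^esub> (u + v)"
  using normal.rcos_sum[OF I_normal, of u v] assms by (simp add: T_simps)

lemma coset_zero: "I #>\<^bsub>F\<^esub> 0 = \<zero>\<^bsub>T\<^esub>"
  using F.coset_mult_one[of I] normal_imp_subgroup[OF I_normal, THEN subgroup.subset]
  by (simp add: T_simps)

lemma abelian_T: "abelian_group T"
proof (rule abelian_groupI)
  fix x y z assume *: "x \<in>! T" "y \<in>! T" "z \<in>! T"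
  obtain u where u: "x = I #>\<^bsub>F\<^esub> u" "supp u \<subseteq> carrier M \<times> carrier N"
    using *(1) by (rule carrier_T_E)
  obtain v where v: "y = I #>\<^bsub>F\<^esub> v" "supp v \<subseteq> carrier M \<times> carrier N"
    using *(2) by (rule carrier_T_E)
  obtain w where w: "z = I #>\<^bsub>F\<^esub> w" "supp w \<subseteq> carrier M \<times> carrier N"
    using *(3) by (rule carrier_T_E)
  note uv = u v w
  have k: "supp (u + v) \<subseteq> carrier M \<times> carrier N" "supp (v + w) \<subseteq> carrier M \<times> carrier N"
    using uv by (blast dest: subsetD[OF keys_add])+
  show "x \<oplus>\<^bsub>T\<^esub> y \<in>! T"
    using uv k by (auto simp: coset_add carrier_T)
  show "x \<oplus>\<^bsub>T\<^esub> y \<oplus>\<^bsub>T\<^esub> z = x \<oplus>\<^bsub>T\<^esub> (y \<oplus>\<^bsub>T\<^esub> z)"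
    using uv k by (simp add: coset_add add.assoc)
  show "x \<oplus>\<^bsub>T\<^esub> y = y \<oplus>\<^bsub>T\<^esub> x"
    using uv by (simp add: coset_add add.commute)
next
  show "\<zero>\<^bsub>T\<^esub> \<in>! T"
    unfolding carrier_T coset_zero[symmetric] by (rule imageI) simp
next
  fix x assume "x \<in>! T"
  then obtain u where u: "x = I #>\<^bsub>F\<^esub> u" "supp u \<subseteq> carrier M \<times> carrier N"
    by (rule carrier_T_E)
  then show "\<zero>\<^bsub>T\<^esub> \<oplus>\<^bsub>T\<^esub> x = x"
    using coset_add[of 0 u] by (simp add: coset_zero)
  show "\<exists>y\<in>carrier T. y \<oplus>\<^bsub>T\<^esub> x = \<zero>\<^bsub>T\<^esub>"
    using u coset_add[of "- u" u]
    by (intro bexI[of _ "I #>\<^bsub>F\<^esub> (- u)"]) (auto simp: coset_zero carrier_T)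
qed

sublocale T: abelian_group T by (rule abelian_T)

lemma pure_closed [simp, intro]: "m \<in>! M ==> n \<in>! N ==> m \<boxtimes>\<^bsub>T\<^esub> n \<in>! T"
  by (auto simp: carrier_T T_simps)

lemma frag_sum_pure:
  assumes "supp u \<subseteq> carrier M \<times> carrier N"
  shows "frag_sum T (case_prod (\<boxtimes>\<^bsub>T\<^esub>)) u = I #>\<^bsub>F\<^esub> u"
proof -
  let ?S = "carrier M \<times> carrier N"
  have p: "case_prod (\<boxtimes>\<^bsub>T\<^esub>) \<in> ?S \<rightarrow> carrier T" by auto
  have "supp u \<subseteq> ?S \<and> frag_sum T (case_prod (\<boxtimes>\<^bsub>T\<^esub>)) u = I #>\<^bsub>F\<^esub> u"
    using assms
  proof (induction u rule: frag_induction)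
    case zero
    then show ?case by (simp add: coset_zero)
  next
    case (one x)
    then obtain m n where "x = (m, n)" "m \<in>! M" "n \<in>! N" by auto
    then show ?case by (simp add: T.frag_sum_of T_simps(3)[symmetric])
  next
    case (diff a b)
    then have k: "supp (a - b) \<subseteq> ?S" using keys_diff by fastforce
    have "frag_sum T (case_prod (\<boxtimes>\<^bsub>T\<^esub>)) (a - b) \<oplus>\<^bsub>T\<^esub> (I #>\<^bsub>F\<^esub> b) = (I #>\<^bsub>F\<^esub> (a - b)) \<oplus>\<^bsub>T\<^esub> (I #>\<^bsub>F\<^esub> b)"
      using T.frag_sum_add[OF p k, of b] coset_add[OF k, of b] diff by simp
    moreover have "frag_sum T (case_prod (\<boxtimes>\<^bsub>T\<^esub>)) (a - b) \<in>! T"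
      using p k by (intro T.frag_sum_closed) auto
    ultimately show ?case
      using k diff by (auto simp: carrier_T)
  qed
  then show ?thesis ..
qed

lemma coset_rep:
  assumes "supp u \<subseteq> carrier M \<times> carrier N" "v \<in> I #>\<^bsub>F\<^esub> u"
  shows "supp v \<subseteq> carrier M \<times> carrier N" "I #>\<^bsub>F\<^esub> v = I #>\<^bsub>F\<^esub> u"
proof -
  have I: "subgroup I F" using I_normal by (rule normal_imp_subgroup)
  show "I #>\<^bsub>F\<^esub> v = I #>\<^bsub>F\<^esub> u"
    using F.repr_independence[OF assms(2) _ I] assms(1) by simp
  show "supp v \<subseteq> carrier M \<times> carrier N"
    using assms subsetD[OF F.r_coset_subset_G[OF subgroup.subset[OF I], of u]] by simp
qed

lemma coset_eq:
  assumes "supp u \<subseteq> carrier M \<times> carrier N" "supp v \<subseteq> carrier M \<times> carrier N"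
    "u - v \<in> tensor_rels M N S ra la"
  shows "I #>\<^bsub>F\<^esub> u = I #>\<^bsub>F\<^esub> v"
proof -
  have "u - v \<in> I" using assms(3) unfolding I_def by (rule generate.incl)
  moreover have "u = (u - v) + v" by simp
  ultimately have "u \<in> I #>\<^bsub>F\<^esub> v" unfolding r_coset_def by force
  then show ?thesis using coset_rep(2)[OF assms(2)] by simp
qed

lemma pure_add_left:
  assumes "m \<in>! M" "m' \<in>! M" "n \<in>! N"
  shows "(m \<oplus>\<^bsub>M\<^esub> m') \<boxtimes>\<^bsub>T\<^esub> n = m \<boxtimes>\<^bsub>T\<^esub> n \<oplus>\<^bsub>T\<^esub> m' \<boxtimes>\<^bsub>T\<^esub> n"
proof -
  have "I #>\<^bsub>F\<^esub> frag_of (m \<oplus>\<^bsub>M\<^esub> m', n) = I #>\<^bsub>F\<^esub> (frag_of (m, n) + frag_of (m', n))"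
    using assms keys_add[of "frag_of (m, n)" "frag_of (m', n)"]
    by (intro coset_eq) (auto simp: tensor_rels_def diff_diff_eq[symmetric])
  then show ?thesis using assms by (simp add: T_simps(3) coset_add)
qed

lemma pure_add_right:
  assumes "m \<in>! M" "n \<in>! N" "n' \<in>! N"
  shows "m \<boxtimes>\<^bsub>T\<^esub> (n \<oplus>\<^bsub>N\<^esub> n') = m \<boxtimes>\<^bsub>T\<^esub> n \<oplus>\<^bsub>T\<^esub> m \<boxtimes>\<^bsub>T\<^esub> n'"
proof -
  have "I #>\<^bsub>F\<^esub> frag_of (m, n \<oplus>\<^bsub>N\<^esub> n') = I #>\<^bsub>F\<^esub> (frag_of (m, n) + frag_of (m, n'))"
    using assms keys_add[of "frag_of (m, n)" "frag_of (m, n')"]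
    by (intro coset_eq) (auto simp: tensor_rels_def diff_diff_eq[symmetric])
  then show ?thesis using assms by (simp add: T_simps(3) coset_add)
qed

lemma pure_balanced:
  assumes "m \<in>! M" "s \<in> S" "n \<in>! N"
  shows "ra m s \<boxtimes>\<^bsub>T\<^esub> n = m \<boxtimes>\<^bsub>T\<^esub> la s n"
  unfolding T_simps using assms
  by (intro coset_eq) (auto simp: tensor_rels_def ra_closed la_closed)

lemma some_rep:
  assumes "X \<in>! T"
  shows "supp (SOME u. u \<in> X) \<subseteq> carrier M \<times> carrier N" "I #>\<^bsub>F\<^esub> (SOME u. u \<in> X) = X"
proof -
  obtain u where u: "X = I #>\<^bsub>F\<^esub> u" "supp u \<subseteq> carrier M \<times> carrier N"
    using assms by (rule carrier_T_E)
  have "u \<in> X"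
    using F.rcos_self[OF _ normal_imp_subgroup[OF I_normal], of u] u by simp
  then have "(SOME u. u \<in> X) \<in> X" by (rule someI)
  then show "supp (SOME u. u \<in> X) \<subseteq> carrier M \<times> carrier N" "I #>\<^bsub>F\<^esub> (SOME u. u \<in> X) = X"
    using coset_rep[OF u(2)] u(1) by auto
qed

lemma rep_in: "X \<in>! T ==> rep_in X (carrier M) (carrier N)"
  unfolding rep_in_def by (rule some_rep)

lemma rsum_pure: "X \<in>! T ==> rsum T (\<boxtimes>\<^bsub>T\<^esub>) X = X"
  unfolding rsum_def using some_rep frag_sum_pure by simp

text \<open>Induction on formal combinations produces differences while this rule offers only sums.
  Hence \<open>P\<close> is proved for an element and its negative together; the negative of a pure
  tensor is again pure.\<close>

lemma induct [consumes 1, case_names pure zero add]: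
  assumes "X \<in>! T"
    and "\<And>m n. m \<in>! M ==> n \<in>! N ==> P (m \<boxtimes>\<^bsub>T\<^esub> n)" "P \<zero>\<^bsub>T\<^esub>"
    and "\<And>X Y. X \<in>! T ==> Y \<in>! T ==> P X ==> P Y ==> P (X \<oplus>\<^bsub>T\<^esub> Y)"
  shows "P X"
proof -
  let ?S = "carrier M \<times> carrier N"
  have neg: "P (\<ominus>\<^bsub>T\<^esub> (m \<boxtimes>\<^bsub>T\<^esub> n))" if "m \<in>! M" "n \<in>! N" for m n
  proof -
    have "m \<boxtimes>\<^bsub>T\<^esub> n \<oplus>\<^bsub>T\<^esub> \<zero>\<^bsub>M\<^esub> \<boxtimes>\<^bsub>T\<^esub> n = m \<boxtimes>\<^bsub>T\<^esub> n"
      using pure_add_left[of m "\<zero>\<^bsub>M\<^esub>" n] that by simp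
    then have "\<zero>\<^bsub>M\<^esub> \<boxtimes>\<^bsub>T\<^esub> n = \<zero>\<^bsub>T\<^esub>"
      using that by (metis M.M.zero_closed T.add.l_cancel_one pure_closed)
    then have "(\<ominus>\<^bsub>M\<^esub> m) \<boxtimes>\<^bsub>T\<^esub> n \<oplus>\<^bsub>T\<^esub> m \<boxtimes>\<^bsub>T\<^esub> n = \<zero>\<^bsub>T\<^esub>"
      using pure_add_left[of "\<ominus>\<^bsub>M\<^esub> m" m n] that by (simp add: M.M.l_neg)
    then have "\<ominus>\<^bsub>T\<^esub> (m \<boxtimes>\<^bsub>T\<^esub> n) = (\<ominus>\<^bsub>M\<^esub> m) \<boxtimes>\<^bsub>T\<^esub> n"
      using that by (intro T.minus_equality) auto
    then show ?thesis using assms(2) that by simp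
  qed
  have "supp u \<subseteq> ?S \<and> P (I #>\<^bsub>F\<^esub> u) \<and> P (\<ominus>\<^bsub>T\<^esub> (I #>\<^bsub>F\<^esub> u))" if "supp u \<subseteq> ?S" for u
    using that
  proof (induction u rule: frag_induction)
    case zero
    have "\<ominus>\<^bsub>T\<^esub> \<zero>\<^bsub>T\<^esub> = \<zero>\<^bsub>T\<^esub>" by (rule T.minus_equality) auto
    then have "P (\<ominus>\<^bsub>T\<^esub> \<zero>\<^bsub>T\<^esub>)" using assms(3) by (simp only:)
    then show ?case unfolding coset_zero using assms(3) by simp
  next
    case (one x)
    then show ?case using assms(2) neg by (auto simp: T_simps(3))
  next
    case (diff a b)
    then have k: "supp (a - b) \<subseteq> ?S" using keys_diff by fastforce
    have c: "I #>\<^bsub>F\<^esub> a \<in>! T" "I #>\<^bsub>F\<^esub> b \<in>! T" "I #>\<^bsub>F\<^esub> (a - b) \<in>! T"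
      using diff k by (auto simp: carrier_T)
    have e: "(I #>\<^bsub>F\<^esub> (a - b)) \<oplus>\<^bsub>T\<^esub> (I #>\<^bsub>F\<^esub> b) = I #>\<^bsub>F\<^esub> a"
      using coset_add[OF k, of b] diff by simp
    then have "I #>\<^bsub>F\<^esub> (a - b) = (I #>\<^bsub>F\<^esub> a) \<oplus>\<^bsub>T\<^esub> \<ominus>\<^bsub>T\<^esub> (I #>\<^bsub>F\<^esub> b)"
      using c by (metis T.add.inv_solve_right)
    moreover then have "\<ominus>\<^bsub>T\<^esub> (I #>\<^bsub>F\<^esub> (a - b)) = \<ominus>\<^bsub>T\<^esub> (I #>\<^bsub>F\<^esub> a) \<oplus>\<^bsub>T\<^esub> (I #>\<^bsub>F\<^esub> b)"
      using c by (simp add: T.minus_add)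
    moreover have "P ((I #>\<^bsub>F\<^esub> a) \<oplus>\<^bsub>T\<^esub> \<ominus>\<^bsub>T\<^esub> (I #>\<^bsub>F\<^esub> b))" "P (\<ominus>\<^bsub>T\<^esub> (I #>\<^bsub>F\<^esub> a) \<oplus>\<^bsub>T\<^esub> (I #>\<^bsub>F\<^esub> b))"
      using c diff by (intro assms(4); simp)+
    ultimately show ?case using k by (simp only: simp_thms)
  qed
  then show ?thesis using assms(1) by (auto simp: carrier_T)
qed

text \<open>\<open>tensor_lift\<close> extracts the unique value of \<open>frag_sum\<close> on a
  coset. It is unique because the defining relations, and with them the subgroup they generate, lie
  in the kernel of the homomorphism \<open>frag_sum G (case_prod \<phi>)\<close>.\<close>

lemma balanced_lift:
  assumes G: "biadditive M N G \<phi>" and bal: "balanced \<phi>" and u: "supp u \<subseteq> carrier M \<times> carrier N"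
  shows "tensor_lift G \<phi> (I #>\<^bsub>F\<^esub> u) = frag_sum G (case_prod \<phi>) u"
proof -
  interpret G: abelian_group G using biadditiveD(1)[OF G] .
  let ?S = "carrier M \<times> carrier N"
  let ?f = "frag_sum G (case_prod \<phi>)"
  have p: "case_prod \<phi> \<in> ?S \<rightarrow> carrier G" using biadditiveD(4)[OF G] by auto
  have cl: "?f v \<in>! G" if "supp v \<subseteq> ?S" for v
    using p that by (intro G.frag_sum_closed) blast
  have hom: "?f \<in> hom F (add_monoid G)"
    using cl p unfolding hom_def by (auto intro!: G.frag_sum_add[where S = ?S])
  interpret h: group_hom F "add_monoid G" ?f
    using hom by (intro group_hom.intro group_hom_axioms.intro F.is_group G.a_group) auto
  note lin = biadditiveD(2,3)[OF G]
  have of: "?f (frag_of (m, n)) = \<phi> m n" if "m \<in>! M" "n \<in>! N" for m n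
    using G.frag_sum_of[of "case_prod \<phi>" "(m, n)"] biadditiveD(4)[OF G that] by simp
  \<comment> \<open>Both biadditivity relations have the shape \<open>a - b - c\<close>, so one
    cancellation serves for the two of them.\<close>
  have cancel: "?f (frag_of a - frag_of b - frag_of c) = \<zero>\<^bsub>G\<^esub>"
    if "?f (frag_of a) = ?f (frag_of b) \<oplus>\<^bsub>G\<^esub> ?f (frag_of c)" "a \<in> ?S" "b \<in> ?S" "c \<in> ?S" for a b c
  proof -
    have "supp (frag_of b + frag_of c) \<subseteq> ?S"
      using keys_add[of "frag_of b" "frag_of c"] that by auto
    then have "?f (frag_of a - (frag_of b + frag_of c)) = ?f (frag_of a) \<ominus>\<^bsub>G\<^esub> ?f (frag_of b + frag_of c)"
      using that by (intro G.frag_sum_diff[OF p]) auto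
    also have "?f (frag_of b + frag_of c) = ?f (frag_of a)"
      using that G.frag_sum_add[OF p, of "frag_of b" "frag_of c"] by simp
    finally show ?thesis
      using cl[of "frag_of a"] that(2) by (simp add: diff_diff_eq G.minus_eq G.r_neg)
  qed
  have "?f r = \<zero>\<^bsub>G\<^esub>" if "r \<in> tensor_rels M N S ra la" for r
  proof -
    from that consider
      (1) m m' n where "r = frag_of (m \<oplus>\<^bsub>M\<^esub> m', n) - frag_of (m, n) - frag_of (m', n)"
        "m \<in>! M" "m' \<in>! M" "n \<in>! N"
    | (2) m n n' where "r = frag_of (m, n \<oplus>\<^bsub>N\<^esub> n') - frag_of (m, n) - frag_of (m, n')"
        "m \<in>! M" "n' \<in>! N" "n \<in>! N"
    | (3) m s n where "r = frag_of (ra m s, n) - frag_of (m, la s n)"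
        "m \<in>! M" "s \<in> S" "n \<in>! N"
      unfolding tensor_rels_def by blast
    then show ?thesis
    proof cases
      case 1
      then show ?thesis unfolding 1(1) by (intro cancel) (simp_all add: of lin)
    next
      case 2
      then show ?thesis unfolding 2(1) by (intro cancel) (simp_all add: of lin)
    next
      case 3
      have "?f r = ?f (frag_of (ra m s, n)) \<ominus>\<^bsub>G\<^esub> ?f (frag_of (m, la s n))"
        unfolding 3(1) using 3 by (intro G.frag_sum_diff[OF p]) (auto simp: ra_closed la_closed)
      also have "... = \<phi> (ra m s) n \<ominus>\<^bsub>G\<^esub> \<phi> (ra m s) n"
        using bal 3 by (simp add: of ra_closed la_closed)
      also have "... = \<zero>\<^bsub>G\<^esub>"
        using biadditiveD(4)[OF G] 3 by (simp add: G.minus_eq G.r_neg ra_closed)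
      finally show ?thesis .
    qed
  qed
  then have "tensor_rels M N S ra la \<subseteq> kernel F (add_monoid G) ?f"
    using subsetD[OF rels_subset] by (intro subsetI) (simp add: kernel_def)
  then have I: "I \<subseteq> kernel F (add_monoid G) ?f"
    unfolding I_def by (rule F.generate_subgroup_incl[OF _ h.subgroup_kernel])
  have "?f v = ?f u" if "v \<in> I #>\<^bsub>F\<^esub> u" for v
  proof -
    from that obtain w where w: "w \<in> I" "v = w + u" by (auto simp: r_coset_def)
    then have "supp w \<subseteq> ?S" "?f w = \<zero>\<^bsub>G\<^esub>" using I by (auto simp: kernel_def)
    then show ?thesis
      using w(2) u G.frag_sum_add[OF p _ u, of w] p
      by (simp add: cl)
  qed
  moreover have "u \<in> I #>\<^bsub>F\<^esub> u"
    using F.rcos_self[OF _ normal_imp_subgroup[OF I_normal], of u] u by simp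
  ultimately have "?f ` (I #>\<^bsub>F\<^esub> u) = {?f u}"
    using image_constant[of u "I #>\<^bsub>F\<^esub> u" "?f u"] by (metis (no_types, lifting) image_cong)
  then show ?thesis unfolding tensor_lift_def by simp
qed

lemma lift_rsum:
  assumes "biadditive M N G \<phi>" "balanced \<phi>" "X \<in>! T"
  shows "tensor_lift G \<phi> X = rsum G \<phi> X"
  using balanced_lift[OF assms(1,2) some_rep(1)[OF assms(3)]] some_rep(2)[OF assms(3)]
  by (simp add: rsum_def)

lemma lift_pure:
  assumes "biadditive M N G \<phi>" "balanced \<phi>" "m \<in>! M" "n \<in>! N"
  shows "tensor_lift G \<phi> (m \<boxtimes>\<^bsub>T\<^esub> n) = \<phi> m n"
proof -
  interpret G: abelian_group G using biadditiveD(1)[OF assms(1)] .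
  show ?thesis
    using balanced_lift[OF assms(1,2), of "frag_of (m, n)"] assms(3,4) biadditiveD(4)[OF assms(1)]
      G.frag_sum_of[of "case_prod \<phi>" "(m, n)"] by (simp add: T_simps)
qed

lemma lift_closed:
  assumes "biadditive M N G \<phi>" "balanced \<phi>" "X \<in>! T"
  shows "tensor_lift G \<phi> X \<in>! G"
proof -
  interpret G: abelian_group G using biadditiveD(1)[OF assms(1)] .
  show ?thesis
    unfolding lift_rsum[OF assms]
    using biadditiveD(4)[OF assms(1)] rep_in[OF assms(3)] G.abelian_group_axioms by (intro rsum_closed)
qed

lemma lift_add:
  assumes "biadditive M N G \<phi>" "balanced \<phi>" "X \<in>! T" "Y \<in>! T"
  shows "tensor_lift G \<phi> (X \<oplus>\<^bsub>T\<^esub> Y) = tensor_lift G \<phi> X \<oplus>\<^bsub>G\<^esub> tensor_lift G \<phi> Y"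
proof -
  interpret G: abelian_group G using biadditiveD(1)[OF assms(1)] .
  obtain u where u: "X = I #>\<^bsub>F\<^esub> u" "supp u \<subseteq> carrier M \<times> carrier N"
    using assms(3) by (rule carrier_T_E)
  obtain v where v: "Y = I #>\<^bsub>F\<^esub> v" "supp v \<subseteq> carrier M \<times> carrier N"
    using assms(4) by (rule carrier_T_E)
  have k: "supp (u + v) \<subseteq> carrier M \<times> carrier N"
    using u v by (blast dest: subsetD[OF keys_add])
  have "frag_sum G (case_prod \<phi>) (u + v) = frag_sum G (case_prod \<phi>) u \<oplus>\<^bsub>G\<^esub> frag_sum G (case_prod \<phi>) v"
    using biadditiveD(4)[OF assms(1)] u v
    by (intro G.frag_sum_add[where S = "carrier M \<times> carrier N"]) auto
  then show ?thesis
    using balanced_lift[OF assms(1,2)] u v k by (simp add: coset_add)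
qed

lemma additive_eqI:
  assumes "abelian_group G" "\<And>X. X \<in>! T ==> f X \<in>! G" "\<And>X. X \<in>! T ==> g X \<in>! G"
    and "\<And>X Y. X \<in>! T ==> Y \<in>! T ==> f (X \<oplus>\<^bsub>T\<^esub> Y) = f X \<oplus>\<^bsub>G\<^esub> f Y"
    and "\<And>X Y. X \<in>! T ==> Y \<in>! T ==> g (X \<oplus>\<^bsub>T\<^esub> Y) = g X \<oplus>\<^bsub>G\<^esub> g Y"
    and "\<And>m n. m \<in>! M ==> n \<in>! N ==> f (m \<boxtimes>\<^bsub>T\<^esub> n) = g (m \<boxtimes>\<^bsub>T\<^esub> n)"
    and "X \<in>! T"
  shows "f X = g X"
  using assms(7)
proof (induction X rule: induct)
  case (pure m n)
  then show ?case using assms(6) by simp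
next
  case zero
  interpret G: abelian_group G by fact
  have "f \<zero>\<^bsub>T\<^esub> = \<zero>\<^bsub>G\<^esub>" "g \<zero>\<^bsub>T\<^esub> = \<zero>\<^bsub>G\<^esub>"
    using assms(2-5)[of "\<zero>\<^bsub>T\<^esub>"] assms(4,5)[of "\<zero>\<^bsub>T\<^esub>" "\<zero>\<^bsub>T\<^esub>"] by (metis G.add.l_cancel_one T.l_zero T.zero_closed)+
  then show ?case by simp
next
  case (add X Y)
  then show ?case using assms(4,5) by simp
qed

lemma smult_T: "smult T c = tensor_lift T (\<lambda>m n. (c \<odot>\<^bsub>M\<^esub> m) \<boxtimes>\<^bsub>T\<^esub> n)"
proof -
  have "smult T c = tensor_lift \<lparr>carrier = carrier T, monoid.mult = undefined, one = undefined,
               ring.zero = \<zero>\<^bsub>T\<^esub>, add = add T\<rparr> (\<lambda>m n. (c \<odot>\<^bsub>M\<^esub> m) \<boxtimes>\<^bsub>T\<^esub> n)"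
    unfolding T tensor_def Let_def by simp
  then show ?thesis
    by (simp add: fun_eq_iff) (intro allI tensor_lift_structure_cong; simp)
qed

lemma scalar_pure:
  assumes "c \<in>! K" "m \<in>! M" "n \<in>! N"
  shows "(c \<odot>\<^bsub>M\<^esub> m) \<boxtimes>\<^bsub>T\<^esub> n = m \<boxtimes>\<^bsub>T\<^esub> (c \<odot>\<^bsub>N\<^esub> n)"
  using scalars[OF assms(1)] assms(2,3) pure_balanced by metis

lemma smult_T_lift:
  assumes "c \<in>! K"
  shows "biadditive M N T (\<lambda>m n. (c \<odot>\<^bsub>M\<^esub> m) \<boxtimes>\<^bsub>T\<^esub> n)" "balanced (\<lambda>m n. (c \<odot>\<^bsub>M\<^esub> m) \<boxtimes>\<^bsub>T\<^esub> n)"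
proof -
  show "biadditive M N T (\<lambda>m n. (c \<odot>\<^bsub>M\<^esub> m) \<boxtimes>\<^bsub>T\<^esub> n)"
    unfolding biadditive_def using assms T.abelian_group_axioms
    by (auto simp: M.smult_r_distr pure_add_left pure_add_right)
  show "balanced (\<lambda>m n. (c \<odot>\<^bsub>M\<^esub> m) \<boxtimes>\<^bsub>T\<^esub> n)"
    using assms by (auto simp: linear_mapD(3)[OF ra, symmetric] pure_balanced ra_closed)
qed

lemma smult_pure:
  assumes "c \<in>! K" "m \<in>! M" "n \<in>! N"
  shows "c \<odot>\<^bsub>T\<^esub> (m \<boxtimes>\<^bsub>T\<^esub> n) = (c \<odot>\<^bsub>M\<^esub> m) \<boxtimes>\<^bsub>T\<^esub> n"
  unfolding smult_T using lift_pure[OF smult_T_lift[OF assms(1)] assms(2,3)] .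

lemma smult_T_closed: "c \<in>! K ==> X \<in>! T ==> c \<odot>\<^bsub>T\<^esub> X \<in>! T"
  unfolding smult_T using lift_closed[OF smult_T_lift] .

lemma smult_T_add:
  "c \<in>! K ==> X \<in>! T ==> Y \<in>! T ==> c \<odot>\<^bsub>T\<^esub> (X \<oplus>\<^bsub>T\<^esub> Y) = c \<odot>\<^bsub>T\<^esub> X \<oplus>\<^bsub>T\<^esub> c \<odot>\<^bsub>T\<^esub> Y"
  unfolding smult_T using lift_add[OF smult_T_lift] .

lemma module_T: "module K T"
proof (rule moduleI)
  note cl = smult_T_closed and add = smult_T_add
  fix a b x assume *: "a \<in>! K" "b \<in>! K" "x \<in>! T"
  show "(a \<oplus>\<^bsub>K\<^esub> b) \<odot>\<^bsub>T\<^esub> x = a \<odot>\<^bsub>T\<^esub> x \<oplus>\<^bsub>T\<^esub> b \<odot>\<^bsub>T\<^esub> x"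
    by (rule additive_eqI[OF T.abelian_group_axioms, of "\<lambda>x. (a \<oplus>\<^bsub>K\<^esub> b) \<odot>\<^bsub>T\<^esub> x" "\<lambda>x. a \<odot>\<^bsub>T\<^esub> x \<oplus>\<^bsub>T\<^esub> b \<odot>\<^bsub>T\<^esub> x"])
      (use * in \<open>auto simp: add cl T.a_ac smult_pure M.smult_l_distr pure_add_left\<close>)
  show "(a \<otimes>\<^bsub>K\<^esub> b) \<odot>\<^bsub>T\<^esub> x = a \<odot>\<^bsub>T\<^esub> (b \<odot>\<^bsub>T\<^esub> x)"
    by (rule additive_eqI[OF T.abelian_group_axioms, of "\<lambda>x. (a \<otimes>\<^bsub>K\<^esub> b) \<odot>\<^bsub>T\<^esub> x" "\<lambda>x. a \<odot>\<^bsub>T\<^esub> (b \<odot>\<^bsub>T\<^esub> x)"])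
      (use * in \<open>auto simp: add cl smult_pure M.smult_assoc1\<close>)
next
  fix x assume *: "x \<in>! T"
  show "\<one>\<^bsub>K\<^esub> \<odot>\<^bsub>T\<^esub> x = x"
    by (rule additive_eqI[OF T.abelian_group_axioms, of "\<lambda>x. \<one>\<^bsub>K\<^esub> \<odot>\<^bsub>T\<^esub> x" "\<lambda>x. x"])
      (use * in \<open>auto simp: smult_T_add smult_T_closed smult_pure\<close>)
qed (auto simp: smult_T_closed smult_T_add M.R.is_cring abelian_T)

lemma pure_bilinear: "bilinear K M N T (\<boxtimes>\<^bsub>T\<^esub>)"
  by (intro bilinearI module_T linear_mapI)
    (auto simp: pure_add_left pure_add_right smult_pure scalar_pure)

lemma lift_linear:
  assumes "bilinear K M N G \<phi>" "balanced \<phi>"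
  shows "linear_map K T G (tensor_lift G \<phi>)"
proof -
  interpret G: module K G using bilinearD(1)[OF assms(1)] .
  note b = bilinear_biadditive[OF assms(1)]
  show ?thesis
  proof (intro linear_mapI)
    fix c X assume c: "c \<in>! K" and X: "X \<in>! T"
    show "tensor_lift G \<phi> (c \<odot>\<^bsub>T\<^esub> X) = c \<odot>\<^bsub>G\<^esub> tensor_lift G \<phi> X"
      by (rule additive_eqI[of G "\<lambda>X. tensor_lift G \<phi> (c \<odot>\<^bsub>T\<^esub> X)" "\<lambda>X. c \<odot>\<^bsub>G\<^esub> tensor_lift G \<phi> X"])
        (use c X in \<open>auto simp: lift_closed[OF b assms(2)] lift_add[OF b assms(2)] smult_T_add smult_T_closed
          lift_pure[OF b assms(2)] smult_pure G.smult_r_distr linear_mapD(3)[OF bilinearD(2)[OF assms(1)]]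
          intro: G.M.abelian_group_axioms\<close>)
  qed (simp_all add: lift_closed[OF b assms(2)] lift_add[OF b assms(2)])
qed

lemma mult_T:
  "X \<otimes>\<^bsub>T\<^esub> Y = tensor_lift T (\<lambda>m' n'. tensor_lift T (\<lambda>m n. (m \<otimes>\<^bsub>M\<^esub> m') \<boxtimes>\<^bsub>T\<^esub> (n \<otimes>\<^bsub>N\<^esub> n')) X) Y"
proof -
  let ?G = "\<lparr>carrier = carrier T, monoid.mult = undefined, one = undefined, ring.zero = \<zero>\<^bsub>T\<^esub>, add = add T\<rparr>"
  have "X \<otimes>\<^bsub>T\<^esub> Y = tensor_lift ?G (\<lambda>m' n'. tensor_lift ?G (\<lambda>m n. (m \<otimes>\<^bsub>M\<^esub> m') \<boxtimes>\<^bsub>T\<^esub> (n \<otimes>\<^bsub>N\<^esub> n')) X) Y"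
    unfolding T tensor_def Let_def by simp
  moreover have "tensor_lift ?G \<phi> Z = tensor_lift T \<phi> Z" for \<phi> :: "'m \<Rightarrow> 'n \<Rightarrow> _" and Z
    by (intro tensor_lift_structure_cong) simp_all
  ultimately show ?thesis by simp
qed

lemma one_T: "\<one>\<^bsub>T\<^esub> = \<one>\<^bsub>M\<^esub> \<boxtimes>\<^bsub>T\<^esub> \<one>\<^bsub>N\<^esub>"
  unfolding T tensor_def Let_def by simp

lemma linear_eqI:
  assumes "linear_map K T G f" "linear_map K T G g" "module K G"
    and "\<And>m n. m \<in>! M ==> n \<in>! N ==> f (m \<boxtimes>\<^bsub>T\<^esub> n) = g (m \<boxtimes>\<^bsub>T\<^esub> n)"
    and "X \<in>! T"
  shows "f X = g X"
proof -
  interpret G: module K G by fact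
  show ?thesis
    by (rule additive_eqI[OF G.M.abelian_group_axioms, of f g])
      (fact linear_mapD[OF assms(1)] linear_mapD[OF assms(2)] assms(4,5))+
qed

end

section \<open>Tensor products over the field\<close>

lemma balanced_tensor_ktensor:
  assumes "module K M" "module K N"
  shows "balanced_tensor K M N (carrier K) (\<lambda>m c. c \<odot>\<^bsub>M\<^esub> m) (\<lambda>c n. c \<odot>\<^bsub>N\<^esub> n) (ktensor K M N)"
  using assms by (intro balanced_tensor.intro)
    (auto simp: ktensor_def intro: linear_map_smult linear_map_id)

lemma bilinear_balanced:
  assumes "bilinear K M N G \<phi>"
  shows "\<forall>m\<in>carrier M. \<forall>c\<in>carrier K. \<forall>n\<in>carrier N. \<phi> (c \<odot>\<^bsub>M\<^esub> m) n = \<phi> m (c \<odot>\<^bsub>N\<^esub> n)"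
  using linear_mapD(3)[OF bilinearD(2)[OF assms]] linear_mapD(3)[OF bilinearD(3)[OF assms]] by simp

text \<open>Rules that reduce linearity of an expression to linearity of its parts, so that a nested
  sum is seen to be linear in each of its variables by following its shape.\<close>

named_theorems lin

lemma bilinearI2 [lin]:
  assumes "module K G" "\<And>y. y \<in>! N ==> linear_map K M G (\<lambda>x. \<phi> x y)"
    "\<And>x. x \<in>! M ==> linear_map K N G (\<lambda>y. \<phi> x y)"
  shows "bilinear K M N G (\<lambda>x y. \<phi> x y)"
  using assms by (simp add: bilinear_def)

declare linear_map_id [lin]

lemma ktensor_module [simp, lin]:
  "module K M ==> module K N ==> module K (ktensor K M N)"
  by (rule balanced_tensor.module_T[OF balanced_tensor_ktensor])

lemma ktensor_pure_closed [simp]: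
  "module K M ==> module K N ==> m \<in>! M ==> n \<in>! N ==>
    m \<boxtimes>\<^bsub>ktensor K M N\<^esub> n \<in>! ktensor K M N"
  by (rule balanced_tensor.pure_closed[OF balanced_tensor_ktensor])

lemma ktensor_pure_bilinear:
  "module K M ==> module K N ==> bilinear K M N (ktensor K M N) (\<lambda>m n. m \<boxtimes>\<^bsub>ktensor K M N\<^esub> n)"
  by (rule balanced_tensor.pure_bilinear[OF balanced_tensor_ktensor])

lemma ktensor_pure_linear [lin]:
  assumes "module K M" "module K N"
  shows "linear_map K Z M f ==> n \<in>! N ==> linear_map K Z (ktensor K M N) (\<lambda>z. f z \<boxtimes>\<^bsub>ktensor K M N\<^esub> n)"
    and "linear_map K Z N g ==> m \<in>! M ==> linear_map K Z (ktensor K M N) (\<lambda>z. m \<boxtimes>\<^bsub>ktensor K M N\<^esub> g z)"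
  using linear_comp[OF _ bilinearD(2)[OF ktensor_pure_bilinear[OF assms]]]
    linear_comp[OF _ bilinearD(3)[OF ktensor_pure_bilinear[OF assms]]] by blast+

lemma ktensor_lift_linear:
  assumes "module K M" "module K N" "bilinear K M N G \<phi>"
  shows "linear_map K (ktensor K M N) G (tensor_lift G \<phi>)"
  by (rule balanced_tensor.lift_linear[OF balanced_tensor_ktensor[OF assms(1,2)] assms(3) bilinear_balanced[OF assms(3)]])

lemma ktensor_lift_linear':
  assumes "linear_map K Z (ktensor K M N) g" "module K M" "module K N" "bilinear K M N G \<phi>"
  shows "linear_map K Z G (\<lambda>z. tensor_lift G \<phi> (g z))"
  using linear_comp[OF assms(1) ktensor_lift_linear[OF assms(2-4)]] .

lemma ktensor_lift_pure:
  assumes "module K M" "module K N" "bilinear K M N G \<phi>" "m \<in>! M" "n \<in>! N"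
  shows "tensor_lift G \<phi> (m \<boxtimes>\<^bsub>ktensor K M N\<^esub> n) = \<phi> m n"
  by (rule balanced_tensor.lift_pure[OF balanced_tensor_ktensor[OF assms(1,2)]
        bilinear_biadditive[OF assms(3)] bilinear_balanced[OF assms(3)] assms(4,5)])

lemma ktensor_lift_rsum:
  assumes "module K M" "module K N" "bilinear K M N G \<phi>" "X \<in>! ktensor K M N"
  shows "tensor_lift G \<phi> X = rsum G \<phi> X"
  by (rule balanced_tensor.lift_rsum[OF balanced_tensor_ktensor[OF assms(1,2)]
        bilinear_biadditive[OF assms(3)] bilinear_balanced[OF assms(3)] assms(4)])

lemma ktensor_rep_in:
  assumes "module K M" "module K N" "X \<in>! ktensor K M N"
  shows "rep_in X (carrier M) (carrier N)"
  by (rule balanced_tensor.rep_in[OF balanced_tensor_ktensor[OF assms(1,2)] assms(3)])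

lemma ktensor_rsum_pure:
  assumes "module K M" "module K N" "X \<in>! ktensor K M N"
  shows "rsum (ktensor K M N) (\<lambda>x y. x \<boxtimes>\<^bsub>ktensor K M N\<^esub> y) X = X"
  by (rule balanced_tensor.rsum_pure[OF balanced_tensor_ktensor[OF assms(1,2)] assms(3)])

lemma ktensor_linear_eqI:
  assumes "module K M" "module K N" "linear_map K (ktensor K M N) G f" "linear_map K (ktensor K M N) G g" "module K G"
    and "\<And>m n. m \<in>! M ==> n \<in>! N ==>
      f (m \<boxtimes>\<^bsub>ktensor K M N\<^esub> n) = g (m \<boxtimes>\<^bsub>ktensor K M N\<^esub> n)"
    and "X \<in>! ktensor K M N"
  shows "f X = g X"
  by (rule balanced_tensor.linear_eqI[OF balanced_tensor_ktensor[OF assms(1,2)] assms(3-7)])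

lemma ktensor_rsum_linear:
  assumes "module K M" "module K N" "linear_map K (ktensor K M N) G f" "module K G" "X \<in>! ktensor K M N"
  shows "rsum G (\<lambda>x y. f (x \<boxtimes>\<^bsub>ktensor K M N\<^esub> y)) X = f X"
  using rsum_linear[OF assms(3) ktensor_module[OF assms(1,2)] assms(4) ktensor_rep_in[OF assms(1,2,5)],
      of "\<lambda>x y. x \<boxtimes>\<^bsub>ktensor K M N\<^esub> y"] assms ktensor_rsum_pure[OF assms(1,2,5)] by simp

lemma rsum_lift_linear:
  assumes "linear_map K Z (ktensor K M N) g" "module K M" "module K N" "module K Z" "bilinear K M N G \<phi>"
  shows "linear_map K Z G (\<lambda>z. rsum G \<phi> (g z))"
  using ktensor_lift_linear'[OF assms(1-3,5)] assms(4)
  by (rule linear_map_cong) (use assms linear_mapD(1)[OF assms(1)] in \<open>simp add: ktensor_lift_rsum\<close>)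

lemma rsum_lift_pure:
  assumes "module K M" "module K N" "bilinear K M N G \<phi>" "m \<in>! M" "n \<in>! N"
  shows "rsum G \<phi> (m \<boxtimes>\<^bsub>ktensor K M N\<^esub> n) = \<phi> m n"
  using ktensor_lift_rsum[OF assms(1-3) ktensor_pure_closed[OF assms(1,2,4,5)]] ktensor_lift_pure[OF assms] by simp

text \<open>The guard makes an unconditional congruence rule available.\<close>

definition tsum ::
  "('m, 'x) ring_scheme \<Rightarrow> ('n, 'y) ring_scheme \<Rightarrow> ('g, 'z) ring_scheme \<Rightarrow> ('m \<Rightarrow> 'n \<Rightarrow> 'g) \<Rightarrow>
    ('m \<times> 'n \<Rightarrow>\<^sub>0 int) set \<Rightarrow> 'g" where
  "tsum M N G \<phi> X = rsum G (\<lambda>x y. if x \<in>! M \<and> y \<in>! N then \<phi> x y else undefined) X"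

lemma tsum_cong [cong]:
  assumes "X = Y" "\<And>x y. x \<in>! M ==> y \<in>! N ==> \<phi> x y = \<psi> x y"
  shows "tsum M N G \<phi> X = tsum M N G \<psi> Y"
proof -
  have "(\<lambda>x y. if x \<in>! M \<and> y \<in>! N then \<phi> x y else undefined)
      = (\<lambda>x y. if x \<in>! M \<and> y \<in>! N then \<psi> x y else undefined)"
    using assms(2) by (intro ext) auto
  then show ?thesis unfolding tsum_def using assms(1) by simp
qed

lemma tsum_rsum: "rep_in X (carrier M) (carrier N) ==> tsum M N G \<phi> X = rsum G \<phi> X"
  unfolding tsum_def by (rule rsum_cong) auto

lemma tsum_closed [simp]:
  assumes "rep_in X (carrier M) (carrier N)" "abelian_group G"
    and "\<And>x y. x \<in>! M ==> y \<in>! N ==> \<phi> x y \<in>! G"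
  shows "tsum M N G \<phi> X \<in>! G"
  using assms by (simp add: tsum_rsum rsum_closed)

lemma tsum_linear:
  assumes "linear_map K G G' f" "module K G" "module K G'" "rep_in X (carrier M) (carrier N)"
    and "\<And>x y. x \<in>! M ==> y \<in>! N ==> \<phi> x y \<in>! G"
  shows "f (tsum M N G \<phi> X) = tsum M N G' (\<lambda>x y. f (\<phi> x y)) X"
  using assms by (simp add: tsum_rsum rsum_linear[OF assms(1-4)])

lemma tsum_swap:
  assumes "abelian_group G" "rep_in X (carrier M) (carrier N)" "rep_in Y (carrier P) (carrier Q)"
    and "\<And>x y z w. x \<in>! M ==> y \<in>! N ==> z \<in>! P ==> w \<in>! Q ==>
      \<phi> x y z w \<in>! G"
  shows "tsum M N G (\<lambda>x y. tsum P Q G (\<lambda>z w. \<phi> x y z w) Y) X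
    = tsum P Q G (\<lambda>z w. tsum M N G (\<lambda>x y. \<phi> x y z w) X) Y"
  using assms(2,3) rsum_swap[OF assms] by (simp add: tsum_rsum)

lemma tsum_linear_param [lin]:
  assumes "module K N" "rep_in X (carrier P) (carrier Q)"
    and "\<And>x y. x \<in>! P ==> y \<in>! Q ==> linear_map K M N (\<lambda>z. \<phi> z x y)"
  shows "linear_map K M N (\<lambda>z. tsum P Q N (\<lambda>x y. \<phi> z x y) X)"
  using linear_map_rsum[OF assms] assms(2) by (simp add: tsum_rsum)

lemma tsum_add:
  assumes "abelian_group G" "rep_in X (carrier M) (carrier N)"
    and "\<And>x y. x \<in>! M ==> y \<in>! N ==> \<phi> x y \<in>! G"
      "\<And>x y. x \<in>! M ==> y \<in>! N ==> \<psi> x y \<in>! G"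
  shows "tsum M N G (\<lambda>x y. \<phi> x y \<oplus>\<^bsub>G\<^esub> \<psi> x y) X = tsum M N G \<phi> X \<oplus>\<^bsub>G\<^esub> tsum M N G \<psi> X"
  using rsum_add[OF assms] assms(2) by (simp add: tsum_rsum)

lemma ktensor_lift_tsum:
  assumes "module K M" "module K N" "bilinear K M N G \<phi>" "X \<in>! ktensor K M N"
  shows "tensor_lift G \<phi> X = tsum M N G \<phi> X"
  using assms ktensor_rep_in[OF assms(1,2,4)] by (simp add: ktensor_lift_rsum tsum_rsum)

lemma ktensor_tsum_linear:
  assumes "linear_map K (ktensor K M N) G f" "module K M" "module K N" "module K G" "X \<in>! ktensor K M N"
  shows "tsum M N G (\<lambda>x y. f (x \<boxtimes>\<^bsub>ktensor K M N\<^esub> y)) X = f X"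
  using ktensor_rsum_linear[OF assms(2,3,1,4,5)] ktensor_rep_in[OF assms(2,3,5)] by (simp add: tsum_rsum)

text \<open>Here the variable sits in the tensor that is summed over, in contrast to
  \<open>tsum_linear_param\<close>. Bilinearity of \<open>\<phi>\<close> makes the sum independent
  of the chosen representative, and only then is it linear in the tensor.\<close>

lemma tsum_linear_arg [lin]:
  assumes "linear_map K Z (ktensor K M N) g" "module K M" "module K N" "module K Z" "bilinear K M N G (\<lambda>x y. \<phi> x y)"
  shows "linear_map K Z G (\<lambda>z. tsum M N G (\<lambda>x y. \<phi> x y) (g z))"
  using rsum_lift_linear[OF assms] assms(4)
  by (rule linear_map_cong)
    (simp add: tsum_rsum[OF ktensor_rep_in[OF assms(2,3) linear_mapD(1)[OF assms(1)]]])

lemma tsum_pure: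
  assumes "module K M" "module K N" "bilinear K M N G \<phi>" "m \<in>! M" "n \<in>! N"
  shows "tsum M N G \<phi> (m \<boxtimes>\<^bsub>ktensor K M N\<^esub> n) = \<phi> m n"
  using rsum_lift_pure[OF assms] ktensor_rep_in[OF assms(1,2) ktensor_pure_closed[OF assms(1,2,4,5)]]
  by (simp add: tsum_rsum)

lemma lift_linear_param:
  assumes "X \<in>! ktensor K P Q" "module K P" "module K Q" "module K M" "module K N"
    and "\<And>z. z \<in>! M ==> bilinear K P Q N (\<lambda>x y. \<phi> z x y)"
    and "\<And>x y. x \<in>! P ==> y \<in>! Q ==> linear_map K M N (\<lambda>z. \<phi> z x y)"
  shows "linear_map K M N (\<lambda>z. tensor_lift N (\<lambda>x y. \<phi> z x y) X)"
  by (rule linear_map_cong[OF tsum_linear_param[OF assms(5) ktensor_rep_in[OF assms(2,3,1)] assms(7)] assms(4)])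
    (simp_all add: ktensor_lift_tsum[OF assms(2,3,6,1)])

lemma linear_map_mult [lin]:
  assumes "k_algebra K A"
  shows "linear_map K Z A f ==> y \<in>! A ==> linear_map K Z A (\<lambda>z. f z \<otimes>\<^bsub>A\<^esub> y)"
    and "linear_map K Z A g ==> x \<in>! A ==> linear_map K Z A (\<lambda>z. x \<otimes>\<^bsub>A\<^esub> g z)"
proof -
  interpret A: ring A using assms by (simp add: k_algebra_def)
  show "linear_map K Z A f ==> y \<in>! A ==> linear_map K Z A (\<lambda>z. f z \<otimes>\<^bsub>A\<^esub> y)"
    "linear_map K Z A g ==> x \<in>! A ==> linear_map K Z A (\<lambda>z. x \<otimes>\<^bsub>A\<^esub> g z)"
    using assms by (auto simp: linear_map_def k_algebra_def Pi_iff A.l_distr A.r_distr)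
qed

declare linear_map_smult [lin] linear_map_scalar [lin]

context
  fixes K :: "('k, 'c) ring_scheme" and A :: "('k, 'a, 'x) module_scheme" and H :: "('k, 'h, 'y) module_scheme"
  assumes A: "k_algebra K A" and H: "k_algebra K H"
begin

private lemma mods: "module K A" "module K H"
  using A H by (simp_all add: k_algebra_def)

interpretation AH: balanced_tensor K A H "carrier K" "\<lambda>m c. c \<odot>\<^bsub>A\<^esub> m" "\<lambda>c n. c \<odot>\<^bsub>H\<^esub> n" "ktensor K A H"
  by (rule balanced_tensor_ktensor[OF mods])

interpretation A: ring A using A by (simp add: k_algebra_def)
interpretation H: ring H using H by (simp add: k_algebra_def)

lemma ktensor_mult_bilinear_aux:
  assumes X: "X \<in>! ktensor K A H"
  shows "bilinear K A H (ktensor K A H) (\<lambda>m' n'. tensor_lift (ktensor K A H)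
     (\<lambda>m n. (m \<otimes>\<^bsub>A\<^esub> m') \<boxtimes>\<^bsub>ktensor K A H\<^esub> (n \<otimes>\<^bsub>H\<^esub> n')) X)"
  by (intro lin lift_linear_param[OF X] A H mods) simp_all

lemma ktensor_mult_tsum:
  assumes "X \<in>! ktensor K A H" "Y \<in>! ktensor K A H"
  shows "X \<otimes>\<^bsub>ktensor K A H\<^esub> Y = tsum A H (ktensor K A H) (\<lambda>m' n'. tsum A H (ktensor K A H)
     (\<lambda>m n. (m \<otimes>\<^bsub>A\<^esub> m') \<boxtimes>\<^bsub>ktensor K A H\<^esub> (n \<otimes>\<^bsub>H\<^esub> n')) X) Y"
proof -
  have b: "bilinear K A H (ktensor K A H) (\<lambda>m n. (m \<otimes>\<^bsub>A\<^esub> m') \<boxtimes>\<^bsub>ktensor K A H\<^esub> (n \<otimes>\<^bsub>H\<^esub> n'))"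
    if "m' \<in>! A" "n' \<in>! H" for m' n'
    by (intro lin A H) (simp_all add: mods that)
  show ?thesis
    unfolding AH.mult_T ktensor_lift_tsum[OF mods ktensor_mult_bilinear_aux[OF assms(1)] assms(2)]
    by (intro tsum_cong refl ktensor_lift_tsum[OF mods b assms(1)])
qed

end

section \<open>Sweedler sums in a Hopf algebra\<close>

text \<open>Rules that move an outer product or an outer scalar into a sum.\<close>

named_theorems push

lemma abelian_group_module [simp]: "module K N ==> abelian_group (ktensor K M N)" if "module K M" for M
  using ktensor_module[OF that] by (rule module.axioms(2))

lemma tsum_push_mult:
  assumes "k_algebra K A" "rep_in X (carrier M) (carrier N)" "a \<in>! A"
    and "\<And>x y. x \<in>! M ==> y \<in>! N ==> \<phi> x y \<in>! A"
  shows "a \<otimes>\<^bsub>A\<^esub> tsum M N A (\<lambda>x y. \<phi> x y) X = tsum M N A (\<lambda>x y. a \<otimes>\<^bsub>A\<^esub> \<phi> x y) X"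
    and "tsum M N A (\<lambda>x y. \<phi> x y) X \<otimes>\<^bsub>A\<^esub> a = tsum M N A (\<lambda>x y. \<phi> x y \<otimes>\<^bsub>A\<^esub> a) X"
  using assms tsum_linear[OF linear_map_mult(1)[OF assms(1) linear_map_id assms(3)] _ _ assms(2), of \<phi>]
    tsum_linear[OF linear_map_mult(2)[OF assms(1) linear_map_id assms(3)] _ _ assms(2), of \<phi>]
  by (simp_all add: k_algebra_def)

lemma tsum_push_smult:
  assumes "module K A" "rep_in X (carrier M) (carrier N)" "c \<in>! K"
    and "\<And>x y. x \<in>! M ==> y \<in>! N ==> \<phi> x y \<in>! A"
  shows "c \<odot>\<^bsub>A\<^esub> tsum M N A (\<lambda>x y. \<phi> x y) X = tsum M N A (\<lambda>x y. c \<odot>\<^bsub>A\<^esub> \<phi> x y) X"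
  using assms tsum_linear[OF linear_map_smult[OF linear_map_id assms(1,3)] assms(1,1,2), of \<phi>] by simp

locale hopf =
  fixes K :: "('k, 'c) ring_scheme" and H :: "('k, 'h, 'x) hopf_scheme" (structure)
  assumes hopf: "hopf_algebra K H"
begin

abbreviation "S \<equiv> antipode H"
abbreviation "\<epsilon> \<equiv> counit H"
text \<open>Sweedler notation: the sum of \<open>\<phi> h1 h2\<close>. A further \<open>sw\<close>
  applied to the second bound variable produces \<open>h1\<close>, \<open>h2\<close>,
  \<open>h3\<close>, and \<open>coassoc\<close> allows it to be applied to the first one
  instead.\<close>

abbreviation sw :: "('k, 'g, 'z) module_scheme \<Rightarrow> ('h \<Rightarrow> 'h \<Rightarrow> 'g) \<Rightarrow> 'h \<Rightarrow> 'g" where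
  "sw G \<phi> h \<equiv> tsum H H G \<phi> (comult H h)"

lemma kalg [simp]: "k_algebra K H"
  and coalg: "coalgebra K H"
  and comult_hom: "alg_hom K H (ktensor K H H) (comult H)"
  and counit_hom: "alg_hom K H (self_module K) \<epsilon>"
  and S_linear: "linear_map K H H S"
  using hopf by (simp_all add: hopf_algebra_def)

sublocale K: field K using kalg by (simp add: k_algebra_def)
sublocale M: module K H using kalg by (simp add: k_algebra_def)
sublocale H: ring H using kalg by (simp add: k_algebra_def)

lemma module_H [simp]: "module K H" by (rule M.module_axioms)
lemma module_K [simp]: "module K (self_module K)" by (rule module_self[OF K.is_cring])
lemma abelian_H [simp]: "abelian_group H" by (rule M.M.abelian_group_axioms)
lemma abelian_K [simp]: "abelian_group (self_module K)" using module_K by (rule module.axioms(2))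
lemma smult_mult [simp]:
  "c \<in>! K ==> x \<in>! H ==> y \<in>! H ==> (c \<odot> x) \<otimes> y = c \<odot> (x \<otimes> y)"
  "c \<in>! K ==> x \<in>! H ==> y \<in>! H ==> x \<otimes> (c \<odot> y) = c \<odot> (x \<otimes> y)"
  using kalg by (simp_all add: k_algebra_def)

lemma comult_linear: "linear_map K H (ktensor K H H) (comult H)"
  using comult_hom by (simp add: alg_hom_def)

lemma counit_linear: "linear_map K H (self_module K) \<epsilon>"
  using counit_hom by (simp add: alg_hom_def)

lemma comult_closed [simp]: "h \<in>! H ==> comult H h \<in>! ktensor K H H"
  by (rule linear_mapD(1)[OF comult_linear])

lemma comult_rep [simp]: "h \<in>! H ==> rep_in (comult H h) (carrier H) (carrier H)"
  by (rule ktensor_rep_in[where K = K]) simp_all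

lemma counit_closed [simp]: "h \<in>! H ==> \<epsilon> h \<in>! K"
  using linear_mapD(1)[OF counit_linear] by simp

lemma S_closed [simp]: "h \<in>! H ==> S h \<in>! H"
  by (rule linear_mapD(1)[OF S_linear])

lemma counit_mult [simp]: "x \<in>! H ==> y \<in>! H ==> \<epsilon> (x \<otimes> y) = \<epsilon> x \<otimes>\<^bsub>K\<^esub> \<epsilon> y"
  and counit_one [simp]: "\<epsilon> \<one> = \<one>\<^bsub>K\<^esub>"
  using counit_hom by (simp_all add: alg_hom_def ring_hom_def)

lemma S_linear' [lin]: "linear_map K Z H f ==> linear_map K Z H (\<lambda>z. S (f z))"
  using linear_comp[OF _ S_linear] .

lemma counit_linear' [lin]: "linear_map K Z H f ==> linear_map K Z (self_module K) (\<lambda>z. \<epsilon> (f z))"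
  using linear_comp[OF _ counit_linear] .

lemma comult_linear' [lin]: "linear_map K Z H f ==> linear_map K Z (ktensor K H H) (\<lambda>z. comult H (f z))"
  using linear_comp[OF _ comult_linear] .

lemma lift_sw:
  "bilinear K H H G \<phi> ==> h \<in>! H ==> tensor_lift G \<phi> (comult H h) = sw G \<phi> h"
  by (rule ktensor_lift_tsum[where K = K]) (simp_all only: module_H comult_closed)

lemma sw_push:
  assumes "linear_map K G G' f" "module K G" "module K G'" "h \<in>! H"
    and "\<And>x y. x \<in>! H ==> y \<in>! H ==> \<phi> x y \<in>! G"
  shows "f (sw G \<phi> h) = sw G' (\<lambda>x y. f (\<phi> x y)) h"
  using assms by (intro tsum_linear) simp_all

text \<open>The axiom equates two elements of the triple tensor product. A trilinear
  \<open>\<psi>\<close> induces a linear map \<open>F\<close> on that space, and applying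
  \<open>F\<close> to the axiom gives the equation between sums.\<close>

lemma coassoc:
  assumes G: "module K G"
    and 1: "\<And>y z. y \<in>! H ==> z \<in>! H ==> linear_map K H G (\<lambda>x. \<psi> x y z)"
    and 2: "\<And>x z. x \<in>! H ==> z \<in>! H ==> linear_map K H G (\<lambda>y. \<psi> x y z)"
    and 3: "\<And>x y. x \<in>! H ==> y \<in>! H ==> linear_map K H G (\<lambda>z. \<psi> x y z)"
    and h: "h \<in>! H"
  shows "sw G (\<lambda>x z. sw G (\<lambda>x y. \<psi> x y z) x) h = sw G (\<lambda>x y. sw G (\<lambda>y z. \<psi> x y z) y) h"
proof -
  let ?C2 = "ktensor K H H" and ?C3 = "ktensor K H (ktensor K H H)"
  define F where "F = tensor_lift G (\<lambda>x Y. tsum H H G (\<lambda>y z. \<psi> x y z) Y)"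
  have b: "bilinear K H ?C2 G (\<lambda>x Y. tsum H H G (\<lambda>y z. \<psi> x y z) Y)"
    by (intro lin linear_comp[OF _ 1] linear_comp[OF _ 2] linear_comp[OF _ 3])
      (simp_all add: G ktensor_rep_in[where K = K])
  have F: "linear_map K ?C3 G F" unfolding F_def by (rule ktensor_lift_linear[OF _ _ b]) simp_all
  have bil: "bilinear K H H G (\<lambda>y z. \<psi> x y z)" if "x \<in>! H" for x
    using G 2 3 that by (intro bilinearI) auto
  have Fp: "F (x \<boxtimes>\<^bsub>?C3\<^esub> Y) = tsum H H G (\<lambda>y z. \<psi> x y z) Y" if "x \<in>! H" "Y \<in>! ?C2" for x Y
    unfolding F_def by (rule ktensor_lift_pure[OF _ _ b that]) simp_all
  have eq: "tensor_lift ?C3 (\<lambda>x y. tensor_lift ?C3 (\<lambda>x1 x2. x1 \<boxtimes>\<^bsub>?C3\<^esub> (x2 \<boxtimes>\<^bsub>?C2\<^esub> y)) (comult H x)) (comult H h)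
    = tensor_lift ?C3 (\<lambda>x y. x \<boxtimes>\<^bsub>?C3\<^esub> comult H y) (comult H h)"
    using coalg h by (simp add: coalgebra_def Let_def)
  have i: "tensor_lift ?C3 (\<lambda>x1 x2. x1 \<boxtimes>\<^bsub>?C3\<^esub> (x2 \<boxtimes>\<^bsub>?C2\<^esub> y)) (comult H x) = sw ?C3 (\<lambda>x1 x2. x1 \<boxtimes>\<^bsub>?C3\<^esub> (x2 \<boxtimes>\<^bsub>?C2\<^esub> y)) x"
    if "x \<in>! H" "y \<in>! H" for x y
    using that by (intro lift_sw lin) simp_all
  have "tensor_lift ?C3 (\<lambda>x y. tensor_lift ?C3 (\<lambda>x1 x2. x1 \<boxtimes>\<^bsub>?C3\<^esub> (x2 \<boxtimes>\<^bsub>?C2\<^esub> y)) (comult H x)) (comult H h)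
     = sw ?C3 (\<lambda>x y. tensor_lift ?C3 (\<lambda>x1 x2. x1 \<boxtimes>\<^bsub>?C3\<^esub> (x2 \<boxtimes>\<^bsub>?C2\<^esub> y)) (comult H x)) h"
    by (intro lift_sw h bilinearI linear_map_cong[OF _ module_H i[symmetric]])
      (auto intro!: lin)
  also have "... = sw ?C3 (\<lambda>x y. sw ?C3 (\<lambda>x1 x2. x1 \<boxtimes>\<^bsub>?C3\<^esub> (x2 \<boxtimes>\<^bsub>?C2\<^esub> y)) x) h"
    by (simp add: i)
  finally have l: "sw ?C3 (\<lambda>x y. sw ?C3 (\<lambda>x1 x2. x1 \<boxtimes>\<^bsub>?C3\<^esub> (x2 \<boxtimes>\<^bsub>?C2\<^esub> y)) x) h
     = sw ?C3 (\<lambda>x y. x \<boxtimes>\<^bsub>?C3\<^esub> comult H y) h"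
    using eq h by (subst (asm) lift_sw[where \<phi> = "\<lambda>x y. x \<boxtimes>\<^bsub>?C3\<^esub> comult H y"]) (auto intro!: lin)
  have "sw G (\<lambda>x z. sw G (\<lambda>x y. \<psi> x y z) x) h = F (sw ?C3 (\<lambda>x y. sw ?C3 (\<lambda>x1 x2. x1 \<boxtimes>\<^bsub>?C3\<^esub> (x2 \<boxtimes>\<^bsub>?C2\<^esub> y)) x) h)"
    using h by (simp add: sw_push[OF F] G Fp tsum_pure bil)
  also have "... = sw G (\<lambda>x y. sw G (\<lambda>y z. \<psi> x y z) y) h"
    unfolding l using h by (simp add: sw_push[OF F] G Fp)
  finally show ?thesis .
qed

text \<open>With a linear map \<open>f\<close> around it, the counit law can be used at any place of
  a nested sum; the antipode laws below follow the same pattern.\<close>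

lemma counit_left:
  assumes "linear_map K H G f" "module K G" "h \<in>! H"
  shows "sw G (\<lambda>x y. \<epsilon> x \<odot>\<^bsub>G\<^esub> f y) h = f h"
proof -
  have "tensor_lift H (\<lambda>x y. \<epsilon> x \<odot> y) (comult H h) = h"
    using coalg assms(3) by (simp add: coalgebra_def Let_def)
  then have "sw H (\<lambda>x y. \<epsilon> x \<odot> y) h = h"
    using assms(3) by (subst (asm) lift_sw) (auto intro!: lin)
  then have "f (sw H (\<lambda>x y. \<epsilon> x \<odot> y) h) = f h" by simp
  then show ?thesis
    using assms by (simp add: sw_push[OF assms(1)] linear_mapD(3)[OF assms(1)])
qed

lemma counit_right:
  assumes "linear_map K H G f" "module K G" "h \<in>! H"
  shows "sw G (\<lambda>x y. \<epsilon> y \<odot>\<^bsub>G\<^esub> f x) h = f h"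
proof -
  have "tensor_lift H (\<lambda>x y. \<epsilon> y \<odot> x) (comult H h) = h"
    using coalg assms(3) by (simp add: coalgebra_def Let_def)
  then have "sw H (\<lambda>x y. \<epsilon> y \<odot> x) h = h"
    using assms(3) by (subst (asm) lift_sw) (auto intro!: lin)
  then have "f (sw H (\<lambda>x y. \<epsilon> y \<odot> x) h) = f h" by simp
  then show ?thesis
    using assms by (simp add: sw_push[OF assms(1)] linear_mapD(3)[OF assms(1)])
qed

lemma antipode_left:
  assumes "linear_map K H G f" "module K G" "h \<in>! H"
  shows "sw G (\<lambda>x y. f (S x \<otimes> y)) h = \<epsilon> h \<odot>\<^bsub>G\<^esub> f \<one>"
proof -
  have "tensor_lift H (\<lambda>x y. S x \<otimes> y) (comult H h) = \<epsilon> h \<odot> \<one>"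
    using hopf assms(3) by (simp add: hopf_algebra_def)
  then have "sw H (\<lambda>x y. S x \<otimes> y) h = \<epsilon> h \<odot> \<one>"
    using assms(3) by (subst (asm) lift_sw) (auto intro!: lin)
  then have "f (sw H (\<lambda>x y. S x \<otimes> y) h) = f (\<epsilon> h \<odot> \<one>)" by simp
  then show ?thesis
    using assms by (simp add: sw_push[OF assms(1)] linear_mapD(3)[OF assms(1)])
qed

lemma antipode_right:
  assumes "linear_map K H G f" "module K G" "h \<in>! H"
  shows "sw G (\<lambda>x y. f (x \<otimes> S y)) h = \<epsilon> h \<odot>\<^bsub>G\<^esub> f \<one>"
proof -
  have "tensor_lift H (\<lambda>x y. x \<otimes> S y) (comult H h) = \<epsilon> h \<odot> \<one>"
    using hopf assms(3) by (simp add: hopf_algebra_def)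
  then have "sw H (\<lambda>x y. x \<otimes> S y) h = \<epsilon> h \<odot> \<one>"
    using assms(3) by (subst (asm) lift_sw) (auto intro!: lin)
  then have "f (sw H (\<lambda>x y. x \<otimes> S y) h) = f (\<epsilon> h \<odot> \<one>)" by simp
  then show ?thesis
    using assms by (simp add: sw_push[OF assms(1)] linear_mapD(3)[OF assms(1)])
qed

lemma sw_mult:
  assumes b: "bilinear K H H G \<phi>" and x: "x \<in>! H" and y: "y \<in>! H"
  shows "sw G \<phi> (x \<otimes> y) = sw G (\<lambda>x1 x2. sw G (\<lambda>y1 y2. \<phi> (x1 \<otimes> y1) (x2 \<otimes> y2)) y) x"
proof -
  let ?T = "ktensor K H H"
  note G = bilinearD(1)[OF b] and cl = bilinearD(4)[OF b]
  have F: "linear_map K ?T G (tsum H H G \<phi>)"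
    by (rule tsum_linear_arg[OF linear_map_id]) (simp_all add: b)
  have "comult H (x \<otimes> y) = comult H x \<otimes>\<^bsub>?T\<^esub> comult H y"
    using comult_hom x y by (simp add: alg_hom_def ring_hom_def)
  then have "sw G \<phi> (x \<otimes> y) = tsum H H G \<phi> (tsum H H ?T (\<lambda>m' n'. tsum H H ?T
      (\<lambda>m n. (m \<otimes> m') \<boxtimes>\<^bsub>?T\<^esub> (n \<otimes> n')) (comult H x)) (comult H y))"
    using x y by (simp add: ktensor_mult_tsum)
  also have "... = sw G (\<lambda>y1 y2. sw G (\<lambda>x1 x2. \<phi> (x1 \<otimes> y1) (x2 \<otimes> y2)) x) y"
    using x y by (simp add: sw_push[OF F] G tsum_pure b)
  also have "... = sw G (\<lambda>x1 x2. sw G (\<lambda>y1 y2. \<phi> (x1 \<otimes> y1) (x2 \<otimes> y2)) y) x"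
    using x y G cl by (intro tsum_swap) (simp_all add: module_def)
  finally show ?thesis .
qed

lemma sw_one:
  assumes b: "bilinear K H H G \<phi>"
  shows "sw G \<phi> \<one> = \<phi> \<one> \<one>"
proof -
  interpret T: balanced_tensor K H H "carrier K" "\<lambda>m c. c \<odot> m" "\<lambda>c n. c \<odot> n" "ktensor K H H"
    by (rule balanced_tensor_ktensor) simp_all
  have "comult H \<one> = \<one> \<boxtimes>\<^bsub>ktensor K H H\<^esub> \<one>"
    using comult_hom by (simp add: alg_hom_def ring_hom_def T.one_T)
  then have "sw G \<phi> \<one> = tsum H H G \<phi> (\<one> \<boxtimes>\<^bsub>ktensor K H H\<^esub> \<one>)" by (rule arg_cong)
  also have "... = \<phi> \<one> \<one>" by (rule tsum_pure) (simp_all add: b)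
  finally show ?thesis .
qed

lemmas push_in_K [push] = tsum_push_mult[where K = K] tsum_push_smult[where K = K]

lemma S_one [simp]: "S \<one> = \<one>"
proof -
  have "sw H (\<lambda>x y. S x \<otimes> y) \<one> = S \<one> \<otimes> \<one>"
    by (rule sw_one) (intro lin; simp)
  then show ?thesis using antipode_left[of H "\<lambda>x. x" \<one>] by (simp add: lin)
qed

text \<open>Convolution argument: the sum of \<open>S(x1 y1) (x2 y2) (S y3 S x3)\<close> contracts
  from the right to \<open>S(x y)\<close> and from the left to \<open>S y S x\<close>.\<close>

lemma S_mult [simp]:
  assumes x: "x \<in>! H" and y: "y \<in>! H"
  shows "S (x \<otimes> y) = S y \<otimes> S x"
proof -
  let ?E = "\<lambda>x1 y1 x2 y2 x3 y3. S (x1 \<otimes> y1) \<otimes> ((x2 \<otimes> y2) \<otimes> (S y3 \<otimes> S x3))"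
  define E where "E = sw H (\<lambda>x1 x'. sw H (\<lambda>y1 y'. sw H (\<lambda>x2 x3. sw H (\<lambda>y2 y3. ?E x1 y1 x2 y2 x3 y3) y') x') y) x"
  have 1: "sw H (\<lambda>y2 y3. ?E x1 y1 x2 y2 x3 y3) y' = \<epsilon> y' \<odot> (S (x1 \<otimes> y1) \<otimes> (x2 \<otimes> S x3))"
    if "x1 \<in>! H" "y1 \<in>! H" "x2 \<in>! H" "x3 \<in>! H" "y' \<in>! H" for x1 y1 x2 x3 y'
    using antipode_right[of H "\<lambda>u. S (x1 \<otimes> y1) \<otimes> ((x2 \<otimes> u) \<otimes> S x3)" y'] that by (simp add: H.m_assoc lin)
  have 2: "sw H (\<lambda>x2 x3. \<epsilon> y' \<odot> (S (x1 \<otimes> y1) \<otimes> (x2 \<otimes> S x3))) x' = \<epsilon> x' \<odot> (\<epsilon> y' \<odot> S (x1 \<otimes> y1))"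
    if "x1 \<in>! H" "y1 \<in>! H" "x' \<in>! H" "y' \<in>! H" for x1 y1 x' y'
    using antipode_right[of H "\<lambda>u. \<epsilon> y' \<odot> (S (x1 \<otimes> y1) \<otimes> u)" x'] that by (simp add: lin)
  have 3: "sw H (\<lambda>y1 y'. \<epsilon> x' \<odot> (\<epsilon> y' \<odot> S (x1 \<otimes> y1))) y = \<epsilon> x' \<odot> S (x1 \<otimes> y)"
    if "x1 \<in>! H" "x' \<in>! H" for x1 x'
    using counit_right[of H "\<lambda>u. \<epsilon> x' \<odot> S (x1 \<otimes> u)" y] that y
    by (simp add: lin M.smult_assoc1[symmetric] K.m_comm)
  have "E = S (x \<otimes> y)"
    unfolding E_def using counit_right[of H "\<lambda>u. S (u \<otimes> y)" x] x y by (simp add: 1 2 3 lin)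
  \<comment> \<open>Regroup so that the first two components of \<open>x\<close>, and those of
    \<open>y\<close>, come from one coproduct each; the left part is then an antipode sum for the
    product of \<open>x'\<close> and \<open>y'\<close>.\<close>
  have "E = sw H (\<lambda>x1 x'. sw H (\<lambda>x2 x3. sw H (\<lambda>y1 y'. sw H (\<lambda>y2 y3. ?E x1 y1 x2 y2 x3 y3) y') y) x') x"
    unfolding E_def using x y
    by (intro tsum_cong refl tsum_swap) (simp_all add: M.M.abelian_group_axioms)
  also have "... = sw H (\<lambda>x' x3. sw H (\<lambda>x1 x2. sw H (\<lambda>y1 y'. sw H (\<lambda>y2 y3. ?E x1 y1 x2 y2 x3 y3) y') y) x') x"
    by (rule coassoc[symmetric]) ((intro lin)?, simp_all add: x y)+
  also have "... = sw H (\<lambda>x' x3. sw H (\<lambda>x1 x2. sw H (\<lambda>y' y3. sw H (\<lambda>y1 y2. ?E x1 y1 x2 y2 x3 y3) y') y) x') x"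
    by (intro tsum_cong refl coassoc[symmetric]) ((intro lin)?, simp_all add: x y)+
  also have "... = sw H (\<lambda>x' x3. sw H (\<lambda>y' y3. sw H (\<lambda>x1 x2. sw H (\<lambda>y1 y2. ?E x1 y1 x2 y2 x3 y3) y') x') y) x"
    using x y by (intro tsum_cong refl tsum_swap) (simp_all add: M.M.abelian_group_axioms)
  also have "... = sw H (\<lambda>x' x3. sw H (\<lambda>y' y3. \<epsilon> (x' \<otimes> y') \<odot> (S y3 \<otimes> S x3)) y) x"
  proof (intro tsum_cong refl)
    fix x' x3 y' y3 assume *: "x' \<in>! H" "x3 \<in>! H" "y' \<in>! H" "y3 \<in>! H"
    have "sw H (\<lambda>x1 x2. sw H (\<lambda>y1 y2. ?E x1 y1 x2 y2 x3 y3) y') x'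
      = sw H (\<lambda>a b. (S a \<otimes> b) \<otimes> (S y3 \<otimes> S x3)) (x' \<otimes> y')"
      using * by (subst sw_mult) ((intro lin)?, simp_all add: H.m_assoc)+
    also have "... = \<epsilon> (x' \<otimes> y') \<odot> (S y3 \<otimes> S x3)"
      using * antipode_left[of H "\<lambda>u. u \<otimes> (S y3 \<otimes> S x3)" "x' \<otimes> y'"] by (simp add: lin)
    finally show "sw H (\<lambda>x1 x2. sw H (\<lambda>y1 y2. ?E x1 y1 x2 y2 x3 y3) y') x' = \<epsilon> (x' \<otimes> y') \<odot> (S y3 \<otimes> S x3)" .
  qed
  also have "... = sw H (\<lambda>x' x3. \<epsilon> x' \<odot> (S y \<otimes> S x3)) x"
  proof (intro tsum_cong refl)
    fix x' x3 assume *: "x' \<in>! H" "x3 \<in>! H"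
    then show "sw H (\<lambda>y' y3. \<epsilon> (x' \<otimes> y') \<odot> (S y3 \<otimes> S x3)) y = \<epsilon> x' \<odot> (S y \<otimes> S x3)"
      using counit_left[of H "\<lambda>u. \<epsilon> x' \<odot> (S u \<otimes> S x3)" y] y
      by (simp add: lin M.smult_assoc1[symmetric] K.m_comm)
  qed
  also have "... = S y \<otimes> S x"
    using counit_left[of H "\<lambda>u. S y \<otimes> S u" x] x y by (simp add: lin)
  finally show ?thesis using \<open>E = S (x \<otimes> y)\<close> by simp
qed

text \<open>The same pattern in \<open>H \<otimes> H\<close>: the product of the coproduct of
  \<open>S h1\<close>, the coproduct of \<open>h2\<close> and \<open>S h4 \<otimes> S h3\<close> is
  evaluated from both ends.\<close>

lemma sw_S:
  assumes b: "bilinear K H H G \<phi>" and h: "h \<in>! H"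
  shows "sw G \<phi> (S h) = sw G (\<lambda>x y. \<phi> (S y) (S x)) h"
proof -
  note G [simp] = bilinearD(1)[OF b] and cl [simp] = bilinearD(4)[OF b]
  note pl = linear_comp[OF _ bilinearD(2)[OF b]] linear_comp[OF _ bilinearD(3)[OF b]]
  have aG [simp]: "abelian_group G" using G by (rule module.axioms(2))
  let ?E = "\<lambda>a b c d s t. \<phi> (a \<otimes> (c \<otimes> S t)) (b \<otimes> (d \<otimes> S s))"
  define E where "E = sw G (\<lambda>h1 r. sw G (\<lambda>a b. sw G (\<lambda>p q. sw G (\<lambda>c d. sw G (\<lambda>s t. ?E a b c d s t) q) p) r) (S h1)) h"
  \<comment> \<open>Contraction from the right. The components \<open>d\<close> and \<open>s\<close>
    are adjacent in the iterated coproduct, so \<open>d S s\<close> collapses first; afterwards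
    \<open>c\<close> and \<open>t\<close> are adjacent.\<close>
  have in1: "sw G (\<lambda>p q. sw G (\<lambda>c d. sw G (\<lambda>s t. ?E a b c d s t) q) p) r = \<epsilon> r \<odot>\<^bsub>G\<^esub> \<phi> a b"
    if ab: "a \<in>! H" "b \<in>! H" and r: "r \<in>! H" for a b r
  proof -
    have "sw G (\<lambda>p q. sw G (\<lambda>c d. sw G (\<lambda>s t. ?E a b c d s t) q) p) r
      = sw G (\<lambda>c q'. sw G (\<lambda>d q. sw G (\<lambda>s t. ?E a b c d s t) q) q') r"
      using ab r by (intro coassoc) ((intro lin pl)?, simp_all)+
    also have "... = sw G (\<lambda>c q'. sw G (\<lambda>u t. sw G (\<lambda>d s. ?E a b c d s t) u) q') r"
      using ab r by (intro tsum_cong refl coassoc[symmetric]) ((intro lin pl)?, simp_all)+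
    also have "... = sw G (\<lambda>c q'. sw G (\<lambda>u t. \<epsilon> u \<odot>\<^bsub>G\<^esub> \<phi> (a \<otimes> (c \<otimes> S t)) b) q') r"
    proof (intro tsum_cong refl)
      fix c q' u t assume "c \<in>! H" "q' \<in>! H" "u \<in>! H" "t \<in>! H"
      then show "sw G (\<lambda>d s. ?E a b c d s t) u = \<epsilon> u \<odot>\<^bsub>G\<^esub> \<phi> (a \<otimes> (c \<otimes> S t)) b"
        using ab antipode_right[of G "\<lambda>v. \<phi> (a \<otimes> (c \<otimes> S t)) (b \<otimes> v)" u] by (simp add: lin pl)
    qed
    also have "... = sw G (\<lambda>c q'. \<phi> (a \<otimes> (c \<otimes> S q')) b) r"
      using ab by (intro tsum_cong refl counit_left) ((intro lin pl)?, simp_all)+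
    also have "... = \<epsilon> r \<odot>\<^bsub>G\<^esub> \<phi> a b"
      using ab r antipode_right[of G "\<lambda>v. \<phi> (a \<otimes> v) b" r] by (simp add: lin pl)
    finally show ?thesis .
  qed
  have "E = sw G (\<lambda>h1 r. \<epsilon> r \<odot>\<^bsub>G\<^esub> sw G \<phi> (S h1)) h"
    unfolding E_def using h by (simp add: in1 push)
  also have "... = sw G \<phi> (S h)"
    using h counit_right[of G "\<lambda>u. sw G \<phi> (S u)" h] by (simp add: lin b)
  finally have E: "E = sw G \<phi> (S h)" .
  have "E = sw G (\<lambda>h1 r. sw G (\<lambda>p q. sw G (\<lambda>a b. sw G (\<lambda>c d. sw G (\<lambda>s t. ?E a b c d s t) q) p) (S h1)) r) h"
    unfolding E_def using h by (intro tsum_cong refl tsum_swap) simp_all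
  also have "... = sw G (\<lambda>r q. sw G (\<lambda>h1 p. sw G (\<lambda>a b. sw G (\<lambda>c d. sw G (\<lambda>s t. ?E a b c d s t) q) p) (S h1)) r) h"
    using h by (intro coassoc[symmetric]) ((intro lin pl)?, simp_all)+
  also have "... = sw G (\<lambda>r q. sw G (\<lambda>h1 p. sw G (\<lambda>x y. sw G (\<lambda>s t. \<phi> (x \<otimes> S t) (y \<otimes> S s)) q) (S h1 \<otimes> p)) r) h"
  proof (rule tsum_cong[OF refl], rule tsum_cong[OF refl])
    fix r q h1 p assume *: "r \<in>! H" "q \<in>! H" "h1 \<in>! H" "p \<in>! H"
    have "bilinear K H H G (\<lambda>x y. sw G (\<lambda>s t. \<phi> (x \<otimes> S t) (y \<otimes> S s)) q)"
      using * by (intro lin pl) simp_all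
    then show "sw G (\<lambda>a b. sw G (\<lambda>c d. sw G (\<lambda>s t. ?E a b c d s t) q) p) (S h1)
      = sw G (\<lambda>x y. sw G (\<lambda>s t. \<phi> (x \<otimes> S t) (y \<otimes> S s)) q) (S h1 \<otimes> p)"
      using * by (simp add: sw_mult H.m_assoc)
  qed
  also have "... = sw G (\<lambda>r q. \<epsilon> r \<odot>\<^bsub>G\<^esub> sw G (\<lambda>s t. \<phi> (S t) (S s)) q) h"
  proof (intro tsum_cong refl)
    fix r q assume *: "r \<in>! H" "q \<in>! H"
    let ?\<phi> = "\<lambda>x y. sw G (\<lambda>s t. \<phi> (x \<otimes> S t) (y \<otimes> S s)) q"
    have b': "bilinear K H H G ?\<phi>"
      using * by (intro lin pl) simp_all
    have "sw G (\<lambda>h1 p. sw G ?\<phi> (S h1 \<otimes> p)) r = \<epsilon> r \<odot>\<^bsub>G\<^esub> sw G ?\<phi> \<one>"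
      using * by (intro antipode_left) (intro lin b', simp_all)
    also have "sw G ?\<phi> \<one> = ?\<phi> \<one> \<one>" by (rule sw_one[OF b'])
    finally show "sw G (\<lambda>h1 p. sw G ?\<phi> (S h1 \<otimes> p)) r = \<epsilon> r \<odot>\<^bsub>G\<^esub> sw G (\<lambda>s t. \<phi> (S t) (S s)) q" by simp
  qed
  also have "... = sw G (\<lambda>s t. \<phi> (S t) (S s)) h"
    using h by (intro counit_left) (intro lin pl, simp_all)
  finally show ?thesis using E by simp
qed

text \<open>Both sides equal the sum of \<open>\<epsilon>(S(h1) h2)\<close>: in one reading the
  counit removes \<open>h2\<close>, in the other the antipode law applies.\<close>

lemma counit_S [simp]:
  assumes h: "h \<in>! H"
  shows "\<epsilon> (S h) = \<epsilon> h"
proof -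
  have "sw (self_module K) (\<lambda>x y. \<epsilon> y \<otimes>\<^bsub>K\<^esub> \<epsilon> (S x)) h = \<epsilon> (S h)"
    using counit_right[of "self_module K" "\<lambda>u. \<epsilon> (S u)" h] h by (simp add: lin)
  moreover have "sw (self_module K) (\<lambda>x y. \<epsilon> (S x \<otimes> y)) h = \<epsilon> h"
    using antipode_left[of "self_module K" "\<lambda>u. \<epsilon> u" h] h by (simp add: lin)
  ultimately show ?thesis using h by (simp add: K.m_comm)
qed

end

section \<open>Dual bases and the bijectivity of the antipode\<close>

text \<open>The elimination step of Gauss: more unknowns than equations.\<close>

lemma (in field) homogeneous_system:
  assumes "finite J" "finite I" "card J < card I" "\<And>i j. i \<in> I ==> j \<in> J ==> a i j \<in>! R"
  shows "\<exists>c. c \<in> I \<rightarrow> carrier R \<and> (\<exists>i\<in>I. c i \<noteq> \<zero>) \<and> (\<forall>j\<in>J. (\<Oplus>i\<in>I. c i \<otimes> a i j) = \<zero>)"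
  using assms
proof (induction J arbitrary: I a rule: finite_induct)
  case empty
  then obtain i where "i \<in> I" by (auto simp: card_gt_0_iff)
  then show ?case by (intro exI[of _ "\<lambda>_. \<one>"]) auto
next
  case (insert j J)
  show ?case
  proof (cases "\<forall>i\<in>I. a i j = \<zero>")
    case True
    have "card J < card I" using insert by simp
    then obtain c where c: "c \<in> I \<rightarrow> carrier R" "\<exists>i\<in>I. c i \<noteq> \<zero>" "\<forall>j\<in>J. (\<Oplus>i\<in>I. c i \<otimes> a i j) = \<zero>"
      using insert.IH[of I a] insert.prems by auto
    moreover have "(\<Oplus>i\<in>I. c i \<otimes> a i j) = \<zero>"
    proof -
      have "(\<Oplus>i\<in>I. c i \<otimes> a i j) = (\<Oplus>i\<in>I. \<zero>)"
        using True c(1) by (intro finsum_eqI) (auto simp: Pi_iff)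
      then show ?thesis by simp
    qed
    ultimately show ?thesis by auto
  next
    case False
    then obtain k where k: "k \<in> I" "a k j \<noteq> \<zero>" by auto
    let ?I = "I - {k}"
    have akj: "a k j \<in> Units R" using k insert.prems(3)[of k j] by (simp add: field_Units)
    then have akj' [simp]: "a k j \<in>! R" "inv (a k j) \<in>! R" by auto
    have inv: "inv (a k j) \<otimes> a k j = \<one>" using akj by simp
    \<comment> \<open>Equation \<open>j\<close> is solved for the unknown with index
      \<open>k\<close> and substituted in the other equations; \<open>b\<close> is the resulting
      matrix of coefficients.\<close>
    define b where "b i l = a i l \<ominus> (a i j \<otimes> inv (a k j)) \<otimes> a k l" for i l
    have a [simp]: "a i l \<in>! R" if "i \<in> I" "l \<in> insert j J" for i l
      using insert.prems(3) that .
    have b [simp]: "b i l \<in>! R" if "i \<in> ?I" "l \<in> J" for i l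
      unfolding b_def using that k(1) by (intro minus_closed m_closed a akj') auto
    have "card J < card ?I" using insert k by (simp add: card_Diff_singleton)
    then obtain c where c: "c \<in> ?I \<rightarrow> carrier R" "\<exists>i\<in>?I. c i \<noteq> \<zero>" "\<forall>l\<in>J. (\<Oplus>i\<in>?I. c i \<otimes> b i l) = \<zero>"
      using insert.IH[of ?I b] insert.prems by auto
    \<comment> \<open>The negative of \<open>s\<close> is the value that equation \<open>j\<close>
      forces on the unknown \<open>k\<close>.\<close>
    define s where "s = (\<Oplus>i\<in>?I. c i \<otimes> (a i j \<otimes> inv (a k j)))"
    define d where "d = c(k := \<ominus> s)"
    have s [simp]: "s \<in>! R" unfolding s_def using c(1) by (intro finsum_closed) auto
    have d: "d \<in> I \<rightarrow> carrier R" using c(1) by (auto simp: d_def Pi_iff)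
    have sum: "(\<Oplus>i\<in>I. d i \<otimes> a i l) = (\<ominus> s \<otimes> a k l) \<oplus> (\<Oplus>i\<in>?I. c i \<otimes> a i l)" if l: "l \<in> insert j J" for l
    proof -
      have da: "d i \<otimes> a i l \<in>! R" if "i \<in> I" for i using d a[OF that l] that by auto
      have "(\<Oplus>i\<in>insert k ?I. d i \<otimes> a i l) = (d k \<otimes> a k l) \<oplus> (\<Oplus>i\<in>?I. d i \<otimes> a i l)"
        using da k(1) insert.prems(1) by (intro finsum_insert) auto
      also have "d k = \<ominus> s" by (simp add: d_def)
      also have "(\<Oplus>i\<in>?I. d i \<otimes> a i l) = (\<Oplus>i\<in>?I. c i \<otimes> a i l)"
        by (intro finsum_eqI) (auto simp: d_def)
      finally show ?thesis using k(1) by (simp add: insert_absorb)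
    qed
    have "(\<Oplus>i\<in>I. d i \<otimes> a i l) = \<zero>" if l: "l \<in> insert j J" for l
    proof -
      have sl: "s \<otimes> a k l = (\<Oplus>i\<in>?I. c i \<otimes> (a i j \<otimes> inv (a k j)) \<otimes> a k l)"
        unfolding s_def using c(1) l k(1) insert.prems(1) by (intro finsum_ldistr) auto
      have "(\<Oplus>i\<in>?I. c i \<otimes> a i l) = s \<otimes> a k l"
      proof (cases "l = j")
        case True
        have "c i \<otimes> (a i j \<otimes> inv (a k j)) \<otimes> a k j = c i \<otimes> a i j" if "i \<in> ?I" for i
          using c(1) that k by (simp add: m_assoc inv Pi_iff)
        note * = this
        show ?thesis unfolding sl by (intro finsum_eqI) (simp add: True *)
      next
        case False
        then have lJ: "l \<in> J" using l by simp
        have "(\<Oplus>i\<in>?I. c i \<otimes> a i l) = (\<Oplus>i\<in>?I. c i \<otimes> b i l \<oplus> c i \<otimes> (a i j \<otimes> inv (a k j)) \<otimes> a k l)"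
          using c(1) l k(1)
          by (intro finsum_eqI) (auto simp: b_def Pi_iff r_distr minus_eq r_minus m_assoc a_assoc l_neg)
        also have "... = (\<Oplus>i\<in>?I. c i \<otimes> b i l) \<oplus> s \<otimes> a k l"
          unfolding sl using c(1) l lJ k(1) by (intro finsum_addf) (auto simp: Pi_iff)
        finally show ?thesis using c(3) lJ k(1) l by simp
      qed
      then show ?thesis unfolding sum[OF l] using k(1) l by (simp add: l_minus l_neg)
    qed
    moreover have "\<exists>i\<in>I. d i \<noteq> \<zero>" using c(2) by (auto simp: d_def)
    ultimately show ?thesis using d by blast
  qed
qed

section \<open>Dual bases and linear algebra in finite dimension\<close>

lemma carrier_dual_bialg:
  "carrier (dual_bialg K H) = {f \<in> extensional (carrier H). linear_map K H (self_module K) f}"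
  by (simp add: dual_bialg_def Let_def bialg.defs module.defs)

lemma dual_bases_expand:
  assumes d: "dual_bases K H n e p" and f: "linear_map K H G f" "module K H" "module K G" and x: "x \<in>! H"
  shows "f x = (\<Oplus>\<^bsub>G\<^esub>i\<in>{..<n}. p i x \<odot>\<^bsub>G\<^esub> f (e i))"
proof -
  interpret M: module K H by fact
  have c: "p i x \<in>! K" "e i \<in>! H" if "i < n" for i
    using d x that linear_mapD(1)[of K H "self_module K" "p i" x]
    by (auto simp: dual_bases_def carrier_dual_bialg)
  have "x = (\<Oplus>\<^bsub>H\<^esub>i\<in>{..<n}. p i x \<odot>\<^bsub>H\<^esub> e i)"
    using d x unfolding dual_bases_def by blast
  then have "f x = f (\<Oplus>\<^bsub>H\<^esub>i\<in>{..<n}. p i x \<odot>\<^bsub>H\<^esub> e i)" by (rule arg_cong)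
  also have "... = (\<Oplus>\<^bsub>G\<^esub>i\<in>{..<n}. f (p i x \<odot>\<^bsub>H\<^esub> e i))"
    using c by (intro linear_map_finsum[OF f]) auto
  also have "... = (\<Oplus>\<^bsub>G\<^esub>i\<in>{..<n}. p i x \<odot>\<^bsub>G\<^esub> f (e i))"
    using c by (intro finsum_eqI) (simp add: linear_mapD(3)[OF f(1)])
  finally show ?thesis .
qed

lemma (in module) finsum_diff_smult:
  assumes "finite I" "c \<in> I \<rightarrow> carrier R" "d \<in> I \<rightarrow> carrier R" "g \<in> I \<rightarrow> carrier M"
  shows "(\<Oplus>\<^bsub>M\<^esub>i\<in>I. (c i \<ominus> d i) \<odot>\<^bsub>M\<^esub> g i) = (\<Oplus>\<^bsub>M\<^esub>i\<in>I. c i \<odot>\<^bsub>M\<^esub> g i) \<ominus>\<^bsub>M\<^esub> (\<Oplus>\<^bsub>M\<^esub>i\<in>I. d i \<odot>\<^bsub>M\<^esub> g i)"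
proof -
  have "(\<Oplus>\<^bsub>M\<^esub>i\<in>I. (c i \<ominus> d i) \<odot>\<^bsub>M\<^esub> g i) \<oplus>\<^bsub>M\<^esub> (\<Oplus>\<^bsub>M\<^esub>i\<in>I. d i \<odot>\<^bsub>M\<^esub> g i) = (\<Oplus>\<^bsub>M\<^esub>i\<in>I. (c i \<ominus> d i) \<odot>\<^bsub>M\<^esub> g i \<oplus>\<^bsub>M\<^esub> d i \<odot>\<^bsub>M\<^esub> g i)"
    using assms by (intro M.finsum_addf[symmetric]) auto
  also have "... = (\<Oplus>\<^bsub>M\<^esub>i\<in>I. c i \<odot>\<^bsub>M\<^esub> g i)"
  proof (intro finsum_eqI)
    fix i assume i: "i \<in> I"
    then have "(c i \<ominus> d i) \<oplus> d i = c i" using assms by (simp add: R.minus_eq R.a_assoc R.l_neg Pi_iff)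
    then show "(c i \<ominus> d i) \<odot>\<^bsub>M\<^esub> g i \<oplus>\<^bsub>M\<^esub> d i \<odot>\<^bsub>M\<^esub> g i = c i \<odot>\<^bsub>M\<^esub> g i"
      using i assms smult_l_distr[of "c i \<ominus> d i" "d i" "g i"] by (simp add: Pi_iff)
  qed
  finally have "(\<Oplus>\<^bsub>M\<^esub>i\<in>I. c i \<odot>\<^bsub>M\<^esub> g i) \<ominus>\<^bsub>M\<^esub> (\<Oplus>\<^bsub>M\<^esub>i\<in>I. d i \<odot>\<^bsub>M\<^esub> g i)
    = (\<Oplus>\<^bsub>M\<^esub>i\<in>I. (c i \<ominus> d i) \<odot>\<^bsub>M\<^esub> g i) \<oplus>\<^bsub>M\<^esub> (\<Oplus>\<^bsub>M\<^esub>i\<in>I. d i \<odot>\<^bsub>M\<^esub> g i) \<ominus>\<^bsub>M\<^esub> (\<Oplus>\<^bsub>M\<^esub>i\<in>I. d i \<odot>\<^bsub>M\<^esub> g i)" by simp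
  moreover have "(\<Oplus>\<^bsub>M\<^esub>i\<in>I. (c i \<ominus> d i) \<odot>\<^bsub>M\<^esub> g i) \<in>! M" "(\<Oplus>\<^bsub>M\<^esub>i\<in>I. d i \<odot>\<^bsub>M\<^esub> g i) \<in>! M"
    using assms by (auto intro!: M.finsum_closed)
  ultimately show ?thesis by (simp add: M.minus_eq M.a_assoc M.r_neg)
qed

text \<open>A spanning set of least cardinality is independent, so coordinates are unique, and
  uniqueness makes the coordinate functionals linear.\<close>

lemma exists_dual_bases:
  assumes K: "field K" and M: "module K H" and f: "finite_dim K H"
  obtains n e p where "dual_bases K H n e p"
proof -
  interpret K: field K by fact
  interpret M: module K H by fact
  define spans where "spans S \<longleftrightarrow> finite S \<and> S \<subseteq> carrier H \<and>
    (\<forall>x \<in> carrier H. \<exists>c \<in> S \<rightarrow> carrier K. x = (\<Oplus>\<^bsub>H\<^esub>s\<in>S. c s \<odot>\<^bsub>H\<^esub> s))" for S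
  obtain S0 where "spans S0" using f unfolding finite_dim_def spans_def by auto
  define S where "S = arg_min card spans"
  have S: "spans S" and min: "\<And>T. spans T ==> card S \<le> card T"
    unfolding S_def using arg_min_nat_lemma[of spans S0 card] \<open>spans S0\<close> by auto
  have fin: "finite S" and sub: "S \<subseteq> carrier H" using S by (auto simp: spans_def)
  have indep: "c s = \<zero>\<^bsub>K\<^esub>" if c: "c \<in> S \<rightarrow> carrier K" and z: "(\<Oplus>\<^bsub>H\<^esub>s\<in>S. c s \<odot>\<^bsub>H\<^esub> s) = \<zero>\<^bsub>H\<^esub>" and s: "s \<in> S" for c s
  proof (rule ccontr)
    assume "c s \<noteq> \<zero>\<^bsub>K\<^esub>"
    then have u: "c s \<in> Units K" using c s by (auto simp: K.field_Units)
    define i where "i = inv\<^bsub>K\<^esub> (c s)"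
    have i: "i \<in>! K" "i \<otimes>\<^bsub>K\<^esub> c s = \<one>\<^bsub>K\<^esub>" using u by (simp_all add: i_def)
    let ?S = "S - {s}"
    define r where "r = (\<Oplus>\<^bsub>H\<^esub>t\<in>?S. c t \<odot>\<^bsub>H\<^esub> t)"
    have "r \<in>! H" unfolding r_def using c sub by (intro M.M.finsum_closed) auto
    have "(\<Oplus>\<^bsub>H\<^esub>t\<in>insert s ?S. c t \<odot>\<^bsub>H\<^esub> t) = c s \<odot>\<^bsub>H\<^esub> s \<oplus>\<^bsub>H\<^esub> r"
      unfolding r_def using c s sub fin by (intro M.M.finsum_insert) auto
    then have "c s \<odot>\<^bsub>H\<^esub> s \<oplus>\<^bsub>H\<^esub> r = \<zero>\<^bsub>H\<^esub>" using z s by (simp add: insert_absorb)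
    moreover have sH: "s \<in>! H" "c s \<in>! K" using s sub c by auto
    ultimately have "c s \<odot>\<^bsub>H\<^esub> s = \<ominus>\<^bsub>H\<^esub> r" using \<open>r \<in>! H\<close> by (simp add: M.M.minus_equality)
    then have "i \<odot>\<^bsub>H\<^esub> (c s \<odot>\<^bsub>H\<^esub> s) = i \<odot>\<^bsub>H\<^esub> (\<ominus>\<^bsub>H\<^esub> r)" by simp
    then have s_eq: "s = i \<odot>\<^bsub>H\<^esub> (\<ominus>\<^bsub>H\<^esub> r)"
      using sH i by (simp add: M.smult_assoc1[symmetric])
    also have "\<ominus>\<^bsub>H\<^esub> r = (\<ominus>\<^bsub>K\<^esub> \<one>\<^bsub>K\<^esub>) \<odot>\<^bsub>H\<^esub> r" using \<open>r \<in>! H\<close> M.smult_l_minus[of "\<one>\<^bsub>K\<^esub>" r] by simp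
    finally have s_eq: "s = (i \<otimes>\<^bsub>K\<^esub> \<ominus>\<^bsub>K\<^esub> \<one>\<^bsub>K\<^esub>) \<odot>\<^bsub>H\<^esub> r" using i \<open>r \<in>! H\<close> by (simp add: M.smult_assoc1)
    define j where "j = i \<otimes>\<^bsub>K\<^esub> \<ominus>\<^bsub>K\<^esub> \<one>\<^bsub>K\<^esub>"
    have j: "j \<in>! K" using i by (simp add: j_def)
    \<comment> \<open>Since \<open>s\<close> is a multiple of \<open>r\<close>, it can be removed
      from every expansion, which contradicts minimality.\<close>
    have "spans ?S"
      unfolding spans_def
    proof (intro conjI ballI)
      fix x assume "x \<in>! H"
      then obtain d where d: "d \<in> S \<rightarrow> carrier K" "x = (\<Oplus>\<^bsub>H\<^esub>s\<in>S. d s \<odot>\<^bsub>H\<^esub> s)"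
        using S by (auto simp: spans_def)
      have "(\<Oplus>\<^bsub>H\<^esub>t\<in>insert s ?S. d t \<odot>\<^bsub>H\<^esub> t) = d s \<odot>\<^bsub>H\<^esub> s \<oplus>\<^bsub>H\<^esub> (\<Oplus>\<^bsub>H\<^esub>t\<in>?S. d t \<odot>\<^bsub>H\<^esub> t)"
        using d s sub fin by (intro M.M.finsum_insert) auto
      then have x1: "x = d s \<odot>\<^bsub>H\<^esub> s \<oplus>\<^bsub>H\<^esub> (\<Oplus>\<^bsub>H\<^esub>t\<in>?S. d t \<odot>\<^bsub>H\<^esub> t)" using d s by (simp add: insert_absorb)
      have x2: "d s \<odot>\<^bsub>H\<^esub> s = (d s \<otimes>\<^bsub>K\<^esub> j) \<odot>\<^bsub>H\<^esub> r"
        using s_eq d s j \<open>r \<in>! H\<close> unfolding j_def[symmetric] by (simp add: M.smult_assoc1 Pi_iff)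
      have dj: "d s \<otimes>\<^bsub>K\<^esub> j \<in>! K" using d s j by auto
      have x3: "(d s \<otimes>\<^bsub>K\<^esub> j) \<odot>\<^bsub>H\<^esub> r = (\<Oplus>\<^bsub>H\<^esub>t\<in>?S. (d s \<otimes>\<^bsub>K\<^esub> j) \<odot>\<^bsub>H\<^esub> (c t \<odot>\<^bsub>H\<^esub> t))"
        unfolding r_def using d s j c sub fin by (intro M.finsum_smult_ldistr) auto
      have "x = (\<Oplus>\<^bsub>H\<^esub>t\<in>?S. (d s \<otimes>\<^bsub>K\<^esub> j) \<odot>\<^bsub>H\<^esub> (c t \<odot>\<^bsub>H\<^esub> t)) \<oplus>\<^bsub>H\<^esub> (\<Oplus>\<^bsub>H\<^esub>t\<in>?S. d t \<odot>\<^bsub>H\<^esub> t)"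
        using x1 x2 x3 by simp
      also have "... = (\<Oplus>\<^bsub>H\<^esub>t\<in>?S. (d s \<otimes>\<^bsub>K\<^esub> j) \<odot>\<^bsub>H\<^esub> (c t \<odot>\<^bsub>H\<^esub> t) \<oplus>\<^bsub>H\<^esub> d t \<odot>\<^bsub>H\<^esub> t)"
        using dj d c sub by (intro M.M.finsum_addf[symmetric]) (auto intro!: M.smult_closed)
      also have "... = (\<Oplus>\<^bsub>H\<^esub>t\<in>?S. ((d s \<otimes>\<^bsub>K\<^esub> j) \<otimes>\<^bsub>K\<^esub> c t \<oplus>\<^bsub>K\<^esub> d t) \<odot>\<^bsub>H\<^esub> t)"
      proof (intro finsum_eqI)
        fix t assume "t \<in> ?S"
        then have "t \<in>! H" "c t \<in>! K" "d t \<in>! K" "d s \<in>! K" using d s c sub by auto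
        then show "(d s \<otimes>\<^bsub>K\<^esub> j) \<odot>\<^bsub>H\<^esub> (c t \<odot>\<^bsub>H\<^esub> t) \<oplus>\<^bsub>H\<^esub> d t \<odot>\<^bsub>H\<^esub> t = ((d s \<otimes>\<^bsub>K\<^esub> j) \<otimes>\<^bsub>K\<^esub> c t \<oplus>\<^bsub>K\<^esub> d t) \<odot>\<^bsub>H\<^esub> t"
          using j by (simp add: M.smult_l_distr M.smult_assoc1)
      qed
      finally show "\<exists>c\<in>?S \<rightarrow> carrier K. x = (\<Oplus>\<^bsub>H\<^esub>s\<in>?S. c s \<odot>\<^bsub>H\<^esub> s)"
        using dj d c by (intro bexI[of _ "\<lambda>t. (d s \<otimes>\<^bsub>K\<^esub> j) \<otimes>\<^bsub>K\<^esub> c t \<oplus>\<^bsub>K\<^esub> d t"]) (auto intro!: K.a_closed K.m_closed)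
    qed (use fin sub in auto)
    then have "card S \<le> card ?S" by (rule min)
    then show False using card_Diff1_less[OF fin s] by simp
  qed
  obtain C where C: "\<And>x. x \<in>! H ==> C x \<in> S \<rightarrow> carrier K"
    "\<And>x. x \<in>! H ==> x = (\<Oplus>\<^bsub>H\<^esub>s\<in>S. C x s \<odot>\<^bsub>H\<^esub> s)"
  proof -
    have "\<forall>x \<in> carrier H. \<exists>c. c \<in> S \<rightarrow> carrier K \<and> x = (\<Oplus>\<^bsub>H\<^esub>s\<in>S. c s \<odot>\<^bsub>H\<^esub> s)"
      using S unfolding spans_def by blast
    from bchoice[OF this] show ?thesis using that by blast
  qed
  have uniq: "d s = C x s" if "x \<in>! H" "d \<in> S \<rightarrow> carrier K" "x = (\<Oplus>\<^bsub>H\<^esub>s\<in>S. d s \<odot>\<^bsub>H\<^esub> s)" "s \<in> S" for x d s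
  proof -
    have "(\<Oplus>\<^bsub>H\<^esub>s\<in>S. (d s \<ominus>\<^bsub>K\<^esub> C x s) \<odot>\<^bsub>H\<^esub> s) = x \<ominus>\<^bsub>H\<^esub> x"
      using M.finsum_diff_smult[of S d "C x" "\<lambda>s. s"] that(1-3) C[OF that(1)] fin sub by auto
    also have "... = \<zero>\<^bsub>H\<^esub>" using that(1) by (simp add: M.M.minus_eq M.M.r_neg)
    finally have "d s \<ominus>\<^bsub>K\<^esub> C x s = \<zero>\<^bsub>K\<^esub>"
      using indep[of "\<lambda>s. d s \<ominus>\<^bsub>K\<^esub> C x s"] that C(1)[OF that(1)] by (auto simp: Pi_iff)
    then show ?thesis
      using K.add.right_cancel[of "\<ominus>\<^bsub>K\<^esub> C x s" "d s" "C x s"] K.minus_eq[of "d s" "C x s"] K.r_neg[of "C x s"] K.a_inv_closed[of "C x s"] funcset_mem[OF that(2,4)] funcset_mem[OF C(1)[OF that(1)] that(4)] by simp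
  qed
  obtain e where e: "bij_betw e {..<card S} S" using ex_bij_betw_nat_finite[OF fin] by (auto simp: atLeast0LessThan)
  define p where "p i = (\<lambda>x\<in>carrier H. C x (e i))" for i
  have eS: "e i \<in> S" if "i < card S" for i using e that by (auto simp: bij_betw_def)
  have reindex: "(\<Oplus>\<^bsub>H\<^esub>s\<in>S. g s) = (\<Oplus>\<^bsub>H\<^esub>i\<in>{..<card S}. g (e i))" if "g \<in> S \<rightarrow> carrier H" for g
    using M.M.finsum_reindex[of g e "{..<card S}"] e that by (simp add: bij_betw_def)
  have p: "p i \<in>! (dual_bialg K H)" if i: "i < card S" for i
  proof -
    have "C (x \<oplus>\<^bsub>H\<^esub> y) (e i) = C x (e i) \<oplus>\<^bsub>K\<^esub> C y (e i)" if x: "x \<in>! H" and y: "y \<in>! H" for x y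
    proof (rule uniq[symmetric])
      have "(\<Oplus>\<^bsub>H\<^esub>s\<in>S. (C x s \<oplus>\<^bsub>K\<^esub> C y s) \<odot>\<^bsub>H\<^esub> s) = (\<Oplus>\<^bsub>H\<^esub>s\<in>S. C x s \<odot>\<^bsub>H\<^esub> s \<oplus>\<^bsub>H\<^esub> C y s \<odot>\<^bsub>H\<^esub> s)"
        using C(1)[OF x] C(1)[OF y] sub by (intro finsum_eqI M.smult_l_distr) auto
      also have "... = (\<Oplus>\<^bsub>H\<^esub>s\<in>S. C x s \<odot>\<^bsub>H\<^esub> s) \<oplus>\<^bsub>H\<^esub> (\<Oplus>\<^bsub>H\<^esub>s\<in>S. C y s \<odot>\<^bsub>H\<^esub> s)"
        using C(1)[OF x] C(1)[OF y] sub by (intro M.M.finsum_addf) auto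
      finally show "x \<oplus>\<^bsub>H\<^esub> y = (\<Oplus>\<^bsub>H\<^esub>s\<in>S. (C x s \<oplus>\<^bsub>K\<^esub> C y s) \<odot>\<^bsub>H\<^esub> s)" using C(2)[OF x] C(2)[OF y] by simp
    qed (use x y C(1)[OF x] C(1)[OF y] eS[OF i] in auto)
    moreover have "C (c \<odot>\<^bsub>H\<^esub> x) (e i) = c \<otimes>\<^bsub>K\<^esub> C x (e i)" if c: "c \<in>! K" and x: "x \<in>! H" for c x
    proof (rule uniq[symmetric])
      have "(\<Oplus>\<^bsub>H\<^esub>s\<in>S. (c \<otimes>\<^bsub>K\<^esub> C x s) \<odot>\<^bsub>H\<^esub> s) = (\<Oplus>\<^bsub>H\<^esub>s\<in>S. c \<odot>\<^bsub>H\<^esub> (C x s \<odot>\<^bsub>H\<^esub> s))"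
        using C(1)[OF x] c sub by (intro finsum_eqI M.smult_assoc1) auto
      also have "... = c \<odot>\<^bsub>H\<^esub> (\<Oplus>\<^bsub>H\<^esub>s\<in>S. C x s \<odot>\<^bsub>H\<^esub> s)"
        using C(1)[OF x] c sub fin by (intro M.finsum_smult_ldistr[symmetric]) auto
      finally show "c \<odot>\<^bsub>H\<^esub> x = (\<Oplus>\<^bsub>H\<^esub>s\<in>S. (c \<otimes>\<^bsub>K\<^esub> C x s) \<odot>\<^bsub>H\<^esub> s)" using C(2)[OF x] by simp
    qed (use x c C(1)[OF x] eS[OF i] in auto)
    ultimately show ?thesis
      using funcset_mem[OF C(1) eS[OF i]] unfolding carrier_dual_bialg p_def
      by (auto intro!: linear_mapI)
  qed
  have "dual_bases K H (card S) e p"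
    unfolding dual_bases_def
  proof (intro conjI allI impI ballI)
    show "e \<in> {..<card S} \<rightarrow> carrier H" using eS sub by auto
    show "p \<in> {..<card S} \<rightarrow> carrier (dual_bialg K H)" using p by auto
  next
    fix i j assume ij: "i < card S" "j < card S"
    have "(if e i = e j then \<one>\<^bsub>K\<^esub> else \<zero>\<^bsub>K\<^esub>) = C (e j) (e i)"
    proof (rule uniq[where d = "\<lambda>s. if s = e j then \<one>\<^bsub>K\<^esub> else \<zero>\<^bsub>K\<^esub>"])
      have "(\<Oplus>\<^bsub>H\<^esub>s\<in>S. (if s = e j then \<one>\<^bsub>K\<^esub> else \<zero>\<^bsub>K\<^esub>) \<odot>\<^bsub>H\<^esub> s) = (\<Oplus>\<^bsub>H\<^esub>s\<in>S. if e j = s then s else \<zero>\<^bsub>H\<^esub>)"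
        using sub by (intro finsum_eqI) auto
      also have "... = e j"
        using M.M.finsum_singleton[OF eS[OF ij(2)] fin, of "\<lambda>s. s"] sub by auto
      finally show "e j = (\<Oplus>\<^bsub>H\<^esub>s\<in>S. (if s = e j then \<one>\<^bsub>K\<^esub> else \<zero>\<^bsub>K\<^esub>) \<odot>\<^bsub>H\<^esub> s)" by simp
    qed (use eS ij sub in auto)
    moreover have "e i = e j \<longleftrightarrow> i = j" using e ij by (auto simp: bij_betw_def inj_on_def)
    ultimately show "p i (e j) = (if i = j then \<one>\<^bsub>K\<^esub> else \<zero>\<^bsub>K\<^esub>)"
      using eS[OF ij(2)] sub by (auto simp: p_def)
  next
    fix x assume x: "x \<in>! H"
    have "x = (\<Oplus>\<^bsub>H\<^esub>i\<in>{..<card S}. C x (e i) \<odot>\<^bsub>H\<^esub> e i)"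
      using C(2)[OF x] reindex[of "\<lambda>s. C x s \<odot>\<^bsub>H\<^esub> s"] C(1)[OF x] sub by (auto simp: Pi_iff)
    then show "x = (\<Oplus>\<^bsub>H\<^esub>i\<in>{..<card S}. p i x \<odot>\<^bsub>H\<^esub> e i)" using x by (simp add: p_def)
  qed
  then show ?thesis by (rule that)
qed

text \<open>In dimension \<open>n\<close> the \<open>n + 1\<close> vectors \<open>T (e i)\<close>
  and \<open>y\<close> satisfy a nontrivial linear relation. Injectivity of \<open>T\<close> forces
  a nonzero coefficient of \<open>y\<close>, and solving for \<open>y\<close> exhibits a
  preimage.\<close>

lemma finite_dim_inj_imp_surj:
  assumes K: "field K" and d: "dual_bases K H n e p" and M: "module K H" and T: "linear_map K H H T"
    and inj: "\<And>x. x \<in>! H ==> T x = \<zero>\<^bsub>H\<^esub> ==> x = \<zero>\<^bsub>H\<^esub>" and y: "y \<in>! H"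
  shows "\<exists>x \<in> carrier H. T x = y"
proof -
  interpret K: field K by fact
  interpret M: module K H by fact
  have p: "linear_map K H (self_module K) (p i)" "e i \<in>! H" if "i < n" for i
    using d that by (auto simp: dual_bases_def carrier_dual_bialg)
  have pe: "p i (e j) = (if i = j then \<one>\<^bsub>K\<^esub> else \<zero>\<^bsub>K\<^esub>)" if "i < n" "j < n" for i j
    using d that by (simp add: dual_bases_def)
  have ex: "x = (\<Oplus>\<^bsub>H\<^esub>i\<in>{..<n}. p i x \<odot>\<^bsub>H\<^esub> e i)" if "x \<in>! H" for x
    using dual_bases_expand[OF d linear_map_id M M that] .
  \<comment> \<open>The index \<open>n\<close>, one beyond the basis, stands for the additional
    vector \<open>y\<close>.\<close>
  define v where "v i = (if i = n then y else T (e i))" for i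
  have v: "v i \<in>! H" if "i \<le> n" for i
    using that y p(2) linear_mapD(1)[OF T] by (simp add: v_def)
  have pc: "p j x \<in>! K" if "j < n" "x \<in>! H" for j x
    using linear_mapD(1)[OF p(1)[OF that(1)] that(2)] by simp
  \<comment> \<open>One equation for each coordinate: \<open>n\<close> equations in the
    \<open>n + 1\<close> unknowns \<open>c 0\<close>, ..., \<open>c n\<close>.\<close>
  obtain c where c: "c \<in> {..n} \<rightarrow> carrier K" "\<exists>i\<in>{..n}. c i \<noteq> \<zero>\<^bsub>K\<^esub>"
      "\<forall>j\<in>{..<n}. (\<Oplus>\<^bsub>K\<^esub>i\<in>{..n}. c i \<otimes>\<^bsub>K\<^esub> p j (v i)) = \<zero>\<^bsub>K\<^esub>"
    using K.homogeneous_system[of "{..<n}" "{..n}" "\<lambda>i j. p j (v i)"] v pc by auto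
  have cK: "c i \<in>! K" if "i \<le> n" for i using c(1) that by auto
  define z where "z = (\<Oplus>\<^bsub>H\<^esub>i\<in>{..<n}. c i \<odot>\<^bsub>H\<^esub> e i)"
  have z: "z \<in>! H" unfolding z_def using cK p(2) by (intro M.M.finsum_closed) auto
  have Tz: "T z = (\<Oplus>\<^bsub>H\<^esub>i\<in>{..<n}. c i \<odot>\<^bsub>H\<^esub> v i)"
  proof -
    have "T z = (\<Oplus>\<^bsub>H\<^esub>i\<in>{..<n}. T (c i \<odot>\<^bsub>H\<^esub> e i))"
      unfolding z_def using cK p(2) by (intro linear_map_finsum[OF T M M]) auto
    also have "... = (\<Oplus>\<^bsub>H\<^esub>i\<in>{..<n}. c i \<odot>\<^bsub>H\<^esub> v i)"
      using cK p(2) by (intro finsum_eqI) (auto simp: linear_mapD(3)[OF T] v_def Pi_iff)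
    finally show ?thesis .
  qed
  let ?w = "\<Oplus>\<^bsub>H\<^esub>i\<in>{..n}. c i \<odot>\<^bsub>H\<^esub> v i"
  have w: "?w \<in>! H" using cK v by (intro M.M.finsum_closed) auto
  have "p j ?w = \<zero>\<^bsub>K\<^esub>" if j: "j < n" for j
  proof -
    have "p j ?w = (\<Oplus>\<^bsub>self_module K\<^esub>i\<in>{..n}. p j (c i \<odot>\<^bsub>H\<^esub> v i))"
      using cK v by (intro linear_map_finsum[OF p(1)[OF j] M module_self[OF K.is_cring]]) auto
    also have "... = (\<Oplus>\<^bsub>self_module K\<^esub>i\<in>{..n}. c i \<otimes>\<^bsub>K\<^esub> p j (v i))"
      using cK v linear_mapD(3)[OF p(1)[OF j]] by (intro finsum_eqI) (auto simp: Pi_iff)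
    also have "... = (\<Oplus>\<^bsub>K\<^esub>i\<in>{..n}. c i \<otimes>\<^bsub>K\<^esub> p j (v i))"
      by (rule finsum_structure_cong) (simp_all add: self_module_def)
    finally show ?thesis using c(3) j by simp
  qed
  then have "?w = (\<Oplus>\<^bsub>H\<^esub>i\<in>{..<n}. \<zero>\<^bsub>H\<^esub>)"
    using p(2) by (subst ex[OF w], intro finsum_eqI) auto
  then have w0: "?w = \<zero>\<^bsub>H\<^esub>" by simp
  have "?w = c n \<odot>\<^bsub>H\<^esub> y \<oplus>\<^bsub>H\<^esub> T z"
    unfolding Tz using cK v y
    by (subst lessThan_Suc_atMost[symmetric], subst lessThan_Suc, subst M.M.finsum_insert) (auto simp: v_def linear_mapD(1)[OF T] p(2))
  then have eq: "c n \<odot>\<^bsub>H\<^esub> y \<oplus>\<^bsub>H\<^esub> T z = \<zero>\<^bsub>H\<^esub>" using w0 by simp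
  have cn: "c n \<in>! K" using cK by auto
  have "c n \<noteq> \<zero>\<^bsub>K\<^esub>"
  proof
    assume c0: "c n = \<zero>\<^bsub>K\<^esub>"
    then have "T z = \<zero>\<^bsub>H\<^esub>" using eq y linear_mapD(1)[OF T z] by simp
    then have z0: "z = \<zero>\<^bsub>H\<^esub>" using inj z by simp
    have "c j = \<zero>\<^bsub>K\<^esub>" if j: "j < n" for j
    proof -
      have "p j z = (\<Oplus>\<^bsub>self_module K\<^esub>i\<in>{..<n}. p j (c i \<odot>\<^bsub>H\<^esub> e i))"
        unfolding z_def using cK p(2) by (intro linear_map_finsum[OF p(1)[OF j] M module_self[OF K.is_cring]]) auto
      also have "... = (\<Oplus>\<^bsub>self_module K\<^esub>i\<in>{..<n}. if j = i then c i else \<zero>\<^bsub>K\<^esub>)"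
        using cK p(2) linear_mapD(3)[OF p(1)[OF j]] pe[OF j] by (intro finsum_eqI) (auto simp: Pi_iff)
      also have "... = (\<Oplus>\<^bsub>K\<^esub>i\<in>{..<n}. if j = i then c i else \<zero>\<^bsub>K\<^esub>)"
        by (rule finsum_structure_cong) (simp_all add: self_module_def)
      also have "... = c j" using j cK by (intro K.finsum_singleton) auto
      finally show ?thesis
        using linear_map_zero[OF p(1)[OF j] M module_self[OF K.is_cring]] by (simp add: z0)
    qed
    then have "\<forall>i\<in>{..n}. c i = \<zero>\<^bsub>K\<^esub>" using c0 by (auto simp: le_less)
    then show False using c(2) by auto
  qed
  then have u: "inv\<^bsub>K\<^esub> (c n) \<in>! K" "inv\<^bsub>K\<^esub> (c n) \<otimes>\<^bsub>K\<^esub> c n = \<one>\<^bsub>K\<^esub>" "\<ominus>\<^bsub>K\<^esub> (inv\<^bsub>K\<^esub> (c n)) \<in>! K"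
    using cn by (auto simp: K.field_Units)
  have Tzc: "T z \<in>! H" using linear_mapD(1)[OF T z] .
  have "c n \<odot>\<^bsub>H\<^esub> y = \<ominus>\<^bsub>H\<^esub> T z" using eq Tzc cn y by (simp add: M.M.minus_equality)
  then have "inv\<^bsub>K\<^esub> (c n) \<odot>\<^bsub>H\<^esub> (c n \<odot>\<^bsub>H\<^esub> y) = inv\<^bsub>K\<^esub> (c n) \<odot>\<^bsub>H\<^esub> (\<ominus>\<^bsub>H\<^esub> T z)" by simp
  then have "y = inv\<^bsub>K\<^esub> (c n) \<odot>\<^bsub>H\<^esub> (\<ominus>\<^bsub>H\<^esub> T z)"
    using u cn y by (simp add: M.smult_assoc1[symmetric])
  also have "... = (\<ominus>\<^bsub>K\<^esub> (inv\<^bsub>K\<^esub> (c n))) \<odot>\<^bsub>H\<^esub> T z"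
    using u Tzc by (simp add: M.smult_l_minus M.smult_r_minus)
  also have "... = T ((\<ominus>\<^bsub>K\<^esub> (inv\<^bsub>K\<^esub> (c n))) \<odot>\<^bsub>H\<^esub> z)" using linear_mapD(3)[OF T u(3) z] by simp
  finally show ?thesis using u z by (intro bexI[of _ "(\<ominus>\<^bsub>K\<^esub> (inv\<^bsub>K\<^esub> (c n))) \<odot>\<^bsub>H\<^esub> z"]) auto
qed

lemma tsum_finsum:
  assumes G: "abelian_group G" and X: "rep_in X (carrier M) (carrier N)" and I: "finite I"
    and cl: "\<And>i x y. i \<in> I ==> x \<in>! M ==> y \<in>! N ==> \<phi> i x y \<in>! G"
  shows "tsum M N G (\<lambda>x y. \<Oplus>\<^bsub>G\<^esub>i\<in>I. \<phi> i x y) X = (\<Oplus>\<^bsub>G\<^esub>i\<in>I. tsum M N G (\<phi> i) X)"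
  using I cl
proof (induction I rule: finite_induct)
  case empty
  interpret G: abelian_group G by fact
  have "tsum M N G (\<lambda>x y. \<zero>\<^bsub>G\<^esub>) X \<oplus>\<^bsub>G\<^esub> tsum M N G (\<lambda>x y. \<zero>\<^bsub>G\<^esub>) X = tsum M N G (\<lambda>x y. \<zero>\<^bsub>G\<^esub>) X"
    using tsum_add[OF G X, of "\<lambda>x y. \<zero>\<^bsub>G\<^esub>" "\<lambda>x y. \<zero>\<^bsub>G\<^esub>"] by simp
  then have "tsum M N G (\<lambda>x y. \<zero>\<^bsub>G\<^esub>) X = \<zero>\<^bsub>G\<^esub>"
    using X G by (metis G.add.l_cancel_one G.zero_closed tsum_closed)
  then show ?case by simp
next
  case (insert i I)
  interpret G: abelian_group G by fact
  have "tsum M N G (\<lambda>x y. \<Oplus>\<^bsub>G\<^esub>i\<in>insert i I. \<phi> i x y) X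
    = tsum M N G (\<lambda>x y. \<phi> i x y \<oplus>\<^bsub>G\<^esub> (\<Oplus>\<^bsub>G\<^esub>i\<in>I. \<phi> i x y)) X"
    using insert by (intro tsum_cong refl G.finsum_insert) auto
  also have "... = tsum M N G (\<phi> i) X \<oplus>\<^bsub>G\<^esub> tsum M N G (\<lambda>x y. \<Oplus>\<^bsub>G\<^esub>i\<in>I. \<phi> i x y) X"
    using insert by (intro tsum_add[OF G X]) (auto intro!: G.finsum_closed)
  also have "... = (\<Oplus>\<^bsub>G\<^esub>i\<in>insert i I. tsum M N G (\<phi> i) X)"
    using insert X G by (subst G.finsum_insert) (auto intro!: tsum_closed)
  finally show ?case .
qed

lemma tsum_zero [simp]:
  assumes "abelian_group G" "rep_in X (carrier M) (carrier N)"
  shows "tsum M N G (\<lambda>x y. \<zero>\<^bsub>G\<^esub>) X = \<zero>\<^bsub>G\<^esub>"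
proof -
  interpret G: abelian_group G by fact
  show ?thesis using tsum_finsum[OF assms, of "{}" "\<lambda>i x y. \<zero>\<^bsub>G\<^esub>"] by simp
qed

lemma (in module) finsum_smult_rdistr:
  assumes "finite I" "c \<in> I \<rightarrow> carrier R" "x \<in>! M"
  shows "(\<Oplus>i\<in>I. c i) \<odot>\<^bsub>M\<^esub> x = (\<Oplus>\<^bsub>M\<^esub>i\<in>I. c i \<odot>\<^bsub>M\<^esub> x)"
  using assms
proof (induction I rule: finite_induct)
  case (insert i I)
  then show ?case by (simp add: Pi_iff smult_l_distr)
qed simp

lemma finsum_self_module [simp]: "finsum (self_module K) f A = finsum K f A"
  by (rule finsum_structure_cong) (simp_all add: self_module_def)

lemma (in abelian_group) finsum_swap:
  assumes "finite I" "finite J" "\<And>i j. i \<in> I ==> j \<in> J ==> f i j \<in>! G"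
  shows "(\<Oplus>i\<in>I. \<Oplus>j\<in>J. f i j) = (\<Oplus>j\<in>J. \<Oplus>i\<in>I. f i j)"
  using assms(1,3)
proof (induction I rule: finite_induct)
  case empty
  then show ?case by simp
next
  case (insert i I)
  have "(\<Oplus>i\<in>insert i I. \<Oplus>j\<in>J. f i j) = (\<Oplus>j\<in>J. f i j) \<oplus> (\<Oplus>j\<in>J. \<Oplus>i\<in>I. f i j)"
    using insert by (subst finsum_insert) (auto intro!: finsum_closed)
  also have "... = (\<Oplus>j\<in>J. f i j \<oplus> (\<Oplus>i\<in>I. f i j))"
    using insert by (intro finsum_addf[symmetric]) (auto intro!: finsum_closed)
  also have "... = (\<Oplus>j\<in>J. \<Oplus>i\<in>insert i I. f i j)"
    using insert by (intro finsum_eqI finsum_insert[symmetric]) (auto intro!: finsum_closed)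
  finally show ?case .
qed

locale fd_hopf = hopf K H for K :: "('k, 'c) ring_scheme" and H :: "('k, 'h, 'x) hopf_scheme" (structure) +
  fixes n :: nat and e :: "nat \<Rightarrow> 'h" and p :: "nat \<Rightarrow> 'h \<Rightarrow> 'k"
  assumes db: "dual_bases K H n e p"
begin

lemma p_linear: "i < n ==> linear_map K H (self_module K) (p i)"
  using db by (auto simp: dual_bases_def carrier_dual_bialg)

lemma p_linear' [lin]: "linear_map K Z H f ==> i < n ==> linear_map K Z (self_module K) (\<lambda>z. p i (f z))"
  using linear_comp[OF _ p_linear] .

lemma e_closed [simp]: "i < n ==> e i \<in>! H"
  using db by (auto simp: dual_bases_def)

lemma p_closed [simp]: "i < n ==> x \<in>! H ==> p i x \<in>! K"
  using linear_mapD(1)[OF p_linear, of i x] by simp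

lemma expand:
  "linear_map K H G f ==> module K G ==> x \<in>! H ==> f x = (\<Oplus>\<^bsub>G\<^esub>i\<in>{..<n}. p i x \<odot>\<^bsub>G\<^esub> f (e i))"
  using dual_bases_expand[OF db _ module_H] .

section \<open>Bijectivity of the antipode through the trace formula for integrals\<close>

context
  fixes g assumes g: "linear_map K H (self_module K) g"
begin

text \<open>The left regular action of the dual algebra on \<open>H\<close>, for the functional
  \<open>g\<close>.\<close>

definition "\<Theta> y = sw H (\<lambda>a b. g b \<odot> a) y"

text \<open>The trace of \<open>u \<mapsto> \<Theta> (x (S (S u)))\<close>: the trace formula for
  left integrals in the dual of \<open>H\<close>. For a single \<open>g\<close> it may vanish
  identically; \<open>sum_lam\<close> shows that it does not vanish for all
  \<open>g\<close>.\<close>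

definition "lam x = (\<Oplus>\<^bsub>self_module K\<^esub>i\<in>{..<n}. p i (\<Theta> (x \<otimes> S (S (e i)))))"

lemma g_closed [simp]: "x \<in>! H ==> g x \<in>! K"
  using linear_mapD(1)[OF g] by simp

lemma Theta_linear: "linear_map K H H \<Theta>"
  unfolding \<Theta>_def by (intro lin linear_comp[OF _ g]) simp_all

lemma Theta_linear' [lin]: "linear_map K Z H f ==> linear_map K Z H (\<lambda>z. \<Theta> (f z))"
  using linear_comp[OF _ Theta_linear] .

lemma Theta_closed [simp]: "y \<in>! H ==> \<Theta> y \<in>! H"
  by (rule linear_mapD(1)[OF Theta_linear])

lemma lam_linear: "linear_map K H (self_module K) lam"
  unfolding lam_def by (intro linear_map_finsum_fun lin) simp_all

lemma lam_linear' [lin]: "linear_map K Z H f ==> linear_map K Z (self_module K) (\<lambda>z. lam (f z))"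
  using linear_comp[OF _ lam_linear] .

lemma lam_closed [simp]: "y \<in>! H ==> lam y \<in>! K"
  using linear_mapD(1)[OF lam_linear] by simp

text \<open>By coassociativity, as \<open>\<Theta>\<close> consumes only the last component of an
  iterated coproduct: it is a map of left comodules.\<close>

lemma sw_Theta:
  assumes b: "bilinear K H H G \<chi>" and z: "z \<in>! H"
  shows "sw G \<chi> (\<Theta> z) = sw G (\<lambda>x y. \<chi> x (\<Theta> y)) z"
proof -
  note G [simp] = bilinearD(1)[OF b] and cl [simp] = bilinearD(4)[OF b]
  note bl = linear_comp[OF _ bilinearD(2)[OF b]] linear_comp[OF _ bilinearD(3)[OF b]]
  have aG [simp]: "abelian_group G" using G by (rule module.axioms(2))
  have f: "linear_map K H G (sw G \<chi>)" by (rule tsum_linear_arg[OF comult_linear]) (simp_all add: b)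
  have "sw G \<chi> (\<Theta> z) = sw G (\<lambda>a b. sw G (\<lambda>s t. g b \<odot>\<^bsub>G\<^esub> \<chi> s t) a) z"
    unfolding \<Theta>_def using z by (simp add: sw_push[OF f] linear_mapD(3)[OF f] push)
  also have "... = sw G (\<lambda>s r. sw G (\<lambda>t b. g b \<odot>\<^bsub>G\<^esub> \<chi> s t) r) z"
    using z by (intro coassoc) ((intro lin bl linear_comp[OF _ g])?, simp_all)+
  also have "... = sw G (\<lambda>s r. \<chi> s (\<Theta> r)) z"
    unfolding \<Theta>_def using z
    by (simp add: sw_push[OF bilinearD(3)[OF b]] linear_mapD(3)[OF bilinearD(3)[OF b]])
  finally show ?thesis .
qed

text \<open>Expanding the coproduct on the right-hand side gives \<open>x1 S(S y2) S(y1)\<close> in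
  the first argument and \<open>S(S y3)\<close> in the second;
  \<open>S(S y2) S(y1) = S(y1 S(y2))\<close> collapses.\<close>

lemma Theta_shift:
  assumes b: "bilinear K H H G \<psi>" and x: "x \<in>! H" and y: "y \<in>! H"
  shows "sw G (\<lambda>x1 x2. \<psi> x1 (\<Theta> (x2 \<otimes> S (S y)))) x
    = sw G (\<lambda>g1 g2. sw G (\<lambda>u1 u2. \<psi> (u1 \<otimes> S g1) u2) (\<Theta> (x \<otimes> S (S g2)))) y"
proof -
  note G [simp] = bilinearD(1)[OF b] and cl [simp] = bilinearD(4)[OF b]
  note bl = linear_comp[OF _ bilinearD(2)[OF b]] linear_comp[OF _ bilinearD(3)[OF b]]
  have aG [simp]: "abelian_group G" using G by (rule module.axioms(2))
  have "sw G (\<lambda>g1 g2. sw G (\<lambda>u1 u2. \<psi> (u1 \<otimes> S g1) u2) (\<Theta> (x \<otimes> S (S g2)))) y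
      = sw G (\<lambda>g1 g2. sw G (\<lambda>x1 x2. sw G (\<lambda>s t. \<psi> (x1 \<otimes> S (S s) \<otimes> S g1) (\<Theta> (x2 \<otimes> S (S t)))) g2) x) y"
  proof (rule tsum_cong[OF refl])
    fix g1 g2 assume *: "g1 \<in>! H" "g2 \<in>! H"
    have b1: "bilinear K H H G (\<lambda>u1 u2. \<psi> (u1 \<otimes> S g1) u2)" using * by (intro lin bl) simp_all
    have b2: "bilinear K H H G (\<lambda>u1 u2. \<psi> (u1 \<otimes> S g1) (\<Theta> u2))" using * by (intro lin bl) simp_all
    have b3: "bilinear K H H G (\<lambda>s t. \<psi> (x1 \<otimes> s \<otimes> S g1) (\<Theta> (x2 \<otimes> t)))"
      "bilinear K H H G (\<lambda>s t. \<psi> (x1 \<otimes> S t \<otimes> S g1) (\<Theta> (x2 \<otimes> S s)))" if "x1 \<in>! H" "x2 \<in>! H" for x1 x2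
      using * that by (intro lin bl; simp)+
    show "sw G (\<lambda>u1 u2. \<psi> (u1 \<otimes> S g1) u2) (\<Theta> (x \<otimes> S (S g2)))
      = sw G (\<lambda>x1 x2. sw G (\<lambda>s t. \<psi> (x1 \<otimes> S (S s) \<otimes> S g1) (\<Theta> (x2 \<otimes> S (S t)))) g2) x"
      using * x by (simp add: sw_Theta[OF b1] sw_mult[OF b2] sw_S[OF b3(1)] sw_S[OF b3(2)])
  qed
  also have "... = sw G (\<lambda>x1 x2. sw G (\<lambda>g1 g2. sw G (\<lambda>s t. \<psi> (x1 \<otimes> S (S s) \<otimes> S g1) (\<Theta> (x2 \<otimes> S (S t)))) g2) y) x"
    using x y by (intro tsum_swap) simp_all
  also have "... = sw G (\<lambda>x1 x2. sw G (\<lambda>r t. sw G (\<lambda>g1 s. \<psi> (x1 \<otimes> S (S s) \<otimes> S g1) (\<Theta> (x2 \<otimes> S (S t)))) r) y) x"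
    using x y by (intro tsum_cong refl coassoc[symmetric]) ((intro lin bl)?, simp_all)+
  also have "... = sw G (\<lambda>x1 x2. sw G (\<lambda>r t. \<epsilon> r \<odot>\<^bsub>G\<^esub> \<psi> x1 (\<Theta> (x2 \<otimes> S (S t)))) y) x"
  proof (intro tsum_cong refl)
    fix x1 x2 r t assume *: "x1 \<in>! H" "x2 \<in>! H" "r \<in>! H" "t \<in>! H"
    then show "sw G (\<lambda>g1 s. \<psi> (x1 \<otimes> S (S s) \<otimes> S g1) (\<Theta> (x2 \<otimes> S (S t)))) r = \<epsilon> r \<odot>\<^bsub>G\<^esub> \<psi> x1 (\<Theta> (x2 \<otimes> S (S t)))"
      using antipode_right[of G "\<lambda>u. \<psi> (x1 \<otimes> S u) (\<Theta> (x2 \<otimes> S (S t)))" r] by (simp add: lin bl H.m_assoc)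
  qed
  also have "... = sw G (\<lambda>x1 x2. \<psi> x1 (\<Theta> (x2 \<otimes> S (S y)))) x"
    using y by (intro tsum_cong refl counit_left) ((intro lin bl)?, simp_all)+
  finally show ?thesis by simp
qed

text \<open>Cyclicity of the trace. After \<open>Theta_shift\<close> the vector \<open>U g2\<close>
  is expanded over a second index \<open>j\<close>, and the sum over \<open>i\<close> is contracted
  instead. What remains begins with \<open>u1 S(u2)\<close> for the components of \<open>e j\<close>
  and collapses to the trace itself.\<close>

lemma lam_invariant:
  assumes x: "x \<in>! H"
  shows "sw H (\<lambda>x1 x2. lam x2 \<odot> x1) x = lam x \<odot> \<one>"
proof -
  define U where "U y = \<Theta> (x \<otimes> S (S y))" for y
  have U [lin]: "linear_map K Z H f ==> linear_map K Z H (\<lambda>z. U (f z))" for Z :: "('k, 'z, 'w) module_scheme" and f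
    unfolding U_def using x by (intro lin) simp_all
  have Uc [simp]: "y \<in>! H ==> U y \<in>! H" for y unfolding U_def using x by simp
  let ?s = "\<lambda>f. \<Oplus>i\<in>{..<n}. f i"
  note fc = finsum_eqI
  have "sw H (\<lambda>x1 x2. lam x2 \<odot> x1) x = sw H (\<lambda>x1 x2. ?s (\<lambda>i. p i (\<Theta> (x2 \<otimes> S (S (e i)))) \<odot> x1)) x"
    unfolding lam_def using x by (intro tsum_cong refl) (simp add: M.finsum_smult_rdistr Pi_iff)
  also have "... = ?s (\<lambda>i. sw H (\<lambda>x1 x2. p i (\<Theta> (x2 \<otimes> S (S (e i)))) \<odot> x1) x)"
    using x by (intro tsum_finsum) (simp_all add: M.M.abelian_group_axioms)
  also have "... = ?s (\<lambda>i. sw H (\<lambda>g1 g2. sw H (\<lambda>u1 u2. p i u2 \<odot> (u1 \<otimes> S g1)) (U g2)) (e i))"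
    unfolding U_def using x by (intro fc Theta_shift) ((intro lin)?, simp_all)+
  also have "... = ?s (\<lambda>i. sw H (\<lambda>g1 g2. ?s (\<lambda>j. p j (U g2) \<odot> sw H (\<lambda>u1 u2. p i u2 \<odot> (u1 \<otimes> S g1)) (e j))) (e i))"
    by (intro fc tsum_cong refl expand) ((intro lin)?, simp_all)+
  also have "... = ?s (\<lambda>i. ?s (\<lambda>j. sw H (\<lambda>g1 g2. p j (U g2) \<odot> sw H (\<lambda>u1 u2. p i u2 \<odot> (u1 \<otimes> S g1)) (e j)) (e i)))"
    by (intro fc tsum_finsum) (simp_all add: M.M.abelian_group_axioms)
  also have "... = ?s (\<lambda>i. ?s (\<lambda>j. sw H (\<lambda>u1 u2. p i u2 \<odot> (u1 \<otimes> sw H (\<lambda>g1 g2. p j (U g2) \<odot> S g1) (e i))) (e j)))"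
  proof (intro fc)
    fix i j assume ij: "i \<in> {..<n}" "j \<in> {..<n}"
    have "sw H (\<lambda>g1 g2. p j (U g2) \<odot> sw H (\<lambda>u1 u2. p i u2 \<odot> (u1 \<otimes> S g1)) (e j)) (e i)
      = sw H (\<lambda>g1 g2. sw H (\<lambda>u1 u2. p i u2 \<odot> (u1 \<otimes> (p j (U g2) \<odot> S g1))) (e j)) (e i)"
      using ij by (simp add: push M.smult_assoc1[symmetric] K.m_comm)
    also have "... = sw H (\<lambda>u1 u2. sw H (\<lambda>g1 g2. p i u2 \<odot> (u1 \<otimes> (p j (U g2) \<odot> S g1))) (e i)) (e j)"
      using ij by (intro tsum_swap) (simp_all add: M.M.abelian_group_axioms)
    also have "... = sw H (\<lambda>u1 u2. p i u2 \<odot> (u1 \<otimes> sw H (\<lambda>g1 g2. p j (U g2) \<odot> S g1) (e i))) (e j)"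
      using ij by (simp add: push)
    finally show "sw H (\<lambda>g1 g2. p j (U g2) \<odot> sw H (\<lambda>u1 u2. p i u2 \<odot> (u1 \<otimes> S g1)) (e j)) (e i)
      = sw H (\<lambda>u1 u2. p i u2 \<odot> (u1 \<otimes> sw H (\<lambda>g1 g2. p j (U g2) \<odot> S g1) (e i))) (e j)" .
  qed
  also have "... = ?s (\<lambda>j. ?s (\<lambda>i. sw H (\<lambda>u1 u2. p i u2 \<odot> (u1 \<otimes> sw H (\<lambda>g1 g2. p j (U g2) \<odot> S g1) (e i))) (e j)))"
    by (intro M.M.finsum_swap) simp_all
  also have "... = ?s (\<lambda>j. sw H (\<lambda>u1 u2. ?s (\<lambda>i. p i u2 \<odot> (u1 \<otimes> sw H (\<lambda>g1 g2. p j (U g2) \<odot> S g1) (e i)))) (e j))"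
    by (intro fc tsum_finsum[symmetric]) (simp_all add: M.M.abelian_group_axioms)
  \<comment> \<open>The sum over \<open>i\<close> is the basis expansion of \<open>u2\<close> and
    disappears.\<close>
  also have "... = ?s (\<lambda>j. sw H (\<lambda>u1 u2. u1 \<otimes> sw H (\<lambda>g1 g2. p j (U g2) \<odot> S g1) u2) (e j))"
    by (intro fc tsum_cong refl expand[symmetric, where f = "\<lambda>v. _ \<otimes> sw H _ v"]) ((intro lin)?, simp_all)+
  also have "... = ?s (\<lambda>j. sw H (\<lambda>u1 u2. sw H (\<lambda>g1 g2. p j (U g2) \<odot> (u1 \<otimes> S g1)) u2) (e j))"
    by (intro fc tsum_cong refl) (simp add: push)
  also have "... = ?s (\<lambda>j. sw H (\<lambda>u g2. sw H (\<lambda>u1 g1. p j (U g2) \<odot> (u1 \<otimes> S g1)) u) (e j))"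
    by (intro fc coassoc[symmetric]) ((intro lin)?, simp_all)+
  also have "... = ?s (\<lambda>j. sw H (\<lambda>u g2. \<epsilon> u \<odot> (p j (U g2) \<odot> \<one>)) (e j))"
    by (intro fc tsum_cong refl antipode_right[where f = "\<lambda>v. p _ (U _) \<odot> v"]) ((intro lin)?, simp_all)+
  also have "... = ?s (\<lambda>j. p j (U (e j)) \<odot> \<one>)"
    by (intro fc counit_left[where f = "\<lambda>v. p _ (U v) \<odot> \<one>"]) ((intro lin)?, simp_all)+
  also have "... = lam x \<odot> \<one>"
    unfolding lam_def U_def using x
    by (simp add: M.finsum_smult_rdistr Pi_iff)
  finally show ?thesis .
qed

text \<open>Invariance at \<open>x S(h1)\<close> turns the left-hand side into a sum of terms
  \<open>lam (x2 S(h1))\<close> times \<open>x1 S(h2) h3\<close>, where \<open>S(h2) h3\<close>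
  collapses.\<close>

lemma lam_shift:
  assumes x: "x \<in>! H" and h: "h \<in>! H"
  shows "sw H (\<lambda>h1 h2. lam (x \<otimes> S h1) \<odot> h2) h = sw H (\<lambda>x1 x2. lam (x2 \<otimes> S h) \<odot> x1) x"
proof -
  have "sw H (\<lambda>h1 h2. lam (x \<otimes> S h1) \<odot> h2) h
    = sw H (\<lambda>h1 h2. sw H (\<lambda>x1 x2. sw H (\<lambda>s t. lam (x2 \<otimes> S s) \<odot> (x1 \<otimes> S t \<otimes> h2)) h1) x) h"
  proof (rule tsum_cong[OF refl])
    fix h1 h2 assume *: "h1 \<in>! H" "h2 \<in>! H"
    have b: "bilinear K H H H (\<lambda>x1 x2. lam x2 \<odot> x1)" by (intro lin) simp_all
    have b': "bilinear K H H H (\<lambda>s t. lam (x2 \<otimes> t) \<odot> (x1 \<otimes> s))" if "x1 \<in>! H" "x2 \<in>! H" for x1 x2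
      using that by (intro lin) simp_all
    have "lam (x \<otimes> S h1) \<odot> h2 = (lam (x \<otimes> S h1) \<odot> \<one>) \<otimes> h2" using * x by simp
    also have "... = sw H (\<lambda>x1 x2. sw H (\<lambda>s t. lam (x2 \<otimes> S s) \<odot> (x1 \<otimes> S t \<otimes> h2)) h1) x"
      using * x by (simp add: lam_invariant[symmetric] sw_mult[OF b] sw_S[OF b'] push)
    finally show "lam (x \<otimes> S h1) \<odot> h2 = sw H (\<lambda>x1 x2. sw H (\<lambda>s t. lam (x2 \<otimes> S s) \<odot> (x1 \<otimes> S t \<otimes> h2)) h1) x" .
  qed
  also have "... = sw H (\<lambda>x1 x2. sw H (\<lambda>h1 h2. sw H (\<lambda>s t. lam (x2 \<otimes> S s) \<odot> (x1 \<otimes> S t \<otimes> h2)) h1) h) x"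
    using x h by (intro tsum_swap) (simp_all add: M.M.abelian_group_axioms)
  also have "... = sw H (\<lambda>x1 x2. sw H (\<lambda>s r. sw H (\<lambda>t h2. lam (x2 \<otimes> S s) \<odot> (x1 \<otimes> S t \<otimes> h2)) r) h) x"
    using x h by (intro tsum_cong refl coassoc) ((intro lin)?, simp_all)+
  also have "... = sw H (\<lambda>x1 x2. sw H (\<lambda>s r. \<epsilon> r \<odot> (lam (x2 \<otimes> S s) \<odot> x1)) h) x"
  proof (intro tsum_cong refl)
    fix x1 x2 s r assume *: "x1 \<in>! H" "x2 \<in>! H" "s \<in>! H" "r \<in>! H"
    then show "sw H (\<lambda>t h2. lam (x2 \<otimes> S s) \<odot> (x1 \<otimes> S t \<otimes> h2)) r = \<epsilon> r \<odot> (lam (x2 \<otimes> S s) \<odot> x1)"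
      using antipode_left[of H "\<lambda>u. lam (x2 \<otimes> S s) \<odot> (x1 \<otimes> u)" r] by (simp add: lin H.m_assoc)
  qed
  also have "... = sw H (\<lambda>x1 x2. lam (x2 \<otimes> S h) \<odot> x1) x"
    using h by (intro tsum_cong refl counit_right) ((intro lin)?, simp_all)+
  finally show ?thesis .
qed

text \<open>By \<open>lam_shift\<close>, \<open>S h = 0\<close> makes the sum of
  \<open>lam (y S(h1))\<close> times \<open>h2\<close> vanish for every \<open>y\<close>. The claim
  is brought to this form by inserting \<open>S(S h2) S(h1)\<close>, which is a counit in
  disguise.\<close>

lemma lam_kernel:
  assumes x: "x \<in>! H" and h: "h \<in>! H" and S0: "S h = \<zero>"
  shows "lam x \<odot> h = \<zero>"
proof -
  have lam0: "lam \<zero> = \<zero>\<^bsub>K\<^esub>" using linear_map_zero[OF lam_linear] by simp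
  let ?F = "\<lambda>a r. sw H (\<lambda>s t. lam (x \<otimes> S (S s) \<otimes> S a) \<odot> t) r"
  have z: "sw H (\<lambda>h1 h2. lam (y \<otimes> S h1) \<odot> h2) h = \<zero>" if y: "y \<in>! H" for y
  proof -
    show ?thesis unfolding lam_shift[OF y h] using y by (simp add: S0 lam0)
  qed
  have "lam x \<odot> h = sw H (\<lambda>r t. \<epsilon> r \<odot> (lam x \<odot> t)) h"
    using counit_left[of H "\<lambda>t. lam x \<odot> t" h] x h by (simp add: lin)
  also have "... = sw H (\<lambda>r t. sw H (\<lambda>a s. lam (x \<otimes> S (S s) \<otimes> S a) \<odot> t) r) h"
  proof (intro tsum_cong refl)
    fix r t assume *: "r \<in>! H" "t \<in>! H"
    then show "\<epsilon> r \<odot> (lam x \<odot> t) = sw H (\<lambda>a s. lam (x \<otimes> S (S s) \<otimes> S a) \<odot> t) r"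
      using antipode_right[of H "\<lambda>u. lam (x \<otimes> S u) \<odot> t" r] x by (simp add: lin H.m_assoc)
  qed
  also have "... = sw H (\<lambda>a r. ?F a r) h"
    using x h by (intro coassoc) ((intro lin)?, simp_all)+
  \<comment> \<open>Expanding \<open>x S(S s)\<close> over the basis separates \<open>s\<close> from
    \<open>a\<close>; each summand is then a linear map \<open>W\<close> applied to a vanishing
    sum.\<close>
  also have "... = sw H (\<lambda>a r. \<Oplus>i\<in>{..<n}. sw H (\<lambda>s t. p i (x \<otimes> S (S s)) \<odot> (lam (e i \<otimes> S a) \<odot> t)) r) h"
  proof (rule tsum_cong[OF refl])
    fix a r assume *: "a \<in>! H" "r \<in>! H"
    have "?F a r = sw H (\<lambda>s t. \<Oplus>i\<in>{..<n}. p i (x \<otimes> S (S s)) \<odot> (lam (e i \<otimes> S a) \<odot> t)) r"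
      using * x by (intro tsum_cong refl expand[where f = "\<lambda>v. lam (v \<otimes> S a) \<odot> _"]) ((intro lin)?, simp_all)+
    also have "... = (\<Oplus>i\<in>{..<n}. sw H (\<lambda>s t. p i (x \<otimes> S (S s)) \<odot> (lam (e i \<otimes> S a) \<odot> t)) r)"
      using * x by (intro tsum_finsum) (simp_all add: M.M.abelian_group_axioms)
    finally show "?F a r = (\<Oplus>i\<in>{..<n}. sw H (\<lambda>s t. p i (x \<otimes> S (S s)) \<odot> (lam (e i \<otimes> S a) \<odot> t)) r)" .
  qed
  also have "... = (\<Oplus>i\<in>{..<n}. sw H (\<lambda>a r. sw H (\<lambda>s t. p i (x \<otimes> S (S s)) \<odot> (lam (e i \<otimes> S a) \<odot> t)) r) h)"
    using h x by (intro tsum_finsum) (simp_all add: M.M.abelian_group_axioms)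
  also have "... = (\<Oplus>i\<in>{..<n}. \<zero>)"
  proof (intro finsum_eqI)
    fix i assume i: "i \<in> {..<n}"
    define W where "W r = sw H (\<lambda>s t. p i (x \<otimes> S (S s)) \<odot> t) r" for r
    have W: "linear_map K H H W" unfolding W_def using x i by (intro lin) simp_all
    have "sw H (\<lambda>a r. sw H (\<lambda>s t. p i (x \<otimes> S (S s)) \<odot> (lam (e i \<otimes> S a) \<odot> t)) r) h
      = sw H (\<lambda>a r. W (lam (e i \<otimes> S a) \<odot> r)) h"
      using x i h by (simp add: linear_mapD(3)[OF W]) (simp add: W_def push M.smult_assoc1[symmetric] K.m_comm)
    also have "... = W (sw H (\<lambda>a r. lam (e i \<otimes> S a) \<odot> r) h)"
      using i h by (simp add: sw_push[OF W])
    also have "... = \<zero>" using z[of "e i"] i linear_map_zero[OF W] by simp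
    finally show "sw H (\<lambda>a r. sw H (\<lambda>s t. p i (x \<otimes> S (S s)) \<odot> (lam (e i \<otimes> S a) \<odot> t)) r) h = \<zero>" .
  qed
  finally show ?thesis by simp
qed

end

text \<open>The product \<open>S (e k) (S (S (e j)))\<close> is \<open>S\<close> of
  \<open>S (e j) (e k)\<close>. Contracting \<open>j\<close> and \<open>k\<close> therefore leaves
  the trace of \<open>u \<mapsto> S(S(u1) u2) = \<epsilon>(u) 1\<close>, which is
  \<open>\<epsilon> \<one> = 1\<close>. Here \<open>g\<close> runs through the dual basis.\<close>

lemma sum_lam: "(\<Oplus>\<^bsub>K\<^esub>k\<in>{..<n}. lam (p k) (S (e k))) = \<one>\<^bsub>K\<^esub>"
proof -
  let ?s = "\<lambda>f. \<Oplus>\<^bsub>K\<^esub>k\<in>{..<n}. f k"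
  let ?SK = "self_module K"
  note fc = finsum_eqI
  have aK: "abelian_group K" by (rule K.abelian_group_axioms)
  define Q where "Q j k y = sw ?SK (\<lambda>a b. p k b \<odot>\<^bsub>?SK\<^esub> p j a) y" for j k y
  have Q: "linear_map K H ?SK (Q j k)" if "j < n" "k < n" for j k
    unfolding Q_def using that by (intro lin) simp_all
  have Qc [simp]: "Q j k y \<in>! K" if "j < n" "k < n" "y \<in>! H" for j k y
    using linear_mapD(1)[OF Q[OF that(1,2)] that(3)] by simp
  have pT: "p j (\<Theta> (p k) y) = Q j k y" if "j < n" "k < n" "y \<in>! H" for j k y
    using that unfolding \<Theta>_def[OF p_linear[OF that(2)]] Q_def
    by (simp add: sw_push[OF p_linear[OF that(1)]] linear_mapD(3)[OF p_linear[OF that(1)]])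
  have 1: "sw ?SK (\<lambda>a b. p m (S (S a \<otimes> b))) (e m) = ?s (\<lambda>k. ?s (\<lambda>j. p m (S (S (e j) \<otimes> e k)) \<otimes>\<^bsub>K\<^esub> Q j k (e m)))" if m: "m < n" for m
  proof -
    have "sw ?SK (\<lambda>a b. p m (S (S a \<otimes> b))) (e m)
      = sw ?SK (\<lambda>a b. \<Oplus>\<^bsub>?SK\<^esub>k\<in>{..<n}. \<Oplus>\<^bsub>?SK\<^esub>j\<in>{..<n}. p k b \<otimes>\<^bsub>K\<^esub> (p j a \<otimes>\<^bsub>K\<^esub> p m (S (S (e j) \<otimes> e k)))) (e m)"
    proof (rule tsum_cong[OF refl])
      fix a b assume *: "a \<in>! H" "b \<in>! H"
      have "p m (S (S a \<otimes> b)) = (\<Oplus>\<^bsub>?SK\<^esub>k\<in>{..<n}. p k b \<odot>\<^bsub>?SK\<^esub> p m (S (S a \<otimes> e k)))"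
        using * m by (intro expand lin) simp_all
      also have "... = (\<Oplus>\<^bsub>?SK\<^esub>k\<in>{..<n}. p k b \<odot>\<^bsub>?SK\<^esub> (\<Oplus>\<^bsub>?SK\<^esub>j\<in>{..<n}. p j a \<odot>\<^bsub>?SK\<^esub> p m (S (S (e j) \<otimes> e k))))"
        using * m by (intro fc arg_cong2[where f = "smult ?SK"] refl expand[where f = "\<lambda>v. p m (S (S v \<otimes> e _))"] lin) simp_all
      also have "... = (\<Oplus>\<^bsub>?SK\<^esub>k\<in>{..<n}. \<Oplus>\<^bsub>?SK\<^esub>j\<in>{..<n}. p k b \<otimes>\<^bsub>K\<^esub> (p j a \<otimes>\<^bsub>K\<^esub> p m (S (S (e j) \<otimes> e k))))"
        using * m by (intro fc) (simp add: K.finsum_rdistr Pi_iff)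
      finally show "p m (S (S a \<otimes> b)) = (\<Oplus>\<^bsub>?SK\<^esub>k\<in>{..<n}. \<Oplus>\<^bsub>?SK\<^esub>j\<in>{..<n}. p k b \<otimes>\<^bsub>K\<^esub> (p j a \<otimes>\<^bsub>K\<^esub> p m (S (S (e j) \<otimes> e k))))" .
    qed
    also have "... = (\<Oplus>\<^bsub>?SK\<^esub>k\<in>{..<n}. \<Oplus>\<^bsub>?SK\<^esub>j\<in>{..<n}. sw ?SK (\<lambda>a b. p k b \<otimes>\<^bsub>K\<^esub> (p j a \<otimes>\<^bsub>K\<^esub> p m (S (S (e j) \<otimes> e k)))) (e m))"
      using m by (subst tsum_finsum, simp_all add: K.finsum_closed Pi_iff, intro fc)
        (subst tsum_finsum[where G = ?SK, unfolded finsum_self_module], simp_all)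
    also have "... = ?s (\<lambda>k. ?s (\<lambda>j. p m (S (S (e j) \<otimes> e k)) \<otimes>\<^bsub>K\<^esub> Q j k (e m)))"
      unfolding finsum_self_module
    proof (intro fc)
      fix k j assume kj: "k \<in> {..<n}" "j \<in> {..<n}"
      have "p m (S (S (e j) \<otimes> e k)) \<otimes>\<^bsub>K\<^esub> Q j k (e m) = sw ?SK (\<lambda>a b. p m (S (S (e j) \<otimes> e k)) \<otimes>\<^bsub>K\<^esub> (p k b \<otimes>\<^bsub>K\<^esub> p j a)) (e m)"
        using kj m tsum_push_smult[of K ?SK "comult H (e m)" H H "p m (S (S (e j) \<otimes> e k))" "\<lambda>a b. p k b \<otimes>\<^bsub>K\<^esub> p j a"]
        unfolding Q_def by simp
      then show "sw ?SK (\<lambda>a b. p k b \<otimes>\<^bsub>K\<^esub> (p j a \<otimes>\<^bsub>K\<^esub> p m (S (S (e j) \<otimes> e k)))) (e m) = p m (S (S (e j) \<otimes> e k)) \<otimes>\<^bsub>K\<^esub> Q j k (e m)"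
        using kj m by (simp add: K.m_ac)
    qed
    finally show ?thesis .
  qed
  have "?s (\<lambda>k. lam (p k) (S (e k))) = ?s (\<lambda>k. ?s (\<lambda>j. ?s (\<lambda>m. p m (S (S (e j) \<otimes> e k)) \<otimes>\<^bsub>K\<^esub> Q j k (e m))))"
  proof (intro fc)
    fix k assume k: "k \<in> {..<n}"
    then have "lam (p k) (S (e k)) = ?s (\<lambda>j. p j (\<Theta> (p k) (S (S (e j) \<otimes> e k))))"
      by (subst lam_def[OF p_linear]) (auto intro!: fc)
    also have "... = ?s (\<lambda>j. ?s (\<lambda>m. p m (S (S (e j) \<otimes> e k)) \<otimes>\<^bsub>K\<^esub> Q j k (e m)))"
    proof (intro fc)
      fix j assume j: "j \<in> {..<n}"
      show "p j (\<Theta> (p k) (S (S (e j) \<otimes> e k))) = ?s (\<lambda>m. p m (S (S (e j) \<otimes> e k)) \<otimes>\<^bsub>K\<^esub> Q j k (e m))"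
        using k j expand[OF Q, of j k "S (S (e j) \<otimes> e k)"] by (simp add: pT del: S_mult)
    qed
    finally show "lam (p k) (S (e k)) = ?s (\<lambda>j. ?s (\<lambda>m. p m (S (S (e j) \<otimes> e k)) \<otimes>\<^bsub>K\<^esub> Q j k (e m)))" .
  qed
  also have "... = ?s (\<lambda>k. ?s (\<lambda>m. ?s (\<lambda>j. p m (S (S (e j) \<otimes> e k)) \<otimes>\<^bsub>K\<^esub> Q j k (e m))))"
    by (intro fc K.finsum_swap) simp_all
  also have "... = ?s (\<lambda>m. ?s (\<lambda>k. ?s (\<lambda>j. p m (S (S (e j) \<otimes> e k)) \<otimes>\<^bsub>K\<^esub> Q j k (e m))))"
    by (intro K.finsum_swap) (simp_all add: K.finsum_closed Pi_iff)
  also have "... = ?s (\<lambda>m. sw ?SK (\<lambda>a b. p m (S (S a \<otimes> b))) (e m))"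
    by (intro fc) (simp add: 1 del: S_mult)
  also have "... = ?s (\<lambda>m. p m \<one> \<otimes>\<^bsub>K\<^esub> \<epsilon> (e m))"
  proof (intro fc)
    fix m assume m: "m \<in> {..<n}"
    then show "sw ?SK (\<lambda>a b. p m (S (S a \<otimes> b))) (e m) = p m \<one> \<otimes>\<^bsub>K\<^esub> \<epsilon> (e m)"
      using antipode_left[of ?SK "\<lambda>v. p m (S v)" "e m"] by (simp add: lin K.m_comm del: S_mult)
  qed
  also have "... = \<epsilon> \<one>"
    using expand[OF counit_linear, of \<one>] by simp
  finally show ?thesis by simp
qed

text \<open>The coefficients of \<open>sum_lam\<close> add up to one, so scaling \<open>h\<close> by
  them gives \<open>h\<close>, while each scaled copy is zero by \<open>lam_kernel\<close>.\<close>

lemma S_inj: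
  assumes h: "h \<in>! H" and S0: "S h = \<zero>"
  shows "h = \<zero>"
proof -
  have l [simp]: "k < n ==> lam (p k) (S (e k)) \<in>! K" for k
    by (intro lam_closed p_linear) simp_all
  have "h = (\<Oplus>\<^bsub>K\<^esub>k\<in>{..<n}. lam (p k) (S (e k))) \<odot> h" using h by (simp add: sum_lam)
  also have "... = (\<Oplus>k\<in>{..<n}. lam (p k) (S (e k)) \<odot> h)"
    using h by (intro M.finsum_smult_rdistr) auto
  also have "... = (\<Oplus>k\<in>{..<n}. \<zero>)"
    using h by (intro finsum_eqI lam_kernel[OF p_linear]) (simp_all add: S0)
  finally show ?thesis by simp
qed

lemma S_bij: "bij_betw S (carrier H) (carrier H)"
proof (rule bij_betw_imageI)
  show "inj_on S (carrier H)"
  proof (rule inj_onI)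
    fix x y assume *: "x \<in>! H" "y \<in>! H" "S x = S y"
    have "S (x \<oplus> \<ominus> y) = S x \<oplus> \<ominus> S y"
      using * linear_mapD(2)[OF S_linear] linear_map_minus[OF S_linear module_H module_H] by simp
    also have "... = \<zero>" unfolding *(3) using *(2) by (simp add: M.M.r_neg)
    finally have "S (x \<oplus> \<ominus> y) = \<zero>" .
    then have "x \<oplus> \<ominus> y = \<zero>" using *(1,2) by (simp add: S_inj)
    then have "\<ominus> (\<ominus> y) = x" using * by (intro M.M.minus_equality) auto
    then show "x = y" using * by simp
  qed
  show "S ` carrier H = carrier H"
  proof (intro equalityI subsetI)
    fix y assume "y \<in>! H"
    from finite_dim_inj_imp_surj[OF K.field_axioms db module_H S_linear S_inj this]
    show "y \<in> S ` carrier H" by blast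
  qed auto
qed

end

text \<open>An opposite algebra, a smash product and a double share these fields with a structure
  that is already understood. Lifts, sums and linearity depend on nothing else, so they carry over
  along this relation.\<close>

definition same_module :: "('k, 'm, 'x) module_scheme \<Rightarrow> ('k, 'm, 'y) module_scheme \<Rightarrow> bool" where
  "same_module M N \<longleftrightarrow> carrier M = carrier N \<and> add M = add N \<and> \<zero>\<^bsub>M\<^esub> = \<zero>\<^bsub>N\<^esub> \<and> smult M = smult N"

lemma same_module_tsum:
  "same_module M M' ==> same_module N N' ==> same_module G G' ==> tsum M N G = tsum M' N' G'"
  unfolding tsum_def[abs_def] rsum_def same_module_def
  by (intro ext, subst frag_sum_structure_cong[of G G']) auto

lemma same_module_lift: "same_module G G' ==> tensor_lift G \<phi> X = tensor_lift G' \<phi> X"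
  unfolding same_module_def by (intro tensor_lift_structure_cong) auto

lemma same_module_linear:
  "same_module M M' ==> same_module N N' ==> linear_map K M N f \<longleftrightarrow> linear_map K M' N' f"
  unfolding same_module_def linear_map_def by auto

lemma same_module_ktensor:
  fixes K :: "('a, 'c) ring_scheme"
  assumes "same_module M M'" "same_module N N'"
  shows "same_module (ktensor K M N) (ktensor K M' N')" "pure_tensor (ktensor K M N) = pure_tensor (ktensor K M' N')"
proof -
  have "tensor_rels M N S ra la = tensor_rels M' N' S ra la" for S :: "'a set" and ra la
    using assms unfolding same_module_def tensor_rels_def by simp
  then show "same_module (ktensor K M N) (ktensor K M' N')" "pure_tensor (ktensor K M N) = pure_tensor (ktensor K M' N')"
    using assms unfolding same_module_def ktensor_def tensor_def Let_def by simp_all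
qed

lemma same_module_module:
  assumes "same_module M M'" "module K M"
  shows "module K M'"
proof -
  interpret M: module K M by fact
  have eq: "carrier M' = carrier M" "add M' = add M" "\<zero>\<^bsub>M'\<^esub> = \<zero>\<^bsub>M\<^esub>" "smult M' = smult M"
    using assms(1) by (simp_all add: same_module_def)
  have "abelian_group M'"
    by (rule abelian_groupI) (auto simp: eq M.M.a_ac M.M.l_neg intro!: bexI[of _ "\<ominus>\<^bsub>M\<^esub> _"])
  then show ?thesis
    by (intro moduleI) (auto simp: eq M.R.is_cring M.smult_l_distr M.smult_r_distr M.smult_assoc1)
qed

section \<open>Hopf algebras with bijective antipode and their opposites\<close>

locale bij_hopf = hopf K H for K :: "('k, 'c) ring_scheme" and H :: "('k, 'h, 'x) hopf_scheme" (structure) +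
  assumes S_bij: "bij_betw S (carrier H) (carrier H)"
begin

abbreviation "Si \<equiv> inv_antipode H"

lemma Si_closed [simp]: "h \<in>! H ==> Si h \<in>! H"
  and S_Si [simp]: "h \<in>! H ==> S (Si h) = h"
  and Si_S [simp]: "h \<in>! H ==> Si (S h) = h"
  using S_bij by (auto simp: bij_betw_def inv_into_into f_inv_into_f)

lemma S_eqD: "S x = S y ==> x \<in>! H ==> y \<in>! H ==> x = y"
  using S_bij by (auto simp: bij_betw_def inj_on_def)

lemma Si_linear: "linear_map K H H Si"
  by (intro linear_mapI; (rule S_eqD)?) (simp_all add: linear_mapD[OF S_linear])

lemma Si_linear' [lin]: "linear_map K Z H f ==> linear_map K Z H (\<lambda>z. Si (f z))"
  using linear_comp[OF _ Si_linear] .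

lemma Si_mult [simp]: "x \<in>! H ==> y \<in>! H ==> Si (x \<otimes> y) = Si y \<otimes> Si x"
  by (rule S_eqD) simp_all

lemma Si_one [simp]: "Si \<one> = \<one>" by (rule S_eqD) simp_all

lemma sw_Si:
  assumes b: "bilinear K H H G \<phi>" and h: "h \<in>! H"
  shows "sw G \<phi> (Si h) = sw G (\<lambda>x y. \<phi> (Si y) (Si x)) h"
proof -
  note bl = linear_comp[OF _ bilinearD(2)[OF b]] linear_comp[OF _ bilinearD(3)[OF b]]
  have "bilinear K H H G (\<lambda>x y. \<phi> (Si y) (Si x))"
    using bilinearD(1)[OF b] by (intro lin bl) simp_all
  from sw_S[OF this, of "Si h"] show ?thesis using h by simp
qed

text \<open>The injective map \<open>S\<close> sends the sum of \<open>h2 S^-1(h1)\<close> to that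
  of \<open>h1 S(h2)\<close>, where the antipode law applies. The next lemma is its mirror
  image.\<close>

lemma antipode_inv_right:
  assumes "linear_map K H G f" "module K G" "h \<in>! H"
  shows "sw G (\<lambda>x y. f (y \<otimes> Si x)) h = \<epsilon> h \<odot>\<^bsub>G\<^esub> f \<one>"
proof -
  have "S (sw H (\<lambda>x y. y \<otimes> Si x) h) = S (\<epsilon> h \<odot> \<one>)"
    using assms(3) antipode_right[of H "\<lambda>v. v" h]
    by (simp add: sw_push[OF S_linear] linear_mapD(3)[OF S_linear] lin)
  then have "sw H (\<lambda>x y. y \<otimes> Si x) h = \<epsilon> h \<odot> \<one>" using assms(3) by (elim S_eqD) simp_all
  then have "f (sw H (\<lambda>x y. y \<otimes> Si x) h) = \<epsilon> h \<odot>\<^bsub>G\<^esub> f \<one>"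
    using assms by (simp add: linear_mapD(3)[OF assms(1)])
  then show ?thesis using assms by (simp add: sw_push[OF assms(1)])
qed

lemma antipode_inv_left:
  assumes "linear_map K H G f" "module K G" "h \<in>! H"
  shows "sw G (\<lambda>x y. f (Si y \<otimes> x)) h = \<epsilon> h \<odot>\<^bsub>G\<^esub> f \<one>"
proof -
  have "S (sw H (\<lambda>x y. Si y \<otimes> x) h) = S (\<epsilon> h \<odot> \<one>)"
    using assms(3) antipode_left[of H "\<lambda>v. v" h]
    by (simp add: sw_push[OF S_linear] linear_mapD(3)[OF S_linear] lin)
  then have "sw H (\<lambda>x y. Si y \<otimes> x) h = \<epsilon> h \<odot> \<one>" using assms(3) by (elim S_eqD) simp_all
  then have "f (sw H (\<lambda>x y. Si y \<otimes> x) h) = \<epsilon> h \<odot>\<^bsub>G\<^esub> f \<one>"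
    using assms by (simp add: linear_mapD(3)[OF assms(1)])
  then show ?thesis using assms by (simp add: sw_push[OF assms(1)])
qed

end

sublocale fd_hopf \<subseteq> bij_hopf by (unfold_locales) (rule S_bij)

text \<open>Reversing the product while keeping the coproduct exchanges \<open>S\<close> for
  \<open>S^-1\<close>: the antipode laws become \<open>antipode_inv_right\<close> and
  \<open>antipode_inv_left\<close>.\<close>

definition op_hopf :: "('k, 'h) hopf \<Rightarrow> ('k, 'h) hopf" where
  "op_hopf H = (opposite H)\<lparr>antipode := inv_antipode H\<rparr>"

lemma op_hopf_simps [simp]:
  "carrier (op_hopf H) = carrier H" "add (op_hopf H) = add H" "\<zero>\<^bsub>op_hopf H\<^esub> = \<zero>\<^bsub>H\<^esub>" "\<one>\<^bsub>op_hopf H\<^esub> = \<one>\<^bsub>H\<^esub>"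
  "smult (op_hopf H) = smult H" "x \<otimes>\<^bsub>op_hopf H\<^esub> y = y \<otimes>\<^bsub>H\<^esub> x" "comult (op_hopf H) = comult H"
  "counit (op_hopf H) = counit H" "antipode (op_hopf H) = inv_antipode H"
  by (simp_all add: op_hopf_def opposite_def)

lemma same_module_op [simp]: "same_module (op_hopf H) H" "same_module H H"
  by (simp_all add: same_module_def)

lemma tsum_op [simp]:
  fixes M :: "('a, 'x) ring_scheme" and N :: "('b, 'y) ring_scheme" and H :: "('k, 'c) hopf"
  shows "tsum (op_hopf H) N G = tsum H N G" "tsum M (op_hopf H) G = tsum M H G" "tsum M N (op_hopf H) = tsum M N H"
proof -
  show "tsum (op_hopf H) N G = tsum H N G" "tsum M (op_hopf H) G = tsum M H G"
    by (simp_all add: tsum_def[abs_def])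
  have "frag_sum (op_hopf H) \<psi> u = frag_sum H \<psi> u" for \<psi> :: "'a \<times> 'b \<Rightarrow> 'c" and u
    by (intro frag_sum_structure_cong) simp_all
  then show "tsum M N (op_hopf H) = tsum M N H" by (simp add: tsum_def[abs_def] rsum_def)
qed

lemma k_algebra_op:
  assumes "k_algebra K H"
  shows "k_algebra K (op_hopf H)"
proof -
  interpret H: ring H using assms by (simp add: k_algebra_def)
  have m: "module K (op_hopf H)"
    by (rule same_module_module[of H]) (use assms in \<open>simp_all add: same_module_def k_algebra_def\<close>)
  then have "abelian_group (op_hopf H)" by (rule module.axioms(2))
  moreover have "monoid (op_hopf H)" by (unfold_locales) (auto simp: H.m_assoc)
  ultimately have "ring (op_hopf H)" by (rule ringI) (auto simp: H.l_distr H.r_distr)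
  then show ?thesis using m assms by (auto simp: k_algebra_def)
qed

lemma hopf_algebra_op:
  fixes H :: "('k, 'h) hopf"
  assumes "hopf_algebra K H" and "bij_betw (antipode H) (carrier H) (carrier H)"
  shows "hopf_algebra K (op_hopf H)"
proof -
  interpret bij_hopf K H using assms by unfold_locales
  let ?H = "op_hopf H"
  note k = k_algebra_op[OF kalg]
  have m [simp]: "module K ?H" using k by (simp add: k_algebra_def)
  note s = same_module_op[of H]
  have s2: "same_module (ktensor K ?H ?H) (ktensor K H H)" "pure_tensor (ktensor K ?H ?H) = pure_tensor (ktensor K H H)"
    by (rule same_module_ktensor[OF s(1) s(1)])+
  have s3: "same_module (ktensor K ?H (ktensor K ?H ?H)) (ktensor K H (ktensor K H H))"
    "pure_tensor (ktensor K ?H (ktensor K ?H ?H)) = pure_tensor (ktensor K H (ktensor K H H))"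
    by (rule same_module_ktensor[OF s(1) s2(1)])+
  have SK: "same_module (self_module K) (self_module K)" by (simp add: same_module_def)
  note lin_op = same_module_linear[OF s(1) s(1)] same_module_linear[OF s(1) s2(1)] same_module_linear[OF s(1) SK]
  have "coalgebra K ?H"
    unfolding coalgebra_def Let_def s2(2) s3(2) same_module_lift[OF s3(1)] same_module_lift[OF s(1)] lin_op op_hopf_simps
    using coalg m unfolding coalgebra_def Let_def by blast
  have "comult H (y \<otimes>\<^bsub>H\<^esub> x) = comult H x \<otimes>\<^bsub>ktensor K ?H ?H\<^esub> comult H y" if xy: "x \<in>! H" "y \<in>! H" for x y
  proof -
    have c: "comult H v \<in>! ktensor K ?H ?H" if "v \<in>! H" for v
      using s2(1) that by (simp add: same_module_def)
    have "comult H (y \<otimes>\<^bsub>H\<^esub> x) = comult H y \<otimes>\<^bsub>ktensor K H H\<^esub> comult H x"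
      using comult_hom xy by (simp add: alg_hom_def ring_hom_def)
    also have "... = sw (ktensor K H H) (\<lambda>m' n'. sw (ktensor K H H) (\<lambda>m n. (m \<otimes>\<^bsub>H\<^esub> m') \<boxtimes>\<^bsub>ktensor K H H\<^esub> (n \<otimes>\<^bsub>H\<^esub> n')) y) x"
      using xy by (simp add: ktensor_mult_tsum)
    \<comment> \<open>Exchanging the order of the two coproduct sums is what reverses the product in
      \<open>H \<otimes> H\<close>.\<close>
    also have "... = sw (ktensor K H H) (\<lambda>m n. sw (ktensor K H H) (\<lambda>m' n'. (m \<otimes>\<^bsub>H\<^esub> m') \<boxtimes>\<^bsub>ktensor K H H\<^esub> (n \<otimes>\<^bsub>H\<^esub> n')) x) y"
      using xy by (intro tsum_swap) simp_all
    also have "... = comult H x \<otimes>\<^bsub>ktensor K ?H ?H\<^esub> comult H y"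
      using xy by (simp add: ktensor_mult_tsum[OF k k c c] same_module_tsum[OF s(2) s(2) s2(1)] s2(2))
    finally show ?thesis .
  qed
  moreover have "\<one>\<^bsub>ktensor K ?H ?H\<^esub> = \<one>\<^bsub>ktensor K H H\<^esub>"
  proof -
    interpret T: balanced_tensor K H H "carrier K" "\<lambda>m c. c \<odot>\<^bsub>H\<^esub> m" "\<lambda>c n. c \<odot>\<^bsub>H\<^esub> n" "ktensor K H H"
      by (rule balanced_tensor_ktensor) simp_all
    interpret T': balanced_tensor K ?H ?H "carrier K" "\<lambda>m c. c \<odot>\<^bsub>?H\<^esub> m" "\<lambda>c n. c \<odot>\<^bsub>?H\<^esub> n" "ktensor K ?H ?H"
      by (rule balanced_tensor_ktensor) simp_all
    show ?thesis by (simp add: T.one_T T'.one_T s2(2))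
  qed
  ultimately have "alg_hom K ?H (ktensor K ?H ?H) (comult ?H)"
    using comult_hom s2(1) unfolding alg_hom_def ring_hom_def
    by (simp add: lin_op) (simp add: same_module_def Pi_iff)
  moreover have "alg_hom K ?H (self_module K) (counit ?H)"
    using counit_hom unfolding alg_hom_def ring_hom_def by (simp add: lin_op K.m_comm)
  moreover have "linear_map K ?H ?H (antipode ?H)" using Si_linear by (simp add: lin_op)
  moreover have "tensor_lift ?H (\<lambda>x y. antipode ?H x \<otimes>\<^bsub>?H\<^esub> y) (comult ?H h) = counit ?H h \<odot>\<^bsub>?H\<^esub> \<one>\<^bsub>?H\<^esub>"
    if "h \<in>! ?H" for h
    using antipode_inv_right[OF linear_map_id module_H that[simplified]] that
    unfolding same_module_lift[OF s(1)] by (simp, subst lift_sw) (auto intro!: lin)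
  moreover have "tensor_lift ?H (\<lambda>x y. x \<otimes>\<^bsub>?H\<^esub> antipode ?H y) (comult ?H h) = counit ?H h \<odot>\<^bsub>?H\<^esub> \<one>\<^bsub>?H\<^esub>"
    if "h \<in>! ?H" for h
    using antipode_inv_left[OF linear_map_id module_H that[simplified]] that
    unfolding same_module_lift[OF s(1)] by (simp, subst lift_sw) (auto intro!: lin)
  ultimately show ?thesis using k \<open>coalgebra K ?H\<close> unfolding hopf_algebra_def by blast
qed

section \<open>Comodules\<close>

locale comodule = hopf K H for K :: "('k, 'c) ring_scheme" and H :: "('k, 'h, 'x) hopf_scheme" (structure) +
  fixes V :: "('k, 'v, 'y) module_scheme" and rho :: "'v \<Rightarrow> ('v \<times> 'h \<Rightarrow>\<^sub>0 int) set"
  assumes modV [simp]: "module K V"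
    and rho_linear: "linear_map K V (ktensor K V H) rho"
    and rho_coassoc_tensor: "v \<in>! V ==>
      tensor_lift (ktensor K V (ktensor K H H)) (\<lambda>x h. tensor_lift (ktensor K V (ktensor K H H))
        (\<lambda>y g. y \<boxtimes>\<^bsub>ktensor K V (ktensor K H H)\<^esub> (g \<boxtimes>\<^bsub>ktensor K H H\<^esub> h)) (rho x)) (rho v)
      = tensor_lift (ktensor K V (ktensor K H H)) (\<lambda>x h. x \<boxtimes>\<^bsub>ktensor K V (ktensor K H H)\<^esub> comult H h) (rho v)"
    and rho_counit_tensor: "v \<in>! V ==> tensor_lift V (\<lambda>x h. \<epsilon> h \<odot>\<^bsub>V\<^esub> x) (rho v) = v"
begin

text \<open>Sweedler notation for a coaction: the sum of \<open>\<phi> v0 v1\<close>.\<close>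

abbreviation rw :: "('k, 'g, 'z) module_scheme \<Rightarrow> ('v \<Rightarrow> 'h \<Rightarrow> 'g) \<Rightarrow> 'v \<Rightarrow> 'g" where
  "rw G \<phi> v \<equiv> tsum V H G \<phi> (rho v)"

lemma abelian_V [simp]: "abelian_group V" using modV by (rule module.axioms(2))

lemma rho_closed [simp]: "v \<in>! V ==> rho v \<in>! ktensor K V H"
  by (rule linear_mapD(1)[OF rho_linear])

lemma rho_rep [simp]: "v \<in>! V ==> rep_in (rho v) (carrier V) (carrier H)"
  by (rule ktensor_rep_in[where K = K]) simp_all

lemma rho_linear' [lin]: "linear_map K Z V f ==> linear_map K Z (ktensor K V H) (\<lambda>z. rho (f z))"
  using linear_comp[OF _ rho_linear] .

lemma lift_rw: "bilinear K V H G \<phi> ==> v \<in>! V ==> tensor_lift G \<phi> (rho v) = rw G \<phi> v"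
  by (rule ktensor_lift_tsum[where K = K]) (simp_all only: module_H modV rho_closed)

lemma rw_push:
  assumes "linear_map K G G' f" "module K G" "module K G'" "v \<in>! V"
    and "\<And>x y. x \<in>! V ==> y \<in>! H ==> \<phi> x y \<in>! G"
  shows "f (rw G \<phi> v) = rw G' (\<lambda>x y. f (\<phi> x y)) v"
  using assms by (intro tsum_linear) simp_all

lemma rho_coassoc:
  assumes G: "module K G"
    and 1: "\<And>y z. y \<in>! H ==> z \<in>! H ==> linear_map K V G (\<lambda>x. \<psi> x y z)"
    and 2: "\<And>x z. x \<in>! V ==> z \<in>! H ==> linear_map K H G (\<lambda>y. \<psi> x y z)"
    and 3: "\<And>x y. x \<in>! V ==> y \<in>! H ==> linear_map K H G (\<lambda>z. \<psi> x y z)"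
    and v: "v \<in>! V"
  shows "rw G (\<lambda>x z. rw G (\<lambda>x y. \<psi> x y z) x) v = rw G (\<lambda>x y. sw G (\<lambda>y z. \<psi> x y z) y) v"
proof -
  let ?C2 = "ktensor K H H" and ?C3 = "ktensor K V (ktensor K H H)"
  define F where "F = tensor_lift G (\<lambda>x Y. tsum H H G (\<lambda>y z. \<psi> x y z) Y)"
  have b: "bilinear K V ?C2 G (\<lambda>x Y. tsum H H G (\<lambda>y z. \<psi> x y z) Y)"
    by (intro lin linear_comp[OF _ 1] linear_comp[OF _ 2] linear_comp[OF _ 3])
      (simp_all add: G ktensor_rep_in[where K = K])
  have F: "linear_map K ?C3 G F" unfolding F_def by (rule ktensor_lift_linear[OF _ _ b]) simp_all
  have bil: "bilinear K H H G (\<lambda>y z. \<psi> x y z)" if "x \<in>! V" for x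
    using G 2 3 that by (intro bilinearI) auto
  have Fp: "F (x \<boxtimes>\<^bsub>?C3\<^esub> Y) = tsum H H G (\<lambda>y z. \<psi> x y z) Y" if "x \<in>! V" "Y \<in>! ?C2" for x Y
    unfolding F_def by (rule ktensor_lift_pure[OF _ _ b that]) simp_all
  have i: "tensor_lift ?C3 (\<lambda>x1 x2. x1 \<boxtimes>\<^bsub>?C3\<^esub> (x2 \<boxtimes>\<^bsub>?C2\<^esub> y)) (rho x) = rw ?C3 (\<lambda>x1 x2. x1 \<boxtimes>\<^bsub>?C3\<^esub> (x2 \<boxtimes>\<^bsub>?C2\<^esub> y)) x"
    if "x \<in>! V" "y \<in>! H" for x y
    using that by (intro lift_rw lin) simp_all
  have "tensor_lift ?C3 (\<lambda>x y. tensor_lift ?C3 (\<lambda>x1 x2. x1 \<boxtimes>\<^bsub>?C3\<^esub> (x2 \<boxtimes>\<^bsub>?C2\<^esub> y)) (rho x)) (rho v)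
     = rw ?C3 (\<lambda>x y. tensor_lift ?C3 (\<lambda>x1 x2. x1 \<boxtimes>\<^bsub>?C3\<^esub> (x2 \<boxtimes>\<^bsub>?C2\<^esub> y)) (rho x)) v"
    by (intro lift_rw v bilinearI linear_map_cong[OF _ modV i[symmetric]] linear_map_cong[OF _ module_H i[symmetric]])
      (auto intro!: lin)
  also have "... = rw ?C3 (\<lambda>x y. rw ?C3 (\<lambda>x1 x2. x1 \<boxtimes>\<^bsub>?C3\<^esub> (x2 \<boxtimes>\<^bsub>?C2\<^esub> y)) x) v"
    by (simp add: i)
  finally have l: "rw ?C3 (\<lambda>x y. rw ?C3 (\<lambda>x1 x2. x1 \<boxtimes>\<^bsub>?C3\<^esub> (x2 \<boxtimes>\<^bsub>?C2\<^esub> y)) x) v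
     = rw ?C3 (\<lambda>x y. x \<boxtimes>\<^bsub>?C3\<^esub> comult H y) v"
    using rho_coassoc_tensor[OF v] v by (subst (asm) lift_rw[where \<phi> = "\<lambda>x y. x \<boxtimes>\<^bsub>?C3\<^esub> comult H y"]) (auto intro!: lin)
  have "rw G (\<lambda>x z. rw G (\<lambda>x y. \<psi> x y z) x) v = F (rw ?C3 (\<lambda>x y. rw ?C3 (\<lambda>x1 x2. x1 \<boxtimes>\<^bsub>?C3\<^esub> (x2 \<boxtimes>\<^bsub>?C2\<^esub> y)) x) v)"
    using v by (simp add: rw_push[OF F] G Fp tsum_pure bil)
  also have "... = rw G (\<lambda>x y. sw G (\<lambda>y z. \<psi> x y z) y) v"
    unfolding l using v by (simp add: rw_push[OF F] G Fp)
  finally show ?thesis .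
qed

lemma rho_counit:
  assumes "linear_map K V G f" "module K G" "v \<in>! V"
  shows "rw G (\<lambda>x y. \<epsilon> y \<odot>\<^bsub>G\<^esub> f x) v = f v"
proof -
  have "rw V (\<lambda>x y. \<epsilon> y \<odot>\<^bsub>V\<^esub> x) v = v"
    using rho_counit_tensor[OF assms(3)] assms(3) by (subst (asm) lift_rw) (auto intro!: lin)
  then have "f (rw V (\<lambda>x y. \<epsilon> y \<odot>\<^bsub>V\<^esub> x) v) = f v" by simp
  then show ?thesis
    using assms module.smult_closed[OF modV] by (simp add: rw_push[OF assms(1)] linear_mapD(3)[OF assms(1)])
qed

end

section \<open>Lu's Hopf algebroid, up to isomorphism\<close>

lemma base_tensor_balanced:
  assumes kL: "k_algebra K L" and kV: "k_algebra K V" and s: "alg_hom K V L s" and t: "alg_hom K V (opposite L) t"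
  shows "balanced_tensor K L L (carrier V) (\<lambda>x r. t r \<otimes>\<^bsub>L\<^esub> x) (\<lambda>r x. s r \<otimes>\<^bsub>L\<^esub> x) (base_tensor L V s t)"
proof (rule balanced_tensor.intro)
  interpret V: ring V using kV by (simp add: k_algebra_def)
  interpret L: ring L using kL by (simp add: k_algebra_def)
  interpret VM: module K V using kV by (simp add: k_algebra_def)
  show m: "module K L" "module K L" using kL by (simp_all add: k_algebra_def)
  have cl: "r \<in>! V ==> s r \<in>! L" "r \<in>! V ==> t r \<in>! L" for r
    using s t by (auto simp: alg_hom_def ring_hom_def opposite_def)
  show "linear_map K L L (\<lambda>x. t r \<otimes>\<^bsub>L\<^esub> x)" "linear_map K L L (\<lambda>x. s r \<otimes>\<^bsub>L\<^esub> x)" if "r \<in>! V" for r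
    using that by (intro lin kL cl; simp)+
  fix c assume c: "c \<in>! K"
  then have "t (c \<odot>\<^bsub>V\<^esub> \<one>\<^bsub>V\<^esub>) = c \<odot>\<^bsub>L\<^esub> \<one>\<^bsub>L\<^esub>" "s (c \<odot>\<^bsub>V\<^esub> \<one>\<^bsub>V\<^esub>) = c \<odot>\<^bsub>L\<^esub> \<one>\<^bsub>L\<^esub>"
    using s t by (simp_all add: alg_hom_def linear_map_def ring_hom_def opposite_def)
  then show "\<exists>r\<in>carrier V. (\<forall>m\<in>carrier L. t r \<otimes>\<^bsub>L\<^esub> m = c \<odot>\<^bsub>L\<^esub> m) \<and> (\<forall>n\<in>carrier L. s r \<otimes>\<^bsub>L\<^esub> n = c \<odot>\<^bsub>L\<^esub> n)"
    using c kL by (intro bexI[of _ "c \<odot>\<^bsub>V\<^esub> \<one>\<^bsub>V\<^esub>"]) (auto simp: k_algebra_def)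
qed (simp add: base_tensor_def)

text \<open>The total algebra is only required to be isomorphic to \<open>V \<otimes> H\<close> by \<open>s v \<star> \<iota> h \<mapsto> v \<otimes> h\<close>,
  so that the smash product and \<open>T_op\<close> are both instances.\<close>

locale lu = bij_hopf K H + comodule K H "base Bd" rho
  for K :: "('k, 'c) ring_scheme" and H :: "('k, 'h, 'x) hopf_scheme" (structure)
    and Bd :: "('k, 'l, 'v) bialgebroid" and rho +
  fixes act :: "'h \<Rightarrow> 'v \<Rightarrow> 'v" and \<iota> :: "'h \<Rightarrow> 'l" and j :: "'l \<Rightarrow> ('v \<times> 'h \<Rightarrow>\<^sub>0 int) set"
  assumes kV: "k_algebra K (base Bd)" and kL: "k_algebra K (total Bd)"
    and act_linear1: "v \<in>! base Bd ==> linear_map K H (base Bd) (\<lambda>h. act h v)"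
    and act_linear2: "h \<in>! H ==> linear_map K (base Bd) (base Bd) (act h)"
    and act_mult [simp]: "g \<in>! H ==> h \<in>! H ==> v \<in>! base Bd ==> act (g \<otimes> h) v = act g (act h v)"
    and act_one [simp]: "v \<in>! base Bd ==> act \<one> v = v"
    and s_hom: "alg_hom K (base Bd) (total Bd) (source Bd)"
    and t_hom: "alg_hom K (base Bd) (opposite (total Bd)) (target Bd)"
    and \<iota>_hom: "alg_hom K H (total Bd) \<iota>"
    and st: "r \<in>! base Bd ==> r' \<in>! base Bd ==>
      source Bd r \<otimes>\<^bsub>total Bd\<^esub> target Bd r' = target Bd r' \<otimes>\<^bsub>total Bd\<^esub> source Bd r"
    and \<iota>s: "h \<in>! H ==> v \<in>! base Bd ==>
      \<iota> h \<otimes>\<^bsub>total Bd\<^esub> source Bd v = sw (total Bd) (\<lambda>x y. source Bd (act x v) \<otimes>\<^bsub>total Bd\<^esub> \<iota> y) h"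
    and \<iota>t: "h \<in>! H ==> v \<in>! base Bd ==>
      \<iota> h \<otimes>\<^bsub>total Bd\<^esub> target Bd v = sw (total Bd) (\<lambda>x y. target Bd (act y v) \<otimes>\<^bsub>total Bd\<^esub> \<iota> x) h"
    and t_eq: "v \<in>! base Bd ==>
      target Bd v = rw (total Bd) (\<lambda>x y. source Bd x \<otimes>\<^bsub>total Bd\<^esub> \<iota> y) v"
    and j_linear: "linear_map K (total Bd) (ktensor K (base Bd) H) j"
    and j_gen: "v \<in>! base Bd ==> h \<in>! H ==>
      j (source Bd v \<otimes>\<^bsub>total Bd\<^esub> \<iota> h) = v \<boxtimes>\<^bsub>ktensor K (base Bd) H\<^esub> h"
    and j_inv: "x \<in>! total Bd ==>
      tsum (base Bd) H (total Bd) (\<lambda>v h. source Bd v \<otimes>\<^bsub>total Bd\<^esub> \<iota> h) (j x) = x"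
    and coprod_linear: "linear_map K (total Bd)
      (base_tensor (total Bd) (base Bd) (source Bd) (target Bd)) (coprod Bd)"
    and coprod_gen: "v \<in>! base Bd ==> h \<in>! H ==> coprod Bd (source Bd v \<otimes>\<^bsub>total Bd\<^esub> \<iota> h) =
      sw (base_tensor (total Bd) (base Bd) (source Bd) (target Bd)) (\<lambda>x y. (source Bd v \<otimes>\<^bsub>total Bd\<^esub> \<iota> x)
        \<boxtimes>\<^bsub>base_tensor (total Bd) (base Bd) (source Bd) (target Bd)\<^esub> \<iota> y) h"
    and coun_linear: "linear_map K (total Bd) (base Bd) (coun Bd)"
    and coun_gen: "v \<in>! base Bd ==> h \<in>! H ==>
      coun Bd (source Bd v \<otimes>\<^bsub>total Bd\<^esub> \<iota> h) = \<epsilon> h \<odot>\<^bsub>base Bd\<^esub> v"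
begin

abbreviation "L \<equiv> total Bd"
abbreviation "V \<equiv> base Bd"
abbreviation "s \<equiv> source Bd"
abbreviation "t \<equiv> target Bd"
abbreviation "cop \<equiv> coprod Bd"
abbreviation "cou \<equiv> coun Bd"
abbreviation "L2 \<equiv> base_tensor L V s t"
abbreviation mulL (infixl \<open>\<star>\<close> 70) where "x \<star> y \<equiv> x \<otimes>\<^bsub>total Bd\<^esub> y"

declare kV [simp] kL [simp]

sublocale V: ring V using kV by (simp add: k_algebra_def)
sublocale L: ring L using kL by (simp add: k_algebra_def)
sublocale VM: module K V by (rule modV)

lemma modL [simp]: "module K L" using kL by (simp add: k_algebra_def)
lemma abelian_L [simp]: "abelian_group L" by (rule L.abelian_group_axioms)
sublocale LM: module K L by (rule modL)

lemma smult_L [simp]: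
  "c \<in>! K ==> x \<in>! L ==> y \<in>! L ==> (c \<odot>\<^bsub>L\<^esub> x) \<star> y = c \<odot>\<^bsub>L\<^esub> (x \<star> y)"
  "c \<in>! K ==> x \<in>! L ==> y \<in>! L ==> x \<star> (c \<odot>\<^bsub>L\<^esub> y) = c \<odot>\<^bsub>L\<^esub> (x \<star> y)"
  using kL by (simp_all add: k_algebra_def)

lemma s_linear: "linear_map K V L s" and t_linear: "linear_map K V L t" and \<iota>_linear: "linear_map K H L \<iota>"
  using s_hom t_hom \<iota>_hom by (auto simp: alg_hom_def linear_map_def opposite_def)

lemmas linear_gens [lin] = linear_comp[OF _ s_linear] linear_comp[OF _ t_linear]
  linear_comp[OF _ \<iota>_linear] linear_comp[OF _ act_linear1] linear_comp[OF _ act_linear2]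
  linear_comp[OF _ coun_linear] linear_comp[OF _ coprod_linear]

lemma gens_closed [simp]:
  "v \<in>! V ==> s v \<in>! L" "v \<in>! V ==> t v \<in>! L" "h \<in>! H ==> \<iota> h \<in>! L"
  "h \<in>! H ==> v \<in>! V ==> act h v \<in>! V" "a \<in>! L ==> cou a \<in>! V"
  using linear_mapD(1)[OF s_linear] linear_mapD(1)[OF t_linear] linear_mapD(1)[OF \<iota>_linear]
    linear_mapD(1)[OF act_linear2] linear_mapD(1)[OF coun_linear] by auto

lemma gens_mult:
  "u \<in>! V ==> v \<in>! V ==> s u \<star> s v = s (u \<otimes>\<^bsub>V\<^esub> v)"
  "u \<in>! V ==> v \<in>! V ==> t u \<star> t v = t (v \<otimes>\<^bsub>V\<^esub> u)"
  "g \<in>! H ==> h \<in>! H ==> \<iota> g \<star> \<iota> h = \<iota> (g \<otimes> h)"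
  using s_hom t_hom \<iota>_hom by (auto simp: alg_hom_def ring_hom_def opposite_def)

lemma gens_mult3:
  assumes "x \<in>! L"
  shows "u \<in>! V ==> v \<in>! V ==> s u \<star> (s v \<star> x) = s (u \<otimes>\<^bsub>V\<^esub> v) \<star> x"
    "u \<in>! V ==> v \<in>! V ==> t u \<star> (t v \<star> x) = t (v \<otimes>\<^bsub>V\<^esub> u) \<star> x"
    "g \<in>! H ==> h \<in>! H ==> \<iota> g \<star> (\<iota> h \<star> x) = \<iota> (g \<otimes> h) \<star> x"
    "u \<in>! V ==> v \<in>! V ==> s u \<star> (t v \<star> x) = t v \<star> (s u \<star> x)"
  using assms by (simp_all add: L.m_assoc[symmetric] gens_mult st)

lemma gens_one [simp]: "s \<one>\<^bsub>V\<^esub> = \<one>\<^bsub>L\<^esub>" "t \<one>\<^bsub>V\<^esub> = \<one>\<^bsub>L\<^esub>" "\<iota> \<one> = \<one>\<^bsub>L\<^esub>"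
  using s_hom t_hom \<iota>_hom by (auto simp: alg_hom_def ring_hom_def opposite_def)

lemma j_closed [simp]: "x \<in>! L ==> j x \<in>! ktensor K V H"
  by (rule linear_mapD(1)[OF j_linear])

lemma j_rep [simp]: "x \<in>! L ==> rep_in (j x) (carrier V) (carrier H)"
  by (rule ktensor_rep_in[where K = K]) simp_all

text \<open>By \<open>j_inv\<close> every element of the total algebra is a sum of products of some
  \<open>s v\<close> with some \<open>\<iota> h\<close>; most identities of this locale are verified
  on such generators.\<close>

lemma L_eqI:
  assumes f: "linear_map K L G f" and g: "linear_map K L G g" and G: "module K G"
    and eq: "\<And>v h. v \<in>! V ==> h \<in>! H ==> f (s v \<star> \<iota> h) = g (s v \<star> \<iota> h)" and x: "x \<in>! L"
  shows "f x = g x"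
proof -
  have "f (tsum V H L (\<lambda>v h. s v \<star> \<iota> h) (j x)) = g (tsum V H L (\<lambda>v h. s v \<star> \<iota> h) (j x))"
    using x G by (simp add: tsum_linear[OF f] tsum_linear[OF g] eq)
  then show ?thesis using x by (simp add: j_inv)
qed

text \<open>The linear map on the total algebra whose value on the product of \<open>s v\<close> and
  \<open>\<iota> h\<close> is \<open>\<phi> v h\<close>, provided that \<open>\<phi>\<close> is
  bilinear.\<close>

definition Lift where "Lift G \<phi> x = tsum V H G \<phi> (j x)"

lemma Lift_linear: "bilinear K V H G \<phi> ==> linear_map K L G (Lift G \<phi>)"
  unfolding Lift_def by (rule tsum_linear_arg[OF j_linear]) simp_all

lemma Lift_gen: "bilinear K V H G \<phi> ==> v \<in>! V ==> h \<in>! H ==> Lift G \<phi> (s v \<star> \<iota> h) = \<phi> v h"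
  unfolding Lift_def by (simp add: j_gen tsum_pure)

text \<open>Targets commute with sources, so \<open>t u\<close> passes \<open>s v\<close> and is
  then replaced by the coaction of \<open>u\<close>. This is the normal form of a product with a
  target on the left.\<close>

lemma t_mult_gen:
  assumes "u \<in>! V" "v \<in>! V" "h \<in>! H"
  shows "t u \<star> (s v \<star> \<iota> h) = rw L (\<lambda>x y. s (v \<otimes>\<^bsub>V\<^esub> x) \<star> \<iota> (y \<otimes> h)) u"
proof -
  have "t u \<star> (s v \<star> \<iota> h) = s v \<star> (t u \<star> \<iota> h)" using assms by (simp add: gens_mult3)
  also have "... = rw L (\<lambda>x y. s v \<star> (s x \<star> \<iota> y \<star> \<iota> h)) u"
    using assms by (simp add: t_eq push)
  also have "... = rw L (\<lambda>x y. s (v \<otimes>\<^bsub>V\<^esub> x) \<star> \<iota> (y \<otimes> h)) u"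
    using assms by (simp add: L.m_assoc gens_mult gens_mult3)
  finally show ?thesis .
qed

lemma coun_t_gen:
  assumes "u \<in>! V" "v \<in>! V" "h \<in>! H"
  shows "cou (t u \<star> (s v \<star> \<iota> h)) = \<epsilon> h \<odot>\<^bsub>V\<^esub> (v \<otimes>\<^bsub>V\<^esub> u)"
proof -
  have "cou (t u \<star> (s v \<star> \<iota> h)) = rw V (\<lambda>x y. \<epsilon> y \<odot>\<^bsub>V\<^esub> (\<epsilon> h \<odot>\<^bsub>V\<^esub> (v \<otimes>\<^bsub>V\<^esub> x))) u"
    using assms by (simp add: t_mult_gen rw_push[OF coun_linear] coun_gen VM.smult_assoc1)
  also have "... = \<epsilon> h \<odot>\<^bsub>V\<^esub> (v \<otimes>\<^bsub>V\<^esub> u)"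
    using assms by (intro rho_counit lin) simp_all
  finally show ?thesis .
qed

lemma gen_mult_gen:
  assumes "v \<in>! V" "g \<in>! H" "w \<in>! V" "h \<in>! H"
  shows "(s v \<star> \<iota> g) \<star> (s w \<star> \<iota> h) = sw L (\<lambda>x y. s (v \<otimes>\<^bsub>V\<^esub> act x w) \<star> \<iota> (y \<otimes> h)) g"
proof -
  have "(s v \<star> \<iota> g) \<star> (s w \<star> \<iota> h) = s v \<star> ((\<iota> g \<star> s w) \<star> \<iota> h)" using assms by (simp add: L.m_assoc)
  also have "... = sw L (\<lambda>x y. s (v \<otimes>\<^bsub>V\<^esub> act x w) \<star> \<iota> (y \<otimes> h)) g"
    using assms by (simp add: \<iota>s push L.m_assoc gens_mult gens_mult3)
  finally show ?thesis .
qed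

sublocale L2: balanced_tensor K L L "carrier V" "\<lambda>x r. t r \<star> x" "\<lambda>r x. s r \<star> x" L2
  by (rule base_tensor_balanced[OF kL kV s_hom t_hom])

abbreviation pureL2 (infixl \<open>\<bowtie>\<close> 67) where "x \<bowtie> y \<equiv> x \<boxtimes>\<^bsub>L2\<^esub> y"

declare L2.module_T [simp] L2.abelian_T [simp]

lemma pure2_linear [lin]:
  "linear_map K Z L f ==> y \<in>! L ==> linear_map K Z L2 (\<lambda>z. f z \<bowtie> y)"
  "linear_map K Z L g ==> x \<in>! L ==> linear_map K Z L2 (\<lambda>z. x \<bowtie> g z)"
  using linear_comp[OF _ bilinearD(2)[OF L2.pure_bilinear]]
    linear_comp[OF _ bilinearD(3)[OF L2.pure_bilinear]] by blast+

lemma cop_closed [simp]: "a \<in>! L ==> cop a \<in>! L2"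
  by (rule linear_mapD(1)[OF coprod_linear])

abbreviation "bal \<phi> \<equiv> \<forall>x\<in>carrier L. \<forall>r\<in>carrier V. \<forall>y\<in>carrier L. \<phi> (t r \<star> x) y = \<phi> x (s r \<star> y)"

lemma lift_cop_linear:
  "bilinear K L L G \<phi> ==> bal \<phi> ==> linear_map K L G (\<lambda>a. tensor_lift G \<phi> (cop a))"
  using linear_comp[OF coprod_linear L2.lift_linear] .

lemma lift_cop_gen:
  assumes b: "bilinear K L L G \<phi>" and bal: "bal \<phi>" and v: "v \<in>! V" and h: "h \<in>! H"
  shows "tensor_lift G \<phi> (cop (s v \<star> \<iota> h)) = sw G (\<lambda>x y. \<phi> (s v \<star> \<iota> x) (\<iota> y)) h"
  using v h bilinearD(1)[OF b]
  by (simp add: coprod_gen sw_push[OF L2.lift_linear[OF b bal]] L2.lift_pure[OF bilinear_biadditive[OF b] bal])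

text \<open>Device for identities about the coproduct: a balanced lift of it is determined by its
  values on generators, and there it is a Sweedler sum in \<open>H\<close>.\<close>

lemma lift_cop_eqI:
  assumes "bilinear K L L G \<phi>" "bal \<phi>" "linear_map K L G g"
    and "\<And>v h. v \<in>! V ==> h \<in>! H ==> sw G (\<lambda>x y. \<phi> (s v \<star> \<iota> x) (\<iota> y)) h = g (s v \<star> \<iota> h)"
    and "a \<in>! L"
  shows "tensor_lift G \<phi> (cop a) = g a"
  using L_eqI[OF lift_cop_linear[OF assms(1,2)] assms(3) bilinearD(1)[OF assms(1)] _ assms(5)]
    lift_cop_gen[OF assms(1,2)] assms(4) by simp

end

text \<open>A lift is read off from the values on the pairs that occur in a coset. Hence the
  function may be rewritten on the carriers even before it is known to be balanced.\<close>

lemma (in balanced_tensor) lift_cong: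
  assumes "X \<in>! T" "\<And>m n. m \<in>! M ==> n \<in>! N ==> \<phi> m n = \<psi> m n"
  shows "tensor_lift G \<phi> X = tensor_lift G \<psi> X"
proof -
  obtain u where u: "X = I #>\<^bsub>F\<^esub> u" "supp u \<subseteq> carrier M \<times> carrier N"
    using assms(1) by (rule carrier_T_E)
  have "frag_sum G (case_prod \<phi>) v = frag_sum G (case_prod \<psi>) v" if "v \<in> X" for v
    using coset_rep(1)[OF u(2)] that u(1) assms(2) by (intro frag_sum_cong) auto
  then show ?thesis unfolding tensor_lift_def by (intro arg_cong[where f = the_elem] image_cong) auto
qed

section \<open>The axioms of a left bialgebroid\<close>

context lu
begin

lemma act_add [simp]:
  "h \<in>! H ==> u \<in>! V ==> v \<in>! V ==> act h (u \<oplus>\<^bsub>V\<^esub> v) = act h u \<oplus>\<^bsub>V\<^esub> act h v"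
  "c \<in>! K ==> h \<in>! H ==> v \<in>! V ==> act h (c \<odot>\<^bsub>V\<^esub> v) = c \<odot>\<^bsub>V\<^esub> act h v"
  "c \<in>! K ==> h \<in>! H ==> v \<in>! V ==> act (c \<odot> h) v = c \<odot>\<^bsub>V\<^esub> act h v"
  using linear_mapD[OF act_linear2] linear_mapD[OF act_linear1] by auto

lemma t_mult_\<iota>:
  "u \<in>! V ==> h \<in>! H ==> t u \<star> \<iota> h = rw L (\<lambda>x y. s x \<star> \<iota> (y \<otimes> h)) u"
  using t_mult_gen[of u "\<one>\<^bsub>V\<^esub>" h] by simp

lemma pure2_move:
  "r \<in>! V ==> x \<in>! L ==> y \<in>! L ==> x \<bowtie> (s r \<star> y) = (t r \<star> x) \<bowtie> y"
  by (simp add: L2.pure_balanced)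

lemma pure2_push:
  assumes "x \<in>! L" "u \<in>! V" "\<And>a b. a \<in>! V ==> b \<in>! H ==> \<phi> a b \<in>! L"
  shows "x \<bowtie> rw L \<phi> u = rw L2 (\<lambda>a b. x \<bowtie> \<phi> a b) u" "rw L \<phi> u \<bowtie> x = rw L2 (\<lambda>a b. \<phi> a b \<bowtie> x) u"
  using assms rw_push[of L L2 "\<lambda>y. x \<bowtie> y" u \<phi>] rw_push[of L L2 "\<lambda>y. y \<bowtie> x" u \<phi>]
  by (simp_all add: lin)

lemma pure2_push_sw:
  assumes "x \<in>! L" "u \<in>! H" "\<And>a b. a \<in>! H ==> b \<in>! H ==> \<phi> a b \<in>! L"
  shows "x \<bowtie> sw L \<phi> u = sw L2 (\<lambda>a b. x \<bowtie> \<phi> a b) u" "sw L \<phi> u \<bowtie> x = sw L2 (\<lambda>a b. \<phi> a b \<bowtie> x) u"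
  using assms sw_push[of L L2 "\<lambda>y. x \<bowtie> y" u \<phi>] sw_push[of L L2 "\<lambda>y. y \<bowtie> x" u \<phi>]
  by (simp_all add: lin)

text \<open>The target \<open>t r'\<close> in the second leg is expanded by the coaction; its source
  part crosses the tensor sign, becomes a target in the first leg and is expanded again.
  Coassociativity of the coaction assembles the two expansions into the coproduct of
  \<open>r'1 h\<close>.\<close>

lemma cop_bimodule:
  assumes r: "r \<in>! V" and r': "r' \<in>! V" and a: "a \<in>! L"
  shows "cop (s r \<star> t r' \<star> a) = tensor_lift L2 (\<lambda>x y. (s r \<star> x) \<bowtie> (t r' \<star> y)) (cop a)"
proof (rule lift_cop_eqI[symmetric])
  show "bilinear K L L L2 (\<lambda>x y. (s r \<star> x) \<bowtie> (t r' \<star> y))" using r r' by (intro lin) simp_all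
  show "\<forall>x\<in>carrier L. \<forall>q\<in>carrier V. \<forall>y\<in>carrier L. (s r \<star> (t q \<star> x)) \<bowtie> (t r' \<star> y) = (s r \<star> x) \<bowtie> (t r' \<star> (s q \<star> y))"
    using r r' by (simp add: gens_mult3(4)[symmetric] pure2_move)
  show "linear_map K L L2 (\<lambda>a. cop (s r \<star> t r' \<star> a))" using r r' by (intro lin) simp_all
  fix v h assume v: "v \<in>! V" and h: "h \<in>! H"
  let ?\<phi> = "\<lambda>a b c x y. (s (r \<otimes>\<^bsub>V\<^esub> (v \<otimes>\<^bsub>V\<^esub> a)) \<star> \<iota> (b \<otimes> x)) \<bowtie> \<iota> (c \<otimes> y)"
  have "sw L2 (\<lambda>x y. (s r \<star> (s v \<star> \<iota> x)) \<bowtie> (t r' \<star> \<iota> y)) h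
    = sw L2 (\<lambda>x y. rw L2 (\<lambda>a b. rw L2 (\<lambda>c d. ?\<phi> c d b x y) a) r') h"
    using r r' v by (simp add: t_mult_\<iota> pure2_push pure2_move gens_mult3 t_mult_gen V.m_assoc)
  also have "... = sw L2 (\<lambda>x y. rw L2 (\<lambda>a b. sw L2 (\<lambda>c d. ?\<phi> a c d x y) b) r') h"
    using r r' v by (intro tsum_cong refl rho_coassoc) ((intro lin)?, simp_all)+
  also have "... = rw L2 (\<lambda>a b. sw L2 (\<lambda>x y. sw L2 (\<lambda>c d. ?\<phi> a c d x y) b) h) r'"
    using r r' v h by (intro tsum_swap) simp_all
  also have "... = rw L2 (\<lambda>a b. sw L2 (\<lambda>c d. sw L2 (\<lambda>x y. ?\<phi> a c d x y) h) b) r'"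
    using r r' v h by (intro tsum_cong refl tsum_swap) simp_all
  also have "... = rw L2 (\<lambda>a b. cop (s (r \<otimes>\<^bsub>V\<^esub> (v \<otimes>\<^bsub>V\<^esub> a)) \<star> \<iota> (b \<otimes> h))) r'"
  proof (rule tsum_cong[OF refl])
    fix a b assume *: "a \<in>! V" "b \<in>! H"
    have "bilinear K H H L2 (\<lambda>x y. (s (r \<otimes>\<^bsub>V\<^esub> (v \<otimes>\<^bsub>V\<^esub> a)) \<star> \<iota> x) \<bowtie> \<iota> y)" using * r v by (intro lin) simp_all
    then show "sw L2 (\<lambda>c d. sw L2 (\<lambda>x y. ?\<phi> a c d x y) h) b = cop (s (r \<otimes>\<^bsub>V\<^esub> (v \<otimes>\<^bsub>V\<^esub> a)) \<star> \<iota> (b \<otimes> h))"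
      using * r v h by (simp add: coprod_gen sw_mult)
  qed
  also have "... = cop (s r \<star> t r' \<star> (s v \<star> \<iota> h))"
    using r r' v h by (simp add: L.m_assoc t_mult_gen push rw_push[OF coprod_linear] gens_mult3)
  finally show "sw L2 (\<lambda>x y. (s r \<star> (s v \<star> \<iota> x)) \<bowtie> (t r' \<star> \<iota> y)) h = cop (s r \<star> t r' \<star> (s v \<star> \<iota> h))" .
qed (rule a)

lemma cop_s: "r \<in>! V ==> a \<in>! L ==> cop (s r \<star> a) = tensor_lift L2 (\<lambda>x y. (s r \<star> x) \<bowtie> y) (cop a)"
  using cop_bimodule[of r "\<one>\<^bsub>V\<^esub>" a]
    L2.lift_cong[of "cop a" "\<lambda>x y. (s r \<star> x) \<bowtie> (\<one>\<^bsub>L\<^esub> \<star> y)" "\<lambda>x y. (s r \<star> x) \<bowtie> y" L2] by simp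

lemma cop_t: "r \<in>! V ==> a \<in>! L ==> cop (t r \<star> a) = tensor_lift L2 (\<lambda>x y. x \<bowtie> (t r \<star> y)) (cop a)"
  using cop_bimodule[of "\<one>\<^bsub>V\<^esub>" r a]
    L2.lift_cong[of "cop a" "\<lambda>x y. (\<one>\<^bsub>L\<^esub> \<star> x) \<bowtie> (t r \<star> y)" "\<lambda>x y. x \<bowtie> (t r \<star> y)" L2] by simp

lemma coun_bimodule:
  assumes r: "r \<in>! V" and r': "r' \<in>! V" and a: "a \<in>! L"
  shows "cou (s r \<star> t r' \<star> a) = r \<otimes>\<^bsub>V\<^esub> cou a \<otimes>\<^bsub>V\<^esub> r'"
proof (rule L_eqI[of V "\<lambda>a. cou (s r \<star> t r' \<star> a)"])
  fix v h assume v: "v \<in>! V" and h: "h \<in>! H"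
  have "s r \<star> t r' \<star> (s v \<star> \<iota> h) = t r' \<star> (s (r \<otimes>\<^bsub>V\<^esub> v) \<star> \<iota> h)"
    using r r' v h by (simp add: L.m_assoc gens_mult3)
  then show "cou (s r \<star> t r' \<star> (s v \<star> \<iota> h)) = r \<otimes>\<^bsub>V\<^esub> cou (s v \<star> \<iota> h) \<otimes>\<^bsub>V\<^esub> r'"
    using r r' v h kV by (simp add: coun_t_gen coun_gen k_algebra_def)
qed ((intro lin)?, simp_all add: r r' a)+

lemma counit_axiom_left: "a \<in>! L ==> tensor_lift L (\<lambda>x y. s (cou x) \<star> y) (cop a) = a"
proof (rule lift_cop_eqI)
  show "\<forall>x\<in>carrier L. \<forall>r\<in>carrier V. \<forall>y\<in>carrier L. s (cou (t r \<star> x)) \<star> y = s (cou x) \<star> (s r \<star> y)"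
    using coun_bimodule[of "\<one>\<^bsub>V\<^esub>"] by (simp add: gens_mult3)
  fix v h assume v: "v \<in>! V" and h: "h \<in>! H"
  then show "sw L (\<lambda>x y. s (cou (s v \<star> \<iota> x)) \<star> \<iota> y) h = s v \<star> \<iota> h"
    using counit_left[of L "\<lambda>y. s v \<star> \<iota> y" h] by (simp add: coun_gen linear_mapD[OF s_linear] lin)
qed ((intro lin)?, simp_all add: linear_map_id)+

lemma counit_axiom_right: "a \<in>! L ==> tensor_lift L (\<lambda>x y. t (cou y) \<star> x) (cop a) = a"
proof (rule lift_cop_eqI)
  show "\<forall>x\<in>carrier L. \<forall>r\<in>carrier V. \<forall>y\<in>carrier L. t (cou y) \<star> (t r \<star> x) = t (cou (s r \<star> y)) \<star> x"
    using coun_bimodule[of _ "\<one>\<^bsub>V\<^esub>"] by (simp add: gens_mult3)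
  fix v h assume v: "v \<in>! V" and h: "h \<in>! H"
  have "t (cou (\<iota> y)) = \<epsilon> y \<odot>\<^bsub>L\<^esub> \<one>\<^bsub>L\<^esub>" if "y \<in>! H" for y
    using coun_gen[of "\<one>\<^bsub>V\<^esub>" y] that linear_mapD[OF t_linear] by simp
  then show "sw L (\<lambda>x y. t (cou (\<iota> y)) \<star> (s v \<star> \<iota> x)) h = s v \<star> \<iota> h"
    using counit_right[of L "\<lambda>y. s v \<star> \<iota> y" h] v h by (simp add: lin)
qed ((intro lin)?, simp_all add: linear_map_id)+

text \<open>For \<open>\<iota> h\<close>, both sides consist of \<open>\<iota>(h1)\<close> and
  \<open>\<iota>(h3)\<close> with the base element \<open>h2 r\<close> between them, attached by
  \<open>t\<close> to the left leg or by \<open>s\<close> to the right leg. The tensor product over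
  the base identifies the two.\<close>

lemma takeuchi:
  assumes r: "r \<in>! V" and a: "a \<in>! L"
  shows "tensor_lift L2 (\<lambda>x y. (x \<star> t r) \<bowtie> y) (cop a) = tensor_lift L2 (\<lambda>x y. x \<bowtie> (y \<star> s r)) (cop a)"
proof (rule lift_cop_eqI)
  have b: "bilinear K L L L2 (\<lambda>x y. x \<bowtie> (y \<star> s r))" using r by (intro lin) simp_all
  have bal: "bal (\<lambda>x y. x \<bowtie> (y \<star> s r))" using r by (simp add: L.m_assoc pure2_move)
  show "linear_map K L L2 (\<lambda>a. tensor_lift L2 (\<lambda>x y. x \<bowtie> (y \<star> s r)) (cop a))" using lift_cop_linear[OF b bal] .
  show "\<forall>x\<in>carrier L. \<forall>q\<in>carrier V. \<forall>y\<in>carrier L. (t q \<star> x \<star> t r) \<bowtie> y = (x \<star> t r) \<bowtie> (s q \<star> y)"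
    using r by (simp add: L.m_assoc pure2_move)
  fix v h assume v: "v \<in>! V" and h: "h \<in>! H"
  have "sw L2 (\<lambda>x y. (s v \<star> \<iota> x \<star> t r) \<bowtie> \<iota> y) h = sw L2 (\<lambda>x y. sw L2 (\<lambda>c d. (s v \<star> (t (act d r) \<star> \<iota> c)) \<bowtie> \<iota> y) x) h"
    using v r h by (simp add: L.m_assoc \<iota>t push pure2_push_sw)
  also have "... = sw L2 (\<lambda>x y. sw L2 (\<lambda>c d. (s v \<star> (t (act c r) \<star> \<iota> x)) \<bowtie> \<iota> d) y) h"
    using v r h by (intro coassoc) ((intro lin)?, simp_all)+
  also have "... = sw L2 (\<lambda>x y. (s v \<star> \<iota> x) \<bowtie> (\<iota> y \<star> s r)) h"
    using v r h by (simp add: \<iota>s pure2_push_sw pure2_move gens_mult3)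
  also have "... = tensor_lift L2 (\<lambda>x y. x \<bowtie> (y \<star> s r)) (cop (s v \<star> \<iota> h))"
    using lift_cop_gen[OF b bal v h] by simp
  finally show "sw L2 (\<lambda>x y. (s v \<star> \<iota> x \<star> t r) \<bowtie> \<iota> y) h = tensor_lift L2 (\<lambda>x y. x \<bowtie> (y \<star> s r)) (cop (s v \<star> \<iota> h))" .
qed ((intro lin)?, simp_all add: r a)+

text \<open>Right multiplication by \<open>m \<otimes> n\<close> makes sense on the whole tensor
  square, but as a function of \<open>m\<close> and \<open>n\<close> it is shown to be balanced on
  the image of the coproduct, by \<open>takeuchi\<close>. With this the product lifts in its second
  factor, and generators are compared by coassociativity in \<open>H\<close>.\<close>

lemma cop_mult:
  assumes a: "a \<in>! L" and b: "b \<in>! L"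
  shows "cop (a \<star> b) = cop a \<otimes>\<^bsub>L2\<^esub> cop b"
proof -
  define F where "F m n X = tensor_lift L2 (\<lambda>x y. (x \<star> m) \<bowtie> (y \<star> n)) X" for m n X
  have Fb: "bilinear K L L L2 (\<lambda>x y. (x \<star> m) \<bowtie> (y \<star> n))" if "m \<in>! L" "n \<in>! L" for m n
    using that by (intro lin) simp_all
  have Fbal: "bal (\<lambda>x y. (x \<star> m) \<bowtie> (y \<star> n))" if "m \<in>! L" "n \<in>! L" for m n
    using that by (simp add: L.m_assoc pure2_move)
  have Flin: "linear_map K L2 L2 (\<lambda>X. F m n X)" if "m \<in>! L" "n \<in>! L" for m n
    unfolding F_def using L2.lift_linear[OF Fb[OF that] Fbal[OF that]] .
  have Fp: "F m n (x \<bowtie> y) = (x \<star> m) \<bowtie> (y \<star> n)" if "m \<in>! L" "n \<in>! L" "x \<in>! L" "y \<in>! L" for m n x y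
    unfolding F_def using L2.lift_pure[OF bilinear_biadditive[OF Fb] Fbal] that by simp
  have Fsum: "F m n X = tsum L L L2 (\<lambda>x y. (x \<star> m) \<bowtie> (y \<star> n)) X" if "m \<in>! L" "n \<in>! L" "X \<in>! L2" for m n X
    unfolding F_def using that L2.lift_rsum[OF bilinear_biadditive[OF Fb] Fbal]
    by (simp add: tsum_rsum L2.rep_in)
  have Ob: "bilinear K L L L2 (\<lambda>m n. F m n (cop a))" if a: "a \<in>! L" for a
  proof (intro bilinearI)
    fix n assume n: "n \<in>! L"
    show "linear_map K L L2 (\<lambda>m. F m n (cop a))"
      by (rule linear_map_cong[OF _ modL, where f = "\<lambda>m. tsum L L L2 (\<lambda>x y. (x \<star> m) \<bowtie> (y \<star> n)) (cop a)"], intro lin)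
        (simp_all add: n a Fsum L2.rep_in)
    show "linear_map K L L2 (\<lambda>m. F n m (cop a))"
      by (rule linear_map_cong[OF _ modL, where f = "\<lambda>m. tsum L L L2 (\<lambda>x y. (x \<star> n) \<bowtie> (y \<star> m)) (cop a)"], intro lin)
        (simp_all add: n a Fsum L2.rep_in)
  qed simp
  have Obal: "bal (\<lambda>m n. F m n (cop a))" if a: "a \<in>! L" for a
  proof (intro ballI)
    fix m r n assume *: "m \<in>! L" "r \<in>! V" "n \<in>! L"
    let ?f = "\<lambda>x y. (x \<star> t r) \<bowtie> y" and ?g = "\<lambda>x y. x \<bowtie> (y \<star> s r)"
    have f: "bilinear K L L L2 ?f" "bal ?f" and g: "bilinear K L L L2 ?g" "bal ?g"
      using * by ((intro lin)?, simp_all add: L.m_assoc pure2_move)+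
    have F1: "F m n (tensor_lift L2 ?f X) = F (t r \<star> m) n X" if "X \<in>! L2" for X
      by (rule L2.linear_eqI[where f = "\<lambda>X. F m n (tensor_lift L2 ?f X)" and g = "F (t r \<star> m) n",
            OF linear_comp[OF L2.lift_linear[OF f] Flin] Flin _ _ that])
        (use * in \<open>simp_all add: L2.lift_pure[OF bilinear_biadditive[OF f(1)] f(2)] Fp L.m_assoc\<close>)
    have F2: "F m n (tensor_lift L2 ?g X) = F m (s r \<star> n) X" if "X \<in>! L2" for X
      by (rule L2.linear_eqI[where f = "\<lambda>X. F m n (tensor_lift L2 ?g X)" and g = "F m (s r \<star> n)",
            OF linear_comp[OF L2.lift_linear[OF g] Flin] Flin _ _ that])
        (use * in \<open>simp_all add: L2.lift_pure[OF bilinear_biadditive[OF g(1)] g(2)] Fp L.m_assoc\<close>)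
    show "F (t r \<star> m) n (cop a) = F m (s r \<star> n) (cop a)"
      using trans[OF F1[OF cop_closed[OF a], symmetric] trans[OF arg_cong[OF takeuchi[OF *(2) a], where f = "F m n"] F2[OF cop_closed[OF a]]]] .
  qed
  have "tensor_lift L2 (\<lambda>m n. F m n (cop a)) (cop b) = cop (a \<star> b)"
  proof (rule lift_cop_eqI[OF Ob[OF a] Obal[OF a] _ _ b])
    show "linear_map K L L2 (\<lambda>b. cop (a \<star> b))" using a by (intro lin) simp_all
    fix w h assume w: "w \<in>! V" and h: "h \<in>! H"
    show "sw L2 (\<lambda>x y. F (s w \<star> \<iota> x) (\<iota> y) (cop a)) h = cop (a \<star> (s w \<star> \<iota> h))"
    proof (rule L_eqI[OF _ _ _ _ a])
      show "linear_map K L L2 (\<lambda>a. sw L2 (\<lambda>x y. F (s w \<star> \<iota> x) (\<iota> y) (cop a)) h)"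
        using w h by (intro lin linear_comp[OF coprod_linear Flin]) simp_all
      show "linear_map K L L2 (\<lambda>a. cop (a \<star> (s w \<star> \<iota> h)))" using w h by (intro lin) simp_all
      fix v g assume v: "v \<in>! V" and g: "g \<in>! H"
      let ?\<phi> = "\<lambda>a b c x y. (s (v \<otimes>\<^bsub>V\<^esub> act a w) \<star> \<iota> (b \<otimes> x)) \<bowtie> \<iota> (c \<otimes> y)"
      have "sw L2 (\<lambda>x y. F (s w \<star> \<iota> x) (\<iota> y) (cop (s v \<star> \<iota> g))) h
        = sw L2 (\<lambda>x y. sw L2 (\<lambda>c d. sw L2 (\<lambda>a b. ?\<phi> a b d x y) c) g) h"
        using v g w h by (simp add: coprod_gen sw_push[OF Flin] Fp gen_mult_gen gens_mult pure2_push_sw)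
      also have "... = sw L2 (\<lambda>x y. sw L2 (\<lambda>a c. sw L2 (\<lambda>b d. ?\<phi> a b d x y) c) g) h"
        using v g w h by (intro tsum_cong refl coassoc) ((intro lin)?, simp_all)+
      also have "... = sw L2 (\<lambda>a c. sw L2 (\<lambda>x y. sw L2 (\<lambda>b d. ?\<phi> a b d x y) c) h) g"
        using v g w h by (intro tsum_swap) simp_all
      also have "... = sw L2 (\<lambda>a c. sw L2 (\<lambda>b d. sw L2 (\<lambda>x y. ?\<phi> a b d x y) h) c) g"
        using v g w h by (intro tsum_cong refl tsum_swap) simp_all
      also have "... = sw L2 (\<lambda>a c. cop (s (v \<otimes>\<^bsub>V\<^esub> act a w) \<star> \<iota> (c \<otimes> h))) g"
      proof (rule tsum_cong[OF refl])
        fix a c assume *: "a \<in>! H" "c \<in>! H"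
        have "bilinear K H H L2 (\<lambda>x y. (s (v \<otimes>\<^bsub>V\<^esub> act a w) \<star> \<iota> x) \<bowtie> \<iota> y)" using * v w by (intro lin) simp_all
        then show "sw L2 (\<lambda>b d. sw L2 (\<lambda>x y. ?\<phi> a b d x y) h) c = cop (s (v \<otimes>\<^bsub>V\<^esub> act a w) \<star> \<iota> (c \<otimes> h))"
          using * v w h by (simp add: coprod_gen sw_mult)
      qed
      also have "... = cop (s v \<star> \<iota> g \<star> (s w \<star> \<iota> h))"
        using v g w h by (simp add: gen_mult_gen sw_push[OF coprod_linear])
      finally show "sw L2 (\<lambda>x y. F (s w \<star> \<iota> x) (\<iota> y) (cop (s v \<star> \<iota> g))) h = cop (s v \<star> \<iota> g \<star> (s w \<star> \<iota> h))" .
    qed simp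
  qed
  then show ?thesis unfolding L2.mult_T F_def by simp
qed

text \<open>Left action of the base on the tensor square, over which the outer tensor sign of the
  triple tensor product is balanced.\<close>

definition "la3 r = tensor_lift L2 (\<lambda>x y. (s r \<star> x) \<bowtie> y)"
abbreviation "L3 \<equiv> tensor L L2 (carrier V) (\<lambda>x r. t r \<star> x) (\<lambda>r. tensor_lift L2 (\<lambda>x y. (s r \<star> x) \<bowtie> y))"

lemma la3:
  assumes r: "r \<in>! V"
  shows "linear_map K L2 L2 (la3 r)" "x \<in>! L ==> y \<in>! L ==> la3 r (x \<bowtie> y) = (s r \<star> x) \<bowtie> y"
    "a \<in>! L ==> la3 r (cop a) = cop (s r \<star> a)"
proof -
  have b: "bilinear K L L L2 (\<lambda>x y. (s r \<star> x) \<bowtie> y)" using r by (intro lin) simp_all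
  have bal: "bal (\<lambda>x y. (s r \<star> x) \<bowtie> y)" using r by (simp add: gens_mult3(4) pure2_move)
  show "linear_map K L2 L2 (la3 r)" unfolding la3_def using L2.lift_linear[OF b bal] .
  show "x \<in>! L ==> y \<in>! L ==> la3 r (x \<bowtie> y) = (s r \<star> x) \<bowtie> y"
    unfolding la3_def using L2.lift_pure[OF bilinear_biadditive[OF b] bal] .
  show "a \<in>! L ==> la3 r (cop a) = cop (s r \<star> a)" unfolding la3_def using cop_s[OF r] by simp
qed

sublocale L3: balanced_tensor K L L2 "carrier V" "\<lambda>x r. t r \<star> x" la3 L3
proof (rule balanced_tensor.intro)
  fix c assume c: "c \<in>! K"
  interpret M2: module K L2 by (rule L2.module_T)
  have 1: "t (c \<odot>\<^bsub>V\<^esub> \<one>\<^bsub>V\<^esub>) = c \<odot>\<^bsub>L\<^esub> \<one>\<^bsub>L\<^esub>" "s (c \<odot>\<^bsub>V\<^esub> \<one>\<^bsub>V\<^esub>) = c \<odot>\<^bsub>L\<^esub> \<one>\<^bsub>L\<^esub>"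
    using c linear_mapD(3)[OF t_linear] linear_mapD(3)[OF s_linear] by simp_all
  have r: "c \<odot>\<^bsub>V\<^esub> \<one>\<^bsub>V\<^esub> \<in>! V" using c by simp
  have "la3 (c \<odot>\<^bsub>V\<^esub> \<one>\<^bsub>V\<^esub>) n = c \<odot>\<^bsub>L2\<^esub> n" if "n \<in>! L2" for n
    by (rule L2.linear_eqI[OF la3(1)[OF r] linear_map_smult[OF linear_map_id] _ _ that])
      (use c r in \<open>simp_all add: la3(2) 1 L2.smult_pure\<close>)
  then show "\<exists>r\<in>carrier V. (\<forall>m\<in>carrier L. t r \<star> m = c \<odot>\<^bsub>L\<^esub> m) \<and> (\<forall>n\<in>carrier L2. la3 r n = c \<odot>\<^bsub>L2\<^esub> n)"
    using c 1 by (intro bexI[of _ "c \<odot>\<^bsub>V\<^esub> \<one>\<^bsub>V\<^esub>"]) auto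
qed (auto simp: la3_def[abs_def] linear_map_mult linear_map_id la3(1)[unfolded la3_def])

declare L3.module_T [simp] L3.abelian_T [simp]

lemma pure3_linear [lin]:
  "linear_map K Z L f ==> y \<in>! L2 ==> linear_map K Z L3 (\<lambda>z. f z \<boxtimes>\<^bsub>L3\<^esub> y)"
  "linear_map K Z L2 g ==> x \<in>! L ==> linear_map K Z L3 (\<lambda>z. x \<boxtimes>\<^bsub>L3\<^esub> g z)"
  using linear_comp[OF _ bilinearD(2)[OF L3.pure_bilinear]]
    linear_comp[OF _ bilinearD(3)[OF L3.pure_bilinear]] by blast+

lemma cop_coassoc:
  assumes a: "a \<in>! L"
  shows "tensor_lift L3 (\<lambda>x y. tensor_lift L3 (\<lambda>x1 x2. x1 \<boxtimes>\<^bsub>L3\<^esub> (x2 \<bowtie> y)) (cop x)) (cop a)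
    = tensor_lift L3 (\<lambda>x y. x \<boxtimes>\<^bsub>L3\<^esub> cop y) (cop a)"
proof -
  define F where "F y X = tensor_lift L3 (\<lambda>x1 x2. x1 \<boxtimes>\<^bsub>L3\<^esub> (x2 \<bowtie> y)) X" for y X
  have b: "bilinear K L L L3 (\<lambda>x1 x2. x1 \<boxtimes>\<^bsub>L3\<^esub> (x2 \<bowtie> y))" if "y \<in>! L" for y
    using that by (intro lin) simp_all
  have bal: "bal (\<lambda>x1 x2. x1 \<boxtimes>\<^bsub>L3\<^esub> (x2 \<bowtie> y))" if "y \<in>! L" for y
    using that by (simp add: L3.pure_balanced la3(2))
  have F: "linear_map K L2 L3 (\<lambda>X. F y X)" if "y \<in>! L" for y
    unfolding F_def using L2.lift_linear[OF b[OF that] bal[OF that]] .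
  have Fp: "F y (x1 \<bowtie> x2) = x1 \<boxtimes>\<^bsub>L3\<^esub> (x2 \<bowtie> y)" if "x1 \<in>! L" "x2 \<in>! L" "y \<in>! L" for x1 x2 y
    unfolding F_def using L2.lift_pure[OF bilinear_biadditive[OF b] bal] that by simp
  have Fsum: "F y X = tsum L L L3 (\<lambda>x1 x2. x1 \<boxtimes>\<^bsub>L3\<^esub> (x2 \<bowtie> y)) X" if "y \<in>! L" "X \<in>! L2" for y X
    unfolding F_def using that L2.lift_rsum[OF bilinear_biadditive[OF b] bal] by (simp add: tsum_rsum L2.rep_in)
  have gb: "bilinear K L L L3 (\<lambda>x y. x \<boxtimes>\<^bsub>L3\<^esub> cop y)" by (intro lin) simp_all
  have gbal: "bal (\<lambda>x y. x \<boxtimes>\<^bsub>L3\<^esub> cop y)" by (simp add: L3.pure_balanced la3(3))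
  show ?thesis
    unfolding F_def[symmetric]
  proof (rule lift_cop_eqI[OF _ _ _ _ a])
    show "bilinear K L L L3 (\<lambda>x y. F y (cop x))"
    proof (intro bilinearI)
      fix y assume y: "y \<in>! L"
      show "linear_map K L L3 (\<lambda>x. F y (cop x))" using linear_comp[OF coprod_linear F[OF y]] .
      show "linear_map K L L3 (\<lambda>z. F z (cop y))"
        by (rule linear_map_cong[OF _ modL, where f = "\<lambda>z. tsum L L L3 (\<lambda>x1 x2. x1 \<boxtimes>\<^bsub>L3\<^esub> (x2 \<bowtie> z)) (cop y)"], intro lin)
          (simp_all add: y Fsum L2.rep_in)
    qed simp
    \<comment> \<open>By \<open>cop_t\<close> the target \<open>t r\<close> enters the second leg of
      the inner coproduct, next to \<open>y\<close>, and crosses the tensor sign there as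
      \<open>s r\<close>.\<close>
    show "\<forall>x\<in>carrier L. \<forall>r\<in>carrier V. \<forall>y\<in>carrier L. F y (cop (t r \<star> x)) = F (s r \<star> y) (cop x)"
    proof (intro ballI)
      fix x r y assume *: "x \<in>! L" "r \<in>! V" "y \<in>! L"
      let ?f = "\<lambda>x y. x \<bowtie> (t r \<star> y)"
      have f: "bilinear K L L L2 ?f" "bal ?f"
        using * by ((intro lin)?, simp_all add: pure2_move gens_mult3(4)[symmetric])+
      have "F y (tensor_lift L2 ?f X) = F (s r \<star> y) X" if "X \<in>! L2" for X
        by (rule L2.linear_eqI[where f = "\<lambda>X. F y (tensor_lift L2 ?f X)" and g = "F (s r \<star> y)",
              OF linear_comp[OF L2.lift_linear[OF f] F] F _ _ that])
          (use * in \<open>simp_all add: L2.lift_pure[OF bilinear_biadditive[OF f(1)] f(2)] Fp pure2_move\<close>)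
      then show "F y (cop (t r \<star> x)) = F (s r \<star> y) (cop x)" using * by (simp add: cop_t)
    qed
    show "linear_map K L L3 (\<lambda>a. tensor_lift L3 (\<lambda>x y. x \<boxtimes>\<^bsub>L3\<^esub> cop y) (cop a))" using lift_cop_linear[OF gb gbal] .
    fix v h assume v: "v \<in>! V" and h: "h \<in>! H"
    have c\<iota>: "cop (\<iota> y) = sw L2 (\<lambda>a b. \<iota> a \<bowtie> \<iota> b) y" if "y \<in>! H" for y
      using coprod_gen[of "\<one>\<^bsub>V\<^esub>" y] that by simp
    have "sw L3 (\<lambda>x y. F (\<iota> y) (cop (s v \<star> \<iota> x))) h = sw L3 (\<lambda>x y. sw L3 (\<lambda>a b. (s v \<star> \<iota> a) \<boxtimes>\<^bsub>L3\<^esub> (\<iota> b \<bowtie> \<iota> y)) x) h"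
      using v h by (simp add: coprod_gen sw_push[OF F] Fp)
    also have "... = sw L3 (\<lambda>x y. sw L3 (\<lambda>a b. (s v \<star> \<iota> x) \<boxtimes>\<^bsub>L3\<^esub> (\<iota> a \<bowtie> \<iota> b)) y) h"
      using v h by (intro coassoc) ((intro lin)?, simp_all)+
    also have "... = sw L3 (\<lambda>x y. (s v \<star> \<iota> x) \<boxtimes>\<^bsub>L3\<^esub> cop (\<iota> y)) h"
    proof (rule tsum_cong[OF refl])
      fix x y assume *: "x \<in>! H" "y \<in>! H"
      show "sw L3 (\<lambda>a b. (s v \<star> \<iota> x) \<boxtimes>\<^bsub>L3\<^esub> (\<iota> a \<bowtie> \<iota> b)) y = (s v \<star> \<iota> x) \<boxtimes>\<^bsub>L3\<^esub> cop (\<iota> y)"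
        unfolding c\<iota>[OF *(2)] using * v
        by (intro sw_push[symmetric, where f = "\<lambda>X. (s v \<star> \<iota> x) \<boxtimes>\<^bsub>L3\<^esub> X"] lin) (simp_all add: linear_map_id)
    qed
    also have "... = tensor_lift L3 (\<lambda>x y. x \<boxtimes>\<^bsub>L3\<^esub> cop y) (cop (s v \<star> \<iota> h))"
      using lift_cop_gen[OF gb gbal v h] by simp
    finally show "sw L3 (\<lambda>x y. F (\<iota> y) (cop (s v \<star> \<iota> x))) h = tensor_lift L3 (\<lambda>x y. x \<boxtimes>\<^bsub>L3\<^esub> cop y) (cop (s v \<star> \<iota> h))" .
  qed
qed

lemma coun_gen_gen:
  assumes "v \<in>! V" "g \<in>! H" "w \<in>! V" "h \<in>! H"
  shows "cou ((s v \<star> \<iota> g) \<star> (s w \<star> \<iota> h)) = \<epsilon> h \<odot>\<^bsub>V\<^esub> (v \<otimes>\<^bsub>V\<^esub> act g w)"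
proof -
  have "cou ((s v \<star> \<iota> g) \<star> (s w \<star> \<iota> h)) = sw V (\<lambda>x y. \<epsilon> y \<odot>\<^bsub>V\<^esub> (\<epsilon> h \<odot>\<^bsub>V\<^esub> (v \<otimes>\<^bsub>V\<^esub> act x w))) g"
    using assms by (simp add: gen_mult_gen sw_push[OF coun_linear] coun_gen VM.smult_assoc1)
  also have "... = \<epsilon> h \<odot>\<^bsub>V\<^esub> (v \<otimes>\<^bsub>V\<^esub> act g w)" using assms by (intro counit_right lin) simp_all
  finally show ?thesis .
qed

lemma coun_gen_t:
  assumes "v \<in>! V" "g \<in>! H" "u \<in>! V"
  shows "cou ((s v \<star> \<iota> g) \<star> t u) = v \<otimes>\<^bsub>V\<^esub> act g u"
proof -
  have "(s v \<star> \<iota> g) \<star> t u = sw L (\<lambda>x y. t (act y u) \<star> (s v \<star> \<iota> x)) g"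
    using assms by (simp add: L.m_assoc \<iota>t push gens_mult3)
  then have "cou ((s v \<star> \<iota> g) \<star> t u) = sw V (\<lambda>x y. \<epsilon> x \<odot>\<^bsub>V\<^esub> (v \<otimes>\<^bsub>V\<^esub> act y u)) g"
    using assms by (simp add: sw_push[OF coun_linear] coun_t_gen)
  also have "... = v \<otimes>\<^bsub>V\<^esub> act g u" using assms by (intro counit_left lin) simp_all
  finally show ?thesis .
qed

lemma coun_mult:
  assumes a: "a \<in>! L" and b: "b \<in>! L"
  shows "cou (a \<star> b) = cou (a \<star> s (cou b))" "cou (a \<star> b) = cou (a \<star> t (cou b))"
proof -
  have g: "cou (x \<star> s (cou y)) = cou (x \<star> y) \<and> cou (x \<star> t (cou y)) = cou (x \<star> y)"
    if "x = s v \<star> \<iota> g" "y = s w \<star> \<iota> h" "v \<in>! V" "g \<in>! H" "w \<in>! V" "h \<in>! H" for x y v g w h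
    using that coun_gen_gen[of v g w \<one>] coun_gen_t[of v g w] kV
    by (simp add: coun_gen coun_gen_gen linear_mapD(3)[OF s_linear] linear_mapD(3)[OF t_linear]
        linear_mapD(3)[OF coun_linear] k_algebra_def)
  \<comment> \<open>\<open>L_eqI\<close> is used twice: first \<open>a\<close> becomes arbitrary
    while the second factor stays a generator, afterwards \<open>b\<close> becomes
    arbitrary.\<close>
  have s1: "cou (a \<star> y) = cou (a \<star> s (cou y))" if y: "y = s w \<star> \<iota> h" "w \<in>! V" "h \<in>! H" for y w h
    by (rule L_eqI[OF _ _ _ _ a, of V "\<lambda>a. cou (a \<star> y)"]; (intro lin)?; simp add: linear_map_id g[OF refl refl] y)
  have t1: "cou (a \<star> y) = cou (a \<star> t (cou y))" if y: "y = s w \<star> \<iota> h" "w \<in>! V" "h \<in>! H" for y w h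
    by (rule L_eqI[OF _ _ _ _ a, of V "\<lambda>a. cou (a \<star> y)"]; (intro lin)?; simp add: linear_map_id g[OF refl refl] y)
  show "cou (a \<star> b) = cou (a \<star> s (cou b))"
    by (rule L_eqI[OF _ _ _ _ b, of V "\<lambda>b. cou (a \<star> b)"]; (intro lin)?; simp add: linear_map_id s1[OF refl] a)
  show "cou (a \<star> b) = cou (a \<star> t (cou b))"
    by (rule L_eqI[OF _ _ _ _ b, of V "\<lambda>b. cou (a \<star> b)"]; (intro lin)?; simp add: linear_map_id t1[OF refl] a)
qed

theorem left_bialgebroid: "left_bialgebroid K Bd"
  unfolding left_bialgebroid_def Let_def
proof (intro conjI ballI)
  show "cop \<one>\<^bsub>L\<^esub> = \<one>\<^bsub>L\<^esub> \<bowtie> \<one>\<^bsub>L\<^esub>"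
    using coprod_gen[of "\<one>\<^bsub>V\<^esub>" \<one>] sw_one[of L2 "\<lambda>x y. \<iota> x \<bowtie> \<iota> y"] by (simp add: lin)
  show "cou \<one>\<^bsub>L\<^esub> = \<one>\<^bsub>V\<^esub>" using coun_gen[of "\<one>\<^bsub>V\<^esub>" \<one>] by simp
qed (rule kV kL s_hom t_hom st coprod_linear coun_linear cop_bimodule coun_bimodule cop_coassoc
    counit_axiom_left counit_axiom_right takeuchi cop_mult coun_mult; assumption)+

section \<open>The antipode and its inverse\<close>

definition "\<sigma> = Lift L (\<lambda>v h. \<iota> (Si h) \<star> t v)"
text \<open>This is the expression \<open>\<Sum> S(S(h_i)) p_i v\<close> of Lu's antipode when the
  coaction of \<open>v\<close> is written over dual bases as the sum of
  \<open>p_i v \<otimes> h_i\<close>.\<close>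

definition "q v = rw V (\<lambda>x y. act (S (S y)) x) v"
definition "\<tau> = Lift L (\<lambda>v h. \<iota> (S h) \<star> t (q v))"

lemma q_linear: "linear_map K V V q"
  unfolding q_def by (intro lin) simp_all

lemma \<sigma>_linear: "linear_map K L L \<sigma>" and \<sigma>_gen: "v \<in>! V ==> h \<in>! H ==> \<sigma> (s v \<star> \<iota> h) = \<iota> (Si h) \<star> t v"
proof -
  have b: "bilinear K V H L (\<lambda>v h. \<iota> (Si h) \<star> t v)" by (intro lin) simp_all
  show "linear_map K L L \<sigma>" "v \<in>! V ==> h \<in>! H ==> \<sigma> (s v \<star> \<iota> h) = \<iota> (Si h) \<star> t v"
    unfolding \<sigma>_def using Lift_linear[OF b] Lift_gen[OF b] by auto
qed

lemma q_closed [simp]: "v \<in>! V ==> q v \<in>! V" using linear_mapD(1)[OF q_linear] .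
lemmas q_linear' [lin] = linear_comp[OF _ q_linear]

lemma \<tau>_linear: "linear_map K L L \<tau>" and \<tau>_gen: "v \<in>! V ==> h \<in>! H ==> \<tau> (s v \<star> \<iota> h) = \<iota> (S h) \<star> t (q v)"
proof -
  have b: "bilinear K V H L (\<lambda>v h. \<iota> (S h) \<star> t (q v))" by (intro lin) simp_all
  show "linear_map K L L \<tau>" "v \<in>! V ==> h \<in>! H ==> \<tau> (s v \<star> \<iota> h) = \<iota> (S h) \<star> t (q v)"
    unfolding \<tau>_def using Lift_linear[OF b] Lift_gen[OF b] by auto
qed

lemmas st_linear' [lin] = linear_comp[OF _ \<sigma>_linear] linear_comp[OF _ \<tau>_linear]

lemma st_closed [simp]: "a \<in>! L ==> \<sigma> a \<in>! L" "a \<in>! L ==> \<tau> a \<in>! L"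
  using linear_mapD(1)[OF \<sigma>_linear] linear_mapD(1)[OF \<tau>_linear] by auto

lemma \<sigma>_s: "v \<in>! V ==> \<sigma> (s v) = t v" and \<sigma>_\<iota>: "h \<in>! H ==> \<sigma> (\<iota> h) = \<iota> (Si h)"
  using \<sigma>_gen[of v \<one>] \<sigma>_gen[of "\<one>\<^bsub>V\<^esub>" h] by simp_all

lemma \<iota>_Si_t:
  assumes "y \<in>! H" "u \<in>! V"
  shows "\<iota> (Si y) \<star> t u = sw L (\<lambda>a b. t (act (Si a) u) \<star> \<iota> (Si b)) y"
  using assms by (simp add: \<iota>t, subst sw_Si) (auto intro!: lin)

lemma \<iota>_S_t:
  assumes "y \<in>! H" "u \<in>! V"
  shows "\<iota> (S y) \<star> t u = sw L (\<lambda>a b. t (act (S a) u) \<star> \<iota> (S b)) y"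
  using assms by (simp add: \<iota>t, subst sw_S) (auto intro!: lin)

text \<open>Once \<open>t\<close> is moved to the left of \<open>\<iota>\<close>, the acting
  elements meet as \<open>S^-1(h2) h1\<close> and collapse. This identity is what makes
  \<open>\<sigma>\<close> reverse products.\<close>

lemma \<iota>_Si_t_act:
  assumes h: "h \<in>! H" and v: "v \<in>! V"
  shows "sw L (\<lambda>x y. \<iota> (Si y) \<star> t (act x v)) h = t v \<star> \<iota> (Si h)"
proof -
  have "sw L (\<lambda>x y. \<iota> (Si y) \<star> t (act x v)) h = sw L (\<lambda>x y. sw L (\<lambda>a b. t (act (Si a \<otimes> x) v) \<star> \<iota> (Si b)) y) h"
    using h v by (simp add: \<iota>_Si_t)
  also have "... = sw L (\<lambda>r b. sw L (\<lambda>x a. t (act (Si a \<otimes> x) v) \<star> \<iota> (Si b)) r) h"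
    using h v by (intro coassoc[symmetric]) ((intro lin)?, simp_all del: act_mult)+
  also have "... = sw L (\<lambda>r b. \<epsilon> r \<odot>\<^bsub>L\<^esub> (t (act \<one> v) \<star> \<iota> (Si b))) h"
    using v by (intro tsum_cong refl antipode_inv_left[where f = "\<lambda>w. t (act w v) \<star> \<iota> (Si _)"]) ((intro lin)?, simp_all)+
  also have "... = t v \<star> \<iota> (Si h)"
    using h v counit_left[of L "\<lambda>b. t v \<star> \<iota> (Si b)" h] by (simp add: lin)
  finally show ?thesis .
qed

lemma \<sigma>_mult:
  assumes a: "a \<in>! L" and b: "b \<in>! L"
  shows "\<sigma> (a \<star> b) = \<sigma> b \<star> \<sigma> a"
proof -
  have g: "\<sigma> ((s v \<star> \<iota> g) \<star> (s w \<star> \<iota> h)) = \<sigma> (s w \<star> \<iota> h) \<star> \<sigma> (s v \<star> \<iota> g)"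
    if *: "v \<in>! V" "g \<in>! H" "w \<in>! V" "h \<in>! H" for v g w h
  proof -
    have "\<sigma> ((s v \<star> \<iota> g) \<star> (s w \<star> \<iota> h)) = sw L (\<lambda>x y. \<iota> (Si (y \<otimes> h)) \<star> t (v \<otimes>\<^bsub>V\<^esub> act x w)) g"
      using * by (simp add: gen_mult_gen sw_push[OF \<sigma>_linear] \<sigma>_gen del: Si_mult)
    also have "... = sw L (\<lambda>x y. \<iota> (Si h) \<star> (\<iota> (Si y) \<star> t (act x w) \<star> t v)) g"
      using * by (simp add: gens_mult[symmetric] L.m_assoc)
    also have "... = \<iota> (Si h) \<star> (sw L (\<lambda>x y. \<iota> (Si y) \<star> t (act x w)) g \<star> t v)"
      using * by (simp add: push)
    finally show ?thesis using * by (simp add: \<iota>_Si_t_act \<sigma>_gen L.m_assoc)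
  qed
  have 1: "\<sigma> (a \<star> (s w \<star> \<iota> h)) = \<sigma> (s w \<star> \<iota> h) \<star> \<sigma> a" if "w \<in>! V" "h \<in>! H" for w h
    by (rule L_eqI[OF _ _ _ _ a, of L "\<lambda>a. \<sigma> (a \<star> (s w \<star> \<iota> h))"]; (intro lin)?; simp add: linear_map_id g that)
  show ?thesis
    by (rule L_eqI[OF _ _ _ _ b, of L "\<lambda>b. \<sigma> (a \<star> b)"]; (intro lin)?; simp add: linear_map_id 1 a)
qed

text \<open>Moving \<open>t\<close> to the left brings together \<open>g2 S^-1(g1)\<close>. The
  action on the base is thereby realised inside the total algebra by a kind of conjugation on
  targets, so that \<open>\<sigma>\<close> can be applied to it.\<close>

lemma t_act:
  assumes g: "g \<in>! H" and r: "r \<in>! V"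
  shows "sw L (\<lambda>a b. \<iota> b \<star> t r \<star> \<iota> (Si a)) g = t (act g r)"
proof -
  have "sw L (\<lambda>a b. \<iota> b \<star> t r \<star> \<iota> (Si a)) g = sw L (\<lambda>a b. sw L (\<lambda>c d. t (act d r) \<star> \<iota> (c \<otimes> Si a)) b) g"
    using g r by (simp add: \<iota>t push L.m_assoc gens_mult)
  also have "... = sw L (\<lambda>u d. sw L (\<lambda>a c. t (act d r) \<star> \<iota> (c \<otimes> Si a)) u) g"
    using g r by (intro coassoc[symmetric]) ((intro lin)?, simp_all)+
  also have "... = sw L (\<lambda>u d. \<epsilon> u \<odot>\<^bsub>L\<^esub> (t (act d r) \<star> \<iota> \<one>)) g"
    using r by (intro tsum_cong refl antipode_inv_right[where f = "\<lambda>w. t (act _ r) \<star> \<iota> w"]) ((intro lin)?, simp_all)+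
  also have "... = t (act g r)"
    using g r counit_left[of L "\<lambda>d. t (act d r)" g] by (simp add: lin)
  finally show ?thesis .
qed

lemma \<sigma>_t: "v \<in>! V ==> \<sigma> (t v) = rw L (\<lambda>x y. \<iota> (Si y) \<star> t x) v"
  by (simp add: t_eq rw_push[OF \<sigma>_linear] \<sigma>_gen cong: tsum_cong)

text \<open>By \<open>t_act\<close> and antimultiplicativity, the left-hand side is the sum of
  \<open>\<iota>(v2 S^-1(v1)) t(v0) \<iota>(S v3)\<close>. The first factor collapses; expanding the
  remaining target by the coaction leaves \<open>s(v0) \<iota>(v1 S(v2))\<close>, which collapses as
  well. The twist \<open>q\<close> is chosen for this computation.\<close>

lemma \<sigma>_t_q:
  assumes v: "v \<in>! V"
  shows "\<sigma> (t (q v)) = s v"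
proof -
  have 1: "\<sigma> (t (act (S (S y)) x)) = sw L (\<lambda>a b. \<iota> a \<star> \<sigma> (t x) \<star> \<iota> (S b)) y" if *: "x \<in>! V" "y \<in>! H" for x y
  proof -
    have b1: "bilinear K H H L (\<lambda>a b. \<iota> b \<star> t x \<star> \<iota> (Si a))" "bilinear K H H L (\<lambda>a b. \<iota> (S a) \<star> t x \<star> \<iota> b)"
      using * by (intro lin; simp)+
    have "t (act (S (S y)) x) = sw L (\<lambda>a b. \<iota> (S (S b)) \<star> t x \<star> \<iota> (S a)) y"
      using * t_act[of "S (S y)" x] by (simp add: sw_S[OF b1(1)] sw_S[OF b1(2)])
    then show ?thesis using * by (simp add: sw_push[OF \<sigma>_linear] \<sigma>_mult \<sigma>_\<iota> L.m_assoc)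
  qed
  let ?f = "\<lambda>c d a b. \<iota> (a \<otimes> Si d) \<star> (t c \<star> \<iota> (S b))"
  have "\<sigma> (t (q v)) = rw L (\<lambda>x y. \<sigma> (t (act (S (S y)) x))) v"
    unfolding q_def using v rw_push[OF linear_comp[OF t_linear \<sigma>_linear], of v "\<lambda>x y. act (S (S y)) x"] by simp
  also have "... = rw L (\<lambda>x y. sw L (\<lambda>a b. rw L (\<lambda>c d. ?f c d a b) x) y) v"
    using v by (simp add: 1) (simp add: \<sigma>_t push L.m_assoc gens_mult3)
  also have "... = rw L (\<lambda>x y. rw L (\<lambda>c d. sw L (\<lambda>a b. ?f c d a b) y) x) v"
    using v by (intro tsum_cong refl tsum_swap) simp_all
  also have "... = rw L (\<lambda>c z. sw L (\<lambda>d y. sw L (\<lambda>a b. ?f c d a b) y) z) v"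
    using v by (intro rho_coassoc) ((intro lin)?, simp_all)+
  also have "... = rw L (\<lambda>c z. sw L (\<lambda>u b. sw L (\<lambda>d a. ?f c d a b) u) z) v"
    using v by (intro tsum_cong refl coassoc[symmetric]) ((intro lin)?, simp_all)+
  also have "... = rw L (\<lambda>c z. sw L (\<lambda>u b. \<epsilon> u \<odot>\<^bsub>L\<^esub> (\<iota> \<one> \<star> (t c \<star> \<iota> (S b)))) z) v"
    by (intro tsum_cong refl antipode_inv_right[where f = "\<lambda>w. \<iota> w \<star> _"]) ((intro lin)?, simp_all)+
  also have "... = rw L (\<lambda>c z. \<iota> \<one> \<star> (t c \<star> \<iota> (S z))) v"
    by (intro tsum_cong refl counit_left[where f = "\<lambda>w. \<iota> \<one> \<star> (t _ \<star> \<iota> (S w))"]) ((intro lin)?, simp_all)+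
  also have "... = rw L (\<lambda>c z. rw L (\<lambda>e f. s e \<star> \<iota> (f \<otimes> S z)) c) v"
    using v by (simp add: t_mult_\<iota>)
  also have "... = rw L (\<lambda>e w. sw L (\<lambda>f z. s e \<star> \<iota> (f \<otimes> S z)) w) v"
    using v by (intro rho_coassoc) ((intro lin)?, simp_all)+
  also have "... = rw L (\<lambda>e w. \<epsilon> w \<odot>\<^bsub>L\<^esub> (s e \<star> \<iota> \<one>)) v"
    by (intro tsum_cong refl antipode_right[where f = "\<lambda>w. s _ \<star> \<iota> w"]) ((intro lin)?, simp_all)+
  also have "... = s v" using v rho_counit[of L "\<lambda>e. s e \<star> \<iota> \<one>" v] by (simp add: lin)
  finally show ?thesis .
qed

lemma \<sigma>_\<tau>: "a \<in>! L ==> \<sigma> (\<tau> a) = a"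
  by (rule L_eqI[of L "\<lambda>a. \<sigma> (\<tau> a)" "\<lambda>a. a"]; (intro lin)?;
      simp add: linear_map_id \<tau>_gen \<sigma>_mult \<sigma>_t_q \<sigma>_\<iota>)

text \<open>A left inverse of \<open>\<sigma>\<close> is the composite of the maps sending \<open>v \<star> h\<close> to
  \<open>v\<^sub>0 \<star> S(v\<^sub>1)h\<close> and to \<open>S(h\<^sub>2)v \<star> S(h\<^sub>1)\<close>.\<close>

lemma \<sigma>_inj:
  assumes "a \<in>! L" "b \<in>! L" "\<sigma> a = \<sigma> b"
  shows "a = b"
proof -
  have b1: "bilinear K V H L (\<lambda>v h. rw L (\<lambda>x y. s x \<star> \<iota> (S y \<otimes> h)) v)"
    and b3: "bilinear K V H L (\<lambda>v h. sw L (\<lambda>x y. s (act (S y) v) \<star> \<iota> (S x)) h)"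
    by (intro lin; simp)+
  define k1 where "k1 = Lift L (\<lambda>v h. rw L (\<lambda>x y. s x \<star> \<iota> (S y \<otimes> h)) v)"
  define k3 where "k3 = Lift L (\<lambda>v h. sw L (\<lambda>x y. s (act (S y) v) \<star> \<iota> (S x)) h)"
  note k1l = Lift_linear[OF b1, folded k1_def] and k1g = Lift_gen[OF b1, folded k1_def]
  note k3l = Lift_linear[OF b3, folded k3_def] and k3g = Lift_gen[OF b3, folded k3_def]
  \<comment> \<open>\<open>k1\<close> turns the target in front of \<open>\<iota> h\<close> back
    into a source.\<close>
  have k1t: "k1 (t u \<star> \<iota> h) = s u \<star> \<iota> h" if *: "u \<in>! V" "h \<in>! H" for u h
  proof -
    have "k1 (t u \<star> \<iota> h) = rw L (\<lambda>x y. rw L (\<lambda>c d. s c \<star> \<iota> (S d \<otimes> y \<otimes> h)) x) u"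
      using * by (simp add: t_mult_\<iota> rw_push[OF k1l] k1g H.m_assoc)
    also have "... = rw L (\<lambda>c w. sw L (\<lambda>d y. s c \<star> \<iota> (S d \<otimes> y \<otimes> h)) w) u"
      using * by (intro rho_coassoc) ((intro lin)?, simp_all)+
    also have "... = rw L (\<lambda>c w. \<epsilon> w \<odot>\<^bsub>L\<^esub> (s c \<star> \<iota> (\<one> \<otimes> h))) u"
      using * by (intro tsum_cong refl antipode_left[where f = "\<lambda>w. s _ \<star> \<iota> (w \<otimes> h)"]) ((intro lin)?, simp_all)+
    also have "... = s u \<star> \<iota> h" using * rho_counit[of L "\<lambda>e. s e \<star> \<iota> (\<one> \<otimes> h)" u] by (simp add: lin)
    finally show ?thesis .
  qed
  \<comment> \<open>On a generator, \<open>\<sigma>\<close> is first rewritten with its target on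
    the left; after \<open>k1\<close> has made it a source, \<open>k3\<close> undoes the inverse
    antipode together with the action it left on \<open>v\<close>.\<close>
  have "k3 (k1 (\<sigma> x)) = x" if x: "x \<in>! L" for x
  proof (rule L_eqI[of L "\<lambda>x. k3 (k1 (\<sigma> x))", OF _ linear_map_id modL _ x])
    show "linear_map K L L (\<lambda>x. k3 (k1 (\<sigma> x)))"
      by (intro linear_comp[OF _ k3l] linear_comp[OF _ k1l] \<sigma>_linear)
    fix v h assume *: "v \<in>! V" "h \<in>! H"
    have b: "bilinear K H H L (\<lambda>x y. s (act (S y) w) \<star> \<iota> (S x))" if "w \<in>! V" for w
      using that by (intro lin) simp_all
    have "k3 (k1 (\<sigma> (s v \<star> \<iota> h))) = sw L (\<lambda>a b. sw L (\<lambda>x y. s (act (x \<otimes> Si a) v) \<star> \<iota> y) b) h"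
      using * by (simp add: \<sigma>_gen \<iota>_Si_t sw_push[OF k1l] k1t sw_push[OF k3l] k3g sw_Si[OF b])
    also have "... = sw L (\<lambda>u y. sw L (\<lambda>a x. s (act (x \<otimes> Si a) v) \<star> \<iota> y) u) h"
      using * by (intro coassoc[symmetric]) ((intro lin)?, simp_all del: act_mult)+
    also have "... = sw L (\<lambda>u y. \<epsilon> u \<odot>\<^bsub>L\<^esub> (s (act \<one> v) \<star> \<iota> y)) h"
      using * by (intro tsum_cong refl antipode_inv_right[where f = "\<lambda>w. s (act w v) \<star> \<iota> _"]) ((intro lin)?, simp_all)+
    also have "... = s v \<star> \<iota> h" using * counit_left[of L "\<lambda>y. s v \<star> \<iota> y" h] by (simp add: lin)
    finally show "k3 (k1 (\<sigma> (s v \<star> \<iota> h))) = s v \<star> \<iota> h" .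
  qed
  then show ?thesis using assms by metis
qed

text \<open>\<open>\<tau>\<close> is a right inverse of the injective map \<open>\<sigma>\<close>,
  hence its two-sided inverse; the facts about \<open>\<tau>\<close> that follow are inherited from
  \<open>\<sigma>\<close>.\<close>

lemma \<tau>_\<sigma>: "a \<in>! L ==> \<tau> (\<sigma> a) = a"
  by (rule \<sigma>_inj) (simp_all add: \<sigma>_\<tau>)

lemma \<tau>_mult: "a \<in>! L ==> b \<in>! L ==> \<tau> (a \<star> b) = \<tau> b \<star> \<tau> a"
  by (rule \<sigma>_inj) (simp_all add: \<sigma>_\<tau> \<sigma>_mult)

lemma \<tau>_t: "v \<in>! V ==> \<tau> (t v) = s v"
  by (rule \<sigma>_inj) (simp_all add: \<sigma>_\<tau> \<sigma>_s)

lemma \<tau>_iso: "alg_iso K L (opposite L) \<tau>"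
proof -
  have "\<tau> \<one>\<^bsub>L\<^esub> = \<one>\<^bsub>L\<^esub>" using \<tau>_t[of "\<one>\<^bsub>V\<^esub>"] by simp
  moreover have "bij_betw \<tau> (carrier L) (carrier L)"
    by (rule bij_betw_byWitness[where f' = \<sigma>]) (auto simp: \<sigma>_\<tau> \<tau>_\<sigma>)
  ultimately show ?thesis
    using \<tau>_linear unfolding alg_iso_def alg_hom_def ring_hom_def linear_map_def opposite_def
    by (auto simp: \<tau>_mult)
qed

text \<open>On a generator, \<open>S(h2) h3\<close> collapses and leaves the target of
  \<open>S(h1)\<close> acting on \<open>q v\<close>; by \<open>coun_gen_t\<close> this element of
  the base is also the counit of the antipode.\<close>

lemma antipode_axiom:
  assumes a: "a \<in>! L"
  shows "tensor_lift L (\<lambda>x y. \<tau> x \<star> y) (cop a) = t (cou (\<tau> a))"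
proof (rule lift_cop_eqI[OF _ _ _ _ a])
  show "linear_map K L L (\<lambda>a. t (cou (\<tau> a)))" by (intro lin)
  show "bal (\<lambda>x y. \<tau> x \<star> y)" by (simp add: \<tau>_mult \<tau>_t L.m_assoc)
  fix v h assume *: "v \<in>! V" "h \<in>! H"
  let ?u = "q v"
  have "sw L (\<lambda>x y. \<tau> (s v \<star> \<iota> x) \<star> \<iota> y) h = sw L (\<lambda>x y. sw L (\<lambda>a b. t (act (S a) ?u) \<star> \<iota> (S b \<otimes> y)) x) h"
    using * by (simp add: \<tau>_gen \<iota>_S_t push L.m_assoc gens_mult)
  also have "... = sw L (\<lambda>a r. sw L (\<lambda>b y. t (act (S a) ?u) \<star> \<iota> (S b \<otimes> y)) r) h"
    using * by (intro coassoc) ((intro lin)?, simp_all)+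
  also have "... = sw L (\<lambda>a r. \<epsilon> r \<odot>\<^bsub>L\<^esub> (t (act (S a) ?u) \<star> \<iota> \<one>)) h"
    using * by (intro tsum_cong refl antipode_left[where f = "\<lambda>w. t (act (S _) ?u) \<star> \<iota> w"]) ((intro lin)?, simp_all)+
  also have "... = t (act (S h) ?u)" using * counit_right[of L "\<lambda>a. t (act (S a) ?u)" h] by (simp add: lin)
  also have "... = t (cou (\<tau> (s v \<star> \<iota> h)))"
    using * coun_gen_t[of "\<one>\<^bsub>V\<^esub>" "S h" ?u] by (simp add: \<tau>_gen)
  finally show "sw L (\<lambda>x y. \<tau> (s v \<star> \<iota> x) \<star> \<iota> y) h = t (cou (\<tau> (s v \<star> \<iota> h)))" .
qed ((intro lin)?, simp_all add: linear_map_id)+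

abbreviation "L2k \<equiv> ktensor K L L"

text \<open>An element of the tensor square can be written with second legs of the form
  \<open>\<iota> h\<close>, since the base part \<open>s w\<close> of that leg crosses to the first
  leg as \<open>t w\<close>. Reading this normal form over \<open>K\<close> is the section. On a
  coproduct it yields \<open>s v \<iota>(h1) \<otimes> \<iota>(h2)\<close>, where the antipode law
  of \<open>H\<close> applies.\<close>

lemma section_axiom:
  "\<exists>\<eta>. linear_map K L2 L2k \<eta> \<and> (\<forall>z \<in> carrier L2. tensor_lift L2 (\<lambda>x y. x \<bowtie> y) (\<eta> z) = z) \<and>
    (\<forall>a \<in> carrier L. tensor_lift L (\<lambda>x y. x \<star> \<tau> y) (\<eta> (cop a)) = s (cou a))"
proof -
  define \<phi> where "\<phi> x = Lift L2k (\<lambda>w h. (t w \<star> x) \<boxtimes>\<^bsub>L2k\<^esub> \<iota> h)" for x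
  have b: "bilinear K V H L2k (\<lambda>w h. (t w \<star> x) \<boxtimes>\<^bsub>L2k\<^esub> \<iota> h)" if "x \<in>! L" for x
    using that by (intro lin) simp_all
  note \<phi>l = Lift_linear[OF b, folded \<phi>_def]
  have \<phi>g: "\<phi> x (s w \<star> \<iota> h) = (t w \<star> x) \<boxtimes>\<^bsub>L2k\<^esub> \<iota> h" if "x \<in>! L" "w \<in>! V" "h \<in>! H" for x w h
    unfolding \<phi>_def using Lift_gen[OF b] that .
  have B: "bilinear K L L L2k (\<lambda>x y. \<phi> x y)"
  proof (intro bilinearI)
    fix y assume "y \<in>! L"
    then show "linear_map K L L2k (\<lambda>x. \<phi> x y)" unfolding \<phi>_def Lift_def by (intro lin) simp_all
    show "linear_map K L L2k (\<phi> y)" unfolding \<phi>_def using \<open>y \<in>! L\<close> by (intro Lift_linear b)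
  qed simp
  have bal: "bal \<phi>"
  proof (intro ballI)
    fix x r y assume *: "x \<in>! L" "r \<in>! V" "y \<in>! L"
    show "\<phi> (t r \<star> x) y = \<phi> x (s r \<star> y)"
      by (rule L_eqI[where f = "\<phi> (t r \<star> x)" and g = "\<lambda>y. \<phi> x (s r \<star> y)" and G = L2k,
            OF bilinearD(3)[OF B] linear_comp[OF _ bilinearD(3)[OF B]] _ _ *(3)]; (intro lin)?;
          simp add: * \<phi>g gens_mult3 linear_map_id)
  qed
  define \<eta> where "\<eta> = tensor_lift L2k \<phi>"
  have \<eta>l: "linear_map K L2 L2k \<eta>" unfolding \<eta>_def using L2.lift_linear[OF B bal] .
  have \<eta>p: "\<eta> (x \<bowtie> y) = \<phi> x y" if "x \<in>! L" "y \<in>! L" for x y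
    unfolding \<eta>_def using L2.lift_pure[OF bilinear_biadditive[OF B] bal that] .
  have p2: "bilinear K L L L2 (\<lambda>x y. x \<bowtie> y)" by (intro lin) simp_all
  have mt: "bilinear K L L L (\<lambda>x y. x \<star> \<tau> y)" by (intro lin) simp_all
  have "tensor_lift L2 (\<lambda>x y. x \<bowtie> y) (\<eta> z) = z" if z: "z \<in>! L2" for z
  proof (rule L2.linear_eqI[OF linear_comp[OF \<eta>l ktensor_lift_linear[OF modL modL p2]] linear_map_id L2.module_T _ z])
    fix x y assume x: "x \<in>! L" and y: "y \<in>! L"
    show "tensor_lift L2 (\<lambda>x y. x \<bowtie> y) (\<eta> (x \<bowtie> y)) = x \<bowtie> y"
      unfolding \<eta>p[OF x y]
      by (rule L_eqI[OF linear_comp[OF \<phi>l[OF x] ktensor_lift_linear[OF modL modL p2]] _ _ _ y]; (intro lin)?;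
          simp add: x \<phi>g ktensor_lift_pure[OF modL modL p2] pure2_move linear_map_id)
  qed
  moreover have "tensor_lift L (\<lambda>x y. x \<star> \<tau> y) (\<eta> (cop a)) = s (cou a)" if a: "a \<in>! L" for a
  proof (rule L_eqI[where G = L, OF linear_comp[OF linear_comp[OF coprod_linear \<eta>l] ktensor_lift_linear[OF modL modL mt]] _ modL _ a])
    show "linear_map K L L (\<lambda>a. s (cou a))" by (intro lin linear_map_id)
    fix v h assume *: "v \<in>! V" "h \<in>! H"
    have \<tau>\<iota>: "\<tau> (\<iota> y) = \<iota> (S y)" if "y \<in>! H" for y
      by (rule \<sigma>_inj) (simp_all add: that \<sigma>_\<tau> \<sigma>_\<iota>)
    have "\<phi> x (\<iota> y) = x \<boxtimes>\<^bsub>L2k\<^esub> \<iota> y" if "x \<in>! L" "y \<in>! H" for x y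
      using \<phi>g[of x "\<one>\<^bsub>V\<^esub>" y] that by simp
    then have "tensor_lift L (\<lambda>x y. x \<star> \<tau> y) (\<eta> (cop (s v \<star> \<iota> h))) = sw L (\<lambda>x y. s v \<star> \<iota> (x \<otimes> S y)) h"
      using * by (simp add: coprod_gen sw_push[OF linear_comp[OF \<eta>l ktensor_lift_linear[OF modL modL mt]]]
          \<eta>p ktensor_lift_pure[OF modL modL mt] \<tau>\<iota> L.m_assoc gens_mult)
    also have "... = s (cou (s v \<star> \<iota> h))"
      using * antipode_right[of L "\<lambda>w. s v \<star> \<iota> w" h] by (simp add: lin coun_gen linear_mapD(3)[OF s_linear])
    finally show "tensor_lift L (\<lambda>x y. x \<star> \<tau> y) (\<eta> (cop (s v \<star> \<iota> h))) = s (cou (s v \<star> \<iota> h))" .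
  qed
  ultimately show ?thesis using \<eta>l by blast
qed

theorem hopf_algebroid: "hopf_algebroid K Bd \<tau>"
  unfolding hopf_algebroid_def Let_def
  using left_bialgebroid \<tau>_iso \<tau>_t antipode_axiom section_axiom by simp

end

section \<open>Hopf-Galois extensions\<close>

lemma linear_map_inv_into:
  assumes f: "linear_map K M N f" and bij: "bij_betw f (carrier M) (carrier N)" and M: "module K M" and N: "module K N"
  shows "linear_map K N M (inv_into (carrier M) f)"
proof -
  interpret M: module K M by fact
  interpret N: module K N by fact
  let ?g = "inv_into (carrier M) f"
  have g: "?g y \<in>! M" "f (?g y) = y" if "y \<in>! N" for y
    using bij that by (auto simp: bij_betw_def inv_into_into f_inv_into_f)
  have inj: "x = y" if "f x = f y" "x \<in>! M" "y \<in>! M" for x y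
    using bij that by (auto simp: bij_betw_def inj_on_def)
  show ?thesis
    by (intro linear_mapI; (rule inj)?) (simp_all add: g linear_mapD[OF f])
qed

lemma (in balanced_tensor) tsum_pure_linear:
  assumes f: "linear_map K T G f" and G: "module K G" and X: "X \<in>! T"
  shows "tsum M N G (\<lambda>x y. f (x \<boxtimes>\<^bsub>T\<^esub> y)) X = f X"
  using rsum_linear[OF f module_T G rep_in[OF X], of "(\<boxtimes>\<^bsub>T\<^esub>)"] X rep_in[OF X] by (simp add: tsum_rsum rsum_pure)

lemma (in balanced_tensor) lift_tsum:
  "bilinear K M N G \<phi> ==> balanced \<phi> ==> X \<in>! T ==> tensor_lift G \<phi> X = tsum M N G \<phi> X"
  by (simp add: lift_rsum[OF bilinear_biadditive] tsum_rsum rep_in)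

locale galois = fd_hopf K H n e p for K :: "'k ring" and H :: "('k, 'h) hopf" (structure) and n e p +
  fixes A :: "('k, 'a) module" and \<rho> :: "'a \<Rightarrow> ('a \<times> 'h \<Rightarrow>\<^sub>0 int) set" and B :: "'a set"
  assumes gal: "galois_extension K H A \<rho> B"
begin

lemma kA [simp]: "k_algebra K A" and rho_hom: "alg_hom K A (ktensor K A H) \<rho>"
  using gal by (simp_all add: galois_extension_def comodule_algebra_def Let_def)

sublocale A: ring A using kA by (simp add: k_algebra_def)

sublocale comodule K H A \<rho>
  using gal by (intro comodule.intro comodule_axioms.intro hopf_axioms)
    (simp_all add: k_algebra_def alg_hom_def galois_extension_def comodule_algebra_def Let_def)

sublocale AM: module K A by (rule modV)

lemma smult_A [simp]:
  "c \<in>! K ==> x \<in>! A ==> y \<in>! A ==> (c \<odot>\<^bsub>A\<^esub> x) \<otimes>\<^bsub>A\<^esub> y = c \<odot>\<^bsub>A\<^esub> (x \<otimes>\<^bsub>A\<^esub> y)"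
  "c \<in>! K ==> x \<in>! A ==> y \<in>! A ==> x \<otimes>\<^bsub>A\<^esub> (c \<odot>\<^bsub>A\<^esub> y) = c \<odot>\<^bsub>A\<^esub> (x \<otimes>\<^bsub>A\<^esub> y)"
  using kA by (simp_all add: k_algebra_def)

abbreviation mulA (infixl \<open>\<bullet>\<close> 70) where "x \<bullet> y \<equiv> x \<otimes>\<^bsub>A\<^esub> y"
abbreviation "AH \<equiv> ktensor K A H"
abbreviation "AA \<equiv> tensor_over A B"

lemma rw_mult:
  assumes b: "bilinear K A H G \<phi>" and x: "x \<in>! A" and y: "y \<in>! A"
  shows "rw G \<phi> (x \<bullet> y) = rw G (\<lambda>u g. rw G (\<lambda>v h. \<phi> (u \<bullet> v) (g \<otimes> h)) y) x"
proof -
  note G = bilinearD(1)[OF b] and cl = bilinearD(4)[OF b]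
  have F: "linear_map K AH G (tsum A H G \<phi>)"
    by (rule tsum_linear_arg[OF linear_map_id]) (simp_all add: b)
  have "\<rho> (x \<bullet> y) = \<rho> x \<otimes>\<^bsub>AH\<^esub> \<rho> y"
    using rho_hom x y by (simp add: alg_hom_def ring_hom_def)
  then have "rw G \<phi> (x \<bullet> y) = tsum A H G \<phi> (tsum A H AH (\<lambda>m' n'. tsum A H AH
      (\<lambda>m n. (m \<bullet> m') \<boxtimes>\<^bsub>AH\<^esub> (n \<otimes> n')) (\<rho> x)) (\<rho> y))"
    using x y by (simp add: ktensor_mult_tsum)
  also have "... = rw G (\<lambda>v h. rw G (\<lambda>u g. \<phi> (u \<bullet> v) (g \<otimes> h)) x) y"
    using x y by (simp add: rw_push[OF F] G tsum_pure b)
  also have "... = rw G (\<lambda>u g. rw G (\<lambda>v h. \<phi> (u \<bullet> v) (g \<otimes> h)) y) x"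
    using x y G cl by (intro tsum_swap) (simp_all add: module_def)
  finally show ?thesis .
qed

lemma rw_coinv:
  assumes b: "bilinear K A H G \<phi>" and "\<rho> x = x \<boxtimes>\<^bsub>AH\<^esub> \<one>" "x \<in>! A"
  shows "rw G \<phi> x = \<phi> x \<one>"
  using assms(2) tsum_pure[OF modV module_H b assms(3), of \<one>] by simp

lemma rho_one: "\<rho> \<one>\<^bsub>A\<^esub> = \<one>\<^bsub>A\<^esub> \<boxtimes>\<^bsub>AH\<^esub> \<one>"
proof -
  interpret T: balanced_tensor K A H "carrier K" "\<lambda>m c. c \<odot>\<^bsub>A\<^esub> m" "\<lambda>c n. c \<odot> n" AH
    by (rule balanced_tensor_ktensor) simp_all
  show ?thesis using rho_hom by (simp add: alg_hom_def ring_hom_def T.one_T)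
qed

lemma B_D [simp]: "b \<in> B ==> b \<in>! A" and rho_B: "b \<in> B ==> \<rho> b = b \<boxtimes>\<^bsub>AH\<^esub> \<one>"
  using gal by (simp_all add: galois_extension_def coinvariants_def)

lemma B_I: "b \<in>! A ==> \<rho> b = b \<boxtimes>\<^bsub>AH\<^esub> \<one> ==> b \<in> B"
  using gal unfolding galois_extension_def coinvariants_def by blast

lemma scalar_in_B:
  assumes c: "c \<in>! K" shows "c \<odot>\<^bsub>A\<^esub> \<one>\<^bsub>A\<^esub> \<in> B"
proof (rule B_I)
  have "linear_map K A AH (\<lambda>x. x \<boxtimes>\<^bsub>AH\<^esub> \<one>)" by (intro lin) simp_all
  from linear_mapD(3)[OF this c] show "\<rho> (c \<odot>\<^bsub>A\<^esub> \<one>\<^bsub>A\<^esub>) = (c \<odot>\<^bsub>A\<^esub> \<one>\<^bsub>A\<^esub>) \<boxtimes>\<^bsub>AH\<^esub> \<one>"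
    using c by (simp add: linear_mapD(3)[OF rho_linear] rho_one)
qed (use c in simp)

lemma rw_B_left:
  assumes b: "bilinear K A H G \<phi>" and "x \<in> B" and y: "y \<in>! A"
  shows "rw G \<phi> (x \<bullet> y) = rw G (\<lambda>v h. \<phi> (x \<bullet> v) h) y"
proof -
  note bl = linear_comp[OF _ bilinearD(2)[OF b]] linear_comp[OF _ bilinearD(3)[OF b]]
  have "bilinear K A H G (\<lambda>u g. rw G (\<lambda>v h. \<phi> (u \<bullet> v) (g \<otimes> h)) y)"
    using y bilinearD(1)[OF b] by (intro lin bl) simp_all
  from rw_coinv[OF this rho_B] show ?thesis using assms by (simp add: rw_mult[OF b])
qed

lemma rw_B_right:
  assumes b: "bilinear K A H G \<phi>" and x: "x \<in> B" and y: "y \<in>! A"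
  shows "rw G \<phi> (y \<bullet> x) = rw G (\<lambda>v h. \<phi> (v \<bullet> x) h) y"
proof -
  note bl = linear_comp[OF _ bilinearD(2)[OF b]] linear_comp[OF _ bilinearD(3)[OF b]]
  have "rw G (\<lambda>v h. \<phi> (u \<bullet> v) (g \<otimes> h)) x = \<phi> (u \<bullet> x) g" if "u \<in>! A" "g \<in>! H" for u g
  proof -
    have "bilinear K A H G (\<lambda>v h. \<phi> (u \<bullet> v) (g \<otimes> h))" using that bilinearD(1)[OF b] by (intro lin bl) simp_all
    from rw_coinv[OF this rho_B] show ?thesis using x that by simp
  qed
  then show ?thesis using x y by (simp add: rw_mult[OF b])
qed

sublocale AA: balanced_tensor K A A B "\<lambda>a b. a \<bullet> b" "\<lambda>b a. b \<bullet> a" AA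
proof (rule balanced_tensor.intro)
  fix c assume "c \<in>! K"
  then show "\<exists>s\<in>B. (\<forall>m\<in>carrier A. m \<bullet> s = c \<odot>\<^bsub>A\<^esub> m) \<and> (\<forall>n\<in>carrier A. s \<bullet> n = c \<odot>\<^bsub>A\<^esub> n)"
    using scalar_in_B by (intro bexI[of _ "c \<odot>\<^bsub>A\<^esub> \<one>\<^bsub>A\<^esub>"]) auto
qed (simp_all add: tensor_over_def linear_map_mult linear_map_id)

abbreviation pureAA (infixl \<open>\<boxdot>\<close> 67) where "x \<boxdot> y \<equiv> x \<boxtimes>\<^bsub>AA\<^esub> y"
abbreviation "oneA \<equiv> \<one>\<^bsub>A\<^esub>"

declare AA.module_T [simp] AA.abelian_T [simp]

abbreviation "balB \<phi> \<equiv> \<forall>x\<in>carrier A. \<forall>b\<in>B. \<forall>y\<in>carrier A. \<phi> (x \<bullet> b) y = \<phi> x (b \<bullet> y)"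

lemma pureA_linear [lin]:
  "linear_map K Z A f ==> y \<in>! A ==> linear_map K Z AA (\<lambda>z. f z \<boxdot> y)"
  "linear_map K Z A g ==> x \<in>! A ==> linear_map K Z AA (\<lambda>z. x \<boxdot> g z)"
  using linear_comp[OF _ bilinearD(2)[OF AA.pure_bilinear]]
    linear_comp[OF _ bilinearD(3)[OF AA.pure_bilinear]] by blast+

lemma rep_AA [simp]: "X \<in>! AA ==> rep_in X (carrier A) (carrier A)" by (rule AA.rep_in)

abbreviation "aw G \<phi> X \<equiv> tsum A A G \<phi> X"

lemma aw_lift: "bilinear K A A G \<phi> ==> balB \<phi> ==> X \<in>! AA ==> aw G \<phi> X = tensor_lift G \<phi> X"
  by (rule AA.lift_tsum[symmetric])

lemma aw_linear:
  assumes "bilinear K A A G \<phi>" "balB \<phi>" "linear_map K Z AA f" "module K Z"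
  shows "linear_map K Z G (\<lambda>z. aw G \<phi> (f z))"
  using linear_comp[OF assms(3) AA.lift_linear[OF assms(1,2)]] assms(4)
  by (rule linear_map_cong) (simp add: aw_lift[OF assms(1,2) linear_mapD(1)[OF assms(3)]])

lemma aw_pure:
  "bilinear K A A G \<phi> ==> balB \<phi> ==> x \<in>! A ==> y \<in>! A ==> aw G \<phi> (x \<boxdot> y) = \<phi> x y"
  by (simp add: aw_lift AA.lift_pure[OF bilinear_biadditive])

lemma aw_push:
  assumes "linear_map K G G' f" "module K G" "module K G'" "X \<in>! AA"
    and "\<And>x y. x \<in>! A ==> y \<in>! A ==> \<phi> x y \<in>! G"
  shows "f (aw G \<phi> X) = aw G' (\<lambda>x y. f (\<phi> x y)) X"
  using assms by (intro tsum_linear) simp_all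

definition "lm a X = tensor_lift AA (\<lambda>x y. (a \<bullet> x) \<boxdot> y) X"
definition "rm a X = tensor_lift AA (\<lambda>x y. x \<boxdot> (y \<bullet> a)) X"

lemma lm_facts:
  assumes "a \<in>! A"
  shows "linear_map K AA AA (lm a)" "x \<in>! A ==> y \<in>! A ==> lm a (x \<boxdot> y) = (a \<bullet> x) \<boxdot> y"
    "X \<in>! AA ==> lm a X = aw AA (\<lambda>x y. (a \<bullet> x) \<boxdot> y) X"
    "linear_map K AA AA (rm a)" "x \<in>! A ==> y \<in>! A ==> rm a (x \<boxdot> y) = x \<boxdot> (y \<bullet> a)"
    "X \<in>! AA ==> rm a X = aw AA (\<lambda>x y. x \<boxdot> (y \<bullet> a)) X"
proof -
  have b: "bilinear K A A AA (\<lambda>x y. (a \<bullet> x) \<boxdot> y)" "bilinear K A A AA (\<lambda>x y. x \<boxdot> (y \<bullet> a))"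
    using assms by (intro lin; simp)+
  have bal: "balB (\<lambda>x y. (a \<bullet> x) \<boxdot> y)" "balB (\<lambda>x y. x \<boxdot> (y \<bullet> a))"
    using assms by (simp_all add: A.m_assoc[symmetric] AA.pure_balanced)
  show "linear_map K AA AA (lm a)" "x \<in>! A ==> y \<in>! A ==> lm a (x \<boxdot> y) = (a \<bullet> x) \<boxdot> y"
    "X \<in>! AA ==> lm a X = aw AA (\<lambda>x y. (a \<bullet> x) \<boxdot> y) X"
    "linear_map K AA AA (rm a)" "x \<in>! A ==> y \<in>! A ==> rm a (x \<boxdot> y) = x \<boxdot> (y \<bullet> a)"
    "X \<in>! AA ==> rm a X = aw AA (\<lambda>x y. x \<boxdot> (y \<bullet> a)) X"
    unfolding lm_def[abs_def] rm_def[abs_def]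
    using AA.lift_linear[OF b(1) bal(1)] AA.lift_linear[OF b(2) bal(2)]
      AA.lift_pure[OF bilinear_biadditive[OF b(1)] bal(1)] AA.lift_pure[OF bilinear_biadditive[OF b(2)] bal(2)]
      aw_lift[OF b(1) bal(1)] aw_lift[OF b(2) bal(2)] by auto
qed

lemma lm_closed [simp]:
  "a \<in>! A ==> X \<in>! AA ==> lm a X \<in>! AA" "a \<in>! A ==> X \<in>! AA ==> rm a X \<in>! AA"
  using linear_mapD(1)[OF lm_facts(1)] linear_mapD(1)[OF lm_facts(4)] by auto

lemma lm_linear [lin]:
  "linear_map K Z AA f ==> a \<in>! A ==> linear_map K Z AA (\<lambda>z. lm a (f z))"
  "linear_map K Z AA f ==> a \<in>! A ==> linear_map K Z AA (\<lambda>z. rm a (f z))"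
  "linear_map K Z A g ==> module K Z ==> X \<in>! AA ==> linear_map K Z AA (\<lambda>z. lm (g z) X)"
  "linear_map K Z A g ==> module K Z ==> X \<in>! AA ==> linear_map K Z AA (\<lambda>z. rm (g z) X)"
proof -
  show "linear_map K Z AA f ==> a \<in>! A ==> linear_map K Z AA (\<lambda>z. lm a (f z))"
    "linear_map K Z AA f ==> a \<in>! A ==> linear_map K Z AA (\<lambda>z. rm a (f z))"
    using linear_comp[OF _ lm_facts(1)] linear_comp[OF _ lm_facts(4)] by auto
  assume g: "linear_map K Z A g" and Z: "module K Z" and X: "X \<in>! AA"
  show "linear_map K Z AA (\<lambda>z. lm (g z) X)"
    by (rule linear_map_cong[where f = "\<lambda>z. aw AA (\<lambda>x y. (g z \<bullet> x) \<boxdot> y) X", OF _ Z], intro lin g)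
      (simp_all add: X lm_facts linear_mapD(1)[OF g])
  show "linear_map K Z AA (\<lambda>z. rm (g z) X)"
    by (rule linear_map_cong[where f = "\<lambda>z. aw AA (\<lambda>x y. x \<boxdot> (y \<bullet> g z)) X", OF _ Z], intro lin g)
      (simp_all add: X lm_facts linear_mapD(1)[OF g])
qed

lemma lm_comp:
  assumes a: "a \<in>! A" and b: "b \<in>! A" and X: "X \<in>! AA"
  shows "lm a (lm b X) = lm (a \<bullet> b) X" "rm a (rm b X) = rm (b \<bullet> a) X" "lm a (rm b X) = rm b (lm a X)"
proof -
  show "lm a (lm b X) = lm (a \<bullet> b) X"
    by (rule AA.linear_eqI[OF _ _ AA.module_T _ X]) ((intro lin lm_facts(1,4))?, simp_all add: a b lm_facts(2,5) A.m_assoc linear_map_id)+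
  show "rm a (rm b X) = rm (b \<bullet> a) X"
    by (rule AA.linear_eqI[OF _ _ AA.module_T _ X]) ((intro lin lm_facts(1,4))?, simp_all add: a b lm_facts(2,5) A.m_assoc linear_map_id)+
  show "lm a (rm b X) = rm b (lm a X)"
    by (rule AA.linear_eqI[OF _ _ AA.module_T _ X]) ((intro lin lm_facts(1,4))?, simp_all add: a b lm_facts(2,5) A.m_assoc linear_map_id)+
qed

lemma lm_one [simp]:
  assumes X: "X \<in>! AA"
  shows "lm oneA X = X" "rm oneA X = X"
proof -
  show "lm oneA X = X"
    by (rule AA.linear_eqI[OF _ linear_map_id AA.module_T _ X]) ((intro lin lm_facts(1,4))?, simp_all add: lm_facts(2,5) linear_map_id)+
  show "rm oneA X = X"
    by (rule AA.linear_eqI[OF _ linear_map_id AA.module_T _ X]) ((intro lin lm_facts(1,4))?, simp_all add: lm_facts(2,5) linear_map_id)+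
qed

section \<open>The Galois map and the elements \<open>\<gamma> h\<close>\<close>

definition "\<beta> = galois_map K H A \<rho>"

lemma beta_facts:
  shows beta_linear: "linear_map K AA AH \<beta>"
    and beta_pure: "x \<in>! A ==> y \<in>! A ==> \<beta> (x \<boxdot> y) = rw AH (\<lambda>u g. (x \<bullet> u) \<boxtimes>\<^bsub>AH\<^esub> g) y"
    and beta_bij: "bij_betw \<beta> (carrier AA) (carrier AH)"
proof -
  have bb: "bilinear K A H AH (\<lambda>u g. (x \<bullet> u) \<boxtimes>\<^bsub>AH\<^esub> g)" if "x \<in>! A" for x
    using that by (intro lin) simp_all
  have eq: "tensor_lift AH (\<lambda>u g. (x \<bullet> u) \<boxtimes>\<^bsub>AH\<^esub> g) (\<rho> y) = rw AH (\<lambda>u g. (x \<bullet> u) \<boxtimes>\<^bsub>AH\<^esub> g) y"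
    if "x \<in>! A" "y \<in>! A" for x y
    using that by (intro lift_rw bb)
  have b: "bilinear K A A AH (\<lambda>x y. tensor_lift AH (\<lambda>u g. (x \<bullet> u) \<boxtimes>\<^bsub>AH\<^esub> g) (\<rho> y))"
    by (intro bilinearI linear_map_cong[OF _ modV eq[symmetric]] lin) simp_all
  have bal: "balB (\<lambda>x y. tensor_lift AH (\<lambda>u g. (x \<bullet> u) \<boxtimes>\<^bsub>AH\<^esub> g) (\<rho> y))"
    by (simp add: eq rw_B_left[OF bb] A.m_assoc)
  show "linear_map K AA AH \<beta>" unfolding \<beta>_def galois_map_def Let_def using AA.lift_linear[OF b bal] .
  show "x \<in>! A ==> y \<in>! A ==> \<beta> (x \<boxdot> y) = rw AH (\<lambda>u g. (x \<bullet> u) \<boxtimes>\<^bsub>AH\<^esub> g) y"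
    unfolding \<beta>_def galois_map_def Let_def using AA.lift_pure[OF bilinear_biadditive[OF b] bal] eq by simp
  show "bij_betw \<beta> (carrier AA) (carrier AH)" using gal unfolding galois_extension_def \<beta>_def by blast
qed

definition "\<gamma> h = inv_into (carrier AA) \<beta> (oneA \<boxtimes>\<^bsub>AH\<^esub> h)"

lemma beta_inj: "\<beta> X = \<beta> Y ==> X \<in>! AA ==> Y \<in>! AA ==> X = Y"
  using beta_bij by (auto simp: bij_betw_def inj_on_def)

lemma gamma_linear: "linear_map K H AA \<gamma>"
  unfolding \<gamma>_def
  by (intro linear_comp[OF _ linear_map_inv_into[OF beta_linear beta_bij]] lin) simp_all

lemmas gamma_linear' [lin] = linear_comp[OF _ gamma_linear]

lemma gamma_closed [simp]: "h \<in>! H ==> \<gamma> h \<in>! AA" using linear_mapD(1)[OF gamma_linear] .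

lemma beta_gamma: "h \<in>! H ==> \<beta> (\<gamma> h) = oneA \<boxtimes>\<^bsub>AH\<^esub> h"
  unfolding \<gamma>_def using beta_bij f_inv_into_f[of "oneA \<boxtimes>\<^bsub>AH\<^esub> h" \<beta> "carrier AA"] by (simp add: bij_betw_def)

abbreviation "gw G \<phi> h \<equiv> aw G \<phi> (\<gamma> h)"

text \<open>The equation \<open>\<beta> (\<gamma> h) = 1 \<otimes> h\<close>, read through a
  bilinear map. It recovers a function of \<open>h\<close> from its combinations with the coaction
  of elements of \<open>A\<close>.\<close>

lemma gw_beta:
  assumes b: "bilinear K A H G \<phi>" and h: "h \<in>! H"
  shows "gw G (\<lambda>x y. rw G (\<lambda>u g. \<phi> (x \<bullet> u) g) y) h = \<phi> oneA h"
proof -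
  note G = bilinearD(1)[OF b] and cl = bilinearD(4)[OF b]
  have F: "linear_map K AH G (tensor_lift G \<phi>)" using ktensor_lift_linear[OF modV module_H b] .
  have "tensor_lift G \<phi> (\<beta> (x \<boxdot> y)) = rw G (\<lambda>u g. \<phi> (x \<bullet> u) g) y" if "x \<in>! A" "y \<in>! A" for x y
    using that by (simp add: beta_pure rw_push[OF F] G ktensor_lift_pure[OF modV module_H b])
  then have "gw G (\<lambda>x y. rw G (\<lambda>u g. \<phi> (x \<bullet> u) g) y) h = gw G (\<lambda>x y. tensor_lift G \<phi> (\<beta> (x \<boxdot> y))) h"
    by simp
  also have "... = tensor_lift G \<phi> (\<beta> (\<gamma> h))"
    using h by (intro AA.tsum_pure_linear linear_comp[OF beta_linear F] G) simp_all
  finally show ?thesis using h by (simp add: beta_gamma ktensor_lift_pure[OF modV module_H b])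
qed

lemma beta_lm:
  assumes a: "a \<in>! A" and X: "X \<in>! AA"
  shows "\<beta> (lm a X) = tensor_lift AH (\<lambda>x g. (a \<bullet> x) \<boxtimes>\<^bsub>AH\<^esub> g) (\<beta> X)"
proof -
  have b: "bilinear K A H AH (\<lambda>x g. (a \<bullet> x) \<boxtimes>\<^bsub>AH\<^esub> g)" using a by (intro lin) simp_all
  note l = ktensor_lift_linear[OF modV module_H b] and pu = ktensor_lift_pure[OF modV module_H b]
  show ?thesis
    by (rule AA.linear_eqI[OF linear_comp[OF lm_facts(1)[OF a] beta_linear] linear_comp[OF beta_linear l] _ _ X])
      (use a in \<open>simp_all add: lm_facts(2,5) beta_pure rw_push[OF l] pu A.m_assoc\<close>)
qed

lemma beta_lm_gamma: "a \<in>! A ==> h \<in>! H ==> \<beta> (lm a (\<gamma> h)) = a \<boxtimes>\<^bsub>AH\<^esub> h"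
proof -
  assume *: "a \<in>! A" "h \<in>! H"
  have b: "bilinear K A H AH (\<lambda>x g. (a \<bullet> x) \<boxtimes>\<^bsub>AH\<^esub> g)" using * by (intro lin) simp_all
  show ?thesis using * by (simp add: beta_lm beta_gamma ktensor_lift_pure[OF modV module_H b])
qed

text \<open>Both sides have the same image under the injective map \<open>\<beta>\<close>, because
  \<open>\<beta>\<close> is left \<open>A\<close>-linear.\<close>

lemma reconstruct:
  assumes x: "x \<in>! A" and y: "y \<in>! A"
  shows "x \<boxdot> y = rw AA (\<lambda>a g. lm (x \<bullet> a) (\<gamma> g)) y"
  by (rule beta_inj) (use x y in \<open>simp_all add: beta_pure rw_push[OF beta_linear] beta_lm_gamma\<close>)

lemma gw_reconstruct:
  assumes b: "bilinear K A A G \<phi>" and bal: "balB \<phi>" and x: "x \<in>! A" and y: "y \<in>! A"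
  shows "\<phi> x y = rw G (\<lambda>a g. gw G (\<lambda>u w. \<phi> (x \<bullet> a \<bullet> u) w) g) y"
proof -
  note G [simp] = bilinearD(1)[OF b]
  have F: "linear_map K AA G (tensor_lift G \<phi>)" using AA.lift_linear[OF b bal] .
  have p: "tensor_lift G \<phi> (x \<boxdot> y) = \<phi> x y" if "x \<in>! A" "y \<in>! A" for x y
    using AA.lift_pure[OF bilinear_biadditive[OF b] bal that] .
  have "\<phi> x y = tensor_lift G \<phi> (rw AA (\<lambda>a g. lm (x \<bullet> a) (\<gamma> g)) y)"
    using x y by (simp add: p[symmetric] reconstruct[symmetric])
  then show ?thesis using x y by (simp add: rw_push[OF F] lm_facts(3) aw_push[OF F] p)
qed

lemma gw_linear [lin]:
  assumes "linear_map K Z H f" "module K Z" "bilinear K A A G (\<lambda>x y. \<phi> x y)" "balB (\<lambda>x y. \<phi> x y)"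
  shows "linear_map K Z G (\<lambda>z. gw G (\<lambda>x y. \<phi> x y) (f z))"
  using aw_linear[OF assms(3,4) gamma_linear'[OF assms(1)] assms(2)] .

text \<open>Rewriting the inner pair by \<open>gw_reconstruct\<close> and using coassociativity of
  the coaction leaves a sum that \<open>gw_beta\<close> contracts. The outcome is colinearity of
  \<open>\<gamma>\<close>: a coaction on its second leg may be traded for a coproduct of
  \<open>h\<close>.\<close>

lemma gw_coaction:
  assumes G: "module K G"
    and 1: "\<And>y z. y \<in>! A ==> z \<in>! H ==> linear_map K A G (\<lambda>x. \<psi> x y z)"
    and 2: "\<And>x z. x \<in>! A ==> z \<in>! H ==> linear_map K A G (\<lambda>y. \<psi> x y z)"
    and 3: "\<And>x y. x \<in>! A ==> y \<in>! A ==> linear_map K H G (\<lambda>z. \<psi> x y z)"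
    and bal: "\<And>z. z \<in>! H ==> balB (\<lambda>x y. \<psi> x y z)"
    and h: "h \<in>! H"
  shows "gw G (\<lambda>x y. rw G (\<lambda>a g. \<psi> x a g) y) h = sw G (\<lambda>h1 h2. gw G (\<lambda>x y. \<psi> x y h2) h1) h"
proof -
  note l = linear_comp[OF _ 1] linear_comp[OF _ 2] linear_comp[OF _ 3]
  have cl [simp]: "\<psi> x y z \<in>! G" if "x \<in>! A" "y \<in>! A" "z \<in>! H" for x y z
    using linear_mapD(1)[OF 3[OF that(1,2)] that(3)] .
  have aG [simp]: "abelian_group G" using G by (rule module.axioms(2))
  have b: "bilinear K A A G (\<lambda>x y. \<psi> x y z)" if "z \<in>! H" for z
    using G 1 2 that by (intro bilinearI) auto
  have bal': "balB (\<lambda>u w. \<psi> (x \<bullet> u) w z)" if "z \<in>! H" "x \<in>! A" for x z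
    using bal[OF that(1)] that by (simp add: A.m_assoc[symmetric])
  have "gw G (\<lambda>x y. rw G (\<lambda>a g. \<psi> x a g) y) h
    = gw G (\<lambda>x y. rw G (\<lambda>a g. rw G (\<lambda>c k. gw G (\<lambda>u w. \<psi> (x \<bullet> c \<bullet> u) w g) k) a) y) h"
    by (intro tsum_cong refl gw_reconstruct[OF b bal])
  also have "... = gw G (\<lambda>x y. rw G (\<lambda>c r. sw G (\<lambda>k g. gw G (\<lambda>u w. \<psi> (x \<bullet> c \<bullet> u) w g) k) r) y) h"
    using h G by (intro tsum_cong refl rho_coassoc) ((intro lin l)?, simp_all add: bal')+
  also have "... = sw G (\<lambda>k g. gw G (\<lambda>u w. \<psi> (oneA \<bullet> u) w g) k) h"
    using h G by (intro gw_beta lin l) (simp_all add: bal')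
  finally show ?thesis using h by simp
qed

text \<open>Right multiplication by a coinvariant corresponds under \<open>\<beta>\<close> to right
  multiplication on the factor \<open>A\<close>; at \<open>1 \<otimes> h\<close>, multiplication by
  \<open>b\<close> on either side gives \<open>b \<otimes> h\<close>. Hence
  \<open>\<gamma> h\<close> belongs to \<open>T\<close>.\<close>

lemma gamma_central:
  assumes b: "b \<in> B" and h: "h \<in>! H"
  shows "lm b (\<gamma> h) = rm b (\<gamma> h)"
proof -
  have bA [simp]: "b \<in>! A" using b by simp
  have bl: "bilinear K A H AH (\<lambda>x g. (x \<bullet> b) \<boxtimes>\<^bsub>AH\<^esub> g)" by (intro lin) simp_all
  have bl': "bilinear K A H AH (\<lambda>u g. (x \<bullet> u) \<boxtimes>\<^bsub>AH\<^esub> g)" if "x \<in>! A" for x using that by (intro lin) simp_all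
  note l = ktensor_lift_linear[OF modV module_H bl] and pu = ktensor_lift_pure[OF modV module_H bl]
  have "\<beta> (rm b X) = tensor_lift AH (\<lambda>x g. (x \<bullet> b) \<boxtimes>\<^bsub>AH\<^esub> g) (\<beta> X)" if X: "X \<in>! AA" for X
    by (rule AA.linear_eqI[OF linear_comp[OF lm_facts(4)[OF bA] beta_linear] linear_comp[OF beta_linear l] _ _ X])
      (use b in \<open>simp_all add: lm_facts(2,5) beta_pure rw_push[OF l] pu A.m_assoc rw_B_right[OF bl']\<close>)
  then show ?thesis using h by (intro beta_inj) (simp_all add: beta_lm_gamma beta_gamma pu)
qed

lemma gw_B:
  assumes bil: "bilinear K A A G \<phi>" and bal: "balB \<phi>" and b: "b \<in> B" and h: "h \<in>! H"
  shows "gw G (\<lambda>x y. \<phi> (b \<bullet> x) y) h = gw G (\<lambda>x y. \<phi> x (y \<bullet> b)) h"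
proof -
  note F = AA.lift_linear[OF bil bal]
  have p: "tensor_lift G \<phi> (x \<boxdot> y) = \<phi> x y" if "x \<in>! A" "y \<in>! A" for x y
    using AA.lift_pure[OF bilinear_biadditive[OF bil] bal that] .
  have "tensor_lift G \<phi> (lm b (\<gamma> h)) = tensor_lift G \<phi> (rm b (\<gamma> h))" using gamma_central[OF b h] by simp
  then show ?thesis using b h bilinearD(1)[OF bil] by (simp add: lm_facts aw_push[OF F] p)
qed

lemma gamma_one: "\<gamma> \<one> = oneA \<boxdot> oneA"
proof (rule beta_inj)
  have "bilinear K A H AH (\<lambda>u g. (oneA \<bullet> u) \<boxtimes>\<^bsub>AH\<^esub> g)" by (intro lin) simp_all
  from rw_coinv[OF this rho_one] show "\<beta> (\<gamma> \<one>) = \<beta> (oneA \<boxdot> oneA)" by (simp add: beta_gamma beta_pure)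
qed simp_all

text \<open>Under \<open>\<beta>\<close> the left-hand side is evaluated by \<open>gw_beta\<close>,
  first for \<open>g\<close> and then for \<open>h\<close>, and multiplicativity of the coaction
  puts \<open>g\<close> in front of \<open>h\<close>. The left-hand side is the product of
  \<open>\<gamma> h\<close> and \<open>\<gamma> g\<close> in \<open>T^op\<close>, so the order is
  reversed there.\<close>

lemma gamma_mult:
  assumes g: "g \<in>! H" and h: "h \<in>! H"
  shows "gw AA (\<lambda>x y. lm x (rm y (\<gamma> g))) h = \<gamma> (g \<otimes> h)"
proof (rule beta_inj)
  have "\<beta> (lm x (rm y (\<gamma> g))) = rw AH (\<lambda>u k. (x \<bullet> u) \<boxtimes>\<^bsub>AH\<^esub> (g \<otimes> k)) y" if x: "x \<in>! A" and y: "y \<in>! A" for x y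
  proof -
    have b1: "bilinear K A H AH (\<lambda>u k. (x \<bullet> (x' \<bullet> u)) \<boxtimes>\<^bsub>AH\<^esub> k)" if "x' \<in>! A" for x'
      using that x by (intro lin) simp_all
    have b2: "bilinear K A H AH (\<lambda>u k. rw AH (\<lambda>u' k'. (x \<bullet> u \<bullet> u') \<boxtimes>\<^bsub>AH\<^esub> (k \<otimes> k')) y)"
      using x y by (intro lin) simp_all
    have "lm x (rm y (\<gamma> g)) = gw AA (\<lambda>x' y'. (x \<bullet> x') \<boxdot> (y' \<bullet> y)) g"
      using x y g by (simp add: lm_facts(6) aw_push[OF lm_facts(1)[OF x]] lm_facts(2))
    then have "\<beta> (lm x (rm y (\<gamma> g))) = gw AH (\<lambda>x' y'. rw AH (\<lambda>u k. rw AH (\<lambda>u' k'. (x \<bullet> (x' \<bullet> u) \<bullet> u') \<boxtimes>\<^bsub>AH\<^esub> (k \<otimes> k')) y) y') g"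
      using x y g by (simp add: aw_push[OF beta_linear] beta_pure rw_mult[OF b1] A.m_assoc)
    then show ?thesis using gw_beta[OF b2 g] x by simp
  qed
  moreover have "bilinear K A H AH (\<lambda>u k. u \<boxtimes>\<^bsub>AH\<^esub> (g \<otimes> k))" using g by (intro lin) simp_all
  from gw_beta[OF this h] have "gw AH (\<lambda>x y. rw AH (\<lambda>u k. (x \<bullet> u) \<boxtimes>\<^bsub>AH\<^esub> (g \<otimes> k)) y) h = oneA \<boxtimes>\<^bsub>AH\<^esub> (g \<otimes> h)" .
  ultimately show "\<beta> (gw AA (\<lambda>x y. lm x (rm y (\<gamma> g))) h) = \<beta> (\<gamma> (g \<otimes> h))"
    using g h by (simp add: aw_push[OF beta_linear] beta_gamma)
qed (use g h in simp_all)

end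

text \<open>Both the centralizer and the invariants of \<open>A \<otimes> A\<close> over
  \<open>B\<close> are cut out by equations between linear maps, one for each member of
  \<open>B\<close>.\<close>

lemma equalizer_module:
  fixes M :: "('k, 'm, 'x) module_scheme"
  assumes M: "module K M" and N: "module K N"
    and f: "\<And>b. b \<in> B ==> linear_map K M N (f b)" and g: "\<And>b. b \<in> B ==> linear_map K M N (g b)"
  shows "module K (M\<lparr>carrier := {x \<in> carrier M. \<forall>b\<in>B. f b x = g b x}\<rparr>)"
proof -
  interpret M: module K M by fact
  interpret N: module K N by fact
  show ?thesis
    by (intro submodule.submodule_is_module M.submoduleI M)
      (auto simp: linear_map_zero[OF f M N] linear_map_zero[OF g M N] linear_map_minus[OF f M N] linear_map_minus[OF g M N]
        linear_mapD(2,3)[OF f] linear_mapD(2,3)[OF g])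
qed

lemma linear_map_restrict:
  "linear_map K Z M f ==> (\<And>z. z \<in>! Z ==> f z \<in> C) ==> linear_map K Z (M\<lparr>carrier := C\<rparr>) f"
  by (simp add: linear_map_def)

lemma linear_map_incl: "C \<subseteq> carrier M ==> linear_map K (M\<lparr>carrier := C\<rparr>) M (\<lambda>x. x)"
  by (auto simp: linear_map_def)

lemma k_algebraI:
  assumes K: "field K" and M: "module K M"
    and 1: "\<And>x y. x \<in>! M ==> y \<in>! M ==> x \<otimes>\<^bsub>M\<^esub> y \<in>! M" "\<one>\<^bsub>M\<^esub> \<in>! M"
      "\<And>x y z. x \<in>! M ==> y \<in>! M ==> z \<in>! M ==> (x \<otimes>\<^bsub>M\<^esub> y) \<otimes>\<^bsub>M\<^esub> z = x \<otimes>\<^bsub>M\<^esub> (y \<otimes>\<^bsub>M\<^esub> z)"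
      "\<And>x. x \<in>! M ==> \<one>\<^bsub>M\<^esub> \<otimes>\<^bsub>M\<^esub> x = x" "\<And>x. x \<in>! M ==> x \<otimes>\<^bsub>M\<^esub> \<one>\<^bsub>M\<^esub> = x"
    and l: "\<And>y. y \<in>! M ==> linear_map K M M (\<lambda>x. x \<otimes>\<^bsub>M\<^esub> y)"
      "\<And>x. x \<in>! M ==> linear_map K M M (\<lambda>y. x \<otimes>\<^bsub>M\<^esub> y)"
  shows "k_algebra K M"
proof -
  have "abelian_group M" using M by (rule module.axioms(2))
  moreover have "monoid M" by (unfold_locales) (simp_all add: 1)
  ultimately have "ring M" by (rule ringI) (auto simp: linear_mapD(2)[OF l(1)] linear_mapD(2)[OF l(2)])
  then show ?thesis using K M by (auto simp: k_algebra_def linear_mapD(3)[OF l(1)] linear_mapD(3)[OF l(2)])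
qed

section \<open>The centralizer with the actions of \<open>H\<close> and of its dual\<close>

context galois begin

abbreviation "R \<equiv> centralizer A B"
abbreviation V :: "('k, 'a) module" where "V \<equiv> A\<lparr>carrier := centralizer A B\<rparr>"

lemma R_D [simp]: "r \<in> R ==> r \<in>! A" and R_comm: "r \<in> R ==> b \<in> B ==> r \<bullet> b = b \<bullet> r"
  by (simp_all add: centralizer_def)

lemma R_I: "r \<in>! A ==> (\<And>b. b \<in> B ==> r \<bullet> b = b \<bullet> r) ==> r \<in> R"
  unfolding centralizer_def by blast

lemma R_mult [simp]: "r \<in> R ==> r' \<in> R ==> r \<bullet> r' \<in> R"
proof (rule R_I)
  fix b assume *: "r \<in> R" "r' \<in> R" "b \<in> B"
  have "r \<bullet> r' \<bullet> b = r \<bullet> (b \<bullet> r')" using * by (simp add: A.m_assoc R_comm[OF *(2,3)])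
  also have "... = b \<bullet> (r \<bullet> r')" using * by (simp add: A.m_assoc[symmetric] R_comm[OF *(1,3)])
  finally show "r \<bullet> r' \<bullet> b = b \<bullet> (r \<bullet> r')" .
qed simp

lemma R_one [simp]: "oneA \<in> R" by (rule R_I) simp_all

lemma module_V [simp]: "module K V"
  unfolding centralizer_def by (rule equalizer_module[where N = A]) (intro modV lin kA B_D; assumption)+

lemma V_incl [lin]: "linear_map K V A (\<lambda>x. x)"
  by (rule linear_map_incl) auto

lemma V_into: "linear_map K Z A f ==> (\<And>z. z \<in>! Z ==> f z \<in> R) ==> linear_map K Z V f"
  by (rule linear_map_restrict)

lemma k_algebra_V: "k_algebra K V"
proof (rule k_algebraI)
  show "field K" by (rule K.field_axioms)
qed (auto intro!: V_into lin simp: A.m_assoc)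

lemma finsum_V: "(\<And>i. i < m ==> f i \<in> R) ==> (\<Oplus>\<^bsub>V\<^esub>i\<in>{..<m::nat}. f i) = (\<Oplus>\<^bsub>A\<^esub>i\<in>{..<m}. f i)"
  by (rule linear_map_finsum[OF V_incl]) auto

lemma smult_R [simp]: "c \<in>! K ==> r \<in> R ==> c \<odot>\<^bsub>A\<^esub> r \<in> R"
  using module.smult_closed[OF module_V] by simp

text \<open>The left action of the dual of \<open>H\<close> that corresponds to the coaction. Its
  values lie in \<open>A\<close>, so that it restricts to the centralizer without any change of
  tensor product.\<close>

definition "E f a = rw A (\<lambda>x h. f h \<odot>\<^bsub>A\<^esub> x) a"

abbreviation "functional f \<equiv> linear_map K H (self_module K) f"

lemma functional_closed [simp]: "functional f ==> h \<in>! H ==> f h \<in>! K"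
  using linear_mapD(1)[of K H "self_module K"] by simp

lemma E_closed [simp]: "functional f ==> a \<in>! A ==> E f a \<in>! A"
  unfolding E_def by simp

lemma E_bilinear [lin]: "functional f ==> bilinear K A H A (\<lambda>x h. f h \<odot>\<^bsub>A\<^esub> x)"
  by (intro lin) simp_all

lemma E_linear [lin]: "functional f ==> linear_map K Z A g ==> module K Z ==> linear_map K Z A (\<lambda>z. E f (g z))"
  unfolding E_def by (intro lin) simp_all

lemma E_linear_f [lin]:
  assumes "\<And>z. z \<in>! Z ==> functional (F z)" "\<And>h. h \<in>! H ==> linear_map K Z (self_module K) (\<lambda>z. F z h)"
    and "a \<in>! A"
  shows "linear_map K Z A (\<lambda>z. E (\<lambda>h. F z h) a)"
  unfolding E_def using assms by (intro lin) simp_all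

lemma E_cong: "(\<And>h. h \<in>! H ==> f h = g h) ==> E f a = E g a"
  unfolding E_def by simp

text \<open>Coinvariants pass through the coaction. Compatibility with \<open>B\<close> on both
  sides is what keeps the centralizer stable under these operators.\<close>

lemma E_B:
  assumes "functional f" "b \<in> B" "a \<in>! A"
  shows "E f (b \<bullet> a) = b \<bullet> E f a" "E f (a \<bullet> b) = E f a \<bullet> b"
  using assms by (simp_all add: E_def rw_B_left[OF E_bilinear] rw_B_right[OF E_bilinear] push)

lemma E_R [simp]: "functional f ==> r \<in> R ==> E f r \<in> R"
  by (rule R_I) (simp_all add: E_B[symmetric] R_comm)

lemma E_counit: "a \<in>! A ==> E \<epsilon> a = a"
  unfolding E_def by (rule rho_counit) (simp_all add: linear_map_id)

lemma E_one: "functional f ==> E f oneA = f \<one> \<odot>\<^bsub>A\<^esub> oneA"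
  unfolding E_def by (rule rw_coinv[OF E_bilinear rho_one]) simp_all

lemma E_comp:
  assumes f: "functional f" and g: "functional g" and a: "a \<in>! A"
  shows "E f (E g a) = E (\<lambda>h. sw (self_module K) (\<lambda>x y. f x \<otimes>\<^bsub>K\<^esub> g y) h) a"
proof -
  note l = linear_comp[OF _ f] linear_comp[OF _ g]
  have s: "linear_map K (self_module K) A (\<lambda>c. c \<odot>\<^bsub>A\<^esub> x)" if "x \<in>! A" for x
    using that by (intro lin) simp_all
  have "E f (E g a) = rw A (\<lambda>x h. g h \<odot>\<^bsub>A\<^esub> E f x) a"
    using a f g by (simp add: E_def[of g] rw_push[OF E_linear[OF f linear_map_id]] linear_mapD(3)[OF E_linear[OF f linear_map_id]])
  also have "... = rw A (\<lambda>x h. rw A (\<lambda>u k. g h \<odot>\<^bsub>A\<^esub> (f k \<odot>\<^bsub>A\<^esub> u)) x) a"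
    using f g by (simp add: E_def push)
  also have "... = rw A (\<lambda>x h. sw A (\<lambda>y z. g z \<odot>\<^bsub>A\<^esub> (f y \<odot>\<^bsub>A\<^esub> x)) h) a"
    using a f g by (intro rho_coassoc) ((intro lin l)?, simp_all)+
  also have "... = E (\<lambda>h. sw (self_module K) (\<lambda>x y. f x \<otimes>\<^bsub>K\<^esub> g y) h) a"
    using f g by (simp add: E_def sw_push[OF s] AM.smult_assoc1[symmetric] K.m_comm)
  finally show ?thesis .
qed

lemma E_mult:
  assumes f: "functional f" and x: "x \<in>! A" and y: "y \<in>! A"
  shows "E f (x \<bullet> y) = rw A (\<lambda>u g. u \<bullet> E (\<lambda>h. f (g \<otimes> h)) y) x"
    "E f (x \<bullet> y) = rw A (\<lambda>v h. E (\<lambda>g. f (g \<otimes> h)) x \<bullet> v) y"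
proof -
  have *: "E f (x \<bullet> y) = rw A (\<lambda>u g. rw A (\<lambda>v h. f (g \<otimes> h) \<odot>\<^bsub>A\<^esub> (u \<bullet> v)) y) x"
    unfolding E_def using x y by (simp add: rw_mult[OF E_bilinear[OF f]])
  then show "E f (x \<bullet> y) = rw A (\<lambda>u g. u \<bullet> E (\<lambda>h. f (g \<otimes> h)) y) x"
    using f x y by (simp add: E_def push)
  have "E f (x \<bullet> y) = rw A (\<lambda>v h. rw A (\<lambda>u g. f (g \<otimes> h) \<odot>\<^bsub>A\<^esub> (u \<bullet> v)) x) y"
    unfolding * using f x y by (intro tsum_swap) simp_all
  then show "E f (x \<bullet> y) = rw A (\<lambda>v h. E (\<lambda>g. f (g \<otimes> h)) x \<bullet> v) y"
    using f x y by (simp add: E_def push)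
qed

text \<open>Expanding the component in \<open>H\<close> over the dual basis recovers the coaction
  from the operators \<open>E (p i)\<close>. Sums over tensors thus become finite sums whose terms
  can be recognised as members of the centralizer.\<close>

lemma rw_expand:
  assumes b: "bilinear K A H G \<phi>" and a: "a \<in>! A"
  shows "rw G \<phi> a = (\<Oplus>\<^bsub>G\<^esub>i\<in>{..<n}. \<phi> (E (p i) a) (e i))"
proof -
  note G = bilinearD(1)[OF b] and cl = bilinearD(4)[OF b]
  have aG: "abelian_group G" using G by (rule module.axioms(2))
  have "rw G \<phi> a = rw G (\<lambda>x h. \<Oplus>\<^bsub>G\<^esub>i\<in>{..<n}. p i h \<odot>\<^bsub>G\<^esub> \<phi> x (e i)) a"
    using expand[OF bilinearD(3)[OF b] G] by (intro tsum_cong refl)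
  also have "... = (\<Oplus>\<^bsub>G\<^esub>i\<in>{..<n}. rw G (\<lambda>x h. p i h \<odot>\<^bsub>G\<^esub> \<phi> x (e i)) a)"
    using a aG module.smult_closed[OF G] cl by (intro tsum_finsum) simp_all
  also have "... = (\<Oplus>\<^bsub>G\<^esub>i\<in>{..<n}. \<phi> (E (p i) a) (e i))"
  proof (intro finsum_eqI)
    fix i assume "i \<in> {..<n}"
    then have i: "i < n" by simp
    note l = bilinearD(2)[OF b e_closed[OF i]]
    show "rw G (\<lambda>x h. p i h \<odot>\<^bsub>G\<^esub> \<phi> x (e i)) a = \<phi> (E (p i) a) (e i)"
      unfolding E_def using i a G by (simp add: rw_push[OF l] linear_mapD(3)[OF l])
  qed
  finally show ?thesis .
qed

definition "act h r = gw A (\<lambda>x y. x \<bullet> r \<bullet> y) h"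

lemma act_bilinear: "r \<in>! A ==> bilinear K A A A (\<lambda>x y. x \<bullet> r \<bullet> y)"
  by (intro lin) simp_all

lemma act_bal: "r \<in> R ==> balB (\<lambda>x y. x \<bullet> r \<bullet> y)"
  by (simp add: A.m_assoc) (simp add: A.m_assoc[symmetric] R_comm)

lemma act_R [simp]: "h \<in>! H ==> r \<in> R ==> act h r \<in> R"
proof (rule R_I)
  fix b assume "h \<in>! H" "r \<in> R" "b \<in> B"
  then show "act h r \<bullet> b = b \<bullet> act h r"
    using gw_B[OF act_bilinear[of r] act_bal, of b h] by (simp add: act_def push A.m_assoc)
qed (simp add: act_def)

lemma act_linear_A [lin]:
  "linear_map K Z H f ==> module K Z ==> r \<in> R ==> linear_map K Z A (\<lambda>z. act (f z) r)"
  "linear_map K Z V g ==> h \<in>! H ==> linear_map K Z A (\<lambda>z. act h (g z))"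
proof -
  show "linear_map K Z H f ==> module K Z ==> r \<in> R ==> linear_map K Z A (\<lambda>z. act (f z) r)"
    unfolding act_def by (rule gw_linear[OF _ _ act_bilinear act_bal]) simp_all
  assume g: "linear_map K Z V g" and h: "h \<in>! H"
  note gA = linear_comp[OF g V_incl]
  show "linear_map K Z A (\<lambda>z. act h (g z))"
    unfolding act_def by (intro lin gA) (simp_all add: h gA linear_mapD(1)[OF gA])
qed

lemma act_linear [lin]:
  "linear_map K Z H f ==> module K Z ==> r \<in> R ==> linear_map K Z V (\<lambda>z. act (f z) r)"
  "linear_map K Z V g ==> h \<in>! H ==> linear_map K Z V (\<lambda>z. act h (g z))"
proof -
  show "linear_map K Z V (\<lambda>z. act (f z) r)" if "linear_map K Z H f" "module K Z" "r \<in> R"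
    using that by (intro V_into act_linear_A(1)) (simp_all add: linear_mapD(1)[OF that(1)])
  show "linear_map K Z V (\<lambda>z. act h (g z))" if "linear_map K Z V g" "h \<in>! H"
    by (rule V_into[OF act_linear_A(2)]) (use that linear_mapD(1)[OF that(1)] in simp_all)
qed

text \<open>Reconstruct \<open>1 \<otimes> y\<close> as \<open>y0 \<gamma>(y1)\<close> and insert
  \<open>r\<close> between the two legs; this is allowed because \<open>r\<close> commutes with
  \<open>B\<close>.\<close>

lemma prebraid:
  assumes r: "r \<in> R" and y: "y \<in>! A"
  shows "r \<bullet> y = rw A (\<lambda>a g. a \<bullet> act g r) y"
  using gw_reconstruct[OF act_bilinear act_bal[OF r] A.one_closed y] r y
  by (simp add: act_def push A.m_assoc)

text \<open>From \<open>gamma_mult\<close>, by inserting \<open>r\<close> between the legs of nested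
  elements \<open>\<gamma>\<close>. The reversed order makes \<open>act\<close> a left action of the
  opposite algebra.\<close>

lemma act_mult:
  assumes "g \<in>! H" "h \<in>! H" and r: "r \<in> R"
  shows "act (g \<otimes> h) r = act h (act g r)"
proof -
  note b = act_bilinear[OF R_D[OF r]] and bal = act_bal[OF r]
  let ?F = "tensor_lift A (\<lambda>x y. x \<bullet> r \<bullet> y)"
  note F = AA.lift_linear[OF b bal]
  have p: "?F (x \<boxdot> y) = x \<bullet> r \<bullet> y" if "x \<in>! A" "y \<in>! A" for x y
    using AA.lift_pure[OF bilinear_biadditive[OF b] bal that] .
  have "?F (lm x (rm y X)) = x \<bullet> (?F X \<bullet> y)" if X: "X \<in>! AA" and xy: "x \<in>! A" "y \<in>! A" for X x y
  proof (rule AA.linear_eqI[OF _ _ modV _ X])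
    show "linear_map K AA A (\<lambda>X. ?F (lm x (rm y X)))" "linear_map K AA A (\<lambda>X. x \<bullet> (?F X \<bullet> y))"
      using xy by (intro linear_comp[OF _ F] lin F; simp)+
  qed (use xy r in \<open>simp_all add: lm_facts(2,5) p A.m_assoc\<close>)
  moreover have "act (g \<otimes> h) r = ?F (\<gamma> (g \<otimes> h))" "act g r = ?F (\<gamma> g)"
    unfolding act_def using assms by (simp_all add: aw_lift[OF b bal])
  ultimately show ?thesis
    using assms by (simp add: gamma_mult[symmetric] aw_push[OF F]) (simp add: act_def A.m_assoc linear_mapD(1)[OF F])
qed

lemma act_one: "r \<in> R ==> act \<one> r = r"
  unfolding act_def by (simp add: gamma_one aw_pure act_bilinear act_bal)

text \<open>Applying the counit to the second factor of \<open>\<beta> (\<gamma> h)\<close> shows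
  that the two legs of \<open>\<gamma> h\<close> multiply to the scalar
  \<open>\<epsilon> h\<close>.\<close>

lemma act_unit: "h \<in>! H ==> act h oneA = \<epsilon> h \<odot>\<^bsub>A\<^esub> oneA"
proof -
  assume h: "h \<in>! H"
  have "rw A (\<lambda>u g. \<epsilon> g \<odot>\<^bsub>A\<^esub> (x \<bullet> u)) y = x \<bullet> y" if "x \<in>! A" "y \<in>! A" for x y
    using that by (intro rho_counit lin) simp_all
  moreover have "gw A (\<lambda>x y. rw A (\<lambda>u g. \<epsilon> g \<odot>\<^bsub>A\<^esub> (x \<bullet> u)) y) h = \<epsilon> h \<odot>\<^bsub>A\<^esub> oneA"
    using h by (intro gw_beta[of A "\<lambda>u g. \<epsilon> g \<odot>\<^bsub>A\<^esub> u"] lin) simp_all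
  ultimately show ?thesis by (simp add: act_def)
qed

text \<open>\<open>prebraid\<close> moves \<open>s\<close> through the second leg of
  \<open>\<gamma> h\<close>, and \<open>gw_coaction\<close> turns the coaction that appears on this
  leg into a coproduct of \<open>h\<close>.\<close>

lemma act_prod:
  assumes h: "h \<in>! H" and r: "r \<in> R" and s: "s \<in> R"
  shows "act h (r \<bullet> s) = sw A (\<lambda>x y. act x r \<bullet> act y s) h"
proof -
  have "act h (r \<bullet> s) = gw A (\<lambda>x y. rw A (\<lambda>a g. x \<bullet> r \<bullet> a \<bullet> act g s) y) h"
    unfolding act_def[of h] using r s by (intro tsum_cong refl) (simp add: A.m_assoc prebraid[OF s] push)
  also have "... = sw A (\<lambda>h1 h2. gw A (\<lambda>x y. x \<bullet> r \<bullet> y \<bullet> act h2 s) h1) h"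
    using h r s by (intro gw_coaction) ((intro lin)?, simp_all add: act_bal)+
  also have "... = sw A (\<lambda>x y. act x r \<bullet> act y s) h"
    using h r s by (simp add: act_def[of _ r] push)
  finally show ?thesis .
qed

text \<open>\<open>E f (v y)\<close> is computed in two ways, applying \<open>prebraid\<close>
  before or after the coaction is split over the product. Both results multiply \<open>y0\<close> by
  one of the two sides, taken at \<open>y1\<close>; since \<open>y\<close> is arbitrary,
  \<open>gw_beta\<close> recovers the sides at \<open>h\<close>.\<close>

lemma yetter_drinfeld:
  assumes f: "functional f" and v: "v \<in> R" and h: "h \<in>! H"
  shows "sw A (\<lambda>x y. E (\<lambda>k. f (x \<otimes> k)) (act y v)) h = sw A (\<lambda>x y. act x (E (\<lambda>k. f (k \<otimes> y)) v)) h"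
proof -
  have fl [simp]: "functional (\<lambda>k. f (x \<otimes> k))" "functional (\<lambda>k. f (k \<otimes> x))" if "x \<in>! H" for x
    using that by (intro linear_comp[OF _ f] lin; simp)+
  have fe: "linear_map K H V (\<lambda>x. E (\<lambda>k. f (k \<otimes> x)) v)"
    using v by (intro V_into lin linear_comp[OF _ f]) simp_all
  have fe': "linear_map K H A (\<lambda>x. E (\<lambda>k. f (x \<otimes> k)) a)" if "a \<in>! A" for a
    using that by (intro lin linear_comp[OF _ f]) simp_all
  let ?l = "\<lambda>k. sw A (\<lambda>x y. E (\<lambda>k. f (x \<otimes> k)) (act y v)) k" and ?r = "\<lambda>k. sw A (\<lambda>x y. act x (E (\<lambda>k. f (k \<otimes> y)) v)) k"
  have ll: "linear_map K H A ?l" using v fe' by (intro lin) simp_all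
  have lr: "linear_map K H A ?r" using v by (intro lin fe) simp_all
  have 1: "rw A (\<lambda>u k. u \<bullet> ?l k) y = E f (v \<bullet> y)" if y: "y \<in>! A" for y
  proof -
    have "E f (v \<bullet> y) = rw A (\<lambda>a g. rw A (\<lambda>u k. u \<bullet> E (\<lambda>l. f (k \<otimes> l)) (act g v)) a) y"
      using y v f by (simp add: prebraid rw_push[OF E_linear[OF f linear_map_id]] E_mult(1))
    also have "... = rw A (\<lambda>u k. sw A (\<lambda>k g. u \<bullet> E (\<lambda>l. f (k \<otimes> l)) (act g v)) k) y"
      using y v by (intro rho_coassoc) ((intro lin fe')?, simp_all)+
    finally show ?thesis using v y by (simp add: push)
  qed
  have 2: "rw A (\<lambda>u k. u \<bullet> ?r k) y = E f (v \<bullet> y)" if y: "y \<in>! A" for y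
  proof -
    have "E f (v \<bullet> y) = rw A (\<lambda>w k. rw A (\<lambda>a g. a \<bullet> act g (E (\<lambda>l. f (l \<otimes> k)) v)) w) y"
      using y v by (simp add: E_mult(2)[OF f]) (simp add: prebraid)
    also have "... = rw A (\<lambda>a g. sw A (\<lambda>g k. a \<bullet> act g (E (\<lambda>l. f (l \<otimes> k)) v)) g) y"
      using y v by (intro rho_coassoc) ((intro lin fe)?, simp_all)+
    finally show ?thesis using v y by (simp add: push)
  qed
  \<comment> \<open>The factor \<open>x\<close> is put in front to match the shape required by
    \<open>gw_beta\<close>, with \<open>x\<close> and \<open>y\<close> the legs of
    \<open>\<gamma> h\<close>.\<close>
  have *: "rw A (\<lambda>u k. (x \<bullet> u) \<bullet> ?l k) y = rw A (\<lambda>u k. (x \<bullet> u) \<bullet> ?r k) y" if y: "y \<in>! A" and "x \<in>! A" for x y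
    using arg_cong[OF trans[OF 1[OF y] 2[OF y, symmetric]], of "\<lambda>z. x \<bullet> z"] that v by (simp add: push A.m_assoc)
  have "gw A (\<lambda>x y. rw A (\<lambda>u k. (x \<bullet> u) \<bullet> ?l k) y) h = gw A (\<lambda>x y. rw A (\<lambda>u k. (x \<bullet> u) \<bullet> ?r k) y) h"
    by (rule tsum_cong[OF refl *])
  moreover have "gw A (\<lambda>x y. rw A (\<lambda>u k. (x \<bullet> u) \<bullet> ?l k) y) h = oneA \<bullet> ?l h"
    using v h by (intro gw_beta[of A "\<lambda>u k. u \<bullet> ?l k"] lin ll) simp_all
  moreover have "gw A (\<lambda>x y. rw A (\<lambda>u k. (x \<bullet> u) \<bullet> ?r k) y) h = oneA \<bullet> ?r h"
    using v h by (intro gw_beta[of A "\<lambda>u k. u \<bullet> ?r k"] lin lr) simp_all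
  ultimately show ?thesis using h v by simp
qed

text \<open>The Yetter-Drinfel'd condition, with the factor to the right of \<open>k\<close>
  transferred to the other side by means of \<open>S h3\<close>. Read in the opposite Hopf algebra,
  whose inverse antipode is \<open>S\<close>, this is the straightening rule of the double.\<close>

lemma straighten:
  assumes f: "functional f" and v: "v \<in> R" and h: "h \<in>! H"
  shows "act h (E f v) = sw A (\<lambda>x yz. sw A (\<lambda>y z. E (\<lambda>k. f (x \<otimes> k \<otimes> S z)) (act y v)) yz) h"
proof -
  note l = linear_comp[OF _ f]
  have fl [simp]: "functional (\<lambda>k. f (x \<otimes> k \<otimes> y))" "functional (\<lambda>k. f (x \<otimes> (k \<otimes> y)))" "functional (\<lambda>k. f (k \<otimes> y))"
    if "x \<in>! H" "y \<in>! H" for x y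
    using that by (intro l lin; simp)+
  have fe: "linear_map K H V (\<lambda>z. E (\<lambda>k. f (k \<otimes> z)) v)"
    using v by (intro V_into lin l) simp_all
  have "sw A (\<lambda>x yz. sw A (\<lambda>y z. E (\<lambda>k. f (x \<otimes> k \<otimes> S z)) (act y v)) yz) h
    = sw A (\<lambda>xy z. sw A (\<lambda>x y. E (\<lambda>k. f (x \<otimes> k \<otimes> S z)) (act y v)) xy) h"
    using v h by (intro coassoc[symmetric]) ((intro lin l)?, simp_all)+
  also have "... = sw A (\<lambda>xy z. sw A (\<lambda>x y. act x (E (\<lambda>k. f (k \<otimes> (y \<otimes> S z))) v)) xy) h"
    using v yetter_drinfeld[of "\<lambda>k. f (k \<otimes> S _)", OF fl(3)]
    by (intro tsum_cong[of "comult H h", OF refl]) (simp add: H.m_assoc cong: E_cong)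
  also have "... = sw A (\<lambda>x yz. sw A (\<lambda>y z. act x (E (\<lambda>k. f (k \<otimes> (y \<otimes> S z))) v)) yz) h"
    using v h by (intro coassoc) ((intro lin linear_comp[OF _ fe])?, simp_all)+
  also have "... = sw A (\<lambda>x y. \<epsilon> y \<odot>\<^bsub>A\<^esub> act x (E (\<lambda>k. f (k \<otimes> \<one>)) v)) h"
    using v by (intro tsum_cong[of "comult H h", OF refl] antipode_right[where f = "\<lambda>z. act _ (E (\<lambda>k. f (k \<otimes> z)) v)"] lin fe) simp_all
  also have "... = act h (E (\<lambda>k. f (k \<otimes> \<one>)) v)"
    using v h by (intro counit_right lin) simp_all
  also have "... = act h (E f v)" by (simp cong: E_cong)
  finally show ?thesis ..
qed

end

subsection \<open>The bialgebroid of the extension\<close>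

lemma T_op_mult:
  "X \<otimes>\<^bsub>opposite (T_algebra A B)\<^esub> Y = tensor_lift (tensor_over A B) (\<lambda>x' y'. tensor_lift (tensor_over A B)
    (\<lambda>x y. (x' \<otimes>\<^bsub>A\<^esub> x) \<boxtimes>\<^bsub>tensor_over A B\<^esub> (y \<otimes>\<^bsub>A\<^esub> y')) Y) X"
  by (simp add: opposite_def T_algebra_def Let_def module.defs)

context galois begin

lemma aw_lm:
  assumes b: "bilinear K A A G \<phi>" and bal: "balB \<phi>" and a: "a \<in>! A" and X: "X \<in>! AA"
  shows "aw G \<phi> (lm a X) = aw G (\<lambda>x y. \<phi> (a \<bullet> x) y) X" "aw G \<phi> (rm a X) = aw G (\<lambda>x y. \<phi> x (y \<bullet> a)) X"
proof -
  note F = AA.lift_linear[OF b bal]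
  have p: "tensor_lift G \<phi> (x \<boxdot> y) = \<phi> x y" if "x \<in>! A" "y \<in>! A" for x y
    using AA.lift_pure[OF bilinear_biadditive[OF b] bal that] .
  have "tensor_lift G \<phi> (lm a X) = aw G (\<lambda>x y. \<phi> (a \<bullet> x) y) X" "tensor_lift G \<phi> (rm a X) = aw G (\<lambda>x y. \<phi> x (y \<bullet> a)) X"
    using a X bilinearD(1)[OF b] by (simp_all add: lm_facts aw_push[OF F] p)
  then show "aw G \<phi> (lm a X) = aw G (\<lambda>x y. \<phi> (a \<bullet> x) y) X" "aw G \<phi> (rm a X) = aw G (\<lambda>x y. \<phi> x (y \<bullet> a)) X"
    using a X by (simp_all add: aw_lift[OF b bal])
qed

lemma aw_pure_id: "X \<in>! AA ==> aw AA (\<lambda>x y. x \<boxdot> y) X = X"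
  using AA.tsum_pure_linear[OF linear_map_id AA.module_T] .

abbreviation T :: "('k, ('a \<times> 'a \<Rightarrow>\<^sub>0 int) set) module" where "T \<equiv> opposite (T_algebra A B)"

abbreviation starT (infixl \<open>\<ast>\<close> 70) where "x \<ast> y \<equiv> x \<otimes>\<^bsub>T\<^esub> y"

lemma carrier_T: "carrier T = {t \<in> carrier AA. \<forall>b\<in>B. lm b t = rm b t}"
  by (simp add: T_algebra_def opposite_def Let_def module.defs lm_def rm_def)

lemma T_simps [simp]:
  "\<one>\<^bsub>T\<^esub> = oneA \<boxdot> oneA"
  "add T = add AA" "smult T = smult AA" "\<zero>\<^bsub>T\<^esub> = \<zero>\<^bsub>AA\<^esub>"
  by (simp_all add: T_algebra_def opposite_def Let_def module.defs AA.one_T)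

lemma T_D [simp]: "X \<in>! T ==> X \<in>! AA" and T_central: "X \<in>! T ==> b \<in> B ==> lm b X = rm b X"
  by (simp_all add: carrier_T)

lemma T_I: "X \<in>! AA ==> (\<And>b. b \<in> B ==> lm b X = rm b X) ==> X \<in>! T"
  unfolding carrier_T by blast

lemma module_T [simp]: "module K T"
proof (rule same_module_module)
  show "module K (AA\<lparr>carrier := {t \<in> carrier AA. \<forall>b\<in>B. lm b t = rm b t}\<rparr>)"
    by (intro equalizer_module[where N = AA] AA.module_T lm_facts(1,4) B_D)
qed (simp add: same_module_def, rule carrier_T[symmetric])

lemma abelian_group_T [simp]: "abelian_group T" using module_T by (rule module.axioms(2))

lemma T_incl [lin]: "linear_map K T AA (\<lambda>x. x)"
  by (auto simp: linear_map_def)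

lemma T_into: "linear_map K Z AA f ==> (\<And>z. z \<in>! Z ==> f z \<in>! T) ==> linear_map K Z T f"
  by (simp add: linear_map_def)

lemma star_bilinear: "Y \<in>! AA ==> bilinear K A A AA (\<lambda>x y. lm x (rm y Y))"
  by (intro lin) simp_all

lemma star_bal: "Y \<in>! T ==> balB (\<lambda>x y. lm x (rm y Y))"
proof (intro ballI)
  fix x b y assume *: "Y \<in>! T" "x \<in>! A" "b \<in> B" "y \<in>! A"
  then have "lm (x \<bullet> b) (rm y Y) = lm x (rm y (lm b Y))" by (simp add: lm_comp(1)[symmetric] lm_comp(3))
  also have "... = lm x (rm (b \<bullet> y) Y)" using * by (simp add: T_central lm_comp(2))
  finally show "lm (x \<bullet> b) (rm y Y) = lm x (rm (b \<bullet> y) Y)" .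
qed

text \<open>With the right factor in \<open>T\<close>, the product is balanced in the left factor,
  which may be any element of \<open>A \<otimes> A\<close> over \<open>B\<close>. This matters
  because an element of \<open>T\<close> need not be a sum of pure tensors that lie in
  \<open>T\<close>: laws are checked with the left factor running through all pure tensors.\<close>

lemma star:
  assumes X: "X \<in>! AA" and Y: "Y \<in>! T"
  shows "X \<ast> Y = aw AA (\<lambda>x y. lm x (rm y Y)) X"
proof -
  have Y': "Y \<in>! AA" using Y by simp
  have in_eq: "tensor_lift AA (\<lambda>x y. (x' \<bullet> x) \<boxdot> (y \<bullet> y')) Y = lm x' (rm y' Y)" if "x' \<in>! A" "y' \<in>! A" for x' y'
  proof -
    have b: "bilinear K A A AA (\<lambda>x y. (x' \<bullet> x) \<boxdot> (y \<bullet> y'))" using that by (intro lin) simp_all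
    have bal: "balB (\<lambda>x y. (x' \<bullet> x) \<boxdot> (y \<bullet> y'))"
      using that by (simp add: A.m_assoc[symmetric] AA.pure_balanced)
    show ?thesis
      by (rule AA.linear_eqI[OF AA.lift_linear[OF b bal] _ AA.module_T _ Y'])
        (use that in \<open>(intro lin)?, simp_all add: lm_facts(2,5) AA.lift_pure[OF bilinear_biadditive[OF b] bal]\<close>)
  qed
  have "X \<ast> Y = tensor_lift AA (\<lambda>x' y'. tensor_lift AA (\<lambda>x y. (x' \<bullet> x) \<boxdot> (y \<bullet> y')) Y) X"
    by (rule T_op_mult)
  also have "... = tensor_lift AA (\<lambda>x y. lm x (rm y Y)) X"
    using X in_eq by (rule AA.lift_cong)
  finally show ?thesis using aw_lift[OF star_bilinear[OF Y'] star_bal[OF Y] X] by simp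
qed

lemma star_linear:
  assumes Y: "Y \<in>! T" shows "linear_map K AA AA (\<lambda>X. X \<ast> Y)"
  by (rule linear_map_cong[OF aw_linear[OF star_bilinear star_bal linear_map_id AA.module_T] AA.module_T])
    (use Y in \<open>simp_all add: star\<close>)

lemma star_pure: "Y \<in>! T ==> x \<in>! A ==> y \<in>! A ==> (x \<boxdot> y) \<ast> Y = lm x (rm y Y)"
  by (simp add: star aw_pure star_bilinear star_bal)

lemma star_lm:
  assumes "Y \<in>! T" and X: "X \<in>! AA" and "a \<in>! A"
  shows "lm a X \<ast> Y = lm a (X \<ast> Y)" "rm a X \<ast> Y = rm a (X \<ast> Y)"
proof -
  note sl = linear_comp[OF _ star_linear[OF assms(1)]]
  show "lm a X \<ast> Y = lm a (X \<ast> Y)"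
  proof (rule AA.linear_eqI[OF _ _ AA.module_T _ X])
    show "linear_map K AA AA (\<lambda>X. lm a X \<ast> Y)" "linear_map K AA AA (\<lambda>X. lm a (X \<ast> Y))"
      using assms(3) by (intro sl lin; simp)+
  qed (use assms in \<open>simp_all add: lm_facts(2) star_pure lm_comp(1)\<close>)
  show "rm a X \<ast> Y = rm a (X \<ast> Y)"
  proof (rule AA.linear_eqI[OF _ _ AA.module_T _ X])
    show "linear_map K AA AA (\<lambda>X. rm a X \<ast> Y)" "linear_map K AA AA (\<lambda>X. rm a (X \<ast> Y))"
      using assms(3) by (intro sl lin; simp)+
  qed (use assms in \<open>simp_all add: lm_facts(5) star_pure lm_comp(2,3)[symmetric]\<close>)
qed

lemma star_closed:
  assumes "X \<in>! T" "Y \<in>! T"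
  shows "X \<ast> Y \<in>! T"
proof -
  have "X \<ast> Y \<in>! AA" using linear_mapD(1)[OF star_linear[OF assms(2)]] assms(1) by simp
  moreover have "lm b (X \<ast> Y) = rm b (X \<ast> Y)" if "b \<in> B" for b
    using star_lm[OF assms(2), of X b] assms(1) that by (simp add: T_central)
  ultimately show ?thesis by (rule T_I)
qed

lemma star_assoc:
  assumes X: "X \<in>! AA" and Y: "Y \<in>! T" and Z: "Z \<in>! T"
  shows "(X \<ast> Y) \<ast> Z = X \<ast> (Y \<ast> Z)"
  by (rule AA.linear_eqI[OF linear_comp[OF star_linear[OF Y] star_linear[OF Z]] star_linear[OF star_closed[OF Y Z]] AA.module_T _ X])
    (use Y Z star_closed[OF Y Z] in \<open>simp add: star_pure star_lm\<close>)

lemma st_T: "v \<in> R ==> v \<boxdot> oneA \<in>! T" "v \<in> R ==> oneA \<boxdot> v \<in>! T"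
  using AA.pure_balanced[of v _ "oneA"] AA.pure_balanced[of "oneA" _ v] by (auto intro!: T_I simp: lm_facts(2,5) R_comm)

lemma k_algebra_T [simp]: "k_algebra K T"
proof (rule k_algebraI)
  show "field K" by (rule K.field_axioms)
  fix x assume x: "x \<in>! T"
  show "\<one>\<^bsub>T\<^esub> \<ast> x = x" using star_pure[OF x, of "oneA" "oneA"] x by simp
  show "x \<ast> \<one>\<^bsub>T\<^esub> = x"
    using x star[of x "\<one>\<^bsub>T\<^esub>"] aw_pure_id[of x] st_T(1)[OF R_one] by (simp add: lm_facts(2,5))
  show "linear_map K T T (\<lambda>y. y \<ast> x)"
    by (rule T_into[OF linear_comp[OF T_incl star_linear[OF x]]]) (rule star_closed[OF _ x])
  have "linear_map K T AA (\<lambda>y. aw AA (\<lambda>u v. lm u (rm v y)) x)"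
    using x by (intro lin) simp_all
  from linear_map_cong[OF this module_T] have "linear_map K T AA (\<lambda>y. x \<ast> y)"
    using x star[of x] by simp
  then show "linear_map K T T (\<lambda>y. x \<ast> y)" by (rule T_into) (rule star_closed[OF x])
qed (simp_all add: star_closed star_assoc st_T)

sublocale T: ring T using k_algebra_T by (simp only: k_algebra_def)

text \<open>A coordinate map of \<open>T\<close> along \<open>\<gamma>\<close>: its value on
  \<open>lm v (\<gamma> h)\<close> is \<open>f h\<close> times \<open>v\<close>, and on
  \<open>T\<close> it takes values in the centralizer.\<close>

definition "mE f X = aw A (\<lambda>x y. x \<bullet> E f y) X"

lemma mE_bilinear: "functional f ==> bilinear K A A A (\<lambda>x y. x \<bullet> E f y)"
  by (intro lin) simp_all

lemma mE_bal: "functional f ==> balB (\<lambda>x y. x \<bullet> E f y)"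
  by (simp add: E_B A.m_assoc)

lemma mE_linear [lin]: "functional f ==> linear_map K Z AA g ==> module K Z ==> linear_map K Z A (\<lambda>z. mE f (g z))"
  unfolding mE_def by (intro aw_linear mE_bilinear mE_bal)

lemma mE_pure: "functional f ==> x \<in>! A ==> y \<in>! A ==> mE f (x \<boxdot> y) = x \<bullet> E f y"
  unfolding mE_def by (simp add: aw_pure mE_bilinear mE_bal)

lemma mE_closed [simp]: "functional f ==> X \<in>! AA ==> mE f X \<in>! A"
  using linear_mapD(1)[OF mE_linear[OF _ linear_map_id AA.module_T]] .

lemma mE_lm:
  assumes f: "functional f" and X: "X \<in>! AA"
  shows "a \<in>! A ==> mE f (lm a X) = a \<bullet> mE f X" "b \<in> B ==> mE f (rm b X) = mE f X \<bullet> b"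
  using assms by (simp_all add: mE_def[of f "lm _ _"] mE_def[of f "rm _ _"] aw_lm mE_bilinear mE_bal)
    (simp_all add: mE_def push E_B A.m_assoc)

lemma mE_R [simp]: "functional f ==> X \<in>! T ==> mE f X \<in> R"
  by (rule R_I) (auto simp: mE_lm[symmetric] T_central)

lemma mE_gamma: "functional f ==> h \<in>! H ==> mE f (\<gamma> h) = f h \<odot>\<^bsub>A\<^esub> oneA"
  using gw_beta[OF E_bilinear, of f h] by (simp add: mE_def E_def push)

abbreviation "VH \<equiv> ktensor K V H"

text \<open>Candidate for the inverse of \<open>v \<otimes> h \<mapsto> lm v (\<gamma> h)\<close>;
  the formula defines an element of \<open>V \<otimes> H\<close> for \<open>X\<close> in
  \<open>T\<close> because of \<open>mE_R\<close>.\<close>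

definition "j X = (\<Oplus>\<^bsub>VH\<^esub>i\<in>{..<n}. mE (p i) X \<boxtimes>\<^bsub>VH\<^esub> e i)"

lemma j_linear: "linear_map K T VH j"
  unfolding j_def by (intro linear_map_finsum_fun lin V_into) (simp_all add: p_linear)

lemma gamma_T: "v \<in> R ==> h \<in>! H ==> lm v (\<gamma> h) \<in>! T"
  by (rule T_I) (simp_all add: lm_comp(1) lm_comp(3)[symmetric] gamma_central[symmetric] R_comm)

lemma st_star: "v \<in> R ==> X \<in>! T ==> (v \<boxdot> oneA) \<ast> X = lm v X" "v \<in> R ==> X \<in>! T ==> (oneA \<boxdot> v) \<ast> X = rm v X"
  using star_pure[of X v "oneA"] star_pure[of X "oneA" v] by auto

lemma gamma_T' [simp]: "h \<in>! H ==> \<gamma> h \<in>! T"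
  using gamma_T[of "oneA" h] by simp

lemma j_gen: "v \<in> R ==> h \<in>! H ==> j (lm v (\<gamma> h)) = v \<boxtimes>\<^bsub>VH\<^esub> h"
proof -
  assume v: "v \<in> R" and h: "h \<in>! H"
  have l: "linear_map K V VH (\<lambda>u. u \<boxtimes>\<^bsub>VH\<^esub> e i)" if "i < n" for i using that by (intro lin) simp_all
  have l': "linear_map K H VH (\<lambda>u. v \<boxtimes>\<^bsub>VH\<^esub> u)" using v by (intro lin) simp_all
  have "j (lm v (\<gamma> h)) = (\<Oplus>\<^bsub>VH\<^esub>i\<in>{..<n}. p i h \<odot>\<^bsub>VH\<^esub> (v \<boxtimes>\<^bsub>VH\<^esub> e i))"
    unfolding j_def using v h by (intro finsum_eqI)
      (simp add: mE_lm p_linear mE_gamma linear_mapD(3)[OF l, simplified])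
  also have "... = v \<boxtimes>\<^bsub>VH\<^esub> h" using expand[OF l' _ h] by simp
  finally show ?thesis .
qed

text \<open>This is \<open>reconstruct\<close> with the coaction of the second leg expanded over the
  dual basis. Together with \<open>j_gen\<close> it shows that \<open>j\<close> and
  \<open>v \<otimes> h \<mapsto> lm v (\<gamma> h)\<close> are inverse to each other.\<close>

lemma T_reconstruct:
  assumes X: "X \<in>! AA"
  shows "X = (\<Oplus>\<^bsub>AA\<^esub>i\<in>{..<n}. lm (mE (p i) X) (\<gamma> (e i)))"
proof (rule AA.linear_eqI[OF linear_map_id _ AA.module_T _ X])
  show "linear_map K AA AA (\<lambda>X. \<Oplus>\<^bsub>AA\<^esub>i\<in>{..<n}. lm (mE (p i) X) (\<gamma> (e i)))"
    by (intro linear_map_finsum_fun lin) (simp_all add: p_linear)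
  fix x y assume *: "x \<in>! A" "y \<in>! A"
  have "bilinear K A H AA (\<lambda>a g. lm (x \<bullet> a) (\<gamma> g))" using * by (intro lin) simp_all
  note trans[OF reconstruct[OF *] rw_expand[OF this *(2)]]
  also have "(\<Oplus>\<^bsub>AA\<^esub>i\<in>{..<n}. lm (x \<bullet> E (p i) y) (\<gamma> (e i))) = (\<Oplus>\<^bsub>AA\<^esub>i\<in>{..<n}. lm (mE (p i) (x \<boxdot> y)) (\<gamma> (e i)))"
    using * by (intro finsum_eqI) (simp add: mE_pure p_linear)
  finally show "x \<boxdot> y = ..." .
qed

lemma T_reconstruct': "X \<in>! T ==> X = (\<Oplus>\<^bsub>T\<^esub>i\<in>{..<n}. lm (mE (p i) X) (\<gamma> (e i)))"
  using T_reconstruct[of X] linear_map_finsum[OF T_incl module_T AA.module_T, of "{..<n}" "\<lambda>i. lm (mE (p i) X) (\<gamma> (e i))"]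
  by (simp add: p_linear gamma_T)

lemma rm_T [simp]: "r \<in> R ==> X \<in>! T ==> rm r X \<in>! T" "r \<in> R ==> X \<in>! T ==> lm r X \<in>! T"
  using star_closed[of "oneA \<boxdot> r" X] star_closed[of "r \<boxdot> oneA" X] by (simp_all add: st_star st_T)

lemma lm_T_linear [lin]:
  "linear_map K Z T f ==> r \<in> R ==> linear_map K Z T (\<lambda>z. rm r (f z))"
  "linear_map K Z T f ==> r \<in> R ==> linear_map K Z T (\<lambda>z. lm r (f z))"
proof -
  assume f: "linear_map K Z T f" and r: "r \<in> R"
  note fA = linear_comp[OF f T_incl]
  show "linear_map K Z T (\<lambda>z. rm r (f z))" "linear_map K Z T (\<lambda>z. lm r (f z))"
    by (rule T_into, intro lin fA; use r linear_mapD(1)[OF f] in simp)+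
qed

section \<open>The coproduct of \<open>T^op\<close>\<close>

abbreviation "AAA \<equiv> tensor A AA B (\<lambda>a b. a \<bullet> b) (\<lambda>b. tensor_lift AA (\<lambda>x y. (b \<bullet> x) \<boxdot> y))"
abbreviation "L2 \<equiv> base_tensor T V (\<lambda>r. r \<boxdot> oneA) (\<lambda>r. oneA \<boxdot> r)"

sublocale AAA: balanced_tensor K A AA B "\<lambda>a b. a \<bullet> b" lm AAA
proof (rule balanced_tensor.intro)
  show "AAA = tensor A AA B (\<lambda>a b. a \<bullet> b) lm" by (simp only: lm_def[abs_def])
  fix c assume c: "c \<in>! K"
  have "lm (c \<odot>\<^bsub>A\<^esub> oneA) X = c \<odot>\<^bsub>AA\<^esub> X" if X: "X \<in>! AA" for X
    using linear_mapD(3)[OF lm_linear(3)[OF linear_map_id modV X] c A.one_closed] X by simp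
  then show "\<exists>s\<in>B. (\<forall>m\<in>carrier A. m \<bullet> s = c \<odot>\<^bsub>A\<^esub> m) \<and> (\<forall>n\<in>carrier AA. lm s n = c \<odot>\<^bsub>AA\<^esub> n)"
    using scalar_in_B[OF c] c by (intro bexI[of _ "c \<odot>\<^bsub>A\<^esub> oneA"]) auto
qed (intro lin lm_facts modV AA.module_T kA B_D; assumption)+

sublocale L2: balanced_tensor K T T R "\<lambda>x r. (oneA \<boxdot> r) \<ast> x" "\<lambda>r x. (r \<boxdot> oneA) \<ast> x" L2
proof (rule balanced_tensor.intro)
  show "L2 = tensor T T R (\<lambda>x r. (oneA \<boxdot> r) \<ast> x) (\<lambda>r x. (r \<boxdot> oneA) \<ast> x)"
    by (simp add: base_tensor_def)
  fix c assume c: "c \<in>! K"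
  then have r: "c \<odot>\<^bsub>A\<^esub> oneA \<in> R" by simp
  have "lm (c \<odot>\<^bsub>A\<^esub> oneA) X = c \<odot>\<^bsub>AA\<^esub> X" "rm (c \<odot>\<^bsub>A\<^esub> oneA) X = c \<odot>\<^bsub>AA\<^esub> X" if X: "X \<in>! AA" for X
    using linear_mapD(3)[OF lm_linear(3)[OF linear_map_id modV X] c A.one_closed]
      linear_mapD(3)[OF lm_linear(4)[OF linear_map_id modV X] c A.one_closed] X by simp_all
  then show "\<exists>s\<in>R. (\<forall>m\<in>carrier T. (oneA \<boxdot> s) \<ast> m = c \<odot>\<^bsub>T\<^esub> m) \<and> (\<forall>n\<in>carrier T. (s \<boxdot> oneA) \<ast> n = c \<odot>\<^bsub>T\<^esub> n)"
    using r by (intro bexI[of _ "c \<odot>\<^bsub>A\<^esub> oneA"]) (auto simp: st_star)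
qed (intro lin k_algebra_T module_T st_T; assumption)+

declare AAA.module_T [simp] AAA.abelian_T [simp] L2.module_T [simp] L2.abelian_T [simp]

lemma pure_AAA_linear [lin]:
  "linear_map K Z A f ==> y \<in>! AA ==> linear_map K Z AAA (\<lambda>z. f z \<boxtimes>\<^bsub>AAA\<^esub> y)"
  "linear_map K Z AA g ==> x \<in>! A ==> linear_map K Z AAA (\<lambda>z. x \<boxtimes>\<^bsub>AAA\<^esub> g z)"
  "linear_map K Z T k ==> u \<in>! T ==> linear_map K Z L2 (\<lambda>z. k z \<boxtimes>\<^bsub>L2\<^esub> u)"
  "linear_map K Z T l ==> u \<in>! T ==> linear_map K Z L2 (\<lambda>z. u \<boxtimes>\<^bsub>L2\<^esub> l z)"
  using linear_comp[OF _ bilinearD(2)[OF AAA.pure_bilinear]] linear_comp[OF _ bilinearD(3)[OF AAA.pure_bilinear]]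
    linear_comp[OF _ bilinearD(2)[OF L2.pure_bilinear]] linear_comp[OF _ bilinearD(3)[OF L2.pure_bilinear]] by blast+

definition "can2 u u' = aw AAA (\<lambda>x y. x \<boxtimes>\<^bsub>AAA\<^esub> lm y u') u"
definition "can = tensor_lift AAA can2"

lemma can2_bb: "u' \<in>! AA ==> bilinear K A A AAA (\<lambda>x y. x \<boxtimes>\<^bsub>AAA\<^esub> lm y u')" "u' \<in>! AA ==> balB (\<lambda>x y. x \<boxtimes>\<^bsub>AAA\<^esub> lm y u')"
proof -
  show "u' \<in>! AA ==> bilinear K A A AAA (\<lambda>x y. x \<boxtimes>\<^bsub>AAA\<^esub> lm y u')" by (intro lin) simp_all
  show "u' \<in>! AA ==> balB (\<lambda>x y. x \<boxtimes>\<^bsub>AAA\<^esub> lm y u')" by (simp add: AAA.pure_balanced lm_comp)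
qed

lemma can2_bilinear: "bilinear K T T AAA can2"
proof (rule bilinearI)
  fix u assume u: "u \<in>! T"
  show "linear_map K T AAA (\<lambda>x. can2 x u)" unfolding can2_def
    using u can2_bb[of u] by (intro aw_linear T_incl) simp_all
  show "linear_map K T AAA (can2 u)" unfolding can2_def[abs_def] using u by (intro lin) simp_all
qed simp

lemma can2_balanced: "\<forall>u\<in>carrier T. \<forall>r\<in>R. \<forall>u'\<in>carrier T. can2 ((oneA \<boxdot> r) \<ast> u) u' = can2 u ((r \<boxdot> oneA) \<ast> u')"
  by (simp add: st_star can2_def aw_lm can2_bb lm_comp)

lemmas can_linear = L2.lift_linear[OF can2_bilinear can2_balanced, folded can_def]

lemma can_pure: "u \<in>! T ==> u' \<in>! T ==> can (u \<boxtimes>\<^bsub>L2\<^esub> u') = can2 u u'"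
  unfolding can_def using L2.lift_pure[OF bilinear_biadditive[OF can2_bilinear] can2_balanced] .

text \<open>The innermost of the three nested lifts is the left action \<open>lm\<close> seen inside
  a pure tensor, by linearity. Agreement on the tensor square is all that an inverse into it can
  notice.\<close>

lemma can_eq:
  assumes w: "w \<in>! L2"
  shows "tensor_lift AAA (\<lambda>u u'. tensor_lift AAA (\<lambda>x y. tensor_lift AAA (\<lambda>x' y'. x \<boxtimes>\<^bsub>AAA\<^esub> ((y \<bullet> x') \<boxdot> y')) u') u) w = can w"
  unfolding can_def
proof (rule L2.lift_cong[OF w])
  fix u u' assume u: "u \<in>! T" "u' \<in>! T"
  have "tensor_lift AAA (\<lambda>x' y'. x \<boxtimes>\<^bsub>AAA\<^esub> ((y \<bullet> x') \<boxdot> y')) u' = x \<boxtimes>\<^bsub>AAA\<^esub> lm y u'" if "x \<in>! A" "y \<in>! A" for x y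
  proof -
    have b: "bilinear K A A AAA (\<lambda>x' y'. x \<boxtimes>\<^bsub>AAA\<^esub> ((y \<bullet> x') \<boxdot> y'))" using that by (intro lin) simp_all
    have bal: "balB (\<lambda>x' y'. x \<boxtimes>\<^bsub>AAA\<^esub> ((y \<bullet> x') \<boxdot> y'))" using that by (simp add: A.m_assoc[symmetric] AA.pure_balanced)
    have "linear_map K AA AAA (\<lambda>z. x \<boxtimes>\<^bsub>AAA\<^esub> lm y z)" using that by (intro lin)
    then show ?thesis
      by (rule AA.linear_eqI[OF AA.lift_linear[OF b bal]])
        (use that u in \<open>simp_all add: lm_facts(2) AA.lift_pure[OF bilinear_biadditive[OF b] bal]\<close>)
  qed
  with T_D[OF u(1)] have "tensor_lift AAA (\<lambda>x y. tensor_lift AAA (\<lambda>x' y'. x \<boxtimes>\<^bsub>AAA\<^esub> ((y \<bullet> x') \<boxdot> y')) u') u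
    = tensor_lift AAA (\<lambda>x y. x \<boxtimes>\<^bsub>AAA\<^esub> lm y u') u" by (rule AA.lift_cong)
  also have "... = can2 u u'" unfolding can2_def by (rule aw_lift[OF can2_bb, symmetric]) (use u in simp_all)
  finally show "tensor_lift AAA (\<lambda>x y. tensor_lift AAA (\<lambda>x' y'. x \<boxtimes>\<^bsub>AAA\<^esub> ((y \<bullet> x') \<boxdot> y')) u') u = can2 u u'" .
qed

text \<open>A left inverse of \<open>can\<close> is \<open>w \<mapsto> \<Sum> \<psi>\<^sub>i (can w) \<otimes> \<gamma> (e\<^sub>i)\<close>, where \<open>\<psi>\<^sub>i (x \<otimes> y \<otimes> z) = x \<otimes> y E\<^sub>i(z)\<close>.\<close>

lemma can_inj: "inj_on can (carrier L2)"
proof -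
  define \<psi> where "\<psi> i = tensor_lift AA (\<lambda>x X. x \<boxdot> mE (p i) X)" for i
  have b: "bilinear K A AA AA (\<lambda>x X. x \<boxdot> mE (p i) X)" if "i < n" for i
    using that by (intro lin) (simp_all add: p_linear)
  have bal: "\<forall>x\<in>carrier A. \<forall>b\<in>B. \<forall>X\<in>carrier AA. (x \<bullet> b) \<boxdot> mE (p i) X = x \<boxdot> mE (p i) (lm b X)" if "i < n" for i
    using that by (simp add: p_linear mE_lm AA.pure_balanced)
  have l: "linear_map K AAA AA (\<psi> i)" if "i < n" for i
    unfolding \<psi>_def by (rule AAA.lift_linear[OF b[OF that] bal[OF that]])
  have \<psi>_can: "\<psi> i (can (u \<boxtimes>\<^bsub>L2\<^esub> u')) = rm (mE (p i) u') u" if "i < n" "u \<in>! T" "u' \<in>! T" for i u u'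
    using that AAA.lift_pure[OF bilinear_biadditive[OF b[OF that(1)]] bal[OF that(1)]]
    by (simp add: can_pure can2_def aw_push[OF l]) (simp add: \<psi>_def mE_lm p_linear lm_facts(6))
  \<comment> \<open>Membership in \<open>T\<close> holds on the image of \<open>can\<close>: for a
    pure tensor the value is \<open>u\<close> multiplied on the right by a member of the
    centralizer, and the general case follows by additivity.\<close>
  have T: "\<psi> i (can w) \<in>! T" if i: "i < n" and "w \<in>! L2" for i w
    using that(2)
  proof (induction w rule: L2.induct)
    case (pure u u')
    then show ?case using i by (simp add: \<psi>_can p_linear)
  next
    case zero
    then show ?case using linear_map_zero[OF linear_comp[OF can_linear l[OF i]] L2.module_T AA.module_T] T.zero_closed by simp
  next
    case (add w w')
    then show ?case using linear_mapD(2)[OF linear_comp[OF can_linear l[OF i]]] T.add.m_closed by simp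
  qed
  have "(\<Oplus>\<^bsub>L2\<^esub>i\<in>{..<n}. \<psi> i (can w) \<boxtimes>\<^bsub>L2\<^esub> \<gamma> (e i)) = w" if w: "w \<in>! L2" for w
  proof (rule L2.linear_eqI[OF _ linear_map_id L2.module_T _ w])
    show "linear_map K L2 L2 (\<lambda>w. \<Oplus>\<^bsub>L2\<^esub>i\<in>{..<n}. \<psi> i (can w) \<boxtimes>\<^bsub>L2\<^esub> \<gamma> (e i))"
      by (intro linear_map_finsum_fun pure_AAA_linear(3) T_into linear_comp[OF can_linear l]) (simp_all add: T)
    fix u u' assume u: "u \<in>! T" "u' \<in>! T"
    have lu: "linear_map K T L2 (\<lambda>z. u \<boxtimes>\<^bsub>L2\<^esub> z)" using u by (intro lin)
    have "(\<Oplus>\<^bsub>L2\<^esub>i\<in>{..<n}. \<psi> i (can (u \<boxtimes>\<^bsub>L2\<^esub> u')) \<boxtimes>\<^bsub>L2\<^esub> \<gamma> (e i)) = (\<Oplus>\<^bsub>L2\<^esub>i\<in>{..<n}. u \<boxtimes>\<^bsub>L2\<^esub> lm (mE (p i) u') (\<gamma> (e i)))"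
    proof (intro finsum_eqI)
      fix i assume "i \<in> {..<n}"
      then show "\<psi> i (can (u \<boxtimes>\<^bsub>L2\<^esub> u')) \<boxtimes>\<^bsub>L2\<^esub> \<gamma> (e i) = u \<boxtimes>\<^bsub>L2\<^esub> lm (mE (p i) u') (\<gamma> (e i))"
        using u L2.pure_balanced[of u "mE (p i) u'" "\<gamma> (e i)"] by (simp add: \<psi>_can p_linear st_star)
    qed
    also have "... = u \<boxtimes>\<^bsub>L2\<^esub> (\<Oplus>\<^bsub>T\<^esub>i\<in>{..<n}. lm (mE (p i) u') (\<gamma> (e i)))"
      using u by (intro linear_map_finsum[OF lu, symmetric]) (simp_all add: p_linear)
    finally show "(\<Oplus>\<^bsub>L2\<^esub>i\<in>{..<n}. \<psi> i (can (u \<boxtimes>\<^bsub>L2\<^esub> u')) \<boxtimes>\<^bsub>L2\<^esub> \<gamma> (e i)) = u \<boxtimes>\<^bsub>L2\<^esub> u'"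
      using T_reconstruct'[OF u(2)] by simp
  qed
  then show ?thesis by (rule inj_on_inverseI)
qed

definition "\<Gamma> = tensor_lift AAA (\<lambda>x y. x \<boxtimes>\<^bsub>AAA\<^esub> (oneA \<boxdot> y))"
definition "cop v h = sw L2 (\<lambda>x y. lm v (\<gamma> x) \<boxtimes>\<^bsub>L2\<^esub> \<gamma> y) h"

lemma \<Gamma>_bb: "bilinear K A A AAA (\<lambda>x y. x \<boxtimes>\<^bsub>AAA\<^esub> (oneA \<boxdot> y))" "balB (\<lambda>x y. x \<boxtimes>\<^bsub>AAA\<^esub> (oneA \<boxdot> y))"
proof -
  show "bilinear K A A AAA (\<lambda>x y. x \<boxtimes>\<^bsub>AAA\<^esub> (oneA \<boxdot> y))" by (intro lin) simp_all
  show "balB (\<lambda>x y. x \<boxtimes>\<^bsub>AAA\<^esub> (oneA \<boxdot> y))"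
    using AA.pure_balanced[of "oneA"] by (simp add: AAA.pure_balanced lm_facts(2))
qed

lemma gamma_linear_T [lin]: "linear_map K Z H f ==> linear_map K Z T (\<lambda>z. \<gamma> (f z))"
  using linear_mapD(1)[of K Z H f] by (intro T_into lin) simp_all

lemma lm_gamma_linear [lin]: "linear_map K Z V g ==> module K Z ==> h \<in>! H ==> linear_map K Z T (\<lambda>z. lm (g z) (\<gamma> h))"
  using linear_mapD(1)[of K Z V g] by (intro T_into lm_linear(3) linear_comp[OF _ V_incl]) (simp_all add: gamma_T)

lemma cop_closed [simp]: "v \<in> R ==> h \<in>! H ==> cop v h \<in>! L2"
  unfolding cop_def by simp

text \<open>Colinearity of \<open>\<gamma>\<close> exchanges the coproduct of \<open>h\<close> for
  the coaction on the second leg \<open>w\<close> of \<open>\<gamma> h\<close>, and the sum of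
  \<open>w0 \<gamma>(w1)\<close> is \<open>1 \<otimes> w\<close> by
  \<open>reconstruct\<close>.\<close>

lemma can_cop: "v \<in> R ==> h \<in>! H ==> can (cop v h) = \<Gamma> (lm v (\<gamma> h))"
proof -
  assume v: "v \<in> R" and h: "h \<in>! H"
  have "can (cop v h) = sw AAA (\<lambda>x y. gw AAA (\<lambda>z w. (v \<bullet> z) \<boxtimes>\<^bsub>AAA\<^esub> lm w (\<gamma> y)) x) h"
    unfolding cop_def using v h by (simp add: sw_push[OF can_linear] can_pure can2_def aw_lm can2_bb)
  also have "... = gw AAA (\<lambda>z w. rw AAA (\<lambda>a g. (v \<bullet> z) \<boxtimes>\<^bsub>AAA\<^esub> lm a (\<gamma> g)) w) h"
    using v h by (intro gw_coaction[symmetric]) ((intro lin)?, simp_all add: AAA.pure_balanced lm_comp A.m_assoc[symmetric])+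
  also have "... = gw AAA (\<lambda>z w. (v \<bullet> z) \<boxtimes>\<^bsub>AAA\<^esub> (oneA \<boxdot> w)) h"
  proof (rule tsum_cong[OF refl])
    fix z w assume zw: "z \<in>! A" "w \<in>! A"
    then have l: "linear_map K AA AAA (\<lambda>X. (v \<bullet> z) \<boxtimes>\<^bsub>AAA\<^esub> X)" using v by (intro lin) simp_all
    have "(v \<bullet> z) \<boxtimes>\<^bsub>AAA\<^esub> (oneA \<boxdot> w) = (v \<bullet> z) \<boxtimes>\<^bsub>AAA\<^esub> rw AA (\<lambda>a g. lm (oneA \<bullet> a) (\<gamma> g)) w"
      using reconstruct[OF A.one_closed zw(2)] by (rule arg_cong)
    then show "rw AAA (\<lambda>a g. (v \<bullet> z) \<boxtimes>\<^bsub>AAA\<^esub> lm a (\<gamma> g)) w = (v \<bullet> z) \<boxtimes>\<^bsub>AAA\<^esub> (oneA \<boxdot> w)"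
      using zw by (simp add: rw_push[OF l])
  qed
  also have "... = \<Gamma> (lm v (\<gamma> h))"
    using v h by (simp add: \<Gamma>_def aw_lift[OF \<Gamma>_bb, symmetric] aw_lm \<Gamma>_bb)
  finally show ?thesis .
qed

lemma cop_linear [lin]:
  "linear_map K Z V g ==> module K Z ==> h \<in>! H ==> linear_map K Z L2 (\<lambda>z. cop (g z) h)"
  unfolding cop_def by (intro lin) simp_all

lemma can_\<Gamma>: "u \<in>! T ==> can (\<Oplus>\<^bsub>L2\<^esub>i\<in>{..<n}. cop (mE (p i) u) (e i)) = \<Gamma> u"
proof -
  assume u: "u \<in>! T"
  note l = linear_comp[OF T_incl AA.lift_linear[OF \<Gamma>_bb], folded \<Gamma>_def]
  have "can (\<Oplus>\<^bsub>L2\<^esub>i\<in>{..<n}. cop (mE (p i) u) (e i)) = (\<Oplus>\<^bsub>AAA\<^esub>i\<in>{..<n}. \<Gamma> (lm (mE (p i) u) (\<gamma> (e i))))"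
    using u by (subst linear_map_finsum[OF can_linear])
      (auto simp: p_linear can_cop intro!: finsum_eqI)
  also have "... = \<Gamma> (\<Oplus>\<^bsub>T\<^esub>i\<in>{..<n}. lm (mE (p i) u) (\<gamma> (e i)))"
    using u by (intro linear_map_finsum[OF l, symmetric]) (simp_all add: p_linear)
  finally show ?thesis using T_reconstruct'[OF u] by simp
qed

lemma T_op_fields:
  "total (T_op A B) = T" "base (T_op A B) = V" "source (T_op A B) = (\<lambda>r. r \<boxdot> oneA)" "target (T_op A B) = (\<lambda>r. oneA \<boxdot> r)"
  "coun (T_op A B) = tensor_lift A (\<lambda>x y. x \<bullet> y)"
  by (simp_all only: T_op_def Let_def bialgebroid.select_convs)

lemma coprod_T_op: "coprod (T_op A B) u = inv_into (carrier L2) can (\<Gamma> u)"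
proof -
  have "inv_into (carrier L2) (tensor_lift AAA (\<lambda>u u'. tensor_lift AAA (\<lambda>x y. tensor_lift AAA (\<lambda>x' y'. x \<boxtimes>\<^bsub>AAA\<^esub> ((y \<bullet> x') \<boxdot> y')) u') u)) z
    = inv_into (carrier L2) can z" for z
    unfolding inv_into_def using can_eq by (intro arg_cong[where f = Eps] ext) auto
  then show ?thesis by (simp only: T_op_def Let_def bialgebroid.select_convs \<Gamma>_def)
qed

text \<open>An inverse image does not show that the coproduct is linear; this explicit preimage
  does.\<close>

lemma coprod_eq: "u \<in>! T ==> coprod (T_op A B) u = (\<Oplus>\<^bsub>L2\<^esub>i\<in>{..<n}. cop (mE (p i) u) (e i))"
  unfolding coprod_T_op by (rule inv_into_f_eq[OF can_inj])
    (auto simp: can_\<Gamma> p_linear intro!: abelian_monoid.finsum_closed abelian_group.axioms)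

lemma coprod_gen_T: "v \<in> R ==> h \<in>! H ==> coprod (T_op A B) (lm v (\<gamma> h)) = cop v h"
  unfolding coprod_T_op by (rule inv_into_f_eq[OF can_inj]) (simp_all add: can_cop)

lemma coun_eq:
  assumes "u \<in>! AA"
  shows "tensor_lift A (\<lambda>x y. x \<bullet> y) u = mE \<epsilon> u"
proof -
  have b: "bilinear K A A A (\<lambda>x y. x \<bullet> y)" and bal: "balB (\<lambda>x y. x \<bullet> y)"
    by (intro lin; simp) (simp add: A.m_assoc)
  show ?thesis using assms by (simp add: mE_def E_counit aw_lift[OF b bal])
qed

end

section \<open>Expansion over bases and change to the opposite algebra\<close>

lemma bilinear_expand:
  fixes n m :: nat
  assumes b: "bilinear K M N G \<phi>" and M: "module K M" and N: "module K N" and xy: "x \<in>! M" "y \<in>! N"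
    and x: "x = (\<Oplus>\<^bsub>M\<^esub>i\<in>{..<n}. c i \<odot>\<^bsub>M\<^esub> f i)" "\<And>i. i < n ==> c i \<in>! K" "\<And>i. i < n ==> f i \<in>! M"
    and y: "y = (\<Oplus>\<^bsub>N\<^esub>i\<in>{..<m}. d i \<odot>\<^bsub>N\<^esub> g i)" "\<And>i. i < m ==> d i \<in>! K" "\<And>i. i < m ==> g i \<in>! N"
  shows "\<phi> x y = (\<Oplus>\<^bsub>G\<^esub>i\<in>{..<n}. \<Oplus>\<^bsub>G\<^esub>j\<in>{..<m}. (c i \<otimes>\<^bsub>K\<^esub> d j) \<odot>\<^bsub>G\<^esub> \<phi> (f i) (g j))"
proof -
  interpret M: module K M by fact
  interpret N: module K N by fact
  interpret G: module K G by (rule bilinearD(1)[OF b])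
  note l = bilinearD(2)[OF b] bilinearD(3)[OF b] and cl = bilinearD(4)[OF b]
  have "\<phi> x y = (\<Oplus>\<^bsub>G\<^esub>i\<in>{..<n}. \<phi> (c i \<odot>\<^bsub>M\<^esub> f i) y)"
    by (subst x(1), rule linear_map_finsum[OF l(1)[OF xy(2)] M]) (use x in \<open>auto intro: G.module_axioms\<close>)
  also have "... = (\<Oplus>\<^bsub>G\<^esub>i\<in>{..<n}. \<Oplus>\<^bsub>G\<^esub>j\<in>{..<m}. (c i \<otimes>\<^bsub>K\<^esub> d j) \<odot>\<^bsub>G\<^esub> \<phi> (f i) (g j))"
  proof (rule finsum_eqI)
    fix i assume "i \<in> {..<n}"
    then have i: "c i \<in>! K" "f i \<in>! M" using x by simp_all
    have "\<phi> (f i) y = (\<Oplus>\<^bsub>G\<^esub>j\<in>{..<m}. \<phi> (f i) (d j \<odot>\<^bsub>N\<^esub> g j))"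
      by (subst y(1), rule linear_map_finsum[OF l(2)[OF i(2)] N]) (use y in \<open>auto intro: G.module_axioms\<close>)
    also have "... = (\<Oplus>\<^bsub>G\<^esub>j\<in>{..<m}. d j \<odot>\<^bsub>G\<^esub> \<phi> (f i) (g j))"
      using y by (intro finsum_eqI) (simp add: linear_mapD(3)[OF l(2)[OF i(2)]])
    finally have "\<phi> (c i \<odot>\<^bsub>M\<^esub> f i) y = c i \<odot>\<^bsub>G\<^esub> (\<Oplus>\<^bsub>G\<^esub>j\<in>{..<m}. d j \<odot>\<^bsub>G\<^esub> \<phi> (f i) (g j))"
      using i by (simp add: linear_mapD(3)[OF l(1)[OF xy(2)]])
    also have "... = (\<Oplus>\<^bsub>G\<^esub>j\<in>{..<m}. c i \<odot>\<^bsub>G\<^esub> (d j \<odot>\<^bsub>G\<^esub> \<phi> (f i) (g j)))"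
      using i y cl by (intro G.finsum_smult_ldistr) auto
    also have "... = (\<Oplus>\<^bsub>G\<^esub>j\<in>{..<m}. (c i \<otimes>\<^bsub>K\<^esub> d j) \<odot>\<^bsub>G\<^esub> \<phi> (f i) (g j))"
      using i y cl by (intro finsum_eqI) (simp add: G.smult_assoc1)
    finally show "\<phi> (c i \<odot>\<^bsub>M\<^esub> f i) y = (\<Oplus>\<^bsub>G\<^esub>j\<in>{..<m}. (c i \<otimes>\<^bsub>K\<^esub> d j) \<odot>\<^bsub>G\<^esub> \<phi> (f i) (g j))" .
  qed
  finally show ?thesis .
qed

text \<open>The coefficient of \<open>e i \<otimes> e j\<close> in the coproduct of \<open>h\<close>
  is the convolution product of \<open>p i\<close> and \<open>p j\<close>, evaluated at
  \<open>h\<close>.\<close>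

lemma (in fd_hopf) sw_expand:
  assumes b: "bilinear K H H G \<phi>" and h: "h \<in>! H"
  shows "sw G \<phi> h = (\<Oplus>\<^bsub>G\<^esub>i\<in>{..<n}. \<Oplus>\<^bsub>G\<^esub>j\<in>{..<n}. sw (self_module K) (\<lambda>x y. p i x \<otimes>\<^bsub>K\<^esub> p j y) h \<odot>\<^bsub>G\<^esub> \<phi> (e i) (e j))"
proof -
  note G = bilinearD(1)[OF b] and cl = bilinearD(4)[OF b]
  interpret G: module K G by (rule G)
  have s: "linear_map K (self_module K) G (\<lambda>c. c \<odot>\<^bsub>G\<^esub> z)" if "z \<in>! G" for z
    using that G by (intro lin) simp_all
  have "sw G \<phi> h = sw G (\<lambda>x y. \<Oplus>\<^bsub>G\<^esub>i\<in>{..<n}. \<Oplus>\<^bsub>G\<^esub>j\<in>{..<n}. (p i x \<otimes>\<^bsub>K\<^esub> p j y) \<odot>\<^bsub>G\<^esub> \<phi> (e i) (e j)) h"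
  proof (rule tsum_cong[OF refl])
    fix x y assume xy: "x \<in>! H" "y \<in>! H"
    show "\<phi> x y = (\<Oplus>\<^bsub>G\<^esub>i\<in>{..<n}. \<Oplus>\<^bsub>G\<^esub>j\<in>{..<n}. (p i x \<otimes>\<^bsub>K\<^esub> p j y) \<odot>\<^bsub>G\<^esub> \<phi> (e i) (e j))"
      by (rule bilinear_expand[OF b module_H module_H xy expand[OF linear_map_id module_H xy(1)] _ _
            expand[OF linear_map_id module_H xy(2)]]) (simp_all add: xy)
  qed
  also have "... = (\<Oplus>\<^bsub>G\<^esub>i\<in>{..<n}. sw G (\<lambda>x y. \<Oplus>\<^bsub>G\<^esub>j\<in>{..<n}. (p i x \<otimes>\<^bsub>K\<^esub> p j y) \<odot>\<^bsub>G\<^esub> \<phi> (e i) (e j)) h)"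
    using h cl by (intro tsum_finsum G.M.abelian_group_axioms) (auto intro!: G.M.finsum_closed)
  also have "... = (\<Oplus>\<^bsub>G\<^esub>i\<in>{..<n}. \<Oplus>\<^bsub>G\<^esub>j\<in>{..<n}. sw G (\<lambda>x y. (p i x \<otimes>\<^bsub>K\<^esub> p j y) \<odot>\<^bsub>G\<^esub> \<phi> (e i) (e j)) h)"
    using h cl by (intro finsum_eqI tsum_finsum G.M.abelian_group_axioms) auto
  also have "... = (\<Oplus>\<^bsub>G\<^esub>i\<in>{..<n}. \<Oplus>\<^bsub>G\<^esub>j\<in>{..<n}. sw (self_module K) (\<lambda>x y. p i x \<otimes>\<^bsub>K\<^esub> p j y) h \<odot>\<^bsub>G\<^esub> \<phi> (e i) (e j))"
    using h cl G by (intro finsum_eqI) (simp add: sw_push[OF s])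
  finally show ?thesis .
qed

lemma ktensor_op:
  fixes H :: "('k, 'h) hopf"
  shows "same_module (ktensor K M (op_hopf H)) (ktensor K M H)" "pure_tensor (ktensor K M (op_hopf H)) = pure_tensor (ktensor K M H)"
proof -
  have "same_module M M" by (simp add: same_module_def)
  from same_module_ktensor[OF this same_module_op(1)]
  show "same_module (ktensor K M (op_hopf H)) (ktensor K M H)" "pure_tensor (ktensor K M (op_hopf H)) = pure_tensor (ktensor K M H)" .
qed

lemma linear_op:
  fixes H :: "('k, 'h) hopf"
  shows "linear_map K (op_hopf H) N f \<longleftrightarrow> linear_map K H N f" "linear_map K M (ktensor K N (op_hopf H)) g \<longleftrightarrow> linear_map K M (ktensor K N H) g"
proof -
  have s: "same_module X X" for X :: "('x, 'y, 'z) module_scheme" by (simp add: same_module_def)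
  show "linear_map K (op_hopf H) N f \<longleftrightarrow> linear_map K H N f" by (rule same_module_linear[OF same_module_op(1) s])
  show "linear_map K M (ktensor K N (op_hopf H)) g \<longleftrightarrow> linear_map K M (ktensor K N H) g" by (rule same_module_linear[OF s ktensor_op(1)])
qed

section \<open>The bialgebroid of the extension as an instance of the abstract data\<close>

context galois begin

text \<open>The coaction of \<open>A\<close> restricted to the centralizer and rewritten in
  \<open>V \<otimes> H\<close>, whose elements are cosets of a group other than the one behind
  \<open>A \<otimes> H\<close>.\<close>

definition "rhoV v = (\<Oplus>\<^bsub>VH\<^esub>i\<in>{..<n}. E (p i) v \<boxtimes>\<^bsub>VH\<^esub> e i)"

lemma rhoV_linear: "linear_map K V VH rhoV"
  unfolding rhoV_def by (intro linear_map_finsum_fun lin V_into) (simp_all add: p_linear)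

lemma
  assumes b: "bilinear K V H G \<phi>" and v: "v \<in> R"
  shows lift_rhoV: "tensor_lift G \<phi> (rhoV v) = (\<Oplus>\<^bsub>G\<^esub>i\<in>{..<n}. \<phi> (E (p i) v) (e i))"
    and tsum_rhoV: "tsum V H G \<phi> (rhoV v) = (\<Oplus>\<^bsub>G\<^esub>i\<in>{..<n}. \<phi> (E (p i) v) (e i))"
proof -
  note l = ktensor_lift_linear[OF module_V module_H b]
  show "tensor_lift G \<phi> (rhoV v) = (\<Oplus>\<^bsub>G\<^esub>i\<in>{..<n}. \<phi> (E (p i) v) (e i))"
    unfolding rhoV_def using v bilinearD(1)[OF b]
    by (subst linear_map_finsum[OF l])
      (auto simp: p_linear ktensor_lift_pure[OF module_V module_H b] intro!: finsum_eqI)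
  then show "tsum V H G \<phi> (rhoV v) = (\<Oplus>\<^bsub>G\<^esub>i\<in>{..<n}. \<phi> (E (p i) v) (e i))"
    using v linear_mapD(1)[OF rhoV_linear, of v] by (simp add: ktensor_lift_tsum[OF module_V module_H b])
qed

lemma E_expand: "functional f ==> v \<in> R ==> E f v = (\<Oplus>\<^bsub>V\<^esub>i\<in>{..<n}. f (e i) \<odot>\<^bsub>A\<^esub> E (p i) v)"
  using rw_expand[OF E_bilinear[of f], of v] by (simp add: E_def[of f] finsum_V p_linear)

text \<open>The iterated coaction has coefficients \<open>E (p j) (E (p i) v)\<close>, that is,
  \<open>E\<close> of a convolution product applied to \<open>v\<close>. Expanding these over the
  dual basis, the double sum becomes the coproduct of \<open>e k\<close>.\<close>

lemma rhoV_coassoc: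
  assumes G: "module K G"
    and 1: "\<And>y z. y \<in>! H ==> z \<in>! H ==> linear_map K V G (\<lambda>x. \<psi> x y z)"
    and 2: "\<And>x z. x \<in> R ==> z \<in>! H ==> linear_map K H G (\<lambda>y. \<psi> x y z)"
    and 3: "\<And>x y. x \<in> R ==> y \<in>! H ==> linear_map K H G (\<lambda>z. \<psi> x y z)"
    and v: "v \<in> R"
  shows "(\<Oplus>\<^bsub>G\<^esub>i\<in>{..<n}. \<Oplus>\<^bsub>G\<^esub>j\<in>{..<n}. \<psi> (E (p j) (E (p i) v)) (e j) (e i))
    = (\<Oplus>\<^bsub>G\<^esub>k\<in>{..<n}. sw G (\<lambda>y z. \<psi> (E (p k) v) y z) (e k))"
proof -
  interpret G: module K G by fact
  have pE [simp]: "E (p i) v \<in> R" if "i < n" for i using that v by (simp add: p_linear)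
  have cl [simp]: "\<psi> x y z \<in>! G" if "x \<in> R" "y \<in>! H" "z \<in>! H" for x y z
    using linear_mapD(1)[OF 3[OF that(1,2)] that(3)] .
  define m where "m j i h = sw (self_module K) (\<lambda>x y. p j x \<otimes>\<^bsub>K\<^esub> p i y) h" for i j h
  have mf [simp]: "functional (m j i)" if "i < n" "j < n" for i j
    unfolding m_def using that linear_map_smult[OF p_linear module_K] linear_map_scalar[OF p_linear module_K]
    by (intro lin) simp_all
  have mK [simp]: "m j i h \<in>! K" if "i < n" "j < n" "h \<in>! H" for i j h
    using functional_closed[OF mf] that by simp
  have "\<psi> (E (p j) (E (p i) v)) (e j) (e i) = (\<Oplus>\<^bsub>G\<^esub>k\<in>{..<n}. m j i (e k) \<odot>\<^bsub>G\<^esub> \<psi> (E (p k) v) (e j) (e i))"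
    if ij: "i < n" "j < n" for i j
  proof -
    note l = 1[OF e_closed[OF ij(2)] e_closed[OF ij(1)]]
    have "E (p j) (E (p i) v) = E (m j i) v"
      unfolding m_def using ij v by (intro E_comp) (simp_all add: p_linear)
    also have "... = (\<Oplus>\<^bsub>V\<^esub>k\<in>{..<n}. m j i (e k) \<odot>\<^bsub>V\<^esub> E (p k) v)"
      using E_expand[OF mf[OF ij] v] by simp
    finally have "\<psi> (E (p j) (E (p i) v)) (e j) (e i) = (\<Oplus>\<^bsub>G\<^esub>k\<in>{..<n}. \<psi> (m j i (e k) \<odot>\<^bsub>V\<^esub> E (p k) v) (e j) (e i))"
      using ij G by (simp only:) (intro linear_map_finsum[OF l], auto)
    also have "... = (\<Oplus>\<^bsub>G\<^esub>k\<in>{..<n}. m j i (e k) \<odot>\<^bsub>G\<^esub> \<psi> (E (p k) v) (e j) (e i))"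
      using ij linear_mapD(3)[OF l] by (intro finsum_eqI) simp
    finally show ?thesis .
  qed
  then have "(\<Oplus>\<^bsub>G\<^esub>i\<in>{..<n}. \<Oplus>\<^bsub>G\<^esub>j\<in>{..<n}. \<psi> (E (p j) (E (p i) v)) (e j) (e i))
    = (\<Oplus>\<^bsub>G\<^esub>i\<in>{..<n}. \<Oplus>\<^bsub>G\<^esub>j\<in>{..<n}. \<Oplus>\<^bsub>G\<^esub>k\<in>{..<n}. m j i (e k) \<odot>\<^bsub>G\<^esub> \<psi> (E (p k) v) (e j) (e i))"
    by (intro finsum_eqI) simp
  also have "... = (\<Oplus>\<^bsub>G\<^esub>j\<in>{..<n}. \<Oplus>\<^bsub>G\<^esub>i\<in>{..<n}. \<Oplus>\<^bsub>G\<^esub>k\<in>{..<n}. m j i (e k) \<odot>\<^bsub>G\<^esub> \<psi> (E (p k) v) (e j) (e i))"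
    by (intro G.M.finsum_swap) (auto intro!: G.M.finsum_closed)
  also have "... = (\<Oplus>\<^bsub>G\<^esub>j\<in>{..<n}. \<Oplus>\<^bsub>G\<^esub>k\<in>{..<n}. \<Oplus>\<^bsub>G\<^esub>i\<in>{..<n}. m j i (e k) \<odot>\<^bsub>G\<^esub> \<psi> (E (p k) v) (e j) (e i))"
    by (intro finsum_eqI G.M.finsum_swap) auto
  also have "... = (\<Oplus>\<^bsub>G\<^esub>k\<in>{..<n}. \<Oplus>\<^bsub>G\<^esub>j\<in>{..<n}. \<Oplus>\<^bsub>G\<^esub>i\<in>{..<n}. m j i (e k) \<odot>\<^bsub>G\<^esub> \<psi> (E (p k) v) (e j) (e i))"
    by (intro G.M.finsum_swap) (auto intro!: G.M.finsum_closed)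
  also have "... = (\<Oplus>\<^bsub>G\<^esub>k\<in>{..<n}. sw G (\<lambda>y z. \<psi> (E (p k) v) y z) (e k))"
    unfolding m_def
  proof (rule finsum_eqI)
    fix k assume "k \<in> {..<n}"
    then have k: "E (p k) v \<in> R" "e k \<in>! H" by simp_all
    have "bilinear K H H G (\<lambda>y z. \<psi> (E (p k) v) y z)" by (intro bilinearI G 2 3 k)
    from sw_expand[OF this k(2)]
    show "(\<Oplus>\<^bsub>G\<^esub>j\<in>{..<n}. \<Oplus>\<^bsub>G\<^esub>i\<in>{..<n}. sw (self_module K) (\<lambda>x y. p j x \<otimes>\<^bsub>K\<^esub> p i y) (e k) \<odot>\<^bsub>G\<^esub> \<psi> (E (p k) v) (e j) (e i))
      = sw G (\<lambda>y z. \<psi> (E (p k) v) y z) (e k)" by (rule sym)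
  qed
  finally show ?thesis .
qed

lemma hopf_op: "hopf K (op_hopf H)"
  by (intro hopf.intro hopf_algebra_op hopf S_bij)

text \<open>A comodule refers to the coalgebra only, which \<open>H\<close> and its opposite have in
  common.\<close>

lemma comodule_rhoV: "comodule K (op_hopf H) V rhoV"
proof (intro comodule.intro hopf_op comodule_axioms.intro module_V)
  let ?H = "op_hopf H" and ?C2 = "ktensor K H H"
  let ?C3 = "ktensor K V ?C2"
  show "linear_map K V (ktensor K V ?H) rhoV" by (simp add: linear_op rhoV_linear)
  fix v assume "v \<in>! V"
  then have v: "v \<in> R" by simp
  have sV: "same_module V V" by (simp add: same_module_def)
  note s2 = same_module_ktensor[OF same_module_op(1)[of H] same_module_op(1)[of H]]
  note s3 = same_module_ktensor[OF sV s2(1)]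
  have b: "bilinear K V H ?C3 (\<lambda>y g. y \<boxtimes>\<^bsub>?C3\<^esub> (g \<boxtimes>\<^bsub>?C2\<^esub> h))" if "h \<in>! H" for h
    using that by (intro lin) simp_all
  have eq: "tensor_lift ?C3 (\<lambda>y g. y \<boxtimes>\<^bsub>?C3\<^esub> (g \<boxtimes>\<^bsub>?C2\<^esub> h)) (rhoV x) = (\<Oplus>\<^bsub>?C3\<^esub>j\<in>{..<n}. E (p j) x \<boxtimes>\<^bsub>?C3\<^esub> (e j \<boxtimes>\<^bsub>?C2\<^esub> h))"
    if "x \<in> R" "h \<in>! H" for x h
    using lift_rhoV[OF b[OF that(2)] that(1)] .
  have b': "bilinear K V H ?C3 (\<lambda>x h. tensor_lift ?C3 (\<lambda>y g. y \<boxtimes>\<^bsub>?C3\<^esub> (g \<boxtimes>\<^bsub>?C2\<^esub> h)) (rhoV x))"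
  proof (rule bilinearI)
    fix h assume h: "h \<in>! H"
    show "linear_map K V ?C3 (\<lambda>x. tensor_lift ?C3 (\<lambda>y g. y \<boxtimes>\<^bsub>?C3\<^esub> (g \<boxtimes>\<^bsub>?C2\<^esub> h)) (rhoV x))"
      by (rule linear_map_cong[where f = "\<lambda>x. \<Oplus>\<^bsub>?C3\<^esub>j\<in>{..<n}. E (p j) x \<boxtimes>\<^bsub>?C3\<^esub> (e j \<boxtimes>\<^bsub>?C2\<^esub> h)", OF _ module_V])
        (intro linear_map_finsum_fun lin V_into, simp_all add: p_linear h eq)
  next
    fix x assume x: "x \<in>! V"
    show "linear_map K H ?C3 (\<lambda>h. tensor_lift ?C3 (\<lambda>y g. y \<boxtimes>\<^bsub>?C3\<^esub> (g \<boxtimes>\<^bsub>?C2\<^esub> h)) (rhoV x))"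
      by (rule linear_map_cong[where f = "\<lambda>h. \<Oplus>\<^bsub>?C3\<^esub>j\<in>{..<n}. E (p j) x \<boxtimes>\<^bsub>?C3\<^esub> (e j \<boxtimes>\<^bsub>?C2\<^esub> h)", OF _ module_H])
        (use x in \<open>intro linear_map_finsum_fun lin\<close>, simp_all add: p_linear eq x[simplified])
  qed simp
  have b'': "bilinear K V H ?C3 (\<lambda>x h. x \<boxtimes>\<^bsub>?C3\<^esub> comult H h)" by (intro lin) simp_all
  have "tensor_lift ?C3 (\<lambda>x h. tensor_lift ?C3 (\<lambda>y g. y \<boxtimes>\<^bsub>?C3\<^esub> (g \<boxtimes>\<^bsub>?C2\<^esub> h)) (rhoV x)) (rhoV v)
    = (\<Oplus>\<^bsub>?C3\<^esub>i\<in>{..<n}. \<Oplus>\<^bsub>?C3\<^esub>j\<in>{..<n}. E (p j) (E (p i) v) \<boxtimes>\<^bsub>?C3\<^esub> (e j \<boxtimes>\<^bsub>?C2\<^esub> e i))"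
    unfolding lift_rhoV[OF b' v] using v by (intro finsum_eqI) (simp add: eq p_linear)
  also have "... = (\<Oplus>\<^bsub>?C3\<^esub>k\<in>{..<n}. sw ?C3 (\<lambda>y z. E (p k) v \<boxtimes>\<^bsub>?C3\<^esub> (y \<boxtimes>\<^bsub>?C2\<^esub> z)) (e k))"
    using v by (intro rhoV_coassoc) ((intro lin)?, simp_all)+
  also have "... = (\<Oplus>\<^bsub>?C3\<^esub>k\<in>{..<n}. E (p k) v \<boxtimes>\<^bsub>?C3\<^esub> comult H (e k))"
  proof (rule finsum_eqI)
    fix k assume "k \<in> {..<n}"
    then have k: "E (p k) v \<in>! V" "e k \<in>! H" using v by (simp_all add: p_linear)
    have l: "linear_map K ?C2 ?C3 (\<lambda>X. E (p k) v \<boxtimes>\<^bsub>?C3\<^esub> X)" using k by (intro lin) simp_all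
    show "sw ?C3 (\<lambda>y z. E (p k) v \<boxtimes>\<^bsub>?C3\<^esub> (y \<boxtimes>\<^bsub>?C2\<^esub> z)) (e k) = E (p k) v \<boxtimes>\<^bsub>?C3\<^esub> comult H (e k)"
      using k by (intro ktensor_tsum_linear[OF l]) simp_all
  qed
  also have "... = tensor_lift ?C3 (\<lambda>x h. x \<boxtimes>\<^bsub>?C3\<^esub> comult H h) (rhoV v)"
    by (rule lift_rhoV[OF b'' v, symmetric])
  finally show "tensor_lift (ktensor K V (ktensor K ?H ?H)) (\<lambda>x h. tensor_lift (ktensor K V (ktensor K ?H ?H))
        (\<lambda>y g. y \<boxtimes>\<^bsub>ktensor K V (ktensor K ?H ?H)\<^esub> (g \<boxtimes>\<^bsub>ktensor K ?H ?H\<^esub> h)) (rhoV x)) (rhoV v)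
      = tensor_lift (ktensor K V (ktensor K ?H ?H)) (\<lambda>x h. x \<boxtimes>\<^bsub>ktensor K V (ktensor K ?H ?H)\<^esub> comult ?H h) (rhoV v)"
    unfolding same_module_lift[OF s3(1)] s3(2) s2(2) op_hopf_simps .
  have "bilinear K V H V (\<lambda>x h. \<epsilon> h \<odot>\<^bsub>V\<^esub> x)" by (intro lin) simp_all
  from lift_rhoV[OF this v] show "tensor_lift V (\<lambda>x h. counit ?H h \<odot>\<^bsub>V\<^esub> x) (rhoV v) = v"
    using E_expand[OF counit_linear v] v by (simp add: E_counit)
qed

text \<open>Reconstruct the pair with \<open>v\<close> inserted after the first leg. Colinearity of
  \<open>\<gamma>\<close> then lets the legs of \<open>\<gamma>(h1)\<close> enclose
  \<open>v\<close>, which is the action.\<close>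

lemma gamma_s:
  assumes h: "h \<in>! H" and v: "v \<in> R"
  shows "\<gamma> h \<ast> (v \<boxdot> oneA) = sw AA (\<lambda>x y. lm (act x v) (\<gamma> y)) h"
proof -
  have "\<gamma> h \<ast> (v \<boxdot> oneA) = gw AA (\<lambda>x y. (x \<bullet> v) \<boxdot> y) h"
    using h v by (simp add: star st_T lm_facts(2,5))
  also have "... = gw AA (\<lambda>x y. rw AA (\<lambda>a g. lm (x \<bullet> v \<bullet> a) (\<gamma> g)) y) h"
    using v by (intro tsum_cong refl reconstruct) simp_all
  also have "... = sw AA (\<lambda>x y. gw AA (\<lambda>u w. lm (u \<bullet> v \<bullet> w) (\<gamma> y)) x) h"
  proof (intro gw_coaction h)
    fix z assume z: "z \<in>! H"
    show "balB (\<lambda>x y. lm (x \<bullet> v \<bullet> y) (\<gamma> z))" using act_bal[OF v] by simp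
  qed (use v in \<open>(intro lin)?, simp_all\<close>)+
  also have "... = sw AA (\<lambda>x y. lm (act x v) (\<gamma> y)) h"
  proof (rule tsum_cong[OF refl])
    fix x y assume xy: "x \<in>! H" "y \<in>! H"
    have l: "linear_map K A AA (\<lambda>a. lm a (\<gamma> y))" using xy by (intro lin) simp_all
    show "gw AA (\<lambda>u w. lm (u \<bullet> v \<bullet> w) (\<gamma> y)) x = lm (act x v) (\<gamma> y)"
      unfolding act_def using xy v by (simp add: aw_push[OF l])
  qed
  finally show ?thesis .
qed

text \<open>\<open>prebraid\<close> moves \<open>v\<close> to the right end of the second leg, and
  colinearity of \<open>\<gamma>\<close> turns the coaction on this leg into a coproduct. The
  coacting component is the last one, so \<open>h2\<close> acts here, where \<open>h1\<close> acts
  in \<open>gamma_s\<close>.\<close>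

lemma gamma_t:
  assumes h: "h \<in>! H" and v: "v \<in> R"
  shows "\<gamma> h \<ast> (oneA \<boxdot> v) = sw AA (\<lambda>x y. rm (act y v) (\<gamma> x)) h"
proof -
  have l: "linear_map K A AA (\<lambda>a. x \<boxdot> a)" if "x \<in>! A" for x using that by (intro lin)
  have "\<gamma> h \<ast> (oneA \<boxdot> v) = gw AA (\<lambda>x y. x \<boxdot> (v \<bullet> y)) h"
    using h v by (simp add: star st_T lm_facts(2,5))
  also have "... = gw AA (\<lambda>x y. rw AA (\<lambda>a g. x \<boxdot> (a \<bullet> act g v)) y) h"
    using v by (intro tsum_cong[OF refl]) (simp add: prebraid rw_push[OF l])
  also have "... = sw AA (\<lambda>x y. gw AA (\<lambda>u w. u \<boxdot> (w \<bullet> act y v)) x) h"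
    using v h by (intro gw_coaction) ((intro lin)?, simp_all add: AA.pure_balanced A.m_assoc)+
  also have "... = sw AA (\<lambda>x y. rm (act y v) (\<gamma> x)) h"
    using v by (intro tsum_cong[OF refl]) (simp add: lm_facts(6))
  finally show ?thesis .
qed

lemma sw_T: "(\<And>x y. x \<in>! H ==> y \<in>! H ==> \<phi> x y \<in>! T) ==> h \<in>! H ==> sw AA \<phi> h = sw T \<phi> h"
  using sw_push[OF T_incl module_T AA.module_T, of h \<phi>] by simp

lemma tsum_j:
  assumes b: "bilinear K V H G \<phi>" and X: "X \<in>! T"
  shows "tsum V H G \<phi> (j X) = (\<Oplus>\<^bsub>G\<^esub>i\<in>{..<n}. \<phi> (mE (p i) X) (e i))"
proof -
  note l = ktensor_lift_linear[OF module_V module_H b]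
  have "tensor_lift G \<phi> (j X) = (\<Oplus>\<^bsub>G\<^esub>i\<in>{..<n}. \<phi> (mE (p i) X) (e i))"
    unfolding j_def using X bilinearD(1)[OF b]
    by (subst linear_map_finsum[OF l])
      (auto simp: p_linear ktensor_lift_pure[OF module_V module_H b] intro!: finsum_eqI)
  then show ?thesis
    using linear_mapD(1)[OF j_linear X] by (simp add: ktensor_lift_tsum[OF module_V module_H b])
qed

text \<open>The laws of \<open>\<gamma>\<close>, \<open>act\<close> and the coaction are matched
  with the locale for the opposite Hopf algebra, which accounts for the reversed factors in
  \<open>act_mult\<close> and \<open>gamma_mult\<close>.\<close>

theorem lu_T_op: "lu K (op_hopf H) (T_op A B) rhoV act \<gamma> j"
proof -
  let ?H = "op_hopf H"
  interpret op: bij_hopf K ?H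
    by (intro bij_hopf.intro hopf_op bij_hopf_axioms.intro) (simp add: bij_betw_inv_into[OF S_bij])
  have lm_st: "(v \<boxdot> oneA) \<ast> \<gamma> h = lm v (\<gamma> h)" if "v \<in> R" "h \<in>! H" for v h
    using that by (simp add: st_star)
  have swT: "sw T (\<lambda>x y. (act x v \<boxdot> oneA) \<ast> \<gamma> y) h = sw AA (\<lambda>x y. lm (act x v) (\<gamma> y)) h"
    "sw T (\<lambda>x y. (oneA \<boxdot> act y v) \<ast> \<gamma> x) h = sw AA (\<lambda>x y. rm (act y v) (\<gamma> x)) h" if "v \<in> R" "h \<in>! H" for v h
    using that by (simp_all add: st_star sw_T gamma_T)
  have bVH: "bilinear K V H T (\<lambda>v h. lm v (\<gamma> h))" by (intro lin) simp_all
  have inj: "tsum V H T (\<lambda>x y. (x \<boxdot> oneA) \<ast> \<gamma> y) z = tsum V H T (\<lambda>x y. lm x (\<gamma> y)) z" for z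
    by (intro tsum_cong refl) (simp add: lm_st)
  have st_linear: "linear_map K V T (\<lambda>r. r \<boxdot> oneA)" "linear_map K V T (\<lambda>r. oneA \<boxdot> r)"
    by (intro T_into lin; simp add: st_T)+
  have s: "alg_hom K V T (\<lambda>r. r \<boxdot> oneA)"
    using st_linear(1) linear_mapD(2)[OF st_linear(1)]
    by (auto simp: alg_hom_def ring_hom_def st_T st_star lm_facts(2))
  have t: "alg_hom K V (opposite T) (\<lambda>r. oneA \<boxdot> r)"
    using st_linear(2) linear_mapD(2)[OF st_linear(2)]
    by (auto simp: alg_hom_def ring_hom_def opposite_def[of T] linear_map_def st_T st_star lm_facts(5))
  have i: "alg_hom K ?H T \<gamma>"
    using gamma_linear_T[OF linear_map_id] linear_mapD(2)[OF gamma_linear_T[OF linear_map_id]]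
    by (auto simp: alg_hom_def ring_hom_def linear_op star gamma_mult gamma_one)
  have "linear_map K T V (mE \<epsilon>)"
    by (rule V_into[OF mE_linear[OF counit_linear T_incl module_T]]) (simp add: counit_linear)
  then have coun: "linear_map K T V (tensor_lift A (\<lambda>x y. x \<bullet> y))"
    by (rule linear_map_cong[OF _ module_T]) (simp add: coun_eq)
  have "linear_map K T L2 (\<lambda>u. \<Oplus>\<^bsub>L2\<^esub>i\<in>{..<n}. cop (mE (p i) u) (e i))"
    by (intro linear_map_finsum_fun lin V_into T_incl) (simp_all add: p_linear)
  then have coprod: "linear_map K T L2 (coprod (T_op A B))"
    by (rule linear_map_cong[OF _ module_T]) (simp add: coprod_eq)
  \<comment> \<open>The coordinates of \<open>1 \<otimes> v\<close> along \<open>\<gamma>\<close>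
    are \<open>E (p i) v\<close>, so they form the coaction of \<open>v\<close>.\<close>
  have t_eq: "oneA \<boxdot> v = tsum V H T (\<lambda>x y. (x \<boxdot> oneA) \<ast> \<gamma> y) (rhoV v)" if v: "v \<in> R" for v
  proof -
    have "oneA \<boxdot> v = (\<Oplus>\<^bsub>T\<^esub>i\<in>{..<n}. lm (mE (p i) (oneA \<boxdot> v)) (\<gamma> (e i)))"
      using v by (intro T_reconstruct' st_T)
    also have "... = (\<Oplus>\<^bsub>T\<^esub>i\<in>{..<n}. lm (E (p i) v) (\<gamma> (e i)))"
      using v by (intro finsum_eqI) (simp add: mE_pure p_linear)
    finally show ?thesis by (simp only: inj tsum_rhoV[OF bVH v])
  qed
  have "lu_axioms K ?H (T_op A B) rhoV act \<gamma> j"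
    apply (rule lu_axioms.intro)
    apply (unfold T_op_fields op_hopf_simps tsum_op linear_op ktensor_op(2))
    subgoal by (rule k_algebra_V)
    subgoal by (rule k_algebra_T)
    subgoal by (intro lin) simp_all
    subgoal by (rule act_linear(2)[OF linear_map_id])
    subgoal by (simp add: act_mult)
    subgoal by (simp add: act_one)
    subgoal by (rule s)
    subgoal by (rule t)
    subgoal by (rule i)
    subgoal by (simp add: st_star st_T lm_facts(2,5))
    subgoal by (simp add: gamma_s swT)
    subgoal by (simp add: gamma_t swT)
    subgoal by (simp add: t_eq)
    subgoal by (rule j_linear)
    subgoal by (simp add: lm_st j_gen)
    subgoal for x unfolding inj tsum_j[OF bVH, of x] by (rule T_reconstruct'[symmetric])
    subgoal by (rule coprod)
    subgoal by (simp add: lm_st coprod_gen_T cop_def)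
    subgoal by (rule coun)
    subgoal by (simp add: lm_st coun_eq mE_lm counit_linear mE_gamma)
    done
  then show ?thesis
    by (intro lu.intro op.bij_hopf_axioms) (simp_all add: T_op_fields comodule_rhoV)
qed

end

section \<open>Transport along an isomorphism of total algebras\<close>

context lu begin

text \<open>An antipode matters only through its values on the carrier, also inside lifts, where
  \<open>lift_cong\<close> exchanges it. This allows \<open>\<tau>\<close> to be replaced by any
  formula that agrees with it there.\<close>

lemma hopf_algebroid_cong:
  assumes eq: "\<And>a. a \<in>! L ==> \<tau>' a = \<tau> a"
  shows "hopf_algebroid K Bd \<tau>'"
proof -
  interpret T2: balanced_tensor K L L "carrier K" "\<lambda>m c. c \<odot>\<^bsub>L\<^esub> m" "\<lambda>c n. c \<odot>\<^bsub>L\<^esub> n" "ktensor K L L"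
    by (rule balanced_tensor_ktensor) simp_all
  have i: "alg_iso K L (opposite L) \<tau>'"
    using \<tau>_iso bij_betw_cong[of "carrier L" \<tau>' \<tau> "carrier (opposite L)"] eq unfolding alg_iso_def alg_hom_def ring_hom_def linear_map_def
    by (auto simp: Pi_iff)
  obtain \<eta> where \<eta>: "linear_map K L2 (ktensor K L L) \<eta>" "\<forall>z\<in>carrier L2. tensor_lift L2 (\<lambda>x y. x \<boxtimes>\<^bsub>L2\<^esub> y) (\<eta> z) = z"
    "\<forall>a\<in>carrier L. tensor_lift L (\<lambda>x y. x \<star> \<tau> y) (\<eta> (cop a)) = s (cou a)"
    using hopf_algebroid unfolding hopf_algebroid_def Let_def by blast
  have "tensor_lift L (\<lambda>x y. x \<star> \<tau>' y) (\<eta> (cop a)) = tensor_lift L (\<lambda>x y. x \<star> \<tau> y) (\<eta> (cop a))" if "a \<in>! L" for a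
    using that by (intro T2.lift_cong linear_mapD(1)[OF \<eta>(1)]) (simp_all add: eq)
  moreover have "tensor_lift L (\<lambda>x y. \<tau>' x \<star> y) (cop a) = tensor_lift L (\<lambda>x y. \<tau> x \<star> y) (cop a)" if "a \<in>! L" for a
    using that by (intro L2.lift_cong) (simp_all add: eq)
  ultimately show ?thesis
    unfolding hopf_algebroid_def Let_def
    using left_bialgebroid i antipode_axiom \<tau>_t \<eta> eq by (intro conjI ballI exI[of _ \<eta>]) simp_all
qed

text \<open>A second bialgebroid over the same base, with source and target those of
  \<open>Bd\<close> followed by an isomorphism \<open>\<Phi>\<close>. Its coproduct and counit are
  then required to have the expected values on the images of generators.\<close>

context
  fixes Bd' :: "('k, 'm, 'v) bialgebroid" and \<Phi> :: "'l \<Rightarrow> 'm" and j' :: "'m \<Rightarrow> ('v \<times> 'h \<Rightarrow>\<^sub>0 int) set"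
  assumes base': "base Bd' = V" and kL': "k_algebra K (total Bd')" and \<Phi>: "alg_iso K L (total Bd') \<Phi>"
    and s': "v \<in>! V ==> source Bd' v = \<Phi> (s v)" and t': "v \<in>! V ==> target Bd' v = \<Phi> (t v)"
begin

abbreviation "L' \<equiv> total Bd'"
abbreviation "L2' \<equiv> base_tensor L' V (source Bd') (target Bd')"

lemma \<Phi>_linear: "linear_map K L L' \<Phi>" and \<Phi>_mult: "x \<in>! L ==> y \<in>! L ==> \<Phi> (x \<star> y) = \<Phi> x \<otimes>\<^bsub>L'\<^esub> \<Phi> y"
  and \<Phi>_one: "\<Phi> \<one>\<^bsub>L\<^esub> = \<one>\<^bsub>L'\<^esub>" and \<Phi>_surj: "z \<in>! L' ==> \<exists>x\<in>carrier L. z = \<Phi> x"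
  using \<Phi> by (auto simp: alg_iso_def alg_hom_def ring_hom_def bij_betw_def)

lemma \<Phi>_closed [simp]: "x \<in>! L ==> \<Phi> x \<in>! L'"
  using linear_mapD(1)[OF \<Phi>_linear] .

lemma \<Phi>_sum: "v \<in>! V ==> u \<in>! V ==> \<Phi> (s (u \<oplus>\<^bsub>V\<^esub> v)) = \<Phi> (s u) \<oplus>\<^bsub>L'\<^esub> \<Phi> (s v)"
  "v \<in>! V ==> u \<in>! V ==> \<Phi> (t (u \<oplus>\<^bsub>V\<^esub> v)) = \<Phi> (t u) \<oplus>\<^bsub>L'\<^esub> \<Phi> (t v)"
  "g \<in>! H ==> h \<in>! H ==> \<Phi> (\<iota> (g \<oplus> h)) = \<Phi> (\<iota> g) \<oplus>\<^bsub>L'\<^esub> \<Phi> (\<iota> h)"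
  using linear_mapD(2)[OF linear_comp[OF s_linear \<Phi>_linear]] linear_mapD(2)[OF linear_comp[OF t_linear \<Phi>_linear]]
    linear_mapD(2)[OF linear_comp[OF \<iota>_linear \<Phi>_linear]] by auto

lemma homs': "alg_hom K V L' (source Bd')" "alg_hom K V (opposite L') (target Bd')" "alg_hom K H L' (\<lambda>h. \<Phi> (\<iota> h))"
proof -
  have "linear_map K V L' (source Bd')" by (rule linear_map_cong[OF linear_comp[OF s_linear \<Phi>_linear]]) (simp_all add: s')
  then show "alg_hom K V L' (source Bd')"
    by (auto simp: alg_hom_def ring_hom_def s' gens_mult[symmetric] \<Phi>_mult \<Phi>_one \<Phi>_sum)
  have "linear_map K V L' (target Bd')" by (rule linear_map_cong[OF linear_comp[OF t_linear \<Phi>_linear]]) (simp_all add: t')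
  then have "linear_map K V (opposite L') (target Bd')" by (simp add: linear_map_def opposite_def)
  then show "alg_hom K V (opposite L') (target Bd')"
    by (auto simp: alg_hom_def ring_hom_def opposite_def t' gens_mult(2)[symmetric] \<Phi>_mult \<Phi>_one \<Phi>_sum)
  show "alg_hom K H L' (\<lambda>h. \<Phi> (\<iota> h))"
    using linear_comp[OF \<iota>_linear \<Phi>_linear] by (auto simp: alg_hom_def ring_hom_def gens_mult(3)[symmetric] \<Phi>_mult \<Phi>_one \<Phi>_sum)
qed

lemma L2'_balanced: "balanced_tensor K L' L' (carrier V) (\<lambda>x r. target Bd' r \<otimes>\<^bsub>L'\<^esub> x) (\<lambda>r x. source Bd' r \<otimes>\<^bsub>L'\<^esub> x) L2'"
  by (rule base_tensor_balanced[OF kL' kV homs'(1,2)])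

context
  assumes j'_linear: "linear_map K L' (ktensor K V H) j'" and j'_\<Phi>: "x \<in>! L ==> j' (\<Phi> x) = j x"
    and coprod'_linear: "linear_map K L' L2' (coprod Bd')"
    and coprod'_gen: "v \<in>! V ==> h \<in>! H ==>
      coprod Bd' (\<Phi> (s v \<star> \<iota> h)) = sw L2' (\<lambda>x y. \<Phi> (s v \<star> \<iota> x) \<boxtimes>\<^bsub>L2'\<^esub> \<Phi> (\<iota> y)) h"
    and coun'_linear: "linear_map K L' V (coun Bd')"
    and coun'_gen: "v \<in>! V ==> h \<in>! H ==> coun Bd' (\<Phi> (s v \<star> \<iota> h)) = \<epsilon> h \<odot>\<^bsub>V\<^esub> v"
begin

lemma \<Phi>_push: "rep_in X (carrier M) (carrier N) ==> (\<And>x y. x \<in>! M ==> y \<in>! N ==> \<phi> x y \<in>! L) ==>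
    \<Phi> (tsum M N L \<phi> X) = tsum M N L' (\<lambda>x y. \<Phi> (\<phi> x y)) X"
  using kL' by (intro tsum_linear[OF \<Phi>_linear]) (simp_all add: k_algebra_def)

lemma transport: "lu K H Bd' rho act (\<lambda>h. \<Phi> (\<iota> h)) j'"
proof -
  have "lu_axioms K H Bd' rho act (\<lambda>h. \<Phi> (\<iota> h)) j'"
    apply (rule lu_axioms.intro)
    apply (unfold base')
    subgoal by (rule kV)
    subgoal by (rule kL')
    subgoal by (rule act_linear1)
    subgoal by (rule act_linear2)
    subgoal by (rule act_mult)
    subgoal by (rule act_one)
    subgoal by (rule homs')
    subgoal by (rule homs')
    subgoal by (rule homs')
    subgoal by (simp add: s' t' \<Phi>_mult[symmetric] st)
    subgoal by (simp add: s' \<Phi>_mult[symmetric] \<iota>s \<Phi>_push)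
    subgoal by (simp add: t' \<Phi>_mult[symmetric] \<iota>t \<Phi>_push)
    subgoal by (simp add: s' t' \<Phi>_mult[symmetric] t_eq \<Phi>_push)
    subgoal by (rule j'_linear)
    subgoal by (simp add: s' \<Phi>_mult[symmetric] j'_\<Phi> j_gen)
    subgoal for x using \<Phi>_surj[of x] \<Phi>_push[OF j_rep, symmetric, of _ "\<lambda>v h. s v \<star> \<iota> h"] j_inv
      by (auto simp: s' \<Phi>_mult[symmetric] j'_\<Phi>)
    subgoal by (rule coprod'_linear)
    subgoal by (simp add: s' \<Phi>_mult[symmetric] coprod'_gen)
    subgoal by (rule coun'_linear)
    subgoal by (simp add: s' \<Phi>_mult[symmetric] coun'_gen)
    done
  then show ?thesis
    using comodule_axioms by (intro lu.intro bij_hopf_axioms) (simp_all only: base')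
qed

text \<open>Compatibility with the coproducts is an equation between balanced lifts, so by
  \<open>lift_cop_eqI\<close> it can be checked on generators; the base algebras are identified by
  the identity map.\<close>

lemma isomorphic: "bialgebroid_isomorphic K Bd Bd'"
proof -
  interpret L2': balanced_tensor K L' L' "carrier V" "\<lambda>x r. target Bd' r \<otimes>\<^bsub>L'\<^esub> x" "\<lambda>r x. source Bd' r \<otimes>\<^bsub>L'\<^esub> x" L2'
    by (rule L2'_balanced)
  have b: "bilinear K L L L2' (\<lambda>x y. \<Phi> x \<boxtimes>\<^bsub>L2'\<^esub> \<Phi> y)"
    by (intro bilinearI linear_comp[OF \<Phi>_linear] bilinearD[OF L2'.pure_bilinear] L2'.module_T)
      (simp_all add: linear_comp[OF \<Phi>_linear bilinearD(3)[OF L2'.pure_bilinear]])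
  have bl: "bal (\<lambda>x y. \<Phi> x \<boxtimes>\<^bsub>L2'\<^esub> \<Phi> y)"
    using L2'.pure_balanced by (simp add: \<Phi>_mult s' t')
  have 1: "coprod Bd' (\<Phi> a) = tensor_lift L2' (\<lambda>x y. \<Phi> x \<boxtimes>\<^bsub>L2'\<^esub> \<Phi> y) (cop a)" if "a \<in>! L" for a
    by (rule lift_cop_eqI[OF b bl linear_comp[OF \<Phi>_linear coprod'_linear] _ that, symmetric]) (simp add: coprod'_gen)
  have 2: "coun Bd' (\<Phi> a) = cou a" if "a \<in>! L" for a
    by (rule L_eqI[OF linear_comp[OF \<Phi>_linear coun'_linear] coun_linear modV _ that]) (simp add: coun'_gen coun_gen)
  have "alg_iso K V V (\<lambda>x. x)" by (simp add: alg_iso_def alg_hom_def ring_hom_def linear_map_id bij_betw_def)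
  then show ?thesis
    unfolding bialgebroid_isomorphic_def Let_def base' using \<Phi> 1 2 s' t'
    by (intro exI[of _ \<Phi>] exI[of _ "\<lambda>x. x"]) simp
qed

end

end

end

section \<open>The Drinfel'd double\<close>

context hopf begin

lemma lift_comult2:
  assumes G: "module K G"
    and 1: "\<And>y z. y \<in>! H ==> z \<in>! H ==> linear_map K H G (\<lambda>x. \<psi> x y z)"
    and 2: "\<And>x z. x \<in>! H ==> z \<in>! H ==> linear_map K H G (\<lambda>y. \<psi> x y z)"
    and 3: "\<And>x y. x \<in>! H ==> y \<in>! H ==> linear_map K H G (\<lambda>z. \<psi> x y z)"
    and h: "h \<in>! H"
  shows "tensor_lift G (\<lambda>x Y. tensor_lift G (\<lambda>y z. \<psi> x y z) Y) (comult2 K H h) = sw G (\<lambda>x y. sw G (\<lambda>y z. \<psi> x y z) y) h"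
proof -
  let ?C2 = "ktensor K H H" and ?C3 = "ktensor K H (ktensor K H H)"
  have b: "bilinear K H H G (\<lambda>y z. \<psi> x y z)" if "x \<in>! H" for x using G 2 3 that by (intro bilinearI) auto
  have eq: "tensor_lift G (\<lambda>y z. \<psi> x y z) Y = tsum H H G (\<lambda>y z. \<psi> x y z) Y" if "x \<in>! H" "Y \<in>! ?C2" for x Y
    by (rule ktensor_lift_tsum[OF _ _ b]) (use that in simp_all)
  have bF: "bilinear K H ?C2 G (\<lambda>x Y. tensor_lift G (\<lambda>y z. \<psi> x y z) Y)"
  proof (rule bilinearI[OF G])
    fix Y assume Y: "Y \<in>! ?C2"
    show "linear_map K H G (\<lambda>x. tensor_lift G (\<lambda>y z. \<psi> x y z) Y)"
      by (rule linear_map_cong[where f = "\<lambda>x. tsum H H G (\<lambda>y z. \<psi> x y z) Y", OF _ module_H])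
        (use Y in \<open>simp_all add: eq, intro lin linear_comp[OF _ 1], simp_all add: G ktensor_rep_in[where K = K]\<close>)
  qed (use ktensor_lift_linear[OF module_H module_H b] in blast)
  note F = ktensor_lift_linear[OF module_H _ bF] and Fp = ktensor_lift_pure[OF module_H _ bF]
  have "comult2 K H h = sw ?C3 (\<lambda>x y. x \<boxtimes>\<^bsub>?C3\<^esub> comult H y) h"
    unfolding comult2_def Let_def using h by (intro lift_sw lin) simp_all
  then have "tensor_lift G (\<lambda>x Y. tensor_lift G (\<lambda>y z. \<psi> x y z) Y) (comult2 K H h)
    = sw G (\<lambda>x y. tensor_lift G (\<lambda>y z. \<psi> x y z) (comult H y)) h"
    using h G by (simp add: sw_push[OF F] Fp)
  also have "... = sw G (\<lambda>x y. sw G (\<lambda>y z. \<psi> x y z) y) h"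
    using eq by (intro tsum_cong[OF refl]) simp
  finally show ?thesis .
qed

abbreviation "P \<equiv> dual_bialg K H"

lemma dual_simps:
  "f \<oplus>\<^bsub>P\<^esub> g = (\<lambda>h\<in>carrier H. f h \<oplus>\<^bsub>K\<^esub> g h)" "c \<odot>\<^bsub>P\<^esub> f = (\<lambda>h\<in>carrier H. c \<otimes>\<^bsub>K\<^esub> f h)" "\<zero>\<^bsub>P\<^esub> = (\<lambda>h\<in>carrier H. \<zero>\<^bsub>K\<^esub>)"
  "\<one>\<^bsub>P\<^esub> = (\<lambda>h\<in>carrier H. \<epsilon> h)" "counit P f = f \<one>"
  "f \<otimes>\<^bsub>P\<^esub> g = (\<lambda>h\<in>carrier H. tensor_lift K (\<lambda>x y. f x \<otimes>\<^bsub>K\<^esub> g y) (comult H h))"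
  by (simp_all add: dual_bialg_def Let_def bialg.defs module.defs)

lemma dual_I: "linear_map K H (self_module K) f ==> (\<lambda>h\<in>carrier H. f h) \<in>! P"
  by (auto simp: carrier_dual_bialg intro: linear_map_cong[OF _ module_H])

lemma dual_D: "f \<in>! P ==> linear_map K H (self_module K) f" "f \<in>! P ==> f \<in> extensional (carrier H)"
  by (simp_all add: carrier_dual_bialg)

lemma dual_closed [simp]: "f \<in>! P ==> h \<in>! H ==> f h \<in>! K"
  using linear_mapD(1)[OF dual_D(1)] by simp

lemma module_dual [simp]: "module K P"
proof -
  note l = linear_map_add[OF _ _ module_K, simplified] linear_map_smult[OF _ module_K, simplified]
  have cl: "f \<oplus>\<^bsub>P\<^esub> g \<in>! P" "c \<odot>\<^bsub>P\<^esub> f \<in>! P" if "f \<in>! P" "g \<in>! P" "c \<in>! K" for f g c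
    unfolding dual_simps using that by (intro dual_I l dual_D(1); simp)+
  have z: "\<zero>\<^bsub>P\<^esub> \<in>! P" unfolding dual_simps using linear_map_const_zero[OF module_K, of H] by (intro dual_I) simp
  have inv: "\<exists>g\<in>carrier P. g \<oplus>\<^bsub>P\<^esub> f = \<zero>\<^bsub>P\<^esub>" if f: "f \<in>! P" for f
  proof
    show "(\<ominus>\<^bsub>K\<^esub> \<one>\<^bsub>K\<^esub>) \<odot>\<^bsub>P\<^esub> f \<in>! P" using cl(2)[OF f f] by simp
    show "(\<ominus>\<^bsub>K\<^esub> \<one>\<^bsub>K\<^esub>) \<odot>\<^bsub>P\<^esub> f \<oplus>\<^bsub>P\<^esub> f = \<zero>\<^bsub>P\<^esub>"
      unfolding dual_simps using f by (auto simp: K.l_minus K.l_neg intro!: restrict_ext)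
  qed
  have ext: "(\<lambda>h\<in>carrier H. f h) = f" if "f \<in>! P" for f using dual_D(2)[OF that] by (rule extensional_restrict)
  have "abelian_group P"
    by (rule abelian_groupI)
      (use cl inv z in \<open>auto simp: dual_simps K.a_ac ext intro!: restrict_ext cong: restrict_cong\<close>)
  then show ?thesis
    by (rule moduleI[OF K.is_cring])
      (use cl in \<open>auto simp: dual_simps K.r_distr K.l_distr K.m_assoc ext intro!: restrict_ext cong: restrict_cong\<close>)
qed

end

text \<open>Replaces a lift of an expression that contains further lifts by a sum of its simplified
  form \<open>\<psi>\<close>, for which bilinearity can be seen from its shape.\<close>

lemma ktensor_lift_eq:
  assumes "bilinear K M N G \<psi>" "module K M" "module K N" "X \<in>! ktensor K M N"
    and "\<And>x y. x \<in>! M ==> y \<in>! N ==> \<phi> x y = \<psi> x y"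
  shows "tensor_lift G \<phi> X = tsum M N G \<psi> X"
  using balanced_tensor.lift_cong[OF balanced_tensor_ktensor[OF assms(2,3)] assms(4), of \<phi> \<psi> G]
    ktensor_lift_tsum[OF assms(2,3,1,4)] assms(5) by simp

text \<open>The coproduct of the dual is described inside the tensor square of the dual before its
  coalgebra fields are added; the tensor product does not see these fields.\<close>

lemma ktensor_extend: "ktensor K (module.extend M x) (module.extend M y) = ktensor K M M"
  by (simp add: ktensor_def tensor_def tensor_rels_def Let_def module.defs)

lemma comult_dual_bialg:
  "comult (dual_bialg K H) f = (THE z. z \<in>! (ktensor K (dual_bialg K H) (dual_bialg K H)) \<and>
     (\<forall>x\<in>carrier H. \<forall>y\<in>carrier H. tensor_lift K (\<lambda>f g. f x \<otimes>\<^bsub>K\<^esub> g y) z = f (x \<otimes>\<^bsub>H\<^esub> y)))"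
  unfolding dual_bialg_def Let_def ktensor_extend by (simp add: bialg.defs module.defs)

lemma drinfeld_double_simps:
  "same_module (drinfeld_double K H) (ktensor K (dual_bialg K H) H)"
  "\<one>\<^bsub>drinfeld_double K H\<^esub> = \<one>\<^bsub>ktensor K (dual_bialg K H) H\<^esub>"
  "X \<otimes>\<^bsub>drinfeld_double K H\<^esub> Y = (let P = dual_bialg K H; T = ktensor K P H in
     tensor_lift T (\<lambda>p h. tensor_lift T (\<lambda>q g. tensor_lift T (\<lambda>h1 h23. tensor_lift T (\<lambda>h2 h3.
       (p \<otimes>\<^bsub>P\<^esub> (\<lambda>x\<in>carrier H. q (inv_antipode H h3 \<otimes>\<^bsub>H\<^esub> x \<otimes>\<^bsub>H\<^esub> h1))) \<boxtimes>\<^bsub>T\<^esub> (h2 \<otimes>\<^bsub>H\<^esub> g)) h23) (comult2 K H h)) Y) X)"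
  "comult (drinfeld_double K H) X = (let P = dual_bialg K H; T = ktensor K P H; TT = ktensor K T T in
     tensor_lift TT (\<lambda>p h. tensor_lift TT (\<lambda>p1 p2. tensor_lift TT (\<lambda>h1 h2.
       (p1 \<boxtimes>\<^bsub>T\<^esub> h1) \<boxtimes>\<^bsub>TT\<^esub> (p2 \<boxtimes>\<^bsub>T\<^esub> h2)) (comult H h))
       (tensor_lift (ktensor K P P) (\<lambda>x y. y \<boxtimes>\<^bsub>ktensor K P P\<^esub> x) (comult P p))) X)"
  "counit (drinfeld_double K H) X = tensor_lift K (\<lambda>p h. counit (dual_bialg K H) p \<otimes>\<^bsub>K\<^esub> counit H h) X"
  by (simp_all add: drinfeld_double_def double_tensor_def co_opposite_def Let_def module.defs bialg.defs same_module_def)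

context hopf begin

lemma lift_K: "tensor_lift K \<phi> X = tensor_lift (self_module K) \<phi> X"
  by (rule tensor_lift_structure_cong) (simp_all add: self_module_def)

lemma dual_eqI: "f \<in>! P ==> g \<in>! P ==> (\<And>h. h \<in>! H ==> f h = g h) ==> f = g"
  using dual_D(2) by (blast intro: extensionalityI)

lemma dual_eval: "linear_map K Z P F ==> h \<in>! H ==> linear_map K Z (self_module K) (\<lambda>z. F z h)"
  by (simp add: linear_map_def Pi_iff dual_simps)

lemma dual_linearI:
  assumes F: "\<And>z. z \<in>! Z ==> F z \<in>! P" and l: "\<And>h. h \<in>! H ==> linear_map K Z (self_module K) (\<lambda>z. F z h)"
    and Z: "module K Z"
  shows "linear_map K Z P F"
proof (intro linear_mapI F)
  interpret Z: module K Z by fact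
  interpret P: module K P by simp
  show "F (x \<oplus>\<^bsub>Z\<^esub> y) = F x \<oplus>\<^bsub>P\<^esub> F y" if "x \<in>! Z" "y \<in>! Z" for x y
    using that linear_mapD(2)[OF l] by (intro dual_eqI F) (simp_all add: F, simp add: dual_simps)
  show "F (c \<odot>\<^bsub>Z\<^esub> x) = c \<odot>\<^bsub>P\<^esub> F x" if "c \<in>! K" "x \<in>! Z" for c x
    using that linear_mapD(3)[OF l] by (intro dual_eqI F) (simp_all add: F, simp add: dual_simps)
qed

lemma dual_mult: "f \<in>! P ==> g \<in>! P ==> h \<in>! H ==>
    (f \<otimes>\<^bsub>P\<^esub> g) h = sw (self_module K) (\<lambda>x y. f x \<otimes>\<^bsub>K\<^esub> g y) h"
  using linear_map_smult[OF dual_D(1) module_K] linear_map_scalar[OF dual_D(1) module_K]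
  by (simp add: dual_simps lift_K) (intro lift_sw bilinearI, simp_all)

lemma dual_mult_closed [simp]:
  assumes "f \<in>! P" "g \<in>! P" shows "f \<otimes>\<^bsub>P\<^esub> g \<in>! P"
proof -
  have "linear_map K H (self_module K) (\<lambda>h. sw (self_module K) (\<lambda>x y. f x \<otimes>\<^bsub>K\<^esub> g y) h)"
    using assms linear_map_smult[OF dual_D(1) module_K] linear_map_scalar[OF dual_D(1) module_K]
    by (intro lin) simp_all
  from dual_I[OF this] have "(\<lambda>h\<in>carrier H. (f \<otimes>\<^bsub>P\<^esub> g) h) \<in>! P" using assms by (simp add: dual_mult cong: restrict_cong)
  then show ?thesis by (simp add: dual_simps cong: restrict_cong)
qed

lemma dual_mult_linear [lin]:
  "linear_map K Z P F ==> g \<in>! P ==> module K Z ==> linear_map K Z P (\<lambda>z. F z \<otimes>\<^bsub>P\<^esub> g)"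
  "linear_map K Z P F ==> g \<in>! P ==> module K Z ==> linear_map K Z P (\<lambda>z. g \<otimes>\<^bsub>P\<^esub> F z)"
proof -
  assume F: "linear_map K Z P F" and g: "g \<in>! P" and Z: "module K Z"
  note Fc = linear_mapD(1)[OF F] and ev = dual_eval[OF F]
  show "linear_map K Z P (\<lambda>z. F z \<otimes>\<^bsub>P\<^esub> g)"
  proof (rule dual_linearI[OF _ _ Z])
    fix h assume h: "h \<in>! H"
    have "linear_map K Z (self_module K) (\<lambda>z. sw (self_module K) (\<lambda>x y. F z x \<otimes>\<^bsub>K\<^esub> g y) h)"
      using h g linear_map_scalar[OF ev module_K] by (intro lin) simp_all
    then show "linear_map K Z (self_module K) (\<lambda>z. (F z \<otimes>\<^bsub>P\<^esub> g) h)"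
      by (rule linear_map_cong[OF _ Z]) (simp add: dual_mult Fc g h)
  qed (simp add: Fc g)
  show "linear_map K Z P (\<lambda>z. g \<otimes>\<^bsub>P\<^esub> F z)"
  proof (rule dual_linearI[OF _ _ Z])
    fix h assume h: "h \<in>! H"
    have "linear_map K Z (self_module K) (\<lambda>z. sw (self_module K) (\<lambda>x y. g x \<otimes>\<^bsub>K\<^esub> F z y) h)"
      using h g linear_map_smult[OF ev module_K] by (intro lin) simp_all
    then show "linear_map K Z (self_module K) (\<lambda>z. (g \<otimes>\<^bsub>P\<^esub> F z) h)"
      by (rule linear_map_cong[OF _ Z]) (simp add: dual_mult Fc g h)
  qed (simp add: Fc g)
qed

lemma dual_one [simp]: "\<one>\<^bsub>P\<^esub> \<in>! P"
  unfolding dual_simps by (rule dual_I[OF counit_linear])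

end

text \<open>Data for a module algebra over the double: actions of \<open>H\<close> and of its dual,
  tied together by the straightening rule \<open>straight\<close>. The indices in
  \<open>E_prod\<close> are crossed because the double carries the co-opposite coproduct of the
  dual.\<close>

locale double_action = fd_hopf K H n e p for K :: "'k ring" and H :: "('k, 'h) hopf" (structure) and n e p +
  fixes V :: "('k, 'v) module" and E :: "('h \<Rightarrow> 'k) \<Rightarrow> 'v \<Rightarrow> 'v" and act :: "'h \<Rightarrow> 'v \<Rightarrow> 'v"
  assumes kV: "k_algebra K V"
    and E_linear1: "v \<in>! V ==> linear_map K P V (\<lambda>f. E f v)"
    and E_linear2: "f \<in>! P ==> linear_map K V V (E f)"
    and act_linear1: "v \<in>! V ==> linear_map K H V (\<lambda>h. act h v)"
    and act_linear2: "h \<in>! H ==> linear_map K V V (act h)"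
    and E_mult: "f \<in>! P ==> f' \<in>! P ==> v \<in>! V ==> E (f \<otimes>\<^bsub>P\<^esub> f') v = E f (E f' v)"
    and E_one [simp]: "v \<in>! V ==> E \<one>\<^bsub>P\<^esub> v = v"
    and act_mult: "g \<in>! H ==> h \<in>! H ==> v \<in>! V ==> act (g \<otimes> h) v = act g (act h v)"
    and act_one [simp]: "v \<in>! V ==> act \<one> v = v"
    and straight: "f \<in>! P ==> h \<in>! H ==> v \<in>! V ==>
      act h (E f v) = sw V (\<lambda>x yz. sw V (\<lambda>y z. E (\<lambda>k\<in>carrier H. f (Si z \<otimes> k \<otimes> x)) (act y v)) yz) h"
    and E_unit: "f \<in>! P ==> E f \<one>\<^bsub>V\<^esub> = f \<one> \<odot>\<^bsub>V\<^esub> \<one>\<^bsub>V\<^esub>"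
    and act_unit: "h \<in>! H ==> act h \<one>\<^bsub>V\<^esub> = \<epsilon> h \<odot>\<^bsub>V\<^esub> \<one>\<^bsub>V\<^esub>"
    and act_prod: "h \<in>! H ==> u \<in>! V ==> v \<in>! V ==>
      act h (u \<otimes>\<^bsub>V\<^esub> v) = sw V (\<lambda>x y. act x u \<otimes>\<^bsub>V\<^esub> act y v) h"
    and E_prod: "f \<in>! P ==> u \<in>! V ==> v \<in>! V ==>
      E f (u \<otimes>\<^bsub>V\<^esub> v) = (\<Oplus>\<^bsub>V\<^esub>i\<in>{..<n}. \<Oplus>\<^bsub>V\<^esub>j\<in>{..<n}. f (e i \<otimes> e j) \<odot>\<^bsub>V\<^esub> (E (p j) u \<otimes>\<^bsub>V\<^esub> E (p i) v))"
begin

abbreviation "PP \<equiv> ktensor K P P"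
abbreviation "PH \<equiv> ktensor K P H"
abbreviation "D \<equiv> drinfeld_double K H"
abbreviation "TT \<equiv> ktensor K PH PH"

sublocale V: ring V using kV by (simp add: k_algebra_def)
sublocale VM: module K V using kV by (simp add: k_algebra_def)

lemma modV [simp]: "module K V" by (rule VM.module_axioms)
lemma abelian_V [simp]: "abelian_group V" by (rule V.abelian_group_axioms)
declare kV [simp]

lemma smult_V [simp]:
  "c \<in>! K ==> x \<in>! V ==> y \<in>! V ==> (c \<odot>\<^bsub>V\<^esub> x) \<otimes>\<^bsub>V\<^esub> y = c \<odot>\<^bsub>V\<^esub> (x \<otimes>\<^bsub>V\<^esub> y)"
  "c \<in>! K ==> x \<in>! V ==> y \<in>! V ==> x \<otimes>\<^bsub>V\<^esub> (c \<odot>\<^bsub>V\<^esub> y) = c \<odot>\<^bsub>V\<^esub> (x \<otimes>\<^bsub>V\<^esub> y)"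
  using kV by (simp_all add: k_algebra_def)

lemmas act_linear [lin] = linear_comp[OF _ act_linear1] linear_comp[OF _ act_linear2]
  linear_comp[OF _ E_linear1] linear_comp[OF _ E_linear2]

lemma act_closed [simp]: "h \<in>! H ==> v \<in>! V ==> act h v \<in>! V" "f \<in>! P ==> v \<in>! V ==> E f v \<in>! V"
  using linear_mapD(1)[OF act_linear2] linear_mapD(1)[OF E_linear2] by auto

lemma p_dual [simp]: "i < n ==> p i \<in>! P"
  using db by (auto simp: dual_bases_def)

definition "actD X v = tensor_lift V (\<lambda>f h. E f (act h v)) X"

lemma actD_bilinear: "v \<in>! V ==> bilinear K P H V (\<lambda>f h. E f (act h v))"
  by (intro lin) simp_all

lemma actD_tsum: "v \<in>! V ==> X \<in>! PH ==> actD X v = tsum P H V (\<lambda>f h. E f (act h v)) X"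
  unfolding actD_def by (rule ktensor_lift_tsum[OF _ _ actD_bilinear]) simp_all

lemma PH_rep [simp]: "X \<in>! PH ==> rep_in X (carrier P) (carrier H)"
  by (rule ktensor_rep_in[where K = K]) simp_all

lemma actD_linear1: "v \<in>! V ==> linear_map K PH V (\<lambda>X. actD X v)"
  unfolding actD_def by (rule ktensor_lift_linear[OF _ _ actD_bilinear]) simp_all

lemma actD_linear2: "X \<in>! PH ==> linear_map K V V (actD X)"
  by (rule linear_map_cong[where f = "\<lambda>v. tsum P H V (\<lambda>f h. E f (act h v)) X", OF _ modV])
    (intro lin, simp_all add: actD_tsum)

lemma actD_pure: "f \<in>! P ==> h \<in>! H ==> v \<in>! V ==> actD (f \<boxtimes>\<^bsub>PH\<^esub> h) v = E f (act h v)"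
  unfolding actD_def by (rule ktensor_lift_pure[OF _ _ actD_bilinear]) simp_all

lemma actD_closed [simp]: "X \<in>! PH ==> v \<in>! V ==> actD X v \<in>! V"
  using linear_mapD(1)[OF actD_linear2] .

definition "cj f z x = (\<lambda>k\<in>carrier H. f (Si z \<otimes> k \<otimes> x))"

lemma cj_closed [simp]: "f \<in>! P ==> x \<in>! H ==> z \<in>! H ==> cj f z x \<in>! P"
  unfolding cj_def by (intro dual_I linear_comp[OF _ dual_D(1)] lin) simp_all

lemma cj_linear [lin]:
  "linear_map K Z P F ==> z \<in>! H ==> x \<in>! H ==> module K Z ==> linear_map K Z P (\<lambda>w. cj (F w) z x)"
  "linear_map K Z H g ==> f \<in>! P ==> x \<in>! H ==> module K Z ==> linear_map K Z P (\<lambda>w. cj f (g w) x)"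
  "linear_map K Z H g ==> f \<in>! P ==> z \<in>! H ==> module K Z ==> linear_map K Z P (\<lambda>w. cj f z (g w))"
proof -
  assume Z: "module K Z"
  show "linear_map K Z P (\<lambda>w. cj (F w) z x)" if "linear_map K Z P F" "z \<in>! H" "x \<in>! H"
    using that linear_mapD(1)[OF that(1)] dual_eval[OF that(1)] by (intro dual_linearI[OF _ _ Z]) (simp_all, simp add: cj_def)
  assume g: "linear_map K Z H g" and f: "f \<in>! P"
  note gc = linear_mapD(1)[OF g]
  show "linear_map K Z P (\<lambda>w. cj f (g w) x)" if x: "x \<in>! H"
  proof (rule dual_linearI[OF _ _ Z])
    fix h assume h: "h \<in>! H"
    then show "linear_map K Z (self_module K) (\<lambda>w. cj f (g w) x h)"
      using x by (simp add: cj_def) (intro linear_comp[OF _ dual_D(1)[OF f]] lin g; simp)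
  qed (simp add: gc f x)
  show "linear_map K Z P (\<lambda>w. cj f z (g w))" if x: "z \<in>! H"
  proof (rule dual_linearI[OF _ _ Z])
    fix h assume h: "h \<in>! H"
    then show "linear_map K Z (self_module K) (\<lambda>w. cj f z (g w) h)"
      using x by (simp add: cj_def) (intro linear_comp[OF _ dual_D(1)[OF f]] lin g; simp)
  qed (simp add: gc f x)
qed

lemma D_mult:
  assumes X: "X \<in>! PH" and Y: "Y \<in>! PH"
  shows "X \<otimes>\<^bsub>D\<^esub> Y = tsum P H PH (\<lambda>f h. tsum P H PH (\<lambda>q g. sw PH (\<lambda>x yz. sw PH (\<lambda>y z.
    (f \<otimes>\<^bsub>P\<^esub> cj q z x) \<boxtimes>\<^bsub>PH\<^esub> (y \<otimes> g)) yz) h) Y) X"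
proof -
  let ?\<mu> = "\<lambda>f h q g. sw PH (\<lambda>x yz. sw PH (\<lambda>y z. (f \<otimes>\<^bsub>P\<^esub> cj q z x) \<boxtimes>\<^bsub>PH\<^esub> (y \<otimes> g)) yz) h"
  have 1: "tensor_lift PH (\<lambda>h1 h23. tensor_lift PH (\<lambda>h2 h3.
       (f \<otimes>\<^bsub>P\<^esub> (\<lambda>x\<in>carrier H. q (Si h3 \<otimes> x \<otimes> h1))) \<boxtimes>\<^bsub>PH\<^esub> (h2 \<otimes> g)) h23) (comult2 K H h) = ?\<mu> f h q g"
    if "f \<in>! P" "h \<in>! H" "q \<in>! P" "g \<in>! H" for f h q g
    unfolding cj_def[symmetric] using that by (intro lift_comult2) ((intro lin)?, simp_all)+
  have b1: "bilinear K P H PH (\<lambda>q g. ?\<mu> f h q g)" if "f \<in>! P" "h \<in>! H" for f h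
    using that by (intro lin) simp_all
  have b2: "bilinear K P H PH (\<lambda>f h. tsum P H PH (\<lambda>q g. ?\<mu> f h q g) Y)"
    using Y by (intro lin) simp_all
  show ?thesis
    unfolding drinfeld_double_simps Let_def
    by (intro ktensor_lift_eq[OF b2] ktensor_lift_eq[OF b1] 1 X Y module_dual module_H)
qed

text \<open>The two inner sums in the product of the double are those of the straightening rule, so
  together they act as \<open>E q\<close> followed by \<open>act h\<close>.\<close>

lemma actD_mult:
  assumes X: "X \<in>! PH" and Y: "Y \<in>! PH" and v: "v \<in>! V"
  shows "actD (X \<otimes>\<^bsub>D\<^esub> Y) v = actD X (actD Y v)"
proof -
  note l = actD_linear1[OF v]
  have "actD (X \<otimes>\<^bsub>D\<^esub> Y) v = tsum P H V (\<lambda>f h. tsum P H V (\<lambda>q g. sw V (\<lambda>x yz. sw V (\<lambda>y z.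
    E f (E (cj q z x) (act y (act g v)))) yz) h) Y) X"
    using X Y v by (simp add: D_mult tsum_linear[OF l] actD_pure E_mult act_mult)
  also have "... = tsum P H V (\<lambda>f h. tsum P H V (\<lambda>q g. E f (act h (E q (act g v)))) Y) X"
    using v by (intro tsum_cong[OF refl]) (simp add: straight cj_def[symmetric] sw_push[OF E_linear2])
  also have "... = actD X (actD Y v)"
    using X Y v by (simp add: actD_tsum[OF _ X])
      (simp add: actD_tsum tsum_linear[OF act_linear2] tsum_linear[OF E_linear2])
  finally show ?thesis .
qed

lemma dual_expand: "f \<in>! P ==> f = (\<Oplus>\<^bsub>P\<^esub>i\<in>{..<n}. f (e i) \<odot>\<^bsub>P\<^esub> p i)"
proof (rule dual_eqI)
  interpret P: module K P by simp
  assume f: "f \<in>! P"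
  show "(\<Oplus>\<^bsub>P\<^esub>i\<in>{..<n}. f (e i) \<odot>\<^bsub>P\<^esub> p i) \<in>! P" using f by (intro P.M.finsum_closed) auto
  fix h assume h: "h \<in>! H"
  have "(\<Oplus>\<^bsub>P\<^esub>i\<in>{..<n}. f (e i) \<odot>\<^bsub>P\<^esub> p i) h = (\<Oplus>\<^bsub>self_module K\<^esub>i\<in>{..<n}. (f (e i) \<odot>\<^bsub>P\<^esub> p i) h)"
    using f by (intro linear_map_finsum[OF dual_eval[OF linear_map_id h]]) auto
  also have "... = (\<Oplus>\<^bsub>self_module K\<^esub>i\<in>{..<n}. p i h \<odot>\<^bsub>self_module K\<^esub> f (e i))"
    using f h by (intro finsum_eqI) (simp add: dual_simps K.m_comm)
  also have "... = f h" using expand[OF dual_D(1)[OF f] module_K h] by simp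
  finally show "f h = (\<Oplus>\<^bsub>P\<^esub>i\<in>{..<n}. f (e i) \<odot>\<^bsub>P\<^esub> p i) h" by simp
qed

lemma eval2_bilinear: "x \<in>! H ==> y \<in>! H ==> bilinear K P P (self_module K) (\<lambda>f g. f x \<otimes>\<^bsub>K\<^esub> g y)"
  using linear_map_smult[OF dual_eval[OF linear_map_id[of K P]] module_K] linear_map_scalar[OF dual_eval[OF linear_map_id[of K P]] module_K]
  by (intro bilinearI) simp_all

text \<open>Two facts determine the definite description in the definition. By bilinear expansion
  the displayed element pairs with \<open>x \<otimes> y\<close> to the value of \<open>f\<close> at
  the product; and an element of the tensor square of the dual is determined by its pairings with
  basis vectors.\<close>

lemma comult_dual:
  assumes f: "f \<in>! P"
  shows "comult P f = (\<Oplus>\<^bsub>PP\<^esub>i\<in>{..<n}. \<Oplus>\<^bsub>PP\<^esub>j\<in>{..<n}. f (e i \<otimes> e j) \<odot>\<^bsub>PP\<^esub> (p i \<boxtimes>\<^bsub>PP\<^esub> p j))" (is "_ = ?z")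
proof -
  interpret PP: module K PP by simp
  let ?L = "\<lambda>x y. tensor_lift (self_module K) (\<lambda>f g. f x \<otimes>\<^bsub>K\<^esub> g y)"
  have L: "linear_map K PP (self_module K) (?L x y)" "?L x y (g \<boxtimes>\<^bsub>PP\<^esub> g') = g x \<otimes>\<^bsub>K\<^esub> g' y"
    if "x \<in>! H" "y \<in>! H" "g \<in>! P" "g' \<in>! P" for x y g g'
    using ktensor_lift_linear[OF module_dual module_dual eval2_bilinear[OF that(1,2)]]
      ktensor_lift_pure[OF module_dual module_dual eval2_bilinear[OF that(1,2)]] that by simp_all
  have z: "?z \<in>! PP" using f by (intro PP.M.finsum_closed) (auto intro!: PP.M.finsum_closed)
  have "?L x y ?z = f (x \<otimes> y)" if xy: "x \<in>! H" "y \<in>! H" for x y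
  proof -
    note l = L(1)[OF xy f f]
    have "?L x y ?z = (\<Oplus>\<^bsub>self_module K\<^esub>i\<in>{..<n}. ?L x y (\<Oplus>\<^bsub>PP\<^esub>j\<in>{..<n}. f (e i \<otimes> e j) \<odot>\<^bsub>PP\<^esub> (p i \<boxtimes>\<^bsub>PP\<^esub> p j)))"
      using f by (intro linear_map_finsum[OF l]) (auto intro!: PP.M.finsum_closed)
    also have "... = (\<Oplus>\<^bsub>self_module K\<^esub>i\<in>{..<n}. \<Oplus>\<^bsub>self_module K\<^esub>j\<in>{..<n}. ?L x y (f (e i \<otimes> e j) \<odot>\<^bsub>PP\<^esub> (p i \<boxtimes>\<^bsub>PP\<^esub> p j)))"
      using f by (intro finsum_eqI linear_map_finsum[OF l]) auto
    also have "... = (\<Oplus>\<^bsub>self_module K\<^esub>i\<in>{..<n}. \<Oplus>\<^bsub>self_module K\<^esub>j\<in>{..<n}. (p i x \<otimes>\<^bsub>K\<^esub> p j y) \<odot>\<^bsub>self_module K\<^esub> f (e i \<otimes> e j))"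
      using f xy by (intro finsum_eqI) (simp add: linear_mapD(3)[OF l] L K.m_comm)
    also have "... = f (x \<otimes> y)"
      using f xy expand[OF linear_map_id module_H]
      by (intro bilinear_expand[symmetric, where M = H and N = H] lin linear_comp[OF _ dual_D(1)[OF f]]) simp_all
    finally show ?thesis .
  qed
  moreover have "w = ?z" if w: "w \<in>! PP" and eq: "\<And>x y. x \<in>! H ==> y \<in>! H ==> ?L x y w = f (x \<otimes> y)" for w
  proof -
    have "w = (\<Oplus>\<^bsub>PP\<^esub>i\<in>{..<n}. \<Oplus>\<^bsub>PP\<^esub>j\<in>{..<n}. ?L (e i) (e j) w \<odot>\<^bsub>PP\<^esub> (p i \<boxtimes>\<^bsub>PP\<^esub> p j))"
    proof (rule ktensor_linear_eqI[OF module_dual module_dual linear_map_id _ PP.module_axioms _ w])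
      show "linear_map K PP PP (\<lambda>w. \<Oplus>\<^bsub>PP\<^esub>i\<in>{..<n}. \<Oplus>\<^bsub>PP\<^esub>j\<in>{..<n}. ?L (e i) (e j) w \<odot>\<^bsub>PP\<^esub> (p i \<boxtimes>\<^bsub>PP\<^esub> p j))"
        by (intro linear_map_finsum_fun linear_map_scalar L(1)) (use f in simp_all)
      fix g g' assume g: "g \<in>! P" "g' \<in>! P"
      have "g \<boxtimes>\<^bsub>PP\<^esub> g' = (\<Oplus>\<^bsub>PP\<^esub>i\<in>{..<n}. \<Oplus>\<^bsub>PP\<^esub>j\<in>{..<n}. (g (e i) \<otimes>\<^bsub>K\<^esub> g' (e j)) \<odot>\<^bsub>PP\<^esub> (p i \<boxtimes>\<^bsub>PP\<^esub> p j))"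
        using g dual_expand by (intro bilinear_expand[OF ktensor_pure_bilinear[OF module_dual module_dual]]) simp_all
      also have "... = (\<Oplus>\<^bsub>PP\<^esub>i\<in>{..<n}. \<Oplus>\<^bsub>PP\<^esub>j\<in>{..<n}. ?L (e i) (e j) (g \<boxtimes>\<^bsub>PP\<^esub> g') \<odot>\<^bsub>PP\<^esub> (p i \<boxtimes>\<^bsub>PP\<^esub> p j))"
        using g by (intro finsum_eqI) (simp add: L(2))
      finally show "g \<boxtimes>\<^bsub>PP\<^esub> g' = ..." .
    qed
    also have "... = ?z" by (intro finsum_eqI) (simp add: eq)
    finally show ?thesis .
  qed
  ultimately have "(THE z. z \<in>! PP \<and> (\<forall>x\<in>carrier H. \<forall>y\<in>carrier H. ?L x y z = f (x \<otimes> y))) = ?z"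
    using z by (intro the_equality) blast+
  moreover have "comult P f = (THE z. z \<in>! PP \<and> (\<forall>x\<in>carrier H. \<forall>y\<in>carrier H. ?L x y z = f (x \<otimes> y)))"
    by (subst comult_dual_bialg) (simp only: lift_K)
  ultimately show ?thesis by simp
qed

end

lemma linear_map_sum2:
  fixes n m :: nat
  assumes g: "linear_map K M N g" and M: "module K M" and N: "module K N"
    and c: "\<And>i j. i < n ==> j < m ==> c i j \<in>! K" and z: "\<And>i j. i < n ==> j < m ==> z i j \<in>! M"
  shows "g (\<Oplus>\<^bsub>M\<^esub>i\<in>{..<n}. \<Oplus>\<^bsub>M\<^esub>j\<in>{..<m}. c i j \<odot>\<^bsub>M\<^esub> z i j) = (\<Oplus>\<^bsub>N\<^esub>i\<in>{..<n}. \<Oplus>\<^bsub>N\<^esub>j\<in>{..<m}. c i j \<odot>\<^bsub>N\<^esub> g (z i j))"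
proof -
  interpret M: module K M by fact
  have "g (\<Oplus>\<^bsub>M\<^esub>i\<in>{..<n}. \<Oplus>\<^bsub>M\<^esub>j\<in>{..<m}. c i j \<odot>\<^bsub>M\<^esub> z i j) = (\<Oplus>\<^bsub>N\<^esub>i\<in>{..<n}. g (\<Oplus>\<^bsub>M\<^esub>j\<in>{..<m}. c i j \<odot>\<^bsub>M\<^esub> z i j))"
    using c z by (intro linear_map_finsum[OF g M N]) (auto intro!: M.M.finsum_closed)
  also have "... = (\<Oplus>\<^bsub>N\<^esub>i\<in>{..<n}. \<Oplus>\<^bsub>N\<^esub>j\<in>{..<m}. g (c i j \<odot>\<^bsub>M\<^esub> z i j))"
    using c z by (intro finsum_eqI linear_map_finsum[OF g M N]) auto
  also have "... = (\<Oplus>\<^bsub>N\<^esub>i\<in>{..<n}. \<Oplus>\<^bsub>N\<^esub>j\<in>{..<m}. c i j \<odot>\<^bsub>N\<^esub> g (z i j))"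
    using c z by (intro finsum_eqI) (simp add: linear_mapD(3)[OF g])
  finally show ?thesis .
qed

context double_action begin

lemma PH_pure_closed [simp]: "f \<in>! P ==> h \<in>! H ==> f \<boxtimes>\<^bsub>PH\<^esub> h \<in>! PH" by simp

text \<open>By linearity it comes down to \<open>f \<bowtie> h\<close>, where
  \<open>act_prod\<close> splits the product under \<open>h\<close> and \<open>E_prod\<close> splits
  it under \<open>f\<close>; the crossed indices of \<open>E_prod\<close> match the flipped
  coproduct of \<open>f\<close>.\<close>

lemma comult_act:
  assumes X: "X \<in>! PH" and u: "u \<in>! V" and v: "v \<in>! V"
  shows "tensor_lift V (\<lambda>d1 d2. actD d1 u \<otimes>\<^bsub>V\<^esub> actD d2 v) (comult D X) = actD X (u \<otimes>\<^bsub>V\<^esub> v)"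
proof -
  define F where "F = tensor_lift V (\<lambda>d1 d2. actD d1 u \<otimes>\<^bsub>V\<^esub> actD d2 v)"
  have bF: "bilinear K PH PH V (\<lambda>d1 d2. actD d1 u \<otimes>\<^bsub>V\<^esub> actD d2 v)"
    using u v by (intro lin actD_linear1) simp_all
  have F: "linear_map K TT V F" and Fp: "a \<in>! PH ==> b \<in>! PH ==> F (a \<boxtimes>\<^bsub>TT\<^esub> b) = actD a u \<otimes>\<^bsub>V\<^esub> actD b v" for a b
    unfolding F_def using ktensor_lift_linear[OF _ _ bF] ktensor_lift_pure[OF _ _ bF] by simp_all
  define \<chi> where "\<chi> h p1 p2 = sw TT (\<lambda>h1 h2. (p1 \<boxtimes>\<^bsub>PH\<^esub> h1) \<boxtimes>\<^bsub>TT\<^esub> (p2 \<boxtimes>\<^bsub>PH\<^esub> h2)) h" for h p1 p2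
  \<comment> \<open>\<open>\<psi> f h\<close> is the coproduct of \<open>f \<bowtie> h\<close> in
    the double, with the coproduct of \<open>f\<close> flipped and written over the dual
    basis.\<close>
  define \<psi> where "\<psi> f h = (\<Oplus>\<^bsub>TT\<^esub>i\<in>{..<n}. \<Oplus>\<^bsub>TT\<^esub>j\<in>{..<n}. f (e i \<otimes> e j) \<odot>\<^bsub>TT\<^esub> \<chi> h (p j) (p i))" for f h
  have \<chi>b: "bilinear K P P TT (\<chi> h)" if "h \<in>! H" for h
    using that unfolding \<chi>_def[abs_def] by (intro lin) simp_all
  have \<chi>h: "linear_map K H TT (\<lambda>h. \<chi> h p1 p2)" if "p1 \<in>! P" "p2 \<in>! P" for p1 p2
    using that unfolding \<chi>_def by (intro lin) simp_all
  note \<chi>c = bilinearD(4)[OF \<chi>b]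
  have \<psi>b: "bilinear K P H TT \<psi>"
    unfolding \<psi>_def[abs_def]
    by (intro bilinearI linear_map_finsum_fun linear_map_scalar linear_map_smult \<chi>h dual_eval[OF linear_map_id]) (simp_all add: \<chi>c)
  have F\<psi>: "F (\<psi> f h) = E f (act h (u \<otimes>\<^bsub>V\<^esub> v))" if f: "f \<in>! P" and h: "h \<in>! H" for f h
  proof -
    have "F (\<psi> f h) = (\<Oplus>\<^bsub>V\<^esub>i\<in>{..<n}. \<Oplus>\<^bsub>V\<^esub>j\<in>{..<n}. f (e i \<otimes> e j) \<odot>\<^bsub>V\<^esub> F (\<chi> h (p j) (p i)))"
      unfolding \<psi>_def using f h by (intro linear_map_sum2[OF F]) (simp_all add: \<chi>c)
    also have "... = (\<Oplus>\<^bsub>V\<^esub>i\<in>{..<n}. \<Oplus>\<^bsub>V\<^esub>j\<in>{..<n}. sw V (\<lambda>x y. f (e i \<otimes> e j) \<odot>\<^bsub>V\<^esub> (E (p j) (act x u) \<otimes>\<^bsub>V\<^esub> E (p i) (act y v))) h)"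
      unfolding \<chi>_def using f h u v by (intro finsum_eqI) (simp add: sw_push[OF F] Fp actD_pure push)
    also have "... = (\<Oplus>\<^bsub>V\<^esub>i\<in>{..<n}. sw V (\<lambda>x y. \<Oplus>\<^bsub>V\<^esub>j\<in>{..<n}. f (e i \<otimes> e j) \<odot>\<^bsub>V\<^esub> (E (p j) (act x u) \<otimes>\<^bsub>V\<^esub> E (p i) (act y v))) h)"
      using f h u v by (intro finsum_eqI tsum_finsum[symmetric]) simp_all
    also have "... = sw V (\<lambda>x y. \<Oplus>\<^bsub>V\<^esub>i\<in>{..<n}. \<Oplus>\<^bsub>V\<^esub>j\<in>{..<n}. f (e i \<otimes> e j) \<odot>\<^bsub>V\<^esub> (E (p j) (act x u) \<otimes>\<^bsub>V\<^esub> E (p i) (act y v))) h"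
      using f h u v by (intro tsum_finsum[symmetric]) (auto intro!: V.finsum_closed)
    also have "... = sw V (\<lambda>x y. E f (act x u \<otimes>\<^bsub>V\<^esub> act y v)) h"
      using f u v by (intro tsum_cong[OF refl]) (simp add: E_prod)
    also have "... = E f (act h (u \<otimes>\<^bsub>V\<^esub> v))"
      using f h u v by (simp add: act_prod sw_push[OF E_linear2])
    finally show ?thesis .
  qed
  have sw_inner: "tensor_lift TT (\<lambda>p1 p2. tensor_lift TT (\<lambda>h1 h2. (p1 \<boxtimes>\<^bsub>PH\<^esub> h1) \<boxtimes>\<^bsub>TT\<^esub> (p2 \<boxtimes>\<^bsub>PH\<^esub> h2)) (comult H h))
      (tensor_lift PP (\<lambda>x y. y \<boxtimes>\<^bsub>PP\<^esub> x) (comult P f)) = \<psi> f h" if f: "f \<in>! P" and h: "h \<in>! H" for f h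
  proof -
    interpret B: balanced_tensor K P P "carrier K" "\<lambda>m c. c \<odot>\<^bsub>P\<^esub> m" "\<lambda>c n. c \<odot>\<^bsub>P\<^esub> n" PP
      by (rule balanced_tensor_ktensor) simp_all
    have bt: "bilinear K P P PP (\<lambda>x y. y \<boxtimes>\<^bsub>PP\<^esub> x)" by (intro lin) simp_all
    have "tensor_lift PP (\<lambda>x y. y \<boxtimes>\<^bsub>PP\<^esub> x) (comult P f) = (\<Oplus>\<^bsub>PP\<^esub>i\<in>{..<n}. \<Oplus>\<^bsub>PP\<^esub>j\<in>{..<n}. f (e i \<otimes> e j) \<odot>\<^bsub>PP\<^esub> (p j \<boxtimes>\<^bsub>PP\<^esub> p i))" (is "?z = ?s")
      using f by (simp add: comult_dual linear_map_sum2[OF ktensor_lift_linear[OF module_dual module_dual bt]])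
        (intro finsum_eqI, simp add: ktensor_lift_pure[OF module_dual module_dual bt])
    moreover have "?s \<in>! PP" using f by (intro B.T.finsum_closed) (auto intro!: B.T.finsum_closed B.smult_T_closed)
    moreover have "tensor_lift TT (\<lambda>p1 p2. tensor_lift TT (\<lambda>h1 h2. (p1 \<boxtimes>\<^bsub>PH\<^esub> h1) \<boxtimes>\<^bsub>TT\<^esub> (p2 \<boxtimes>\<^bsub>PH\<^esub> h2)) (comult H h)) z = tensor_lift TT (\<chi> h) z"
      if "z \<in>! PP" for z
      unfolding \<chi>_def[abs_def] using h by (intro B.lift_cong[OF that] lift_sw lin) simp_all
    moreover have "tensor_lift TT (\<chi> h) ?s = \<psi> f h"
      unfolding \<psi>_def using f h
      by (subst linear_map_sum2[OF ktensor_lift_linear[OF module_dual module_dual \<chi>b]])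
        (auto simp: ktensor_lift_pure[OF module_dual module_dual \<chi>b] intro!: finsum_eqI)
    ultimately show ?thesis by simp
  qed
  have "comult D X = tsum P H TT \<psi> X"
    unfolding drinfeld_double_simps Let_def by (intro ktensor_lift_eq[OF \<psi>b] sw_inner X module_dual module_H)
  then have "F (comult D X) = tsum P H V (\<lambda>f h. E f (act h (u \<otimes>\<^bsub>V\<^esub> v))) X"
    using X bilinearD(4)[OF \<psi>b] by (simp add: tsum_linear[OF F] F\<psi>)
  then show ?thesis using X u v by (simp add: F_def actD_tsum)
qed

theorem module_algebra_double: "module_algebra K D V actD"
proof -
  have s: "same_module D PH" by (rule drinfeld_double_simps)
  then have c: "carrier D = carrier PH" by (simp add: same_module_def)
  have lD: "linear_map K D V f \<longleftrightarrow> linear_map K PH V f" for f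
    by (rule same_module_linear[OF s]) (simp add: same_module_def)
  interpret B: balanced_tensor K P H "carrier K" "\<lambda>m c. c \<odot>\<^bsub>P\<^esub> m" "\<lambda>c n. c \<odot> n" PH
    by (rule balanced_tensor_ktensor) simp_all
  have one: "actD \<one>\<^bsub>D\<^esub> v = v" if "v \<in>! V" for v
    using that by (simp add: drinfeld_double_simps(2) B.one_T actD_pure)
  have unit: "actD X \<one>\<^bsub>V\<^esub> = counit D X \<odot>\<^bsub>V\<^esub> \<one>\<^bsub>V\<^esub>" if X: "X \<in>! PH" for X
  proof -
    have b: "bilinear K P H (self_module K) (\<lambda>f h. counit P f \<otimes>\<^bsub>K\<^esub> \<epsilon> h)"
      using linear_map_smult[OF counit_linear module_K] linear_map_scalar[OF dual_eval[OF linear_map_id[of K P]] module_K]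
      by (intro bilinearI) (simp_all add: dual_simps(5))
    have l: "linear_map K (self_module K) V (\<lambda>c. c \<odot>\<^bsub>V\<^esub> \<one>\<^bsub>V\<^esub>)" by (intro lin) simp_all
    have "counit D X = tsum P H (self_module K) (\<lambda>f h. counit P f \<otimes>\<^bsub>K\<^esub> \<epsilon> h) X"
      unfolding drinfeld_double_simps lift_K by (rule ktensor_lift_tsum[OF _ _ b X]) simp_all
    then have "counit D X \<odot>\<^bsub>V\<^esub> \<one>\<^bsub>V\<^esub> = tsum P H V (\<lambda>f h. (f \<one> \<otimes>\<^bsub>K\<^esub> \<epsilon> h) \<odot>\<^bsub>V\<^esub> \<one>\<^bsub>V\<^esub>) X"
      using X tsum_linear[OF l, of X P H] by (simp add: dual_simps(5))
    also have "... = tsum P H V (\<lambda>f h. E f (act h \<one>\<^bsub>V\<^esub>)) X"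
      by (intro tsum_cong[OF refl]) (simp add: act_unit linear_mapD(3)[OF E_linear2] E_unit VM.smult_assoc1[symmetric] K.m_comm)
    finally show ?thesis using X by (simp add: actD_tsum)
  qed
  show ?thesis
    unfolding module_algebra_def c lD using one unit
    by (simp add: actD_linear1 actD_linear2 actD_mult comult_act)
qed

lemma hopf_act: "h \<in>! H ==> v \<in>! V ==> hopf_act K H actD h v = act h v"
  and dual_act: "f \<in>! P ==> v \<in>! V ==> dual_act K H actD f v = E f v"
  by (simp_all add: hopf_act_def dual_act_def double_tensor_def actD_pure)

end

section \<open>The smash product with the opposite Hopf algebra\<close>

lemma smash_algebra_simps:
  "same_module (smash_algebra K H V act) (ktensor K V H)" "\<one>\<^bsub>smash_algebra K H V act\<^esub> = \<one>\<^bsub>ktensor K V H\<^esub>"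
  "X \<otimes>\<^bsub>smash_algebra K H V act\<^esub> Y = (let T = ktensor K V H in tensor_lift T (\<lambda>v h. tensor_lift T (\<lambda>v' h'.
     tensor_lift T (\<lambda>h1 h2. (v \<otimes>\<^bsub>V\<^esub> hopf_act K H act h1 v') \<boxtimes>\<^bsub>T\<^esub> (h2 \<otimes>\<^bsub>H\<^esub> h')) (comult H h)) Y) X)"
  by (simp_all add: smash_algebra_def Let_def module.defs same_module_def)

lemma lu_bialgebroid_fields:
  "total (lu_bialgebroid K H V act n h p) = smash_algebra K H V act" "base (lu_bialgebroid K H V act n h p) = V"
  "source (lu_bialgebroid K H V act n h p) = (\<lambda>v. v \<boxtimes>\<^bsub>ktensor K V H\<^esub> \<one>\<^bsub>H\<^esub>)"
  "target (lu_bialgebroid K H V act n h p) = lu_target K H V act n h p"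
  "coun (lu_bialgebroid K H V act n h p) = tensor_lift V (\<lambda>v g. counit H g \<odot>\<^bsub>V\<^esub> v)"
  "coprod (lu_bialgebroid K H V act n h p) = (let T = ktensor K V H; L2 = base_tensor (smash_algebra K H V act) V (\<lambda>v. v \<boxtimes>\<^bsub>T\<^esub> \<one>\<^bsub>H\<^esub>) (lu_target K H V act n h p)
    in tensor_lift L2 (\<lambda>v g. tensor_lift L2 (\<lambda>g1 g2. (v \<boxtimes>\<^bsub>T\<^esub> g1) \<boxtimes>\<^bsub>L2\<^esub> (\<one>\<^bsub>V\<^esub> \<boxtimes>\<^bsub>T\<^esub> g2)) (comult H g)))"
  by (simp_all add: lu_bialgebroid_def Let_def)

lemma dual_bases_op: "dual_bases K (op_hopf H) n e p \<longleftrightarrow> dual_bases K H n e p"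
proof -
  have "finsum (op_hopf H) f I = finsum H f I" for f :: "nat \<Rightarrow> _" and I
    by (rule finsum_structure_cong) simp_all
  then show ?thesis by (simp add: dual_bases_def carrier_dual_bialg linear_op)
qed

context galois begin

abbreviation "Ho \<equiv> op_hopf H"
abbreviation "Po \<equiv> dual_bialg K Ho"

lemma Po_functional: "f \<in>! Po ==> functional f"
  by (simp add: carrier_dual_bialg linear_op)

lemma sw_V: "(\<And>x y. x \<in>! H ==> y \<in>! H ==> \<phi> x y \<in> R) ==> h \<in>! H ==> sw V \<phi> h = sw A \<phi> h"
  using sw_push[OF V_incl module_V modV, of h \<phi>] by simp

lemma sw_R: "(\<And>x y. x \<in>! H ==> y \<in>! H ==> \<phi> x y \<in> R) ==> h \<in>! H ==> sw A \<phi> h \<in> R"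
  using tsum_closed[of "comult H h" H H V \<phi>] module_V by (simp add: sw_V module.axioms(2))

text \<open>The antipode of the opposite Hopf algebra is \<open>S^-1\<close>; its inverse, which
  enters the straightening rule of the double, is \<open>S\<close> again.\<close>

lemma SS_inv: "h \<in>! H ==> inv_into (carrier H) (inv_antipode H) h = S h"
  using inv_into_inv_into_eq[OF S_bij, of h] .

text \<open>Expand the coactions of both factors over the dual basis. The argument
  \<open>e j \<otimes> e i\<close> is the product of \<open>e i\<close> and \<open>e j\<close> in
  the opposite algebra, which is the order that \<open>double_action\<close> asks for.\<close>

lemma E_prod_V:
  assumes f: "functional f" and u: "u \<in> R" and v: "v \<in> R"
  shows "E f (u \<bullet> v) = (\<Oplus>\<^bsub>V\<^esub>i\<in>{..<n}. \<Oplus>\<^bsub>V\<^esub>j\<in>{..<n}. f (e j \<otimes> e i) \<odot>\<^bsub>A\<^esub> (E (p j) u \<bullet> E (p i) v))"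
proof -
  interpret V: module K V by simp
  have fl: "functional (\<lambda>h. f (g \<otimes> h))" if "g \<in>! H" for g
    using that by (intro linear_comp[OF _ f] lin; simp)
  have b: "bilinear K A H A (\<lambda>u g. u \<bullet> E (\<lambda>h. f (g \<otimes> h)) v)"
    using v by (intro lin linear_comp[OF _ f]) (simp_all add: fl)
  have "E f (u \<bullet> v) = (\<Oplus>\<^bsub>V\<^esub>j\<in>{..<n}. E (p j) u \<bullet> E (\<lambda>h. f (e j \<otimes> h)) v)"
    using u v rw_expand[OF b, of u] by (simp add: E_mult(1)[OF f] finsum_V p_linear fl)
  also have "... = (\<Oplus>\<^bsub>V\<^esub>j\<in>{..<n}. \<Oplus>\<^bsub>V\<^esub>i\<in>{..<n}. f (e j \<otimes> e i) \<odot>\<^bsub>A\<^esub> (E (p j) u \<bullet> E (p i) v))"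
  proof (rule finsum_eqI)
    fix j assume j: "j \<in> {..<n}"
    have l: "linear_map K V V (\<lambda>z. E (p j) u \<bullet> z)" using j u by (intro V_into lin) (simp_all add: p_linear)
    have "E (\<lambda>h. f (e j \<otimes> h)) v = (\<Oplus>\<^bsub>V\<^esub>i\<in>{..<n}. f (e j \<otimes> e i) \<odot>\<^bsub>A\<^esub> E (p i) v)"
      using j v by (intro E_expand fl) simp_all
    then have "E (p j) u \<bullet> E (\<lambda>h. f (e j \<otimes> h)) v = (\<Oplus>\<^bsub>V\<^esub>i\<in>{..<n}. E (p j) u \<bullet> (f (e j \<otimes> e i) \<odot>\<^bsub>A\<^esub> E (p i) v))"
      using j f u v by (simp only:) (intro linear_map_finsum[OF l], auto simp: p_linear)
    then show "E (p j) u \<bullet> E (\<lambda>h. f (e j \<otimes> h)) v = (\<Oplus>\<^bsub>V\<^esub>i\<in>{..<n}. f (e j \<otimes> e i) \<odot>\<^bsub>A\<^esub> (E (p j) u \<bullet> E (p i) v))"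
      using j f u v by (simp only:) (intro finsum_eqI, simp add: p_linear)
  qed
  also have "... = (\<Oplus>\<^bsub>V\<^esub>i\<in>{..<n}. \<Oplus>\<^bsub>V\<^esub>j\<in>{..<n}. f (e j \<otimes> e i) \<odot>\<^bsub>A\<^esub> (E (p j) u \<bullet> E (p i) v))"
    using f u v by (intro V.M.finsum_swap) (simp_all add: p_linear)
  finally show ?thesis .
qed

lemma double_action_op: "double_action K Ho n e p V E act"
proof -
  interpret op: fd_hopf K Ho n e p
    using db by (intro fd_hopf.intro hopf_op fd_hopf_axioms.intro) (simp add: dual_bases_op)
  have str: "act h (E f v) = sw V (\<lambda>x yz. sw V (\<lambda>y z. E (\<lambda>k\<in>carrier H. f (x \<otimes> (k \<otimes> S z))) (act y v)) yz) h"
    if f: "functional f" and "h \<in>! H" "v \<in> R" for f h v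
  proof -
    have fl: "functional (\<lambda>k. f (x \<otimes> (k \<otimes> y)))" if "x \<in>! H" "y \<in>! H" for x y
      using that by (intro linear_comp[OF _ f] lin; simp)
    have "E (\<lambda>k\<in>carrier H. f (x \<otimes> (k \<otimes> S z))) w = E (\<lambda>k. f (x \<otimes> (k \<otimes> S z))) w" for x z w
      by (rule E_cong) simp
    then show ?thesis using that by (simp add: straighten sw_V sw_R fl H.m_assoc cong: E_cong)
  qed
  have "double_action_axioms K Ho n e p V E act"
    apply (rule double_action_axioms.intro)
    apply (unfold op_hopf_simps tsum_op linear_op)
    subgoal by (rule k_algebra_V)
    subgoal for v by (rule V_into, rule E_linear_f[of Po "\<lambda>f. f"])
      (simp_all add: Po_functional op.dual_eval[OF linear_map_id])
    subgoal for f by (rule V_into[OF E_linear[OF _ V_incl module_V]]) (simp_all add: Po_functional)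
    subgoal by (rule act_linear(1)[OF linear_map_id]) simp_all
    subgoal by (rule act_linear(2)[OF linear_map_id])
    subgoal for f f' v by (simp add: E_comp Po_functional op.dual_mult[simplified] cong: E_cong)
    subgoal for v using E_counit[of v] E_cong[of "\<one>\<^bsub>Po\<^esub>" \<epsilon> v] by (simp add: op.dual_simps)
    subgoal by (simp add: act_mult)
    subgoal by (simp add: act_one)
    subgoal for f h v using str[of f h v] by (simp add: Po_functional SS_inv H.m_assoc)
    subgoal by (simp add: E_one Po_functional)
    subgoal by (simp add: act_unit)
    subgoal by (simp add: act_prod sw_V)
    subgoal by (simp add: E_prod_V Po_functional)
    done
  then show ?thesis by (intro double_action.intro op.fd_hopf_axioms)
qed

end

context galois begin

abbreviation "VHo \<equiv> ktensor K V Ho"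
abbreviation actV :: "(('h \<Rightarrow> 'k) \<times> 'h \<Rightarrow>\<^sub>0 int) set \<Rightarrow> 'a \<Rightarrow> 'a" where "actV \<equiv> double_action.actD V E act"
abbreviation "Sm \<equiv> smash_algebra K Ho V actV"
abbreviation "Lu \<equiv> lu_bialgebroid K Ho V actV n e p"

lemma op_act: "h \<in>! H ==> v \<in> R ==> hopf_act K Ho actV h v = act h v"
    "i < n ==> v \<in> R ==> dual_act K Ho actV (p i) v = E (p i) v"
    "module_algebra K (drinfeld_double K Ho) V actV"
proof -
  interpret op: double_action K Ho n e p V E act by (rule double_action_op)
  show "h \<in>! H ==> v \<in> R ==> hopf_act K Ho actV h v = act h v" using op.hopf_act by simp
  show "i < n ==> v \<in> R ==> dual_act K Ho actV (p i) v = E (p i) v" using op.dual_act op.p_dual by simp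
  show "module_algebra K (drinfeld_double K Ho) V actV" by (rule op.module_algebra_double)
qed

lemma VHo: "carrier VHo = carrier VH" "pure_tensor VHo = pure_tensor VH"
  "tensor_lift VHo = tensor_lift VH" "tsum M N VHo = tsum M N VH" "tsum V Ho = tsum V H" "finsum VHo f I = finsum VH f I"
  and same_VHo: "same_module VHo VH"
proof -
  show s: "same_module VHo VH" "pure_tensor VHo = pure_tensor VH" by (rule ktensor_op)+
  then show "carrier VHo = carrier VH" by (simp add: same_module_def)
  have ss: "same_module X X" for X :: "('x, 'y, 'z) module_scheme" by (simp add: same_module_def)
  show "tensor_lift VHo = tensor_lift VH" using same_module_lift[OF s(1)] by (intro ext)
  show "tsum M N VHo = tsum M N VH"
    unfolding tsum_def[abs_def] rsum_def using s(1) by (intro ext frag_sum_structure_cong) (simp_all add: same_module_def)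
  show "tsum V Ho = tsum V H" by (intro ext) simp
  show "finsum VHo f I = finsum VH f I"
    using s(1) by (intro finsum_structure_cong) (simp_all add: same_module_def)
qed

lemma gamma_star: "g \<in>! H ==> h \<in>! H ==> \<gamma> g \<ast> \<gamma> h = \<gamma> (h \<otimes> g)"
  by (simp add: star gamma_mult)

lemma gen_star:
  assumes "v \<in> R" "g \<in>! H" "w \<in> R" "h \<in>! H"
  shows "lm v (\<gamma> g) \<ast> lm w (\<gamma> h) = sw AA (\<lambda>x y. lm (v \<bullet> act x w) (\<gamma> (h \<otimes> y))) g"
proof -
  note l = star_linear[OF gamma_T'[OF assms(4)]]
  have "lm v (\<gamma> g) \<ast> lm w (\<gamma> h) = lm v (\<gamma> g \<ast> ((w \<boxdot> oneA) \<ast> \<gamma> h))"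
    using assms by (simp add: star_lm gamma_T st_star)
  also have "... = lm v (sw AA (\<lambda>x y. lm (act x w) (\<gamma> y)) g \<ast> \<gamma> h)"
    using assms by (simp add: star_assoc[symmetric] st_T gamma_s del: T.m_assoc)
  also have "... = sw AA (\<lambda>x y. lm (v \<bullet> act x w) (\<gamma> (h \<otimes> y))) g"
    using assms by (simp add: sw_push[OF l] star_lm gamma_star sw_push[OF lm_facts(1)] lm_comp)
  finally show ?thesis .
qed

text \<open>The inverse of \<open>j\<close>, through which the multiplications of the smash product
  and of \<open>T^op\<close> are compared.\<close>

definition "\<Psi> z = tsum V H T (\<lambda>v h. lm v (\<gamma> h)) z"

lemma \<Psi>_facts:
  shows \<Psi>_linear: "linear_map K VH T \<Psi>" and \<Psi>_pure: "v \<in> R ==> h \<in>! H ==> \<Psi> (v \<boxtimes>\<^bsub>VH\<^esub> h) = lm v (\<gamma> h)"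
    and j_\<Psi>: "z \<in>! VH ==> j (\<Psi> z) = z" and \<Psi>_j: "X \<in>! T ==> \<Psi> (j X) = X"
proof -
  have b: "bilinear K V H T (\<lambda>v h. lm v (\<gamma> h))" by (intro lin) simp_all
  show l: "linear_map K VH T \<Psi>" unfolding \<Psi>_def[abs_def] by (rule tsum_linear_arg[OF linear_map_id]) (simp_all add: b)
  show p: "v \<in> R ==> h \<in>! H ==> \<Psi> (v \<boxtimes>\<^bsub>VH\<^esub> h) = lm v (\<gamma> h)" for v h unfolding \<Psi>_def by (rule tsum_pure) (simp_all add: b)
  show "z \<in>! VH ==> j (\<Psi> z) = z"
    by (rule ktensor_linear_eqI[OF _ _ linear_comp[OF l j_linear] linear_map_id]) (simp_all add: p j_gen)
  show "X \<in>! T ==> \<Psi> (j X) = X" unfolding \<Psi>_def by (simp add: tsum_j[OF b] T_reconstruct'[symmetric])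
qed

lemma j_closed [simp]: "X \<in>! T ==> j X \<in>! VH" using linear_mapD(1)[OF j_linear] .
lemma \<Psi>_closed [simp]: "z \<in>! VH ==> \<Psi> z \<in>! T" using linear_mapD(1)[OF \<Psi>_linear] .

lemma carrier_Sm [simp]: "carrier Sm = carrier VH"
  using smash_algebra_simps(1)[of K Ho V actV] by (simp add: same_module_def VHo)

lemma same_Sm: "same_module Sm VH"
  using smash_algebra_simps(1)[of K Ho V actV] same_VHo by (simp add: same_module_def)

lemma linear_Sm: "linear_map K Sm N f \<longleftrightarrow> linear_map K VH N f" "linear_map K M Sm g \<longleftrightarrow> linear_map K M VH g"
proof -
  have ss: "same_module X X" for X :: "('x, 'y, 'z) module_scheme" by (simp add: same_module_def)
  show "linear_map K Sm N f \<longleftrightarrow> linear_map K VH N f" by (rule same_module_linear[OF same_Sm ss])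
  show "linear_map K M Sm g \<longleftrightarrow> linear_map K M VH g" by (rule same_module_linear[OF ss same_Sm])
qed

lemma module_Sm: "module K Sm"
  by (rule same_module_module[of VH]) (use same_Sm in \<open>simp_all add: same_module_def\<close>)

text \<open>Read in coordinates, the rule \<open>gen_star\<close> for products of generators of
  \<open>T^op\<close> is the smash product formula. Associativity, unit and bilinearity of the smash
  product are inherited from \<open>T^op\<close> through this identity.\<close>

lemma Sm_mult:
  assumes X: "X \<in>! VH" and Y: "Y \<in>! VH"
  shows "X \<otimes>\<^bsub>Sm\<^esub> Y = j (\<Psi> X \<ast> \<Psi> Y)"
proof -
  let ?\<mu> = "\<lambda>v h v' h'. sw VH (\<lambda>x y. (v \<bullet> act x v') \<boxtimes>\<^bsub>VH\<^esub> (h' \<otimes> y)) h"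
  have 1: "tensor_lift VH (\<lambda>h1 h2. (v \<otimes>\<^bsub>V\<^esub> hopf_act K Ho actV h1 v') \<boxtimes>\<^bsub>VH\<^esub> (h2 \<otimes>\<^bsub>Ho\<^esub> h')) (comult Ho h) = ?\<mu> v h v' h'"
    if "v \<in>! V" "h \<in>! H" "v' \<in>! V" "h' \<in>! H" for v h v' h'
  proof -
    have "bilinear K H H VH (\<lambda>x y. (v \<bullet> act x v') \<boxtimes>\<^bsub>VH\<^esub> (h' \<otimes> y))"
      using that by (intro lin V_into) simp_all
    from ktensor_lift_eq[OF this, of "comult H h" "\<lambda>h1 h2. (v \<otimes>\<^bsub>V\<^esub> hopf_act K Ho actV h1 v') \<boxtimes>\<^bsub>VH\<^esub> (h2 \<otimes>\<^bsub>Ho\<^esub> h')"]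
    show ?thesis using that by (simp add: op_act)
  qed
  have b1: "bilinear K V H VH (\<lambda>v' h'. ?\<mu> v h v' h')" if "v \<in>! V" "h \<in>! H" for v h
    using that by (intro lin V_into) simp_all
  have rep: "rep_in Z (carrier V) (carrier H)" if "Z \<in>! VH" for Z
    using that by (intro ktensor_rep_in[where K = K]) simp_all
  have b2: "bilinear K V H VH (\<lambda>v h. tsum V H VH (\<lambda>v' h'. ?\<mu> v h v' h') Y)"
    using rep[OF Y] by (intro lin V_into) simp_all
  have m: "X \<otimes>\<^bsub>Sm\<^esub> Y = tsum V H VH (\<lambda>v h. tsum V H VH (\<lambda>v' h'. ?\<mu> v h v' h') Y) X"
    unfolding smash_algebra_simps Let_def VHo
    by (intro ktensor_lift_eq[OF b2] ktensor_lift_eq[OF b1] 1 X Y module_V module_H)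
  have c1: "v \<in>! V ==> h \<in>! H ==> linear_map K T T (\<lambda>Z. lm v (\<gamma> h) \<ast> Z)" for v h
    using gamma_T by (intro lin k_algebra_T) simp_all
  have c2: "linear_map K T T (\<lambda>Z. Z \<ast> \<Psi> Y)" using Y by (intro lin k_algebra_T) simp_all
  have p1: "\<Psi> (?\<mu> v h v' h') = lm v (\<gamma> h) \<ast> lm v' (\<gamma> h')" if "v \<in>! V" "h \<in>! H" "v' \<in>! V" "h' \<in>! H" for v h v' h'
    using that by (simp add: sw_push[OF \<Psi>_linear] \<Psi>_pure gen_star sw_T gamma_T)
  have p2: "\<Psi> (tsum V H VH (\<lambda>v' h'. ?\<mu> v h v' h') Y) = tsum V H T (\<lambda>v' h'. lm v (\<gamma> h) \<ast> lm v' (\<gamma> h')) Y"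
    if vh: "v \<in>! V" "h \<in>! H" for v h
  proof -
    have "\<Psi> (tsum V H VH (\<lambda>v' h'. ?\<mu> v h v' h') Y) = tsum V H T (\<lambda>v' h'. \<Psi> (?\<mu> v h v' h')) Y"
      by (rule tsum_linear[OF \<Psi>_linear _ module_T rep[OF Y]]) (use bilinearD(4)[OF b1[OF vh]] in simp_all)
    also have "... = tsum V H T (\<lambda>v' h'. lm v (\<gamma> h) \<ast> lm v' (\<gamma> h')) Y" by (rule tsum_cong[OF refl p1[OF vh]])
    finally show ?thesis .
  qed
  have "\<Psi> (X \<otimes>\<^bsub>Sm\<^esub> Y) = tsum V H T (\<lambda>v h. tsum V H T (\<lambda>v' h'. lm v (\<gamma> h) \<ast> lm v' (\<gamma> h')) Y) X"
    unfolding m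
    by (rule trans[OF tsum_linear[OF \<Psi>_linear _ module_T rep[OF X]] tsum_cong[OF refl p2]])
      (use bilinearD(4)[OF b2] in simp_all)
  also have "... = tsum V H T (\<lambda>v h. lm v (\<gamma> h) \<ast> \<Psi> Y) X"
    unfolding \<Psi>_def[of Y]
    by (rule tsum_cong[OF refl tsum_linear[OF c1 module_T module_T rep[OF Y], symmetric]]) (simp_all add: gamma_T)
  also have "... = \<Psi> X \<ast> \<Psi> Y"
    unfolding \<Psi>_def[of X]
    by (rule tsum_linear[OF c2 module_T module_T rep[OF X], symmetric]) (simp add: gamma_T)
  finally have "j (\<Psi> (X \<otimes>\<^bsub>Sm\<^esub> Y)) = j (\<Psi> X \<ast> \<Psi> Y)" by simp
  moreover have "X \<otimes>\<^bsub>Sm\<^esub> Y \<in>! VH" unfolding m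
    using module.axioms(2)[OF ktensor_module[OF module_V module_H]] by (rule tsum_closed[OF rep[OF X] _ bilinearD(4)[OF b2]])
  ultimately show ?thesis by (simp add: j_\<Psi>)
qed

lemma Sm_one: "\<one>\<^bsub>Sm\<^esub> = j \<one>\<^bsub>T\<^esub>"
proof -
  interpret B: balanced_tensor K V Ho "carrier K" "\<lambda>m c. c \<odot>\<^bsub>V\<^esub> m" "\<lambda>c n. c \<odot>\<^bsub>Ho\<^esub> n" VHo
    using hopf.module_H[OF hopf_op] by (intro balanced_tensor_ktensor) simp_all
  have "j \<one>\<^bsub>T\<^esub> = oneA \<boxtimes>\<^bsub>VH\<^esub> \<one>"
    using j_gen[of "oneA" \<one>] by (simp add: gamma_one)
  then show ?thesis by (simp add: smash_algebra_simps(2) B.one_T VHo)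
qed

lemma k_algebra_Sm: "k_algebra K Sm"
proof (rule k_algebraI)
  show "field K" by (rule K.field_axioms)
  have l: "linear_map K VH VH (\<lambda>x. j (\<Psi> x \<ast> \<Psi> y))" "linear_map K VH VH (\<lambda>x. j (\<Psi> y \<ast> \<Psi> x))" if "y \<in>! VH" for y
    using linear_comp[OF linear_map_mult(1)[OF k_algebra_T \<Psi>_linear \<Psi>_closed[OF that]] j_linear]
      linear_comp[OF linear_map_mult(2)[OF k_algebra_T \<Psi>_linear \<Psi>_closed[OF that]] j_linear] .
  have m: "module K VH" by simp
  show "linear_map K Sm Sm (\<lambda>x. x \<otimes>\<^bsub>Sm\<^esub> y)" if "y \<in>! Sm" for y
    unfolding linear_Sm by (rule linear_map_cong[OF l(1) m]) (use that in \<open>simp_all add: Sm_mult\<close>)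
  show "linear_map K Sm Sm (\<lambda>y. x \<otimes>\<^bsub>Sm\<^esub> y)" if "x \<in>! Sm" for x
    unfolding linear_Sm by (rule linear_map_cong[OF l(2) m]) (use that in \<open>simp_all add: Sm_mult\<close>)
qed (simp_all add: module_Sm Sm_mult Sm_one \<Psi>_j j_\<Psi> T.m_assoc del: T_simps)

lemma j_iso: "alg_iso K T Sm j"
proof -
  have "bij_betw j (carrier T) (carrier VH)"
    by (rule bij_betw_byWitness[where f' = \<Psi>]) (auto simp: j_\<Psi> \<Psi>_j)
  moreover have "j \<in> ring_hom T Sm"
    using linear_mapD(2)[OF j_linear] same_Sm unfolding same_module_def
    by (auto simp: ring_hom_def Sm_mult \<Psi>_j Sm_one simp del: T_simps)
  ultimately show ?thesis
    using j_linear by (simp add: alg_iso_def alg_hom_def linear_Sm)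
qed

lemma j_gamma: "h \<in>! H ==> j (\<gamma> h) = oneA \<boxtimes>\<^bsub>VH\<^esub> h"
  using j_gen[of "oneA" h] by simp

text \<open>The operator \<open>mE (p i)\<close> sends \<open>1 \<otimes> v\<close> to
  \<open>E (p i) v\<close>, so the coordinates of \<open>1 \<otimes> v\<close> spell out Lu's sum
  over dual bases.\<close>

lemma Lu_target: "v \<in> R ==> lu_target K Ho V actV n e p v = j (oneA \<boxdot> v)"
  unfolding lu_target_def j_def VHo
  by (intro finsum_eqI) (simp add: op_act mE_pure p_linear)

lemma Lu_source: "v \<in> R ==> v \<boxtimes>\<^bsub>VH\<^esub> \<one> = j (v \<boxdot> oneA)"
  using j_gen[of v \<one>] by (simp add: gamma_one lm_facts(2))

text \<open>The two bialgebroids are compared along \<open>j\<close>. It remains to recognise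
  source, target, coproduct and counit of the smash product on generators, after which
  \<open>transport\<close> and \<open>isomorphic\<close> apply.\<close>

theorem lu_smash:
  "lu K Ho Lu rhoV act (\<lambda>h. j (\<gamma> h)) (\<lambda>z. z)" "bialgebroid_isomorphic K (T_op A B) Lu"
proof -
  interpret o: hopf K Ho by (rule hopf_op)
  interpret LU: lu K Ho "T_op A B" rhoV act \<gamma> j by (rule lu_T_op)
  note fields = T_op_fields lu_bialgebroid_fields op_hopf_simps VHo
  let ?L2 = "base_tensor Sm V (source Lu) (target Lu)"
  have 1: "base Lu = base (T_op A B)" by (simp add: fields)
  have 2: "k_algebra K (total Lu)" by (simp add: fields k_algebra_Sm)
  have 3: "alg_iso K (total (T_op A B)) (total Lu) j" by (simp add: fields j_iso)
  have 4: "source Lu v = j (source (T_op A B) v)" "target Lu v = j (target (T_op A B) v)" if "v \<in>! (base (T_op A B))" for v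
    using that by (simp_all add: fields Lu_source Lu_target)
  interpret M2: balanced_tensor K Sm Sm R "\<lambda>x r. target Lu r \<otimes>\<^bsub>Sm\<^esub> x" "\<lambda>r x. source Lu r \<otimes>\<^bsub>Sm\<^esub> x" ?L2
    using LU.L2'_balanced[OF 1 2 3 4] by (simp add: fields)
  have pl: "linear_map K Z ?L2 (\<lambda>z. f z \<boxtimes>\<^bsub>?L2\<^esub> y)" "linear_map K Z ?L2 (\<lambda>z. y \<boxtimes>\<^bsub>?L2\<^esub> f z)"
    if "linear_map K Z VH f" "y \<in>! VH" for Z :: "('k, 'z, 'zz) module_scheme" and f y
    using linear_comp[OF _ bilinearD(2)[OF M2.pure_bilinear]] linear_comp[OF _ bilinearD(3)[OF M2.pure_bilinear]] that
    by (simp_all add: linear_Sm)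
  define \<chi> where "\<chi> v g = sw ?L2 (\<lambda>g1 g2. (v \<boxtimes>\<^bsub>VH\<^esub> g1) \<boxtimes>\<^bsub>?L2\<^esub> (oneA \<boxtimes>\<^bsub>VH\<^esub> g2)) g" for v g
  have \<chi>b: "bilinear K V H ?L2 \<chi>"
    unfolding \<chi>_def[abs_def] by (intro lin pl) (simp_all add: M2.module_T)
  have cop: "coprod Lu z = tsum V H ?L2 \<chi> z" if "z \<in>! VH" for z
  proof -
    have "coprod Lu = tensor_lift ?L2 (\<lambda>v g. tensor_lift ?L2 (\<lambda>g1 g2. (v \<boxtimes>\<^bsub>VH\<^esub> g1) \<boxtimes>\<^bsub>?L2\<^esub> (oneA \<boxtimes>\<^bsub>VH\<^esub> g2)) (comult H g))"
      by (simp add: fields Let_def)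
    moreover have "tensor_lift ?L2 (\<lambda>g1 g2. (v \<boxtimes>\<^bsub>VH\<^esub> g1) \<boxtimes>\<^bsub>?L2\<^esub> (oneA \<boxtimes>\<^bsub>VH\<^esub> g2)) (comult H g) = \<chi> v g"
      if "v \<in>! V" "g \<in>! H" for v g
      unfolding \<chi>_def using that by (intro lift_sw lin pl) (simp_all add: M2.module_T)
    ultimately show ?thesis using ktensor_lift_eq[OF \<chi>b module_V module_H that] by simp
  qed
  have E2: "base_tensor (total Lu) (base (T_op A B)) (source Lu) (target Lu) = ?L2"
    by (simp only: T_op_fields(2) lu_bialgebroid_fields(1))
  have "linear_map K VH ?L2 (\<lambda>z. tsum V H ?L2 \<chi> z)"
    by (rule tsum_linear_arg[OF linear_map_id]) (simp_all add: \<chi>b)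
  then have 5: "linear_map K (total Lu) (base_tensor (total Lu) (base (T_op A B)) (source Lu) (target Lu)) (coprod Lu)"
    unfolding fields(1,2) lu_bialgebroid_fields(1) linear_Sm by (rule linear_map_cong) (simp_all add: cop)
  have gen: "j (source (T_op A B) v \<otimes>\<^bsub>total (T_op A B)\<^esub> \<gamma> h) = v \<boxtimes>\<^bsub>VH\<^esub> h"
    if "v \<in> R" "h \<in>! H" for v h
    using that j_gen[of v h] by (simp add: fields st_star)
  \<comment> \<open>Elements of the smash product are their own coordinates, so the coordinate map
    is the identity.\<close>
  have 6: "linear_map K (total Lu) (ktensor K (base (T_op A B)) Ho) (\<lambda>z. z)"
    unfolding fields(1,2) lu_bialgebroid_fields(1) linear_Sm
    using same_VHo by (simp add: linear_map_def same_module_def)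
  have 7: "j x = j x" for x ..
  have 8: "coprod Lu (j (source (T_op A B) v \<otimes>\<^bsub>total (T_op A B)\<^esub> \<gamma> h)) = tsum Ho Ho (base_tensor (total Lu) (base (T_op A B)) (source Lu) (target Lu))
      (\<lambda>x y. j (source (T_op A B) v \<otimes>\<^bsub>total (T_op A B)\<^esub> \<gamma> x) \<boxtimes>\<^bsub>base_tensor (total Lu) (base (T_op A B)) (source Lu) (target Lu)\<^esub> j (\<gamma> y)) (comult Ho h)"
    if "v \<in>! (base (T_op A B))" "h \<in>! Ho" for v h
  proof -
    have v: "v \<in> R" and h: "h \<in>! H" using that by (simp_all add: fields)
    have "coprod Lu (v \<boxtimes>\<^bsub>VH\<^esub> h) = \<chi> v h" using v h by (simp add: cop tsum_pure \<chi>b)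
    then show ?thesis
      unfolding E2 op_hopf_simps tsum_op gen[OF v h] \<chi>_def
      by (rule trans) (intro tsum_cong[OF refl], simp add: gen v j_gamma)
  qed
  have bc: "bilinear K V H V (\<lambda>v g. \<epsilon> g \<odot>\<^bsub>V\<^esub> v)" by (intro lin) simp_all
  have 9: "linear_map K (total Lu) (base (T_op A B)) (coun Lu)"
    unfolding fields(1,2) lu_bialgebroid_fields(1,5) linear_Sm op_hopf_simps
    by (rule ktensor_lift_linear[OF module_V module_H bc])
  have 10: "coun Lu (j (source (T_op A B) v \<otimes>\<^bsub>total (T_op A B)\<^esub> \<gamma> h)) = counit Ho h \<odot>\<^bsub>base (T_op A B)\<^esub> v"
    if "v \<in>! (base (T_op A B))" "h \<in>! Ho" for v h
    using that gen[of v h] ktensor_lift_pure[OF module_V module_H bc] by (simp add: fields)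
  show "lu K Ho Lu rhoV act (\<lambda>h. j (\<gamma> h)) (\<lambda>z. z)"
    by (rule LU.transport[OF 1 2 3 4 6 7 5 8 9 10])
  show "bialgebroid_isomorphic K (T_op A B) Lu"
    by (rule LU.isomorphic[OF 1 2 3 4 6 7 5 8 9 10])
qed

text \<open>By linearity of the target, the sum in Lu's antipode can be taken inside it, where it
  becomes \<open>LU.q v\<close> with the coaction written over the dual basis. So the formula agrees
  with \<open>LU.\<tau>\<close> on the carrier, and \<open>hopf_algebroid_cong\<close> exchanges the
  two.\<close>

theorem lu_smash_hopf_algebroid: "hopf_algebroid K Lu (lu_antipode K Ho V actV n e p)"
proof -
  interpret o: hopf K Ho by (rule hopf_op)
  interpret LU: lu K Ho Lu rhoV act "\<lambda>h. j (\<gamma> h)" "\<lambda>z. z" by (rule lu_smash(1))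
  note fields = lu_bialgebroid_fields op_hopf_simps VHo
  have total: "total Lu = Sm" "base Lu = V" by (simp_all add: fields)
  show ?thesis
  proof (rule LU.hopf_algebroid_cong)
    fix a assume "a \<in>! total Lu"
    then have a: "a \<in>! VH" by (simp add: total)
    have t: "linear_map K V Sm (target Lu)" using LU.t_linear by (simp add: total)
    have i: "linear_map K H Sm (\<lambda>h. j (\<gamma> h))" using LU.\<iota>_linear by (simp add: total linear_op)
    have q: "LU.q v = (\<Oplus>\<^bsub>V\<^esub>i\<in>{..<n}. act (Si (Si (e i))) (E (p i) v))" if v: "v \<in> R" for v
    proof -
      have "bilinear K V H V (\<lambda>x y. act (Si (Si y)) x)" by (intro lin) simp_all
      from tsum_rhoV[OF this v] show ?thesis by (simp add: LU.q_def total VHo)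
    qed
    have ql: "linear_map K V V LU.q" using LU.q_linear by (simp add: total)
    have l: "linear_map K V Sm (\<lambda>z. j (\<gamma> g) \<otimes>\<^bsub>Sm\<^esub> target Lu z)" if "g \<in>! H" for g
      using that linear_mapD(1)[OF i] by (intro lin k_algebra_Sm t) simp_all
    have b: "bilinear K V H Sm (\<lambda>v g. j (\<gamma> (Si g)) \<otimes>\<^bsub>Sm\<^esub> target Lu (LU.q v))"
    proof (rule bilinearI[OF module_Sm])
      show "linear_map K V Sm (\<lambda>v. j (\<gamma> (Si g)) \<otimes>\<^bsub>Sm\<^esub> target Lu (LU.q v))" if "g \<in>! H" for g
        using linear_comp[OF ql l] that by simp
      show "linear_map K H Sm (\<lambda>g. j (\<gamma> (Si g)) \<otimes>\<^bsub>Sm\<^esub> target Lu (LU.q v))" if "v \<in>! V" for v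
        using that linear_mapD(1)[OF linear_comp[OF ql t]]
        by (intro linear_map_mult(1)[OF k_algebra_Sm] linear_comp[OF Si_linear i])
    qed
    have "lu_antipode K Ho V actV n e p a = tsum V H Sm (\<lambda>v g. j (\<gamma> (Si g)) \<otimes>\<^bsub>Sm\<^esub> target Lu (LU.q v)) a"
      unfolding lu_antipode_def Let_def
    proof (rule ktensor_lift_eq[OF b module_V module_H a])
      fix v g assume v: "v \<in>! V" and g: "g \<in>! H"
      have "(\<Oplus>\<^bsub>Sm\<^esub>i\<in>{..<n}. (\<one>\<^bsub>V\<^esub> \<boxtimes>\<^bsub>VHo\<^esub> antipode Ho g) \<otimes>\<^bsub>Sm\<^esub>
         lu_target K Ho V actV n e p (hopf_act K Ho actV (antipode Ho (antipode Ho (e i))) (dual_act K Ho actV (p i) v)))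
        = (\<Oplus>\<^bsub>Sm\<^esub>i\<in>{..<n}. j (\<gamma> (Si g)) \<otimes>\<^bsub>Sm\<^esub> target Lu (act (Si (Si (e i))) (E (p i) v)))"
        using v g by (intro finsum_eqI) (simp add: op_act p_linear j_gamma VHo lu_bialgebroid_fields)
      also have "... = j (\<gamma> (Si g)) \<otimes>\<^bsub>Sm\<^esub> target Lu (\<Oplus>\<^bsub>V\<^esub>i\<in>{..<n}. act (Si (Si (e i))) (E (p i) v))"
        using v g by (intro linear_map_finsum[OF l, symmetric] module_V module_Sm) (simp_all add: p_linear)
      finally show "(\<Oplus>\<^bsub>Sm\<^esub>i\<in>{..<n}. (\<one>\<^bsub>V\<^esub> \<boxtimes>\<^bsub>VHo\<^esub> antipode Ho g) \<otimes>\<^bsub>Sm\<^esub>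
         lu_target K Ho V actV n e p (hopf_act K Ho actV (antipode Ho (antipode Ho (e i))) (dual_act K Ho actV (p i) v)))
        = j (\<gamma> (Si g)) \<otimes>\<^bsub>Sm\<^esub> target Lu (LU.q v)" using v q by simp
    qed
    then show "lu_antipode K Ho V actV n e p a = LU.\<tau> a"
      by (simp add: LU.\<tau>_def LU.Lift_def total VHo)
  qed
qed

text \<open>This is \<open>prebraid\<close> on the centralizer, with the coaction of
  \<open>u\<close> expanded over the dual basis.\<close>

lemma prebraided: "prebraided_commutative K Ho V actV n e p"
  unfolding prebraided_commutative_def
proof (intro ballI)
  fix u v assume "u \<in>! V" "v \<in>! V"
  then have uv: "u \<in> R" "v \<in> R" by simp_all
  have b: "bilinear K A H A (\<lambda>a g. a \<bullet> act g v)" using uv by (intro lin) simp_all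
  have "(\<Oplus>\<^bsub>V\<^esub>i\<in>{..<n}. dual_act K Ho actV (p i) u \<otimes>\<^bsub>V\<^esub> hopf_act K Ho actV (e i) v) = (\<Oplus>\<^bsub>V\<^esub>i\<in>{..<n}. E (p i) u \<bullet> act (e i) v)"
    using uv by (intro finsum_eqI) (simp add: op_act)
  also have "... = v \<bullet> u"
    using uv rw_expand[OF b, of u] by (simp add: prebraid[OF uv(2)] finsum_V p_linear)
  finally show "(\<Oplus>\<^bsub>V\<^esub>i\<in>{..<n}. dual_act K Ho actV (p i) u \<otimes>\<^bsub>V\<^esub> hopf_act K Ho actV (e i) v) = v \<otimes>\<^bsub>V\<^esub> u" by simp
qed

end

theorem theorem5p2:
  fixes K :: "'k ring" and H :: "('k, 'h) hopf" and A :: "('k, 'a) module"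
    and \<rho> :: "'a \<Rightarrow> ('a \<times> 'h \<Rightarrow>\<^sub>0 int) set" and B :: "'a set"
  assumes "field K"
    and "hopf_algebra K H" and "finite_dim K H"
    and "galois_extension K H A \<rho> B"
  shows "(\<exists>(H' :: ('k, 'h) hopf) (V :: ('k, 'a) module) act.
            hopf_algebra K H' \<and> finite_dim K H' \<and>
            module_algebra K (drinfeld_double K H') V act \<and>
            (\<forall>n h p. dual_bases K H' n h p \<longrightarrow>
               prebraided_commutative K H' V act n h p \<and>
               hopf_algebroid K (lu_bialgebroid K H' V act n h p) (lu_antipode K H' V act n h p) \<and>
               bialgebroid_isomorphic K (T_op A B) (lu_bialgebroid K H' V act n h p)))
         \<and> (\<exists>\<tau>. hopf_algebroid K (T_op A B) \<tau>)"
proof -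
  let ?V = "A\<lparr>carrier := centralizer A B\<rparr>" and ?H = "op_hopf H"
  \<comment> \<open>The operators \<open>E\<close> and \<open>act\<close> are defined without
    reference to a basis, so one action of the double serves every choice of dual bases.\<close>
  let ?act = "double_action.actD ?V (galois.E H A \<rho>) (galois.act K H A \<rho> B)"
  have galois: "galois K H n e p A \<rho> B" if "dual_bases K H n e p" for n e p
    using that assms(2,4) by (intro galois.intro fd_hopf.intro hopf.intro fd_hopf_axioms.intro galois_axioms.intro)
  have "module K H" using assms(2) by (simp add: hopf_algebra_def k_algebra_def)
  then obtain n e p where "dual_bases K H n e p" using exists_dual_bases[OF assms(1) _ assms(3)] by blast
  then interpret galois K H n e p A \<rho> B by (rule galois)
  have "finsum ?H f I = finsum H f I" for f :: "'h \<Rightarrow> _" and I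
    by (rule finsum_structure_cong) simp_all
  then have "finite_dim K ?H" using assms(3) unfolding finite_dim_def by simp
  moreover have "hopf_algebra K ?H" by (rule hopf_algebra_op[OF assms(2) S_bij])
  moreover have "module_algebra K (drinfeld_double K ?H) ?V ?act" by (rule op_act(3))
  moreover have "prebraided_commutative K ?H ?V ?act n h p \<and>
      hopf_algebroid K (lu_bialgebroid K ?H ?V ?act n h p) (lu_antipode K ?H ?V ?act n h p) \<and>
      bialgebroid_isomorphic K (T_op A B) (lu_bialgebroid K ?H ?V ?act n h p)" if "dual_bases K ?H n h p" for n h p
  proof -
    \<comment> \<open>Dual bases of the opposite Hopf algebra are dual bases of \<open>H\<close>;
      each choice gives its own instance of the locale, all of them with the same action.\<close>
    have g: "galois K H n h p A \<rho> B" using galois that by (simp add: dual_bases_op)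
    show ?thesis
      using galois.prebraided[OF g] galois.lu_smash_hopf_algebroid[OF g] galois.lu_smash(2)[OF g] by blast
  qed
  moreover have "\<exists>\<tau>. hopf_algebroid K (T_op A B) \<tau>"
    using lu.hopf_algebroid[OF lu_T_op] by blast
  ultimately show ?thesis by blast
qed

end
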